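(* Let $\mathring V\in C^1(S^1)$ (viewed as a $1$-periodic $C^1$ function on $\mathbb R$), let $K$ be the Sierpiński gasket with standard energy form $(\mathcal E,\mathcal C)$, and let $V_0=\{q_0,q_1,q_2\}$. (i) Let $h$ be harmonic on $K\setminus V_0$ with $h(q_0)=\frac12$, $h(q_1)=0$, $h(q_2)=1$, and let $h^{(m)}$ be the edge-wise linear extension of $h|_{V_m}$ to the metric graph $K^{(m)}$. Let $\Theta$ (for $(K,\partial h)$) and $\Theta^{(m)}$ (for $(K^{(m)},\partial h^{(m)})$) be the restrictions to the respective space $H_-$ of $(x_0,x_1,x_2,w)\mapsto(x_0,-x_2,-x_1,w)$. Let $v$ be the unique solution of the Cauchy problem $\frac{d}{dt}v=A^\Theta v$, $v(0)=\mathring V\circ h$, on $K$ with $b=\partial h$, and $v^{(m)}$ the unique solution of $\frac d{dt}v^{(m)}=A^{\Theta^{(m)}}v^{(m)}$, $v^{(m)}(0)=\mathring V\circ h^{(m)}$, on $K^{(m)}$ with $b=\partial h^{(m)}$. Then $$\lim_{m\to\infty}\ \sup_{(t,x)\in[0,+\infty)\times K^{(m)}}\big|v(t,x)-v^{(m)}(t,x)\big|=0.$$ (ii) Let $h$ be harmonic on $K\setminus V_0$ with $h(q_0)=0$, $h(q_1)=h(q_2)=1$, and let $h^{(m)}$ be the edge-wise linear extension of $h|_{V_m}$, considered on the reduced metric graph $\widetilde K^{(m)}$. Let $\Theta$ (for $(K,\partial h)$) and $\Theta^{(m)}$ (for $(\widetilde K^{(m)},\partial h^{(m)})$) be given by $(0,x_1,x_2,w)\mapsto\big(-\frac12(x_1+x_2),0,0,w\big)$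 from the respective space $H_-$ to $H_+$. Let $v$ be the unique solution of $\frac d{dt}v=A^\Theta v$, $v(0)=\mathring V\circ h$, on $K$ with $b=\partial h$, and $v^{(m)}$ the unique solution of $\frac d{dt}v^{(m)}=A^{\Theta^{(m)}}v^{(m)}$, $v^{(m)}(0)=\mathring V\circ h^{(m)}$, on $\widetilde K^{(m)}$ with $b=\partial h^{(m)}$. Then $$\lim_{m\to\infty}\ \sup_{(t,x)\in[0,+\infty)\times\widetilde K^{(m)}}\big|v(t,x)-v^{(m)}(t,x)\big|=0.$$ In both items $v(t,\cdot)$ and $v^{(m)}(t,\cdot)$ are evaluated pointwise through their continuous representatives.
   Context: **Sierpiński gasket.** $q_0,q_1,q_2$ are the vertices of an equilateral triangle in $\mathbb R^2$, $F_i(x)=\frac12(x-q_i)+q_i$; $K$ is the unique nonempty compact set with $K=\bigcup_{i=0}^2F_i(K)$. $V_0=\{q_0,q_1,q_2\}$, $V_{n+1}=\bigcup_iF_i(V_n)$. The standard energy form is $\mathcal E(u)=\lim_n\mathcal E_{V_n}(u)$ with $\mathcal E_{V_n}(u)=\frac12(\frac53)^n\sum_{x\in V_n}\sum_{y\in V_n,\,y\sim_nx}(u(x)-u(y))^2$, $\sim_n$ denoting neighbors in the $n$-th level graph (distinct points of some $F_{\alpha}(V_0)$, $|\alpha|=n$), extended by polarization; $\mathcal C$ is the algebra of continuous $u$ on $K$ with $\lim_n\mathcal E_{V_n}(u)<\infty$. $h\in\mathcal C$ is harmonic on $K\setminus V_0$ if $\mathcal E(h,\varphi)=0$ for all $\varphi\in\mathcal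 C$ with $\varphi|_{V_0}=0$. **Graph approximations.** $K^{(0)}$ is the triangle graph with vertex set $V_0$ and the three sides as edges; $K^{(m)}=\bigcup_{|\alpha|=m}F_\alpha(K^{(0)})\subset K$ (union over words $\alpha\in\{0,1,2\}^m$ of compositions of the $F_i$), a metric graph with vertex set $V_m$ whose edges are each identified with $[0,1]$. $\widetilde K^{(m)}$ is $K^{(m)}$ with the (open) edge between $F_0^m(q_1)$ and $F_0^m(q_2)$ removed (the edge opposite to $q_0$ in the smallest triangle containing $q_0$, on which the $h^{(m)}$ of (ii) is constant). On a metric graph $X$ with edge set $E$ use $\mathcal C=H^1(X)=\{f\in C(X):f|_e\in H^1(e),e\in E\}$ and $\mathcal E(f,g)=\sum_{e\in E}\int_ef_e'g_e'\,dx$. In all cases ($X=K,K^{(m)},\widetilde K^{(m)}$, boundary $B=V_0$) the following applies; the field $b=\partial h$ resp. $b=\partial h^{(m)}$ is then minimal energy-dominant (its energy measure dominates all energy measures $\nu_f$, $f\in\mathcal C$, and is absolutely continuous w.r.t. any measure that does) and the martingale dimension is one. **First order structure.** For $f_1,f_2\in\mathcal C$, $\nu_{f_1,f_2}$ is the unique finite signed Radon measure with $\int g\,d\nu_{f_1,f_2}=\frac12\{\mathcal E(f_1g,f_2)+\mathcal E(f_1,f_2g)-\mathcal E(f_1f_2,g)\}$, $g\in\mathcal C$; $\nu_f=\nu_{f,f}$. Put $d_uf(x,y)=f(x)-f(y)$, $\overline g(x,y)=\frac12(g(x)+g(y))$. $\mathcal H$ is the Hilbert space obtained from the span of all $\overline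 g\,d_uf$ ($g\in C(X)$, $f\in\mathcal C$) with $\langle\overline g_1d_uf_1,\overline g_2d_uf_2\rangle_{\mathcal H}=\int g_1g_2\,d\nu_{f_1,f_2}$ by factoring out null elements and completing; $\partial f$ is the class of $d_uf$, $g\,\partial f$ that of $\overline g\,d_uf$. For $b=\partial h$ (resp. $\partial h^{(m)}$), $\nu_b$ is the energy measure of $h$ (resp. $h^{(m)}$), and $\star_b:L^2(X,\nu_b)\to\mathcal H$, $\star_bg=gb$ (extended isometrically from $g\in C(X)$), is an isometric isomorphism. **Operators.** $\mathcal C_B=\{f\in\mathcal C:f|_B=0\}$, $\partial_B=\partial|_{\mathcal C_B}$. $\partial^\ast,\partial_B^\ast$ are the adjoints (from $\mathcal H$ to $L^2(X,\nu_b)$) of the densely defined operators $(\partial,\mathcal C)$, $(\partial_B,\mathcal C_B)$ from $L^2(X,\nu_b)$ to $\mathcal H$. $\mathcal D(\partial^\bot)=\star_b^{-1}\mathcal D(\partial^\ast)$, $\partial^\bot f=-\partial^\ast\star_bf$; $\mathcal D(\partial_B^\bot)=\star_b^{-1}\mathcal D(\partial_B^\ast)$, $\partial_B^\bot f=-\partial_B^\ast\star_bf$. **Normal parts.** For $v\in\mathcal D(\partial_B^\ast)$ and $q\in B$, $n_Bv(q):=\langle v,\partial\psi_q\rangle_{\mathcal H}-\int_X(\partial_B^\ast v)\psi_q\,d\nu_b$, where $\psi_q\in\mathcal C$ satisfies $\psi_q(q)=1$, $\psi_q=0$ on $B\setminus\{q\}$, $\mathcal E(\psi_q,\varphi)=0$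 for $\varphi\in\mathcal C_B$. $u\in\mathcal C$ is in $\mathcal D(\Delta_B)$ with $\Delta_Bu=f\in L^2(X,\nu_b)$ if $\mathcal E(u,\varphi)=-\int f\varphi\,d\nu_b$ for all $\varphi\in\mathcal C_B$; then $(du)_B:=n_B\partial u$. $u$ is a weak solution of $\Delta_Bu=f$ on $X\setminus B$, $(du)_B=G\in\ell(B)$ on $B$ if $\mathcal E(u,\varphi)=\sum_{q\in B}G(q)\varphi(q)-\int f\varphi\,d\nu_b$ for all $\varphi\in\mathcal C$. **Canonical representation** of $f\in\mathcal D(\partial_B^\bot)$: $f=g+\star_b^{-1}\partial u+w$ with $g\in\mathcal C$ such that $z:=\partial_B^\bot f-\star_b^{-1}\partial g\in\ker\partial^\bot$, $w\in\ker\partial^\bot$, $u$ a weak solution of $\Delta_Bu=z$ on $X\setminus B$, $(du)_B=n_B(fb)-g\,n_Bb$ on $B$. It exists and is unique up to replacing $g$ by $g+c$ and $\partial u$ by $\partial u-c\,b$, $c\in\mathbb R$. **Boundary spaces and maps.** $\mathring B,\check B,\hat B\subset B$ are the sets where $n_Bb$ is $=0$, $<0$, $>0$. $\widetilde H_\pm=\ell(\mathring B)\oplus\ell(\check B,|n_Bb|)\oplus\ell(\hat B,|n_Bb|)\oplus\ker\partial^\bot$, with counting measure on $\mathring B$, weights $|n_Bb|$ on $\check B,\hat B$, and the $L^2(X,\nu_b)$-scalar product on $\ker\partial^\bot$. $H_-$ is the orthogonal complement of $(\frac{\mathbf 1}{\sqrt2},\mathbf 1,0,0)$, $H_+$ that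 of $(\frac{\mathbf 1}{\sqrt2},0,-\mathbf 1,0)$, with projections $P_-,P_+$; trivial summands are omitted. Elements are written $(x_0,x_1,x_2,w)$ with $x_i$ the component at $q_i$. In (i) $\mathring B=\{q_0\}$, $\check B=\{q_1\}$, $\hat B=\{q_2\}$; in (ii) $\mathring B=\emptyset$, $\check B=\{q_0\}$, $\hat B=\{q_1,q_2\}$, so $H_-=\{x_0=0\}$. $G_-f=P_-\big(\frac1{\sqrt2}(g+n_B(fb)),\frac{(du)_B}{|n_Bb|},\frac{n_B(fb)}{|n_Bb|},\frac1{\sqrt2}(w+z)\big)$, $G_+f=P_+\big(\frac1{\sqrt2}(g-n_B(fb)),\frac{n_B(fb)}{|n_Bb|},\frac{(du)_B}{|n_Bb|},\frac1{\sqrt2}(w-z)\big)$, the first three components restricted to $\mathring B,\check B,\hat B$. For a linear contraction $\Theta:H_-\to H_+$, $\mathcal D(A^\Theta)=\{f\in\mathcal D(\partial_B^\bot):\Theta G_-f=G_+f\}$, $A^\Theta f=-\partial_B^\bot f$; it generates a strongly continuous contraction semigroup on $L^2(X,\nu_b)$, and for $\mathring v\in\mathcal D(A^\Theta)$ the Cauchy problem $\frac d{dt}v=A^\Theta v$, $v(0)=\mathring v$ has a unique solution in $C^1([0,\infty),L^2(X,\nu_b))\cap C([0,\infty),\mathcal D(A^\Theta))$. *)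

theory Defs
  imports "HOL-Analysis.Analysis" "HOL-Library.FuncSet"
begin

text \<open>
  Conventions. A function on a subset \<open>X\<close> of a type is a total function of which only the values
  on \<open>X\<close> matter. An element of \<open>L\<^sup>2\<close> is a function, two functions being identified when they agree
  almost everywhere; accordingly operators with values in \<open>L\<^sup>2\<close> return an arbitrary
  representative, and equations in \<open>L\<^sup>2\<close> are stated with \<open>AE\<close>. All spaces are real.
\<close>

section \<open>Energy forms and their first order structure\<close>

record 'a energy_space =
  carr :: "'a set"
  bdry :: "'a set"
  fdom :: "('a \<Rightarrow> real) set"
  energy :: "('a \<Rightarrow> real) \<Rightarrow> ('a \<Rightarrow> real) \<Rightarrow> real"

definition cont_funs :: "'a::topological_space energy_space \<Rightarrow> ('a \<Rightarrow> real) set" where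
  "cont_funs S = {g. continuous_on (carr S) g}"

definition fdom_bdry :: "'a energy_space \<Rightarrow> ('a \<Rightarrow> real) set" where
  "fdom_bdry S = {f \<in> fdom S. \<forall>q\<in>bdry S. f q = 0}"

text \<open>The functional on \<open>fdom S\<close> represented by the energy measure of \<open>f1, f2\<close>.\<close>

definition energy_functional ::
    "'a energy_space \<Rightarrow> ('a \<Rightarrow> real) \<Rightarrow> ('a \<Rightarrow> real) \<Rightarrow> ('a \<Rightarrow> real) \<Rightarrow> real" where
  "energy_functional S f1 f2 g =
     (energy S (\<lambda>x. f1 x * g x) f2 + energy S f1 (\<lambda>x. f2 x * g x)
       - energy S (\<lambda>x. f1 x * f2 x) g) / 2"

text \<open>On the compact metric spaces used here every finite Borel measure is Radon.\<close>

definition radon_on :: "'a::topological_space energy_space \<Rightarrow> 'a measure \<Rightarrow> bool" where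
  "radon_on S M \<longleftrightarrow> sets M = sets (restrict_space borel (carr S)) \<and> finite_measure M"

text \<open>
  The integral of a continuous \<open>g\<close> with respect to the finite signed Radon measure of \<open>f1, f2\<close>;
  a signed measure is given as a difference of two finite measures \<open>M\<close> and \<open>N\<close>.
\<close>

definition energy_int ::
    "'a::topological_space energy_space \<Rightarrow> ('a \<Rightarrow> real) \<Rightarrow> ('a \<Rightarrow> real) \<Rightarrow> ('a \<Rightarrow> real) \<Rightarrow> real" where
  "energy_int S f1 f2 g =
     (THE c. \<exists>M N. radon_on S M \<and> radon_on S N \<and>
        (\<forall>\<phi>\<in>fdom S. (\<integral>x. \<phi> x \<partial>M) - (\<integral>x. \<phi> x \<partial>N) = energy_functional S f1 f2 \<phi>) \<and>
        c = (\<integral>x. g x \<partial>M) - (\<integral>x. g x \<partial>N))"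

definition energy_measure :: "'a::topological_space energy_space \<Rightarrow> ('a \<Rightarrow> real) \<Rightarrow> 'a measure" where
  "energy_measure S f =
     (THE M. radon_on S M \<and> (\<forall>\<phi>\<in>fdom S. (\<integral>x. \<phi> x \<partial>M) = energy_functional S f f \<phi>))"

text \<open>
  A list \<open>[(g1, f1), ..., (gk, fk)]\<close> stands for the sum of the functions
  \<open>(x, y) \<mapsto> (gi x + gi y) / 2 * (fi x - fi y)\<close> on \<open>X \<times> X\<close>. Scalar factors are absorbed in
  the \<open>gi\<close>, so \<open>one_forms\<close> is the linear span of these functions.
\<close>

type_synonym 'a one_form = "'a \<times> 'a \<Rightarrow> real"

definition form_terms ::
    "'a::topological_space energy_space \<Rightarrow> (('a \<Rightarrow> real) \<times> ('a \<Rightarrow> real)) list set" where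
  "form_terms S = lists (cont_funs S \<times> fdom S)"

definition form_of ::
    "'a energy_space \<Rightarrow> (('a \<Rightarrow> real) \<times> ('a \<Rightarrow> real)) list \<Rightarrow> 'a one_form" where
  "form_of S ps = (\<lambda>(x, y)\<in>carr S \<times> carr S. \<Sum>(g, f)\<leftarrow>ps. (g x + g y) / 2 * (f x - f y))"

definition one_forms :: "'a::topological_space energy_space \<Rightarrow> 'a one_form set" where
  "one_forms S = form_of S ` form_terms S"

text \<open>Bilinear extension of \<open>\<langle>g1 df1, g2 df2\<rangle> = \<integral> g1 g2 d\<nu>(f1, f2)\<close>.\<close>

definition form_ip :: "'a::topological_space energy_space \<Rightarrow> 'a one_form \<Rightarrow> 'a one_form \<Rightarrow> real" where
  "form_ip S \<omega> \<eta> =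
     (THE c. \<exists>ps\<in>form_terms S. \<exists>qs\<in>form_terms S. form_of S ps = \<omega> \<and> form_of S qs = \<eta> \<and>
        c = (\<Sum>(g1, f1)\<leftarrow>ps. \<Sum>(g2, f2)\<leftarrow>qs. energy_int S f1 f2 (\<lambda>x. g1 x * g2 x)))"

definition form_dist2 :: "'a::topological_space energy_space \<Rightarrow> 'a one_form \<Rightarrow> 'a one_form \<Rightarrow> real" where
  "form_dist2 S \<omega> \<eta> = form_ip S \<omega> \<omega> - 2 * form_ip S \<omega> \<eta> + form_ip S \<eta> \<eta>"

text \<open>
  The Hilbert space \<open>\<H>\<close> is the quotient of the Cauchy sequences of one-forms by the null
  sequences. This factors out the null elements and completes in one step. Only its elements and
  its scalar product are needed below.
\<close>

definition form_cauchy :: "'a::topological_space energy_space \<Rightarrow> (nat \<Rightarrow> 'a one_form) set" where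
  "form_cauchy S = {s. (\<forall>n. s n \<in> one_forms S) \<and>
     (\<forall>e>0. \<exists>N. \<forall>m\<ge>N. \<forall>n\<ge>N. form_dist2 S (s m) (s n) < e)}"

definition form_class ::
    "'a::topological_space energy_space \<Rightarrow> (nat \<Rightarrow> 'a one_form) \<Rightarrow> (nat \<Rightarrow> 'a one_form) set" where
  "form_class S s = {t \<in> form_cauchy S. (\<lambda>n. form_dist2 S (s n) (t n)) \<longlonglongrightarrow> 0}"

definition hilb :: "'a::topological_space energy_space \<Rightarrow> (nat \<Rightarrow> 'a one_form) set set" where
  "hilb S = form_class S ` form_cauchy S"

definition hilb_ip ::
    "'a::topological_space energy_space \<Rightarrow> (nat \<Rightarrow> 'a one_form) set \<Rightarrow> (nat \<Rightarrow> 'a one_form) set \<Rightarrow> real"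
  where
  "hilb_ip S v w = (THE c. \<exists>s\<in>v. \<exists>t\<in>w. (\<lambda>n. form_ip S (s n) (t n)) \<longlonglongrightarrow> c)"

definition grad ::
    "'a::topological_space energy_space \<Rightarrow> ('a \<Rightarrow> real) \<Rightarrow> (nat \<Rightarrow> 'a one_form) set" where
  "grad S f = form_class S (\<lambda>_. form_of S [(\<lambda>_. 1, f)])"

section \<open>Square integrable functions and operators for the field \<open>b = \<partial>h\<close>\<close>

definition L2 :: "'a measure \<Rightarrow> ('a \<Rightarrow> real) set" where
  "L2 M = {f \<in> borel_measurable M. integrable M (\<lambda>x. (f x)\<^sup>2)}"

definition L2_norm :: "'a measure \<Rightarrow> ('a \<Rightarrow> real) \<Rightarrow> real" where
  "L2_norm M f = sqrt (\<integral>x. (f x)\<^sup>2 \<partial>M)"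

text \<open>
  The map \<open>\<star>\<^sub>b\<close>, that is, the isometric extension of \<open>g \<mapsto> g \<partial>h\<close> from continuous \<open>g\<close> to
  \<open>L\<^sup>2\<close>, and its inverse.
\<close>

definition star ::
    "'a::topological_space energy_space \<Rightarrow> ('a \<Rightarrow> real) \<Rightarrow> ('a \<Rightarrow> real) \<Rightarrow> (nat \<Rightarrow> 'a one_form) set" where
  "star S h f = (THE v. \<exists>g. (\<forall>n. g n \<in> cont_funs S) \<and>
     (\<lambda>n. L2_norm (energy_measure S h) (\<lambda>x. g n x - f x)) \<longlonglongrightarrow> 0 \<and>
     v = form_class S (\<lambda>n. form_of S [(g n, h)]))"

definition star_inv ::
    "'a::topological_space energy_space \<Rightarrow> ('a \<Rightarrow> real) \<Rightarrow> (nat \<Rightarrow> 'a one_form) set \<Rightarrow> ('a \<Rightarrow> real)" where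
  "star_inv S h v = (SOME f. f \<in> L2 (energy_measure S h) \<and> star S h f = v)"

text \<open>
  The adjoint of the restriction of \<open>\<partial>\<close> to \<open>D\<close>; here \<open>D\<close> is \<open>fdom S\<close> (for \<open>\<partial>\<^sup>*\<close>) or
  \<open>fdom_bdry S\<close> (for the adjoint of \<open>\<partial>\<^sub>B\<close>).
\<close>

definition is_adj ::
    "'a::topological_space energy_space \<Rightarrow> ('a \<Rightarrow> real) \<Rightarrow> ('a \<Rightarrow> real) set \<Rightarrow>
       (nat \<Rightarrow> 'a one_form) set \<Rightarrow> ('a \<Rightarrow> real) \<Rightarrow> bool" where
  "is_adj S h D v f \<longleftrightarrow> f \<in> L2 (energy_measure S h) \<and>
     (\<forall>u\<in>D. hilb_ip S v (grad S u) = (\<integral>x. f x * u x \<partial>energy_measure S h))"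

definition adj_dom ::
    "'a::topological_space energy_space \<Rightarrow> ('a \<Rightarrow> real) \<Rightarrow> ('a \<Rightarrow> real) set \<Rightarrow>
       (nat \<Rightarrow> 'a one_form) set set" where
  "adj_dom S h D = {v \<in> hilb S. \<exists>f. is_adj S h D v f}"

definition adj ::
    "'a::topological_space energy_space \<Rightarrow> ('a \<Rightarrow> real) \<Rightarrow> ('a \<Rightarrow> real) set \<Rightarrow>
       (nat \<Rightarrow> 'a one_form) set \<Rightarrow> ('a \<Rightarrow> real)" where
  "adj S h D v = (SOME f. is_adj S h D v f)"

definition perp_dom ::
    "'a::topological_space energy_space \<Rightarrow> ('a \<Rightarrow> real) \<Rightarrow> ('a \<Rightarrow> real) set \<Rightarrow> ('a \<Rightarrow> real) set" where
  "perp_dom S h D = {f \<in> L2 (energy_measure S h). star S h f \<in> adj_dom S h D}"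

definition perp ::
    "'a::topological_space energy_space \<Rightarrow> ('a \<Rightarrow> real) \<Rightarrow> ('a \<Rightarrow> real) set \<Rightarrow> ('a \<Rightarrow> real) \<Rightarrow> ('a \<Rightarrow> real)"
  where
  "perp S h D f = (\<lambda>x. - adj S h D (star S h f) x)"

definition ker_perp :: "'a::topological_space energy_space \<Rightarrow> ('a \<Rightarrow> real) \<Rightarrow> ('a \<Rightarrow> real) set" where
  "ker_perp S h =
     {f \<in> perp_dom S h (fdom S). AE x in energy_measure S h. perp S h (fdom S) f x = 0}"

section \<open>Normal parts, canonical representation and boundary maps\<close>

definition bdry_harmonic :: "'a energy_space \<Rightarrow> 'a \<Rightarrow> ('a \<Rightarrow> real)" where
  "bdry_harmonic S q = (SOME \<psi>. \<psi> \<in> fdom S \<and> \<psi> q = 1 \<and> (\<forall>p\<in>bdry S - {q}. \<psi> p = 0) \<and>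
     (\<forall>\<phi>\<in>fdom_bdry S. energy S \<psi> \<phi> = 0))"

definition normal_part ::
    "'a::topological_space energy_space \<Rightarrow> ('a \<Rightarrow> real) \<Rightarrow> (nat \<Rightarrow> 'a one_form) set \<Rightarrow> 'a \<Rightarrow> real" where
  "normal_part S h v q =
     hilb_ip S v (grad S (bdry_harmonic S q))
     - (\<integral>x. adj S h (fdom_bdry S) v x * bdry_harmonic S q x \<partial>energy_measure S h)"

definition weak_solution ::
    "'a::topological_space energy_space \<Rightarrow> ('a \<Rightarrow> real) \<Rightarrow> ('a \<Rightarrow> real) \<Rightarrow> ('a \<Rightarrow> real) \<Rightarrow>
       ('a \<Rightarrow> real) \<Rightarrow> bool" where
  "weak_solution S h f G u \<longleftrightarrow> u \<in> fdom S \<and> f \<in> L2 (energy_measure S h) \<and>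
     (\<forall>\<phi>\<in>fdom S. energy S u \<phi> =
        (\<Sum>q\<in>bdry S. G q * \<phi> q) - (\<integral>x. f x * \<phi> x \<partial>energy_measure S h))"

text \<open>The function \<open>z\<close> belonging to \<open>f\<close> and the component \<open>g\<close> of a representation of \<open>f\<close>.\<close>

definition rep_z ::
    "'a::topological_space energy_space \<Rightarrow> ('a \<Rightarrow> real) \<Rightarrow> ('a \<Rightarrow> real) \<Rightarrow> ('a \<Rightarrow> real) \<Rightarrow> ('a \<Rightarrow> real)"
  where
  "rep_z S h f g = (\<lambda>x. perp S h (fdom_bdry S) f x - star_inv S h (grad S g) x)"

fun is_canonical_rep ::
    "'a::topological_space energy_space \<Rightarrow> ('a \<Rightarrow> real) \<Rightarrow> ('a \<Rightarrow> real) \<Rightarrow>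
       ('a \<Rightarrow> real) \<times> ('a \<Rightarrow> real) \<times> ('a \<Rightarrow> real) \<Rightarrow> bool" where
  "is_canonical_rep S h f (g, u, w) \<longleftrightarrow>
     g \<in> fdom S \<and> rep_z S h f g \<in> ker_perp S h \<and> w \<in> ker_perp S h \<and>
     weak_solution S h (rep_z S h f g)
       (\<lambda>q. normal_part S h (star S h f) q - g q * normal_part S h (grad S h) q) u \<and>
     (AE x in energy_measure S h. f x = g x + star_inv S h (grad S u) x + w x)"

text \<open>
  The representation is unique only up to \<open>g + c\<close> and \<open>\<partial>u - c b\<close>; the projections in
  \<open>G_minus\<close> and \<open>G_plus\<close> make these maps independent of the choice made here.
\<close>

definition canonical_rep ::
    "'a::topological_space energy_space \<Rightarrow> ('a \<Rightarrow> real) \<Rightarrow> ('a \<Rightarrow> real) \<Rightarrow>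
       ('a \<Rightarrow> real) \<times> ('a \<Rightarrow> real) \<times> ('a \<Rightarrow> real)" where
  "canonical_rep S h f = (SOME r. is_canonical_rep S h f r)"

text \<open>
  An element of the boundary space consists of a function \<open>x\<close> on the boundary, which combines the
  components on the sets where \<open>n\<^sub>B b\<close> is zero, negative and positive, and an element \<open>w\<close> of
  \<open>ker_perp\<close>.
\<close>

type_synonym 'a bvec = "('a \<Rightarrow> real) \<times> ('a \<Rightarrow> real)"

definition bdry_weight :: "'a::topological_space energy_space \<Rightarrow> ('a \<Rightarrow> real) \<Rightarrow> 'a \<Rightarrow> real" where
  "bdry_weight S h q =
     (if normal_part S h (grad S h) q = 0 then 1 else \<bar>normal_part S h (grad S h) q\<bar>)"

fun bvec_ip ::
    "'a::topological_space energy_space \<Rightarrow> ('a \<Rightarrow> real) \<Rightarrow> 'a bvec \<Rightarrow> 'a bvec \<Rightarrow> real" where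
  "bvec_ip S h (x, w) (x', w') =
     (\<Sum>q\<in>bdry S. bdry_weight S h q * x q * x' q) + (\<integral>p. w p * w' p \<partial>energy_measure S h)"

fun bvec_eq ::
    "'a::topological_space energy_space \<Rightarrow> ('a \<Rightarrow> real) \<Rightarrow> 'a bvec \<Rightarrow> 'a bvec \<Rightarrow> bool" where
  "bvec_eq S h (x, w) (x', w') \<longleftrightarrow>
     (\<forall>q\<in>bdry S. x q = x' q) \<and> (AE p in energy_measure S h. w p = w' p)"

text \<open>Orthogonal projection of \<open>y\<close> onto the complement of \<open>e\<close>.\<close>

definition bvec_proj ::
    "'a::topological_space energy_space \<Rightarrow> ('a \<Rightarrow> real) \<Rightarrow> 'a bvec \<Rightarrow> 'a bvec \<Rightarrow> 'a bvec" where
  "bvec_proj S h e y = (let c = bvec_ip S h y e / bvec_ip S h e e in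
     (\<lambda>q. fst y q - c * fst e q, \<lambda>p. snd y p - c * snd e p))"

definition e_minus :: "'a::topological_space energy_space \<Rightarrow> ('a \<Rightarrow> real) \<Rightarrow> 'a bvec" where
  "e_minus S h = (\<lambda>q. let n = normal_part S h (grad S h) q in
     if n = 0 then 1 / sqrt 2 else if n < 0 then 1 else 0, \<lambda>_. 0)"

definition e_plus :: "'a::topological_space energy_space \<Rightarrow> ('a \<Rightarrow> real) \<Rightarrow> 'a bvec" where
  "e_plus S h = (\<lambda>q. let n = normal_part S h (grad S h) q in
     if n = 0 then 1 / sqrt 2 else if n < 0 then 0 else - 1, \<lambda>_. 0)"

definition G_minus ::
    "'a::topological_space energy_space \<Rightarrow> ('a \<Rightarrow> real) \<Rightarrow> ('a \<Rightarrow> real) \<Rightarrow> 'a bvec" where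
  "G_minus S h f = (case canonical_rep S h f of (g, u, w) \<Rightarrow>
     bvec_proj S h (e_minus S h)
       (\<lambda>q. let n = normal_part S h (grad S h) q; nf = normal_part S h (star S h f) q;
                du = normal_part S h (grad S u) q in
          if n = 0 then (g q + nf) / sqrt 2 else if n < 0 then du / \<bar>n\<bar> else nf / \<bar>n\<bar>,
        \<lambda>p. (w p + rep_z S h f g p) / sqrt 2))"

definition G_plus ::
    "'a::topological_space energy_space \<Rightarrow> ('a \<Rightarrow> real) \<Rightarrow> ('a \<Rightarrow> real) \<Rightarrow> 'a bvec" where
  "G_plus S h f = (case canonical_rep S h f of (g, u, w) \<Rightarrow>
     bvec_proj S h (e_plus S h)
       (\<lambda>q. let n = normal_part S h (grad S h) q; nf = normal_part S h (star S h f) q;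
                du = normal_part S h (grad S u) q in
          if n = 0 then (g q - nf) / sqrt 2 else if n < 0 then nf / \<bar>n\<bar> else du / \<bar>n\<bar>,
        \<lambda>p. (w p - rep_z S h f g p) / sqrt 2))"

section \<open>The generator and the Cauchy problem\<close>

definition gen_dom ::
    "'a::topological_space energy_space \<Rightarrow> ('a \<Rightarrow> real) \<Rightarrow> ('a bvec \<Rightarrow> 'a bvec) \<Rightarrow> ('a \<Rightarrow> real) set" where
  "gen_dom S h \<Theta> =
     {f \<in> perp_dom S h (fdom_bdry S). bvec_eq S h (\<Theta> (G_minus S h f)) (G_plus S h f)}"

definition gen :: "'a::topological_space energy_space \<Rightarrow> ('a \<Rightarrow> real) \<Rightarrow> ('a \<Rightarrow> real) \<Rightarrow> ('a \<Rightarrow> real)" where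
  "gen S h f = (\<lambda>x. - perp S h (fdom_bdry S) f x)"

text \<open>
  \<open>v\<close> is a solution of \<open>v' = A v\<close>, \<open>v(0) = v0\<close> in \<open>C\<^sup>1([0,\<infinity>), L\<^sup>2) \<inter> C([0,\<infinity>), D(A))\<close>, the
  domain carrying the graph norm.
\<close>

definition cauchy_solution ::
    "'a::topological_space energy_space \<Rightarrow> ('a \<Rightarrow> real) \<Rightarrow> ('a bvec \<Rightarrow> 'a bvec) \<Rightarrow> ('a \<Rightarrow> real) \<Rightarrow>
       (real \<Rightarrow> 'a \<Rightarrow> real) \<Rightarrow> bool" where
  "cauchy_solution S h \<Theta> v0 v \<longleftrightarrow> (let M = energy_measure S h in
     (\<forall>t\<ge>0. v t \<in> gen_dom S h \<Theta>) \<and>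
     (AE x in M. v 0 x = v0 x) \<and>
     (\<exists>v'. (\<forall>t\<ge>0. v' t \<in> L2 M) \<and>
        (\<forall>t\<ge>0. ((\<lambda>s. L2_norm M (\<lambda>x. (v s x - v t x) / (s - t) - v' t x)) \<longlongrightarrow> 0) (at t within {0..})) \<and>
        (\<forall>t\<ge>0. ((\<lambda>s. L2_norm M (\<lambda>x. v' s x - v' t x)) \<longlongrightarrow> 0) (at t within {0..})) \<and>
        (\<forall>t\<ge>0. AE x in M. v' t x = gen S h (v t) x)) \<and>
     (\<forall>t\<ge>0. ((\<lambda>s. L2_norm M (\<lambda>x. v s x - v t x)
               + L2_norm M (\<lambda>x. gen S h (v s) x - gen S h (v t) x)) \<longlongrightarrow> 0) (at t within {0..})))"

text \<open>\<open>v\<close> is the unique solution, with every \<open>v t\<close> given by its continuous representative.\<close>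

definition the_solution ::
    "'a::topological_space energy_space \<Rightarrow> ('a \<Rightarrow> real) \<Rightarrow> ('a bvec \<Rightarrow> 'a bvec) \<Rightarrow> ('a \<Rightarrow> real) \<Rightarrow>
       (real \<Rightarrow> 'a \<Rightarrow> real) \<Rightarrow> bool" where
  "the_solution S h \<Theta> v0 v \<longleftrightarrow> cauchy_solution S h \<Theta> v0 v \<and>
     (\<forall>v'. cauchy_solution S h \<Theta> v0 v' \<longrightarrow> (\<forall>t\<ge>0. AE x in energy_measure S h. v' t x = v t x)) \<and>
     (\<forall>t\<ge>0. continuous_on (carr S) (v t))"

section \<open>The Sierpinski gasket\<close>

definition equilateral :: "(nat \<Rightarrow> real^2) \<Rightarrow> bool" where
  "equilateral q \<longleftrightarrow> dist (q 0) (q 1) > 0 \<and>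
     dist (q 1) (q 2) = dist (q 0) (q 1) \<and> dist (q 2) (q 0) = dist (q 0) (q 1)"

definition sgF :: "(nat \<Rightarrow> real^2) \<Rightarrow> nat \<Rightarrow> real^2 \<Rightarrow> real^2" where
  "sgF q i x = (1/2) *\<^sub>R (x - q i) + q i"

definition gasket :: "(nat \<Rightarrow> real^2) \<Rightarrow> (real^2) set" where
  "gasket q = (THE K. K \<noteq> {} \<and> compact K \<and> K = (\<Union>i\<in>{0,1,2}. sgF q i ` K))"

fun sgV :: "(nat \<Rightarrow> real^2) \<Rightarrow> nat \<Rightarrow> (real^2) set" where
  "sgV q 0 = {q 0, q 1, q 2}"
| "sgV q (Suc n) = (\<Union>i\<in>{0,1,2}. sgF q i ` sgV q n)"

definition sgFw :: "(nat \<Rightarrow> real^2) \<Rightarrow> nat list \<Rightarrow> real^2 \<Rightarrow> real^2" where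
  "sgFw q \<alpha> = foldr (\<lambda>i f. sgF q i \<circ> f) \<alpha> id"

definition words :: "nat \<Rightarrow> nat list set" where
  "words n = {\<alpha>. length \<alpha> = n \<and> set \<alpha> \<subseteq> {0,1,2}}"

definition sg_nbr :: "(nat \<Rightarrow> real^2) \<Rightarrow> nat \<Rightarrow> real^2 \<Rightarrow> real^2 \<Rightarrow> bool" where
  "sg_nbr q n x y \<longleftrightarrow> x \<noteq> y \<and>
     (\<exists>\<alpha>\<in>words n. x \<in> sgFw q \<alpha> ` sgV q 0 \<and> y \<in> sgFw q \<alpha> ` sgV q 0)"

definition sgE :: "(nat \<Rightarrow> real^2) \<Rightarrow> nat \<Rightarrow> (real^2 \<Rightarrow> real) \<Rightarrow> real" where
  "sgE q n u = 1/2 * (5/3)^n * (\<Sum>x\<in>sgV q n. \<Sum>y\<in>{y \<in> sgV q n. sg_nbr q n y x}. (u x - u y)\<^sup>2)"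

definition sg_energy :: "(nat \<Rightarrow> real^2) \<Rightarrow> (real^2 \<Rightarrow> real) \<Rightarrow> real" where
  "sg_energy q u = lim (\<lambda>n. sgE q n u)"

text \<open>\<open>sgE q n u\<close> is nondecreasing in \<open>n\<close>, so convergence means that the limit is finite.\<close>

definition sg_space :: "(nat \<Rightarrow> real^2) \<Rightarrow> (real^2) energy_space" where
  "sg_space q = \<lparr>
     carr = gasket q,
     bdry = sgV q 0,
     fdom = {u. continuous_on (gasket q) u \<and> convergent (\<lambda>n. sgE q n u)},
     energy = (\<lambda>u v. (sg_energy q (\<lambda>x. u x + v x) - sg_energy q (\<lambda>x. u x - v x)) / 4) \<rparr>"

definition harmonic :: "'a energy_space \<Rightarrow> ('a \<Rightarrow> real) \<Rightarrow> bool" where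
  "harmonic S h \<longleftrightarrow> h \<in> fdom S \<and> (\<forall>\<phi>\<in>fdom_bdry S. energy S h \<phi> = 0)"

section \<open>Metric graphs\<close>

text \<open>
  A metric graph with straight edges in the plane is given by a symmetric set \<open>Ed\<close> of pairs of
  vertices. Every edge occurs in \<open>Ed\<close> with both orientations, hence the factor \<open>1/2\<close> in
  \<open>graph_energy\<close>, and is identified with \<open>[0,1]\<close> by its affine parametrisation.
\<close>

definition edge_pt :: "real^2 \<Rightarrow> real^2 \<Rightarrow> real \<Rightarrow> real^2" where
  "edge_pt x y t = (1 - t) *\<^sub>R x + t *\<^sub>R y"

definition graph_pts :: "((real^2) \<times> (real^2)) set \<Rightarrow> (real^2) set" where
  "graph_pts Ed = (\<Union>(x, y)\<in>Ed. edge_pt x y ` {0..1})"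

text \<open>
  A continuous \<open>f\<close> is in \<open>H\<^sup>1([0,1])\<close> iff it is absolutely continuous with derivative \<open>f'\<close> in
  \<open>L\<^sup>2\<close>, i.e. \<open>f\<close> is the indefinite integral of some \<open>f'\<close> in \<open>L\<^sup>2([0,1])\<close>.
\<close>

definition h1_deriv :: "(real \<Rightarrow> real) \<Rightarrow> (real \<Rightarrow> real) \<Rightarrow> bool" where
  "h1_deriv f f' \<longleftrightarrow> f' \<in> borel_measurable borel \<and>
     set_integrable lborel {0..1} (\<lambda>t. (f' t)\<^sup>2) \<and>
     (\<forall>t\<in>{0..1}. f t = f 0 + (LINT s:{0..t}|lborel. f' s))"

definition weak_deriv :: "(real \<Rightarrow> real) \<Rightarrow> (real \<Rightarrow> real)" where
  "weak_deriv f = (SOME f'. h1_deriv f f')"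

definition graph_energy ::
    "((real^2) \<times> (real^2)) set \<Rightarrow> (real^2 \<Rightarrow> real) \<Rightarrow> (real^2 \<Rightarrow> real) \<Rightarrow> real" where
  "graph_energy Ed f g = 1/2 * (\<Sum>(x, y)\<in>Ed. LINT t:{0..1}|lborel.
     weak_deriv (\<lambda>s. f (edge_pt x y s)) t * weak_deriv (\<lambda>s. g (edge_pt x y s)) t)"

definition graph_space ::
    "((real^2) \<times> (real^2)) set \<Rightarrow> (real^2) set \<Rightarrow> (real^2) energy_space" where
  "graph_space Ed B = \<lparr>
     carr = graph_pts Ed,
     bdry = B,
     fdom = {f. continuous_on (graph_pts Ed) f \<and>
               (\<forall>(x, y)\<in>Ed. \<exists>f'. h1_deriv (\<lambda>s. f (edge_pt x y s)) f')},
     energy = graph_energy Ed \<rparr>"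

text \<open>The edge-wise linear extension of the restriction of \<open>h\<close> to the vertices.\<close>

definition edge_linear :: "((real^2) \<times> (real^2)) set \<Rightarrow> (real^2 \<Rightarrow> real) \<Rightarrow> real^2 \<Rightarrow> real" where
  "edge_linear Ed h p = (THE c. \<exists>(x, y)\<in>Ed. \<exists>t\<in>{0..1}.
     p = edge_pt x y t \<and> c = (1 - t) * h x + t * h y)"

definition sg_edges :: "(nat \<Rightarrow> real^2) \<Rightarrow> nat \<Rightarrow> ((real^2) \<times> (real^2)) set" where
  "sg_edges q m = {(x, y). sg_nbr q m x y}"

definition sg_edges_red :: "(nat \<Rightarrow> real^2) \<Rightarrow> nat \<Rightarrow> ((real^2) \<times> (real^2)) set" where
  "sg_edges_red q m = sg_edges q m -
     {((sgF q 0 ^^ m) (q 1), (sgF q 0 ^^ m) (q 2)), ((sgF q 0 ^^ m) (q 2), (sgF q 0 ^^ m) (q 1))}"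

section \<open>The boundary contractions\<close>

text \<open>Only their restrictions to the range of \<open>G_minus\<close> are used.\<close>

definition Theta_i :: "(nat \<Rightarrow> real^2) \<Rightarrow> (real^2) bvec \<Rightarrow> (real^2) bvec" where
  "Theta_i q = (\<lambda>(x, w). (x(q 1 := - x (q 2), q 2 := - x (q 1)), w))"

definition Theta_ii :: "(nat \<Rightarrow> real^2) \<Rightarrow> (real^2) bvec \<Rightarrow> (real^2) bvec" where
  "Theta_ii q = (\<lambda>(x, w). ((\<lambda>_. 0)(q 0 := - 1/2 * (x (q 1) + x (q 2))), w))"

end

(* On each of the spaces the field b = dh is minimal energy-dominant, so every gradient is
   df = (D f) b for a derivation D with values in L^2, and the transport equation is solved by
   v(t,x) = V(h(x) - t): the canonical representation of this function satisfies the boundary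
   condition because V is 1-periodic and h only takes values in {0,1} on the in- and outflow
   boundary. Solutions are unique because the generator is dissipative. As the graph solutions are
   V(h^(m)(x) - t), the limit reduces to the uniform convergence of the edge-wise linear
   interpolations h^(m) to h. On the gasket, D f is the L^2-limit of the martingale of ratios of cell
   energies E_w(f,h)/E_w(h); it is one-dimensional because the area form shrinks by 3/25 under
   harmonic extension. *)

theory Submission
  imports Defs "HOL-Probability.Probability"
begin

section \<open>Square integrable functions\<close>

text \<open>The objects of the problem are given by descriptions and choices. They are evaluated
  once, for an abstract space with a derivation \<open>D\<close>; the gasket and the graphs then
  only supply \<open>D\<close> and the measure. The decisive axiom \<open>calc\<close> compares
  increments: if u(x) - u(y) is a sum of c(x) (f(x) - f(y)) up to a small multiple of the |f(x) -
  f(y)|, then \<open>D u\<close> is the sum of the c D f. It yields the rules of calculus, and it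
  shows that two lists with the same function on pairs of points represent the same element of the
  Hilbert space.

  The shrinking of areas does not suffice by itself, since the energy of h in a cell shrinks too and
  appears in a denominator. Squared area over energy is therefore summed over subcells: 5/3 *
  (3/25)^2 = 3/125, and the inverse energies of the three subcells add up to at most 225/7 times
  that of the cell, which gives the ratio 27/35 < 1. On a graph the corresponding condition is that
  h is constant on no edge; an invariant modulo 3 secures it, except for the edge removed in
  (ii).\<close>

lemma L2_measurable [measurable_dest]: "f \<in> L2 M ==> f \<in> borel_measurable M" by (simp add: L2_def)

lemma L2_square_integrable: "f \<in> L2 M ==> integrable M (%x. (f x)^2)" by (simp add: L2_def)

lemma L2_mult_integrable:
 assumes f: "f \<in> L2 M" and g: "g \<in> L2 M"
 shows "integrable M (%x. f x * g x)"
proof (rule Bochner_Integration.integrable_bound[of _ "%x. (f x)^2 + (g x)^2"])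
 show "integrable M (%x. (f x)^2 + (g x)^2)" using f g by (simp add: L2_def)
 show "(%x. f x * g x) \<in> borel_measurable M" using f g by (auto simp: L2_def)
 have "\<bar>a * b\<bar> <= a^2 + b^2" for a b :: real
 proof -
  have "2 * \<bar>a\<bar> * \<bar>b\<bar> <= \<bar>a\<bar>^2 + \<bar>b\<bar>^2" by (rule sum_squares_bound)
  moreover have "0 <= \<bar>a\<bar> * \<bar>b\<bar>" by simp
  ultimately show ?thesis unfolding abs_mult power2_abs by linarith
 qed
 thus "AE x in M. norm (f x * g x) <= norm ((f x)^2 + (g x)^2)" by simp
qed

lemma L2_add:
 assumes "f \<in> L2 M" "g \<in> L2 M"
 shows "(%x. f x + g x) \<in> L2 M"
proof -
 have "integrable M (%x. (f x)^2 + 2 * (f x * g x) + (g x)^2)"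
  using assms L2_mult_integrable[OF assms] by (simp add: L2_def)
 hence "integrable M (%x. (f x + g x)^2)" by (simp add: power2_sum algebra_simps)
 thus ?thesis using assms by (auto simp: L2_def)
qed

lemma L2_cmult: "f \<in> L2 M ==> (%x. c * f x) \<in> L2 M" by (auto simp: L2_def power_mult_distrib)

lemma L2_uminus: "f \<in> L2 M ==> (%x. - f x) \<in> L2 M" by (simp add: L2_def)

lemma L2_diff: "f \<in> L2 M ==> g \<in> L2 M ==> (%x. f x - g x) \<in> L2 M"
 using L2_add[of f M "%x. - g x"] L2_uminus[of g M] by simp

lemma L2_zero: "(%_. 0) \<in> L2 M" by (simp add: L2_def)

lemma L2_cong_AE:
 assumes "f \<in> L2 M" "g \<in> borel_measurable M" "AE x in M. f x = g x"
 shows "g \<in> L2 M"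
proof -
 have "integrable M (%x. (g x)^2)" by (rule iffD1[OF integrable_cong_AE L2_square_integrable[OF assms(1)]])
   (use assms in "auto simp: L2_def")
 thus ?thesis using assms by (simp add: L2_def)
qed

lemma (in finite_measure) L2_bounded:
 assumes "f \<in> borel_measurable M" "AE x in M. \<bar>f x\<bar> <= B"
 shows "f \<in> L2 M"
proof -
 have "integrable M (%x. (f x)^2)" by (rule integrable_const_bound[of _ "B^2"])
   (use assms in "auto elim!: eventually_mono simp: abs_le_square_iff[symmetric]")
 thus ?thesis using assms by (simp add: L2_def)
qed

lemma (in finite_measure) L2_const: "(%_. c) \<in> L2 M" by (rule L2_bounded[of _ "\<bar>c\<bar>"]) auto

lemma (in finite_measure) L2_integrable: "f \<in> L2 M ==> integrable M f"
 using L2_mult_integrable[OF _ L2_const[of 1]] by fastforce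

lemma L2_mult_bounded:
 assumes g: "g \<in> borel_measurable M" "AE x in M. \<bar>g x\<bar> <= B" and f: "f \<in> L2 M"
 shows "(%x. g x * f x) \<in> L2 M"
proof -
 have "integrable M (%x. (g x * f x)^2)"
 proof (rule Bochner_Integration.integrable_bound[of _ "%x. B^2 * (f x)^2"])
  show "AE x in M. norm ((g x * f x)^2) <= norm (B^2 * (f x)^2)" using g(2)
  proof eventually_elim
   case (elim x)
   hence "(g x)^2 <= B^2" by (simp add: abs_le_square_iff[symmetric])
   thus ?case by (simp add: power_mult_distrib mult_right_mono)
  qed
 qed (use f g in "auto simp: L2_def")
 thus ?thesis using f g by (auto simp: L2_def)
qed

text \<open>The squared norm of a f - b g is a nonnegative quadratic form in (a, b); the choice a =
  C, b = B gives the inequality when C is not 0.\<close>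

lemma L2_Cauchy_Schwarz:
 assumes f: "f \<in> L2 M" and g: "g \<in> L2 M"
 shows "(LINT x|M. f x * g x)^2 <= (LINT x|M. (f x)^2) * (LINT x|M. (g x)^2)"
proof -
 define A B C where "A = (LINT x|M. (f x)^2)" and "B = (LINT x|M. f x * g x)" and "C = (LINT x|M. (g x)^2)"
 have int: "integrable M (%x. (f x)^2)" "integrable M (%x. (g x)^2)" "integrable M (%x. f x * g x)"
  using f g L2_mult_integrable by (auto simp: L2_def)
 have q: "0 <= a^2 * A - 2 * a * b * B + b^2 * C" for a b
 proof -
  have "0 <= (LINT x|M. (a * f x - b * g x)^2)" by simp
  also have "(%x. (a * f x - b * g x)^2)
    = (%x. a^2 * (f x)^2 - 2 * a * b * (f x * g x) + b^2 * (g x)^2)"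
   by (auto simp: power2_eq_square algebra_simps)
  also have "(LINT x|M. \<dots> x) = a^2 * A - 2 * a * b * B + b^2 * C" using int by (simp add: A_def B_def C_def)
  finally show ?thesis .
 qed
 have A: "0 <= A" "0 <= C" by (simp_all add: A_def C_def)
 show ?thesis
 proof (cases "C = 0")
  case True
  have "B = 0"
  proof (rule ccontr)
   assume "B ~= 0"
   \<comment> \<open>This b turns the form, which is linear in b for C = 0, into A - (A + 1) =
     -1.\<close>
   have "0 <= A - 2 * ((A + 1) / (2 * B)) * B" using q[of 1 "(A + 1) / (2 * B)"] True by simp
   with \<open>B ~= 0\<close> show False by (simp add: field_simps)
  qed
  thus ?thesis using A by (simp add: A_def B_def C_def)
 next
  case False
  have "0 <= C * (A * C - B^2)" using q[of C B] by (simp add: power2_eq_square algebra_simps)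
  hence "B^2 <= A * C" using A False by (simp add: zero_le_mult_iff)
  thus ?thesis by (simp add: A_def B_def C_def)
 qed
qed

lemma L2_norm_nonneg [simp]: "0 <= L2_norm M f" by (simp add: L2_norm_def)

lemma L2_norm_sq: "(L2_norm M f)^2 = (LINT x|M. (f x)^2)" by (simp add: L2_norm_def)

lemma L2_norm_CS:
 assumes "f \<in> L2 M" "g \<in> L2 M"
 shows "\<bar>\<integral>x. f x * g x \<partial>M\<bar> <= L2_norm M f * L2_norm M g" using real_sqrt_le_mono[OF L2_Cauchy_Schwarz[OF assms]]
 by (simp add: L2_norm_def real_sqrt_mult)

lemma L2_norm_add_sq:
 assumes f: "f \<in> L2 M" and g: "g \<in> L2 M"
 shows "(L2_norm M (%x. f x + g x))^2
  = (L2_norm M f)^2 + 2 * (LINT x|M. f x * g x) + (L2_norm M g)^2"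
proof -
 have "(%x. (f x + g x)^2) = (%x. (f x)^2 + 2 * (f x * g x) + (g x)^2)"
  by (auto simp: power2_eq_square algebra_simps)
 thus ?thesis using f g L2_mult_integrable[OF f g] by (simp add: L2_norm_sq L2_def)
qed

lemma L2_norm_uminus [simp]: "L2_norm M (%x. - f x) = L2_norm M f" by (simp add: L2_norm_def)

lemma L2_norm_minus_commute: "L2_norm M (%x. f x - g x) = L2_norm M (%x. g x - f x)"
 by (simp add: L2_norm_def power2_commute)

lemma L2_norm_diff_sq:
 assumes f: "f \<in> L2 M" and g: "g \<in> L2 M"
 shows "(L2_norm M (%x. f x - g x))^2
  = (L2_norm M f)^2 - 2 * (LINT x|M. f x * g x) + (L2_norm M g)^2"
 using L2_norm_add_sq[OF f L2_uminus[OF g]] by simp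

lemma L2_norm_add:
 assumes f: "f \<in> L2 M" and g: "g \<in> L2 M"
 shows "L2_norm M (%x. f x + g x) <= L2_norm M f + L2_norm M g"
proof (rule power2_le_imp_le)
 show "(L2_norm M (%x. f x + g x))^2 <= (L2_norm M f + L2_norm M g)^2"
  using L2_norm_CS[OF f g] by (simp add: L2_norm_add_sq[OF f g] power2_sum)
qed simp

lemma L2_norm_diff:
 assumes f: "f \<in> L2 M" and g: "g \<in> L2 M"
 shows "L2_norm M (%x. f x - g x) <= L2_norm M f + L2_norm M g" using L2_norm_add[OF f L2_uminus[OF g]] by simp

lemma L2_norm_triangle:
 assumes "f \<in> L2 M" "g \<in> L2 M" "k \<in> L2 M"
 shows "L2_norm M (%x. f x - k x) <= L2_norm M (%x. f x - g x) + L2_norm M (%x. g x - k x)"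
 using L2_norm_add[OF L2_diff[OF assms(1,2)] L2_diff[OF assms(2,3)]] by simp

lemma L2_norm_cmult: "L2_norm M (%x. c * f x) = \<bar>c\<bar> * L2_norm M f"
 by (simp add: L2_norm_def power_mult_distrib real_sqrt_mult)

lemma L2_norm_cong_AE:
 assumes "AE x in M. f x = g x"
  and [measurable]: "f \<in> borel_measurable M" "g \<in> borel_measurable M"
 shows "L2_norm M f = L2_norm M g" unfolding L2_norm_def
 by (rule arg_cong[where f=sqrt], rule integral_cong_AE) (use assms(1) in auto)

lemma L2_norm_eq_0:
 assumes "f \<in> L2 M" shows "L2_norm M f = 0 \<longleftrightarrow> (AE x in M. f x = 0)"
proof -
 have "L2_norm M f = 0 \<longleftrightarrow> (LINT x|M. (f x)^2) = 0" by (simp add: L2_norm_def)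
 also have "\<dots> \<longleftrightarrow> (AE x in M. (f x)^2 = 0)"
  by (rule integral_nonneg_eq_0_iff_AE) (use assms in "auto simp: L2_def")
 finally show ?thesis by simp
qed

lemma L2_AE_eqI:
 assumes "f \<in> L2 M" "g \<in> L2 M" "L2_norm M (%x. f x - g x) = 0"
 shows "AE x in M. f x = g x" using L2_norm_eq_0[OF L2_diff[OF assms(1,2)]] assms(3) by simp

text \<open>Membership in \<open>L2\<close> is included because \<open>L2_norm\<close> takes the
  value 0 on functions whose square is not integrable.\<close>

definition L2_lim :: "'a measure => (nat => 'a => real) => ('a => real) => bool" where
 "L2_lim M F f \<longleftrightarrow> (\<forall>n. F n \<in> L2 M) & f \<in> L2 M & (%n. L2_norm M (%x. F n x - f x)) \<longlonglongrightarrow> 0"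

definition L2_Cauchy :: "'a measure => (nat => 'a => real) => bool" where
 "L2_Cauchy M F \<longleftrightarrow> (\<forall>n. F n \<in> L2 M) &
  (\<forall>e>0. \<exists>N. ALL m>=N. ALL n>=N. L2_norm M (%x. F m x - F n x) < e)"

lemma L2_lim_I:
 assumes "!!n. F n \<in> L2 M" "f \<in> L2 M" "!!n. L2_norm M (%x. F n x - f x) <= b n" "b \<longlonglongrightarrow> 0"
 shows "L2_lim M F f" unfolding L2_lim_def using assms
 by (auto intro: tendsto_sandwich[OF _ _ tendsto_const assms(4)])

lemma L2_lim_unique:
 assumes "L2_lim M F f" "L2_lim M F g"
 shows "AE x in M. f x = g x"
proof (rule L2_AE_eqI)
 show fg: "f \<in> L2 M" "g \<in> L2 M" using assms by (auto simp: L2_lim_def)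
 have "(%n. L2_norm M (%x. F n x - f x) + L2_norm M (%x. F n x - g x)) \<longlonglongrightarrow> 0 + 0"
  using assms by (intro tendsto_add) (auto simp: L2_lim_def)
 moreover have "L2_norm M (%x. f x - g x)
   <= L2_norm M (%x. F n x - f x) + L2_norm M (%x. F n x - g x)" for n
  using L2_norm_triangle[of f M "F n" g] assms fg by (simp add: L2_lim_def L2_norm_minus_commute[of M f "F n"])
 ultimately have "L2_norm M (%x. f x - g x) <= 0 + 0" by (intro tendsto_lowerbound[where F=sequentially]) auto
 thus "L2_norm M (%x. f x - g x) = 0" by (simp add: order_antisym)
qed

lemma L2_lim_const: "f \<in> L2 M ==> L2_lim M (%_. f) f" by (simp add: L2_lim_def L2_norm_def)

lemma L2_lim_add:
 assumes "L2_lim M F f" "L2_lim M G g"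
 shows "L2_lim M (%n x. F n x + G n x) (%x. f x + g x)"
proof (rule L2_lim_I)
 fix n
 have "L2_norm M (%x. (F n x - f x) + (G n x - g x))
  <= L2_norm M (%x. F n x - f x) + L2_norm M (%x. G n x - g x)"
  by (rule L2_norm_add) (use assms in "auto simp: L2_lim_def intro: L2_diff")
 thus "L2_norm M (%x. (F n x + G n x) - (f x + g x))
   <= L2_norm M (%x. F n x - f x) + L2_norm M (%x. G n x - g x)" by (simp add: algebra_simps)
next
 show "(%n. L2_norm M (%x. F n x - f x) + L2_norm M (%x. G n x - g x)) \<longlonglongrightarrow> 0"
  using assms tendsto_add[of _ 0 sequentially _ 0] by (auto simp: L2_lim_def)
qed (use assms in "auto simp: L2_lim_def intro: L2_add")

lemma L2_lim_cmult:
 assumes "L2_lim M F f"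
 shows "L2_lim M (%n x. c * F n x) (%x. c * f x)"
proof -
 have "(%n. \<bar>c\<bar> * L2_norm M (%x. F n x - f x)) \<longlonglongrightarrow> \<bar>c\<bar> * 0"
  using assms by (intro tendsto_mult) (auto simp: L2_lim_def)
 thus ?thesis using assms by (auto simp: L2_lim_def L2_cmult L2_norm_cmult[symmetric] right_diff_distrib)
qed

lemma L2_lim_diff:
 assumes "L2_lim M F f" "L2_lim M G g"
 shows "L2_lim M (%n x. F n x - G n x) (%x. f x - g x)"
 using L2_lim_add[OF assms(1) L2_lim_cmult[OF assms(2), of "-1"]] by simp

lemma L2_lim_norm:
 assumes "L2_lim M F f"
 shows "(%n. L2_norm M (F n)) \<longlonglongrightarrow> L2_norm M f"
proof (rule LIM_zero_cancel, rule Lim_null_comparison)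
 show "\<forall>\<^sub>F n in sequentially. norm (L2_norm M (F n) - L2_norm M f) <= L2_norm M (%x. F n x - f x)"
 proof (rule always_eventually, rule allI)
  fix n
  have 1: "L2_norm M (F n) <= L2_norm M (%x. F n x - f x) + L2_norm M f"
   using L2_norm_add[of "%x. F n x - f x" M f] assms by (auto simp: L2_lim_def L2_diff)
  have 2: "L2_norm M f <= L2_norm M (%x. F n x - f x) + L2_norm M (F n)"
   using L2_norm_add[of "%x. f x - F n x" M "F n"] assms
   by (auto simp: L2_lim_def L2_diff L2_norm_minus_commute[of M f "F n"])
  show "norm (L2_norm M (F n) - L2_norm M f) <= L2_norm M (%x. F n x - f x)" using 1 2 by auto
 qed
qed (use assms in "simp add: L2_lim_def")

text \<open>Polarization reduces this to the convergence of norms.\<close>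

lemma L2_lim_inner:
 assumes F: "L2_lim M F f" and G: "L2_lim M G g"
 shows "(%n. LINT x|M. F n x * G n x) \<longlonglongrightarrow> (LINT x|M. f x * g x)"
proof -
 have pol: "(LINT x|M. u x * v x)
   = ((L2_norm M (%x. u x + v x))^2 - (L2_norm M (%x. u x - v x))^2) / 4"
  if "u \<in> L2 M" "v \<in> L2 M" for u v using that by (simp add: L2_norm_add_sq L2_norm_diff_sq)
 have "(%n. ((L2_norm M (%x. F n x + G n x))^2 - (L2_norm M (%x. F n x - G n x))^2) / 4) \<longlonglongrightarrow>
  ((L2_norm M (%x. f x + g x))^2 - (L2_norm M (%x. f x - g x))^2) / 4"
  by (intro tendsto_intros L2_lim_norm L2_lim_add L2_lim_diff F G)
   simp
 moreover have "f \<in> L2 M" "g \<in> L2 M" "!!n. F n \<in> L2 M" "!!n. G n \<in> L2 M" using F G by (auto simp: L2_lim_def)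
 ultimately show ?thesis by (simp add: pol)
qed

lemma L2_lim_Cauchy:
 assumes F: "L2_lim M F f" shows "L2_Cauchy M F" unfolding L2_Cauchy_def
proof (intro conjI allI impI)
 show "F n \<in> L2 M" for n using F by (simp add: L2_lim_def)
 fix e :: real assume "e > 0"
 hence "eventually (%n. L2_norm M (%x. F n x - f x) < e / 2) sequentially"
  using F by (intro order_tendstoD(2)[where y=0]) (auto simp: L2_lim_def)
 then obtain N where N: "!!n. n >= N ==> L2_norm M (%x. F n x - f x) < e / 2"
  by (auto simp: eventually_sequentially)
 have "L2_norm M (%x. F m x - F n x) < e" if "m >= N" "n >= N" for m n
 proof -
  have "L2_norm M (%x. F m x - F n x) <= L2_norm M (%x. F m x - f x) + L2_norm M (%x. f x - F n x)"
   by (rule L2_norm_triangle) (use F in "auto simp: L2_lim_def")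
  thus ?thesis using N[OF that(1)] N[OF that(2)] L2_norm_minus_commute[of M f "F n"] by simp
 qed
 thus "\<exists>N. ALL m>=N. ALL n>=N. L2_norm M (%x. F m x - F n x) < e" by blast
qed

text \<open>Riesz-Fischer. Along a subsequence with geometrically small gaps the sum of the gaps is
  integrable, because the measure is finite, so the subsequence converges almost everywhere. Fatou's
  lemma transfers the Cauchy estimate to the pointwise limit.\<close>

lemma (in finite_measure) L2_complete:
 assumes F: "L2_Cauchy M F"
 obtains f where "L2_lim M F f"
proof -
 have FL [simp]: "F n \<in> L2 M" for n using F by (simp add: L2_Cauchy_def)
 have FM [measurable]: "F n \<in> borel_measurable M" for n by (rule L2_measurable) simp
 have "\<exists>r. \<forall>k. (ALL m>=r k. ALL n>=r k. L2_norm M (%x. F m x - F n x) < (1/2)^k) & r k < r (Suc k)"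
 proof (rule dependent_nat_choice)
  show "\<exists>x. ALL m>=x. ALL n>=x. L2_norm M (%y. F m y - F n y) < (1/2) ^ 0"
   using F unfolding L2_Cauchy_def by simp
 next
  fix x k
  obtain N where N: "ALL m>=N. ALL n>=N. L2_norm M (%y. F m y - F n y) < (1/2) ^ Suc k"
   using F unfolding L2_Cauchy_def by (meson zero_less_power half_gt_zero zero_less_one)
  show "\<exists>y. (ALL m>=y. ALL n>=y. L2_norm M (%x. F m x - F n x) < (1/2) ^ Suc k) & x < y"
   by (rule exI[of _ "max N (Suc x)"]) (use N in auto)
 qed
 then obtain r where r: "!!k m n. m >= r k ==> n >= r k ==> L2_norm M (%x. F m x - F n x) < (1/2)^k"
  and rS: "!!k. r k < r (Suc k)" by blast
 have mono: "r k <= r l" if "k <= l" for k l using lift_Suc_mono_le[of r, OF less_imp_le[OF rS] that] .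
 define d where "d k x = \<bar>F (r (Suc k)) x - F (r k) x\<bar>" for k x
 have dL: "d k \<in> L2 M" for k
  using L2_square_integrable[OF L2_diff[OF FL FL]] unfolding d_def by (simp add: L2_def)
 have dM [measurable]: "d k \<in> borel_measurable M" for k by (rule L2_measurable[OF dL])
 define c where "c = L2_norm M (%_. 1)"
 have dI: "(LINT x|M. d k x) <= c * (1/2)^k" for k
 proof -
  have "(LINT x|M. d k x * 1) <= L2_norm M (d k) * c"
   unfolding c_def using L2_norm_CS[OF dL L2_const[of 1], of k] by simp
  moreover have "L2_norm M (d k) <= (1/2)^k"
   using r[of k "r (Suc k)" "r k"] mono[of k "Suc k"] by (simp add: L2_norm_def d_def)
  ultimately show ?thesis
   using mult_right_mono[of "L2_norm M (d k)" "(1/2)^k" c] by (simp add: c_def mult.commute)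
 qed
 have "(\<integral>\<^sup>+x. (\<Sum>k. ennreal (d k x)) \<partial>M) = (\<Sum>k. \<integral>\<^sup>+x. ennreal (d k x) \<partial>M)" by (rule nn_integral_suminf) simp
 also have "\<dots> = (\<Sum>k. ennreal (LINT x|M. d k x))"
  by (subst nn_integral_eq_integral) (auto intro: L2_integrable[OF dL] simp: d_def)
 also have "\<dots> <= (\<Sum>k. ennreal (c * (1/2)^k))" by (intro suminf_le ennreal_leI dI summableI)
 also have "\<dots> < \<top>" by (subst suminf_ennreal2) (auto simp: c_def intro!: summable_mult summable_geometric)
 finally have "AE x in M. (\<Sum>k. ennreal (d k x)) ~= \<infinity>" by (intro nn_integral_PInf_AE) auto
 hence AEsum: "AE x in M. summable (%k. d k x)"
  by eventually_elim (rule summable_suminf_not_top, auto simp: d_def)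
 \<comment> \<open>Where the subsequence diverges, \<open>lim\<close> returns an arbitrary value; by
   \<open>AEsum\<close> this happens on a null set only.\<close>
 define f where "f x = lim (%k. F (r k) x)" for x
 have fM [measurable]: "f \<in> borel_measurable M" unfolding f_def by (rule borel_measurable_lim_metric) simp
 have AElim: "AE x in M. (%k. F (r k) x) \<longlonglongrightarrow> f x" using AEsum
 proof eventually_elim
  case (elim x)
  hence "summable (%k. F (r (Suc k)) x - F (r k) x)" unfolding d_def by (rule summable_rabs_cancel)
  hence "convergent (%n. \<Sum>k<n. F (r (Suc k)) x - F (r k) x)" by (simp add: summable_iff_convergent)
  hence "convergent (%n. F (r n) x - F (r 0) x)" by (simp add: sum_lessThan_telescope[of "%k. F (r k) x"])
  hence "convergent (%n. F (r n) x)" using convergent_add[of "%n. F (r n) x - F (r 0) x" "%_. F (r 0) x"]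
   by (simp add: convergent_const)
  thus ?case by (simp add: f_def convergent_LIMSEQ_iff)
 qed
 have bound: "(\<integral>\<^sup>+x. ennreal ((F n x - f x)^2) \<partial>M) <= ennreal (((1/2)^k)^2)" if n: "n >= r k" for n k
 proof -
  have "(\<integral>\<^sup>+x. ennreal ((F n x - f x)^2) \<partial>M)
    = (\<integral>\<^sup>+x. liminf (%j. ennreal ((F n x - F (r j) x)^2)) \<partial>M)"
  proof (rule nn_integral_cong_AE)
   show "AE x in M. ennreal ((F n x - f x)^2) = liminf (%j. ennreal ((F n x - F (r j) x)^2))" using AElim
   proof eventually_elim
    case (elim x)
    have "(%j. ennreal ((F n x - F (r j) x)^2)) \<longlonglongrightarrow> ennreal ((F n x - f x)^2)"
     by (intro tendsto_intros tendsto_ennrealI elim)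
    from lim_imp_Liminf[OF _ this] show ?case by simp
   qed
  qed
  also have "\<dots> <= liminf (%j. \<integral>\<^sup>+x. ennreal ((F n x - F (r j) x)^2) \<partial>M)" by (rule nn_integral_liminf) simp
  also have "\<dots> <= liminf (%j. ennreal (((1/2)^k)^2))"
  proof (rule Liminf_mono, unfold eventually_sequentially, intro exI allI impI)
   fix j assume "k <= j"
   hence "L2_norm M (%x. F n x - F (r j) x) < (1/2)^k" using r[OF n mono] by simp
   hence "(L2_norm M (%x. F n x - F (r j) x))^2 <= ((1/2)^k)^2" by (intro power_mono) auto
   moreover have "(\<integral>\<^sup>+x. ennreal ((F n x - F (r j) x)^2) \<partial>M)
     = ennreal ((L2_norm M (%x. F n x - F (r j) x))^2)" unfolding L2_norm_sq
    by (rule nn_integral_eq_integral) (use L2_square_integrable[OF L2_diff[OF FL FL]] in auto)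
   ultimately show "(\<integral>\<^sup>+x. ennreal ((F n x - F (r j) x)^2) \<partial>M) <= ennreal (((1/2)^k)^2)"
    by (simp add: ennreal_leI)
  qed
  also have "\<dots> = ennreal (((1/2)^k)^2)" by (intro lim_imp_Liminf) auto
  finally show ?thesis .
 qed
 have dfL: "(%x. F (r 0) x - f x) \<in> L2 M" unfolding L2_def
  using bound[of 0 "r 0"] by (auto intro!: integrableI_bounded simp: le_less_trans)
 hence fL: "f \<in> L2 M" using L2_diff[OF FL[of "r 0"] dfL] by simp
 have le: "L2_norm M (%x. F n x - f x) <= (1/2)^k" if n: "n >= r k" for n k
 proof -
  have "ennreal ((L2_norm M (%x. F n x - f x))^2) <= ennreal (((1/2)^k)^2)"
   using bound[OF n] unfolding L2_norm_sq by (subst nn_integral_eq_integral[symmetric])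
    (use L2_square_integrable[OF L2_diff[OF FL fL]] in auto)
  hence "(L2_norm M (%x. F n x - f x))^2 <= ((1/2)^k)^2" by (subst (asm) ennreal_le_iff) auto
  thus ?thesis by (rule power2_le_imp_le) simp
 qed
 have "(%n. L2_norm M (%x. F n x - f x)) \<longlonglongrightarrow> 0"
 proof (rule LIMSEQ_I)
  fix e :: real assume "e > 0"
  then obtain k where "(1/2::real)^k < e" using real_arch_pow_inv[of e "1/2"] by auto
  thus "\<exists>no. ALL n>=no. norm (L2_norm M (%x. F n x - f x) - 0) < e"
   by (intro exI[of _ "r k"]) (auto intro: le_less_trans[OF le])
 qed
 thus ?thesis using that[of f] fL by (simp add: L2_lim_def)
qed

lemma L2_lim_L2: "L2_lim M F f ==> f \<in> L2 M" "L2_lim M F f ==> F n \<in> L2 M" by (auto simp: L2_lim_def)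

text \<open>By the parallelogram law a sequence minimising the distance to the closed subspace is
  Cauchy; varying its limit in the direction u gives orthogonality to u.\<close>

lemma (in finite_measure) L2_projection:
 assumes W: "W \<subseteq> L2 M" "W ~= {}"
  and Wadd: "!!u v. u \<in> W ==> v \<in> W ==> (%x. u x + v x) \<in> W"
  and Wcm: "!!c u. u \<in> W ==> (%x. c * u x) \<in> W"
  and Wcl: "!!F f. (!!n. F n \<in> W) ==> L2_lim M F f ==> f \<in> W"
  and f: "f \<in> L2 M"
 obtains w where "w \<in> W" "!!v. v \<in> W ==> (LINT x|M. (f x - w x) * v x) = 0"
proof -
 define N where "N w = (L2_norm M (%x. f x - w x))^2" for w
 define d where "d = (INF w\<in>W. N w)"
 have bdd: "bdd_below (N ` W)" by (rule bdd_belowI[of _ 0]) (auto simp: N_def)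
 have dle: "d <= N w" if "w \<in> W" for w unfolding d_def using that bdd by (intro cINF_lower)
 have "\<exists>w\<in>W. N w < d + 1 / (real n + 1)" for n
  using cINF_less_iff[OF W(2) bdd, of "d + 1 / (real n + 1)"] by (auto simp: d_def)
 then obtain w where w: "!!n. w n \<in> W" "!!n. N (w n) < d + 1 / (real n + 1)" by metis
 have wL: "w n \<in> L2 M" for n using w W by auto
 have par: "(L2_norm M (%x. w m x - w n x))^2 <= 2 / (real m + 1) + 2 / (real n + 1)" for m n
 proof -
  let ?a = "%x. f x - w m x" and ?b = "%x. f x - w n x"
  have ab: "?a \<in> L2 M" "?b \<in> L2 M" by (auto intro: L2_diff f wL)
  have "(L2_norm M (%x. ?b x - ?a x))^2 + (L2_norm M (%x. ?b x + ?a x))^2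
    = 2 * N (w m) + 2 * N (w n)" unfolding L2_norm_add_sq[OF ab(2,1)] L2_norm_diff_sq[OF ab(2,1)] N_def by simp
  moreover have "(%x. ?b x + ?a x) = (%x. 2 * (f x - (1/2) * (w m x + w n x)))"
   by (rule ext) (simp add: algebra_simps)
  hence "(L2_norm M (%x. ?b x + ?a x))^2 = 4 * N (%x. (1/2) * (w m x + w n x))"
   unfolding N_def using L2_norm_cmult[of M 2 "%x. f x - (1/2) * (w m x + w n x)"]
   by (simp only: power_mult_distrib) simp
  moreover have "d <= N (%x. (1/2) * (w m x + w n x))" by (intro dle Wcm Wadd w)
  moreover have "(%x. ?b x - ?a x) = (%x. w m x - w n x)" by auto
  moreover have "2 * N (w m) + 2 * N (w n) <= 4 * d + (2 / (real m + 1) + 2 / (real n + 1))"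
   using w(2)[of m] w(2)[of n] by simp
  ultimately show ?thesis by (simp only:)
 qed
 have "L2_Cauchy M w" unfolding L2_Cauchy_def
 proof (intro conjI allI impI wL)
  fix e :: real assume "e > 0"
  hence e2: "e^2 > 0" by simp
  obtain K where "4 / e^2 < real K" using reals_Archimedean2 by blast
  hence "4 < real K * e^2" using e2 by (simp add: pos_divide_less_eq)
  also have "\<dots> <= (real K + 1) * e^2" by (rule mult_right_mono) auto
  finally have K: "4 / (real K + 1) < e^2" by (simp add: pos_divide_less_eq mult.commute)
  have "L2_norm M (%x. w m x - w n x) < e" if "m >= K" "n >= K" for m n
  proof -
   have "2 / (real m + 1) <= 2 / (real K + 1)" "2 / (real n + 1) <= 2 / (real K + 1)"
    using that by (auto intro!: divide_left_mono)
   hence "(L2_norm M (%x. w m x - w n x))^2 < e^2" using par[of m n] K by simp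
   thus ?thesis using \<open>e > 0\<close> by (simp add: power2_less_imp_less)
  qed
  thus "\<exists>N. ALL m>=N. ALL n>=N. L2_norm M (%x. w m x - w n x) < e" by blast
 qed
 then obtain v where v: "L2_lim M w v" by (rule L2_complete)
 have vW: "v \<in> W" by (rule Wcl[OF w(1) v])
 have vL: "v \<in> L2 M" using vW W by auto
 have "(%n. N (w n)) \<longlonglongrightarrow> N v" unfolding N_def by (intro tendsto_power L2_lim_norm L2_lim_diff L2_lim_const f v)
 moreover have "(%n. d + 1 / (real n + 1)) \<longlonglongrightarrow> d + 0"
  by (intro tendsto_add tendsto_const) (use LIMSEQ_inverse_real_of_nat in "simp add: inverse_eq_divide add.commute")
 ultimately have Nv: "N v <= d"
  using LIMSEQ_le[of "%n. N (w n)" "N v" "%n. d + 1 / (real n + 1)" "d + 0"] less_imp_le[OF w(2)] by auto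
 show ?thesis
 proof (rule that[OF vW])
  fix u assume u: "u \<in> W"
  hence uL: "u \<in> L2 M" using W by auto
  define p s where "p = (LINT x|M. (f x - v x) * u x)" and "s = (L2_norm M u)^2"
  have q: "0 <= - 2 * t * p + t^2 * s" for t
  proof -
   have "d <= N (%x. v x + t * u x)" by (intro dle Wadd Wcm vW u)
   also have "N (%x. v x + t * u x) = (L2_norm M (%x. (f x - v x) - t * u x))^2"
    by (simp add: N_def diff_diff_eq)
   also have "\<dots> = N v - 2 * (LINT x|M. (f x - v x) * (t * u x)) + t^2 * s"
    by (simp add: L2_norm_diff_sq L2_diff L2_cmult f vL uL N_def L2_norm_cmult s_def power_mult_distrib)
   also have "(LINT x|M. (f x - v x) * (t * u x)) = t * p"
    unfolding p_def by (subst integral_mult_right_zero[symmetric]) (simp add: ac_simps)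
   finally show ?thesis using Nv by simp
  qed
  have "s >= 0" by (simp add: s_def)
  \<comment> \<open>The optimal step is p / s. The added 1 avoids division by zero and still turns
    the inequality into 0 <= - t^2 (s + 2).\<close>
  define t where "t = p / (s + 1)"
  have p: "p = t * (s + 1)" using \<open>s >= 0\<close> by (simp add: t_def)
  have "0 <= - (t^2 * (s + 2))" using q[of t] unfolding p by (simp add: power2_eq_square algebra_simps)
  hence "t^2 * (s + 2) <= 0" by simp
  hence "t = 0" using \<open>s >= 0\<close> by (simp add: mult_le_0_iff)
  hence "p = 0" by (simp add: p)
  thus "(LINT x|M. (f x - v x) * u x) = 0" by (simp add: p_def)
 qed
qed

section \<open>Finite Borel measures on compact metric spaces\<close>

lemma radon_on_measurable:
 assumes "radon_on S M" "continuous_on (carr S) f"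
 shows "f \<in> borel_measurable M" using assms borel_measurable_continuous_on_restrict[of "carr S" f]
 by (simp add: radon_on_def cong: measurable_cong_sets)

lemma radon_on_space: "radon_on S M ==> space M = carr S"
 unfolding radon_on_def using sets_eq_imp_space_eq[of M "restrict_space borel (carr S)"]
 by (simp add: space_restrict_space)

lemma radon_on_bounded:
 assumes "radon_on S M" "compact (carr S)" "continuous_on (carr S) (f :: _ => real)"
 obtains B where "AE x in M. \<bar>f x\<bar> <= B" "!!x. x \<in> carr S ==> \<bar>f x\<bar> <= B"
proof -
 have "bounded (f ` carr S)" using assms by (intro compact_imp_bounded compact_continuous_image)
 then obtain B where "!!x. x \<in> carr S ==> \<bar>f x\<bar> <= B" by (auto simp: bounded_iff)
 thus ?thesis using that[of B] radon_on_space[OF assms(1)] by (auto intro: AE_I2)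
qed

text \<open>The closed subsets generate the sigma-algebra and are stable under intersection, so two
  measures are equal if they agree on them. The indicator of a closed set is the bounded pointwise
  limit of the continuous cutoffs max 0 (1 - n * infdist x F).\<close>

lemma radon_eqI:
 fixes S :: "'a::metric_space energy_space"
 assumes M: "radon_on S M" and N: "radon_on S N" and cpt: "compact (carr S)"
  and eq: "!!f :: 'a => real. continuous_on (carr S) f ==> (LINT x|M. f x) = (LINT x|N. f x)"
 shows "M = N"
proof (rule measure_eqI_generator_eq[where \<Omega>="carr S" and E="(\<inter>) (carr S) ` Collect closed"
   and A="%_. carr S"])
 show "Int_stable ((\<inter>) (carr S) ` Collect closed)"
 proof (rule Int_stableI)
  fix a b assume "a \<in> (\<inter>) (carr S) ` Collect closed" "b \<in> (\<inter>) (carr S) ` Collect closed"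
  then obtain F G where "closed F" "closed G" "a = carr S \<inter> F" "b = carr S \<inter> G" by auto
  hence "a \<inter> b = carr S \<inter> (F \<inter> G)" "closed (F \<inter> G)" by auto
  thus "a \<inter> b \<in> (\<inter>) (carr S) ` Collect closed" by simp
 qed
 have "sets (restrict_space borel (carr S)) = sigma_sets (carr S) ((\<inter>) (carr S) ` Collect closed)"
  unfolding sets_restrict_space borel_eq_closed by (subst sets_measure_of, simp, rule sigma_sets_Int)
   (auto intro!: sigma_sets.Basic compact_imp_closed[OF cpt])
 thus "sets M = sigma_sets (carr S) ((\<inter>) (carr S) ` Collect closed)"
  "sets N = sigma_sets (carr S) ((\<inter>) (carr S) ` Collect closed)" using M N by (auto simp: radon_on_def)
 show "range (%_::nat. carr S) \<subseteq> (\<inter>) (carr S) ` Collect closed" using compact_imp_closed[OF cpt] by auto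
 interpret M: finite_measure M using M by (simp add: radon_on_def)
 interpret N: finite_measure N using N by (simp add: radon_on_def)
 show "emeasure M (carr S) ~= \<infinity>" by simp
 fix X assume "X \<in> (\<inter>) (carr S) ` Collect closed"
 then obtain F where F: "closed F" and X: "X = carr S \<inter> F" by auto
 show "emeasure M X = emeasure N X"
 \<comment> \<open>\<open>infdist x {}\<close> is 0, so for the empty set the cutoffs would be
   constantly 1.\<close>
 proof (cases "F = {}")
  case True thus ?thesis by (simp add: X)
 next
  case False
  define f where "f n x = max 0 (1 - real n * infdist x F)" for n x
  have fc: "continuous_on (carr S) (f n)" for n unfolding f_def by (intro continuous_intros)
  have lim: "(%n. f n x) \<longlonglongrightarrow> indicator F x" for x
  proof (cases "x \<in> F")
   case True thus ?thesis by (simp add: f_def)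
  next
   case False
   hence pos: "infdist x F > 0"
    using F \<open>F ~= {}\<close> infdist_nonneg[of x F] in_closed_iff_infdist_zero[of F x] by fastforce
   then obtain n0 where "1 / infdist x F < real n0" using reals_Archimedean2 by blast
   hence "f n x = 0" if "n >= n0" for n
   proof -
    have "1 < real n0 * infdist x F" using \<open>1 / infdist x F < real n0\<close> pos by (simp add: field_simps)
    also have "\<dots> <= real n * infdist x F" using that pos by (intro mult_right_mono) auto
    finally show ?thesis by (simp add: f_def)
   qed
   thus ?thesis using False by (intro tendsto_eventually) (auto simp: eventually_sequentially)
  qed
  have int: "(%n. LINT x|Q. f n x) \<longlonglongrightarrow> measure Q X" if Q: "radon_on S Q" for Q
  proof -
   interpret Q: finite_measure Q using Q by (simp add: radon_on_def)
   have XQ: "X \<in> sets Q" using Q F unfolding X radon_on_def by (auto simp: sets_restrict_space)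
   have "(%n. LINT x|Q. f n x) \<longlonglongrightarrow> (LINT x|Q. indicator X x)"
   proof (rule integral_dominated_convergence[where w="%_. 1"])
    show "AE x in Q. (%n. f n x) \<longlonglongrightarrow> indicator X x"
    proof (rule AE_I2)
     fix x assume "x \<in> space Q"
     hence "indicator X x = (indicator F x :: real)" by (auto simp: radon_on_space[OF Q] X indicator_def)
     thus "(%n. f n x) \<longlonglongrightarrow> indicator X x" using lim by simp
    qed
    show "AE x in Q. norm (f n x) <= 1" for n by (auto simp: f_def infdist_nonneg)
   qed (use XQ radon_on_measurable[OF Q fc] in auto)
   thus ?thesis using XQ by simp
  qed
  have "measure M X = measure N X" by (rule LIMSEQ_unique[OF int[OF M]]) (use int[OF N] eq[OF fc] in simp)
  thus ?thesis by (simp add: M.emeasure_eq_measure N.emeasure_eq_measure)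
 qed
next
 show "(\<inter>) (carr S) ` Collect closed \<subseteq> Pow (carr S)" by blast
 show "(\<Union>i::nat. carr S) = carr S" by blast
qed

text \<open>\<open>ennreal\<close> sends negative reals to 0, so this is the measure with density
  max 0 k. Applied to k and to - k it gives the two parts of a signed measure with density
  k.\<close>

lemma radon_on_density:
 fixes k :: "'a::topological_space => real"
 assumes M: "radon_on S M" and k: "integrable M k"
 shows "radon_on S (density M (%x. ennreal (k x)))"
proof -
 have km [measurable]: "k \<in> borel_measurable M" using k by auto
 have "emeasure (density M (%x. ennreal (k x))) (space M) = (\<integral>\<^sup>+x. ennreal (k x) \<partial>M)"
  by (subst emeasure_density) (auto intro!: nn_integral_cong)
 moreover have "(\<integral>\<^sup>+x. ennreal (k x) \<partial>M) ~= \<infinity>" using k unfolding real_integrable_def by blast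
 ultimately have "finite_measure (density M (%x. ennreal (k x)))" by (intro finite_measureI) simp
 thus ?thesis using M by (simp add: radon_on_def)
qed

lemma radon_on_density_diff:
 fixes k f :: "'a::topological_space => real"
 assumes M: "radon_on S M" and cpt: "compact (carr S)" and k: "integrable M k"
  and f: "continuous_on (carr S) f"
 shows "(\<integral>x. f x \<partial>density M (%x. ennreal (k x))) - (\<integral>x. f x \<partial>density M (%x. ennreal (- k x)))
  = (LINT x|M. k x * f x)"
proof -
 have km [measurable]: "k \<in> borel_measurable M" using k by auto
 have fm [measurable]: "f \<in> borel_measurable M" by (rule radon_on_measurable[OF M f])
 obtain B where B: "AE x in M. \<bar>f x\<bar> <= B" using radon_on_bounded[OF M cpt f] by blast
 have int: "(\<integral>x. f x \<partial>density M (%x. ennreal (l x))) = (LINT x|M. max 0 (l x) * f x)"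
  if [measurable]: "l \<in> borel_measurable M" for l
 proof -
  have "density M (%x. ennreal (l x)) = density M (%x. ennreal (max 0 (l x)))"
   by (rule density_cong) (auto simp: max_def ennreal_neg)
  thus ?thesis using integral_density[of f M "%x. max 0 (l x)"] by (simp only:) simp
 qed
 have "integrable M (%x. max 0 (l x) * f x)" if l: "integrable M l" for l
 proof (rule Bochner_Integration.integrable_bound[of _ "%x. B * l x"])
  show "AE x in M. norm (max 0 (l x) * f x) <= norm (B * l x)" using B
  proof eventually_elim
   case (elim x)
   have "\<bar>max 0 (l x)\<bar> * \<bar>f x\<bar> <= \<bar>l x\<bar> * \<bar>B\<bar>" by (rule mult_mono) (use elim in auto)
   thus ?case by (simp add: abs_mult mult_ac)
  qed
 qed (use l in "auto intro: borel_measurable_times")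
 hence "(LINT x|M. max 0 (k x) * f x) - (LINT x|M. max 0 (- k x) * f x)
   = (LINT x|M. max 0 (k x) * f x - max 0 (- k x) * f x)"
  using k by (intro Bochner_Integration.integral_diff[symmetric]) auto
 also have "\<dots> = (LINT x|M. k x * f x)"
  by (rule Bochner_Integration.integral_cong) (auto simp: max_def algebra_simps)
 finally show ?thesis by (simp add: int)
qed

text \<open>The positive and the negative part of k define Radon measures with the same integrals of
  continuous functions. The measures are therefore equal, and so are their densities.\<close>

lemma radon_integral_zero_AE:
 fixes S :: "'a::metric_space energy_space"
  and k :: "'a => real"
 assumes M: "radon_on S M" and cpt: "compact (carr S)" and k: "integrable M k"
  and eq: "!!f :: 'a => real. continuous_on (carr S) f ==> (LINT x|M. k x * f x) = 0"
 shows "AE x in M. k x = 0"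
proof -
 have km [measurable]: "k \<in> borel_measurable M" using k by auto
 have "density M (%x. ennreal (k x)) = density M (%x. ennreal (- k x))"
 proof (rule radon_eqI[OF radon_on_density[OF M] radon_on_density[OF M] cpt])
  fix f :: "'a => real" assume f: "continuous_on (carr S) f"
  show "(\<integral>x. f x \<partial>density M (%x. ennreal (k x))) = (\<integral>x. f x \<partial>density M (%x. ennreal (- k x)))"
   using radon_on_density_diff[OF M cpt k f] eq[OF f] by simp
 qed (use k in auto)
 moreover have "(\<integral>\<^sup>+x. ennreal (k x) \<partial>M) ~= \<infinity>" using k unfolding real_integrable_def by blast
 ultimately have "AE x in M. ennreal (k x) = ennreal (- k x)" by (subst finite_density_unique[symmetric]) auto
 thus ?thesis
 proof eventually_elim
  case (elim x)
  thus ?case by (cases "k x" "0::real" rule: linorder_cases) (auto simp: ennreal_neg)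
 qed
qed

lemma L2_lim_cong_AE:
 assumes F: "L2_lim M F f" and G: "!!n. G n \<in> L2 M" "!!n. AE x in M. F n x = G n x"
  and g: "g \<in> L2 M" "AE x in M. f x = g x"
 shows "L2_lim M G g"
proof -
 have "L2_norm M (%x. G n x - g x) = L2_norm M (%x. F n x - f x)" for n
 proof (rule L2_norm_cong_AE)
  show "AE x in M. G n x - g x = F n x - f x" using G(2)[of n] g(2) by eventually_elim simp
 qed (use F G(1)[of n] g(1) in "auto simp: L2_lim_def intro!: L2_measurable L2_diff")
 thus ?thesis using F G(1) g(1) by (simp add: L2_lim_def)
qed

section \<open>Energy spaces with a one-dimensional first order structure\<close>

text \<open>
 In the presence of a minimal energy-dominant field \<open>\<partial>h\<close> every gradient is \<open>\<partial>f = D f \<cdot> \<partial>h\<close>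
 for a function \<open>D f \<in> L^2(\<nu>\<^sub>h)\<close>, so \<open>D\<close> carries the whole first order structure. The rule
 \<open>calc\<close> bundles linearity, the Leibniz rule, the chain rule and locality of \<open>D\<close>.
\<close>

locale one_dim_energy =
 fixes S :: "'a::metric_space energy_space" and h :: "'a => real" and M :: "'a measure"
  and D :: "('a => real) => 'a => real"
 assumes cpt: "compact (carr S)"
  and fin_bdry: "finite (bdry S)" and bdry_sub: "bdry S \<subseteq> carr S" and bdry_ne: "bdry S ~= {}"
  and dom_cont: "f \<in> fdom S ==> continuous_on (carr S) f"
  and radon: "radon_on S M"
  and supp: "open U ==> U \<inter> carr S ~= {} ==> emeasure M (U \<inter> carr S) ~= 0"
  and bdry_null: "AE x in M. x \<notin> bdry S"
  and h_dom: "h \<in> fdom S" and D_h: "AE x in M. D h x = 1"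
  and D_L2: "f \<in> fdom S ==> D f \<in> L2 M"
  and energy_eq: "f \<in> fdom S ==> g \<in> fdom S ==> energy S f g = (LINT x|M. D f x * D g x)"
  and separate: "x \<in> carr S ==> y \<in> carr S ==> x ~= y ==> \<exists>f\<in>fdom S. f x ~= f y"
  and calc: "!!ps u. ps \<in> form_terms S ==>
   (!!e. e > 0 ==> \<exists>d>0. \<forall>x\<in>carr S. \<forall>y\<in>carr S. dist x y < d -->
     \<bar>u x - u y - (\<Sum>(a, f)\<leftarrow>ps. a x * (f x - f y))\<bar> <= e * (\<Sum>(a, f)\<leftarrow>ps. \<bar>f x - f y\<bar>)) ==>
   u \<in> fdom S & (AE x in M. D u x = (\<Sum>(a, f)\<leftarrow>ps. a x * D f x))"
  and poincare: "EX c>=0. \<forall>f\<in>fdom S. \<forall>x\<in>carr S. \<forall>y\<in>carr S. \<bar>f x - f y\<bar> <= c * L2_norm M (D f)"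
  and closed_D: "!!u v \<xi>. (!!n. u n \<in> fdom S) ==> uniform_limit (carr S) u v sequentially ==>
   L2_lim M (%n. D (u n)) \<xi> ==> v \<in> fdom S & (AE x in M. D v x = \<xi> x)"
begin

sublocale finite_measure M using radon unfolding radon_on_def by blast

lemma space_M: "space M = carr S" by (rule radon_on_space[OF radon])

lemma cont_meas [measurable_dest]: "continuous_on (carr S) f ==> f \<in> borel_measurable M"
 by (rule radon_on_measurable[OF radon])

lemma dom_meas: "f \<in> fdom S ==> f \<in> borel_measurable M" by (rule cont_meas[OF dom_cont])

lemma cont_bdd:
 assumes "continuous_on (carr S) (f :: 'a => real)"
 obtains B where "B > 0" "!!x. x \<in> carr S ==> \<bar>f x\<bar> <= B" "AE x in M. \<bar>f x\<bar> <= B"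
proof -
 obtain B where B: "!!x. x \<in> carr S ==> \<bar>f x\<bar> <= B" using radon_on_bounded[OF radon cpt assms] by blast
 hence "\<bar>f x\<bar> <= max B 1" if "x \<in> carr S" for x using that by (meson max.coboundedI1)
 thus ?thesis by (intro that[of "max B 1"]) (auto intro!: AE_I2 simp: space_M)
qed

lemma cont_L2: assumes "continuous_on (carr S) f" shows "f \<in> L2 M"
proof -
 obtain B where "AE x in M. \<bar>f x\<bar> <= B" using cont_bdd[OF assms] by blast
 thus ?thesis by (intro L2_bounded[of f B] cont_meas assms)
qed

lemma cont_mult_L2:
 assumes g: "continuous_on (carr S) g" and f: "f \<in> L2 M"
 shows "(%x. g x * f x) \<in> L2 M"
proof -
 obtain B where "AE x in M. \<bar>g x\<bar> <= B" using cont_bdd[OF g] by blast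
 thus ?thesis by (intro L2_mult_bounded[of g M B] cont_meas g f)
qed

lemma dom_L2: "f \<in> fdom S ==> f \<in> L2 M" by (rule cont_L2[OF dom_cont])

lemma D_meas: "f \<in> fdom S ==> D f \<in> borel_measurable M" using D_L2 by (auto simp: L2_def)

lemma const_dom: "(%_. c) \<in> fdom S" and D_const: "AE x in M. D (%_. c) x = 0"
 using calc[of "[]" "%_. c"] by (auto simp: form_terms_def intro: exI[of _ 1])

lemma lin_dom:
 assumes "f \<in> fdom S" "g \<in> fdom S"
 shows "(%x. a * f x + b * g x) \<in> fdom S"
  and D_lin: "AE x in M. D (%x. a * f x + b * g x) x = a * D f x + b * D g x"
proof -
 have "(%x. a * f x + b * g x) \<in> fdom S &
  (AE x in M. D (%x. a * f x + b * g x) x = (\<Sum>(a, f)\<leftarrow>[(%_. a, f), (%_. b, g)]. a x * D f x))"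
 proof (rule calc)
  fix e :: real assume "e > 0"
  thus "\<exists>d>0. \<forall>x\<in>carr S. \<forall>y\<in>carr S. dist x y < d -->
   \<bar>a * f x + b * g x - (a * f y + b * g y) - (\<Sum>(a, f)\<leftarrow>[(%_. a, f), (%_. b, g)]. a x * (f x - f y))\<bar>
   <= e * (\<Sum>(a, f)\<leftarrow>[(%_. a, f), (%_. b, g)]. \<bar>f x - f y\<bar>)" by (intro exI[of _ 1]) (auto simp: algebra_simps)
 qed (use assms in "auto simp: form_terms_def cont_funs_def")
 thus "(%x. a * f x + b * g x) \<in> fdom S"
  "AE x in M. D (%x. a * f x + b * g x) x = a * D f x + b * D g x" by auto
qed

lemma add_dom: "f \<in> fdom S ==> g \<in> fdom S ==> (%x. f x + g x) \<in> fdom S"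
 and D_add: "f \<in> fdom S ==> g \<in> fdom S ==> AE x in M. D (%x. f x + g x) x = D f x + D g x"
 using lin_dom[of f g 1 1] D_lin[of f g 1 1] by auto

lemma diff_dom: "f \<in> fdom S ==> g \<in> fdom S ==> (%x. f x - g x) \<in> fdom S"
 and D_diff: "f \<in> fdom S ==> g \<in> fdom S ==> AE x in M. D (%x. f x - g x) x = D f x - D g x"
 using lin_dom[of f g 1 "-1"] D_lin[of f g 1 "-1"] by auto

lemma cmult_dom: "f \<in> fdom S ==> (%x. c * f x) \<in> fdom S"
 and D_cmult: "f \<in> fdom S ==> AE x in M. D (%x. c * f x) x = c * D f x"
 using lin_dom[of f f c 0] D_lin[of f f c 0] by auto

lemma sum_dom: "finite I ==> (!!i. i \<in> I ==> f i \<in> fdom S) ==> (%x. \<Sum>i\<in>I. f i x) \<in> fdom S"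
 by (induction I rule: finite_induct) (auto intro: const_dom add_dom)

lemma unif_cont:
 fixes a :: "'a => real"
 assumes "continuous_on (carr S) a" "e > 0"
 obtains d where "d > 0" "!!x y. x \<in> carr S ==> y \<in> carr S ==> dist x y < d ==> \<bar>a x - a y\<bar> < e"
 using compact_uniformly_continuous[OF assms(1) cpt] assms(2)
 unfolding uniformly_continuous_on_def by (metis dist_real_def dist_commute)

lemma mult_dom:
 assumes fg: "f \<in> fdom S" "g \<in> fdom S"
 shows "(%x. f x * g x) \<in> fdom S"
  and D_mult: "AE x in M. D (%x. f x * g x) x = g x * D f x + f x * D g x"
proof -
 have "(%x. f x * g x) \<in> fdom S &
  (AE x in M. D (%x. f x * g x) x = (\<Sum>(a, f)\<leftarrow>[(g, f), (f, g)]. a x * D f x))"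
 proof (rule calc)
  fix e :: real assume "e > 0"
  then obtain d where d: "d > 0"
   "!!x y. x \<in> carr S ==> y \<in> carr S ==> dist x y < d ==> \<bar>f x - f y\<bar> < e"
   using unif_cont[OF dom_cont[OF fg(1)]] by blast
  show "\<exists>d>0. \<forall>x\<in>carr S. \<forall>y\<in>carr S. dist x y < d -->
   \<bar>f x * g x - f y * g y - (\<Sum>(a, f)\<leftarrow>[(g, f), (f, g)]. a x * (f x - f y))\<bar>
   <= e * (\<Sum>(a, f)\<leftarrow>[(g, f), (f, g)]. \<bar>f x - f y\<bar>)"
  proof (intro exI conjI ballI impI)
   fix x y assume xy: "x \<in> carr S" "y \<in> carr S" "dist x y < d"
   have "f x * g x - f y * g y - (g x * (f x - f y) + f x * (g x - g y)) = - ((f x - f y) * (g x - g y))"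
    by (simp add: algebra_simps)
   hence "\<bar>f x * g x - f y * g y - (g x * (f x - f y) + f x * (g x - g y))\<bar> = \<bar>f x - f y\<bar> * \<bar>g x - g y\<bar>"
    by (simp add: abs_mult)
   also have "\<dots> <= e * \<bar>g x - g y\<bar>" using d(2)[OF xy] by (intro mult_right_mono) auto
   also have "\<dots> <= e * (\<bar>f x - f y\<bar> + \<bar>g x - g y\<bar>)" using \<open>e > 0\<close> by simp
   finally show "\<bar>f x * g x - f y * g y - (\<Sum>(a, f)\<leftarrow>[(g, f), (f, g)]. a x * (f x - f y))\<bar>
   <= e * (\<Sum>(a, f)\<leftarrow>[(g, f), (f, g)]. \<bar>f x - f y\<bar>)" by simp
  qed (use d in auto)
 qed (use fg dom_cont in "auto simp: form_terms_def cont_funs_def")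
 thus "(%x. f x * g x) \<in> fdom S"
  "AE x in M. D (%x. f x * g x) x = g x * D f x + f x * D g x" by auto
qed

text \<open>The mean value theorem without an order between a and b; for a = b the point z = a
  serves.\<close>

lemma real_mean_value:
 fixes F F' :: "real => real"
 assumes "!!x. (F has_real_derivative F' x) (at x)"
 obtains z where "\<bar>z - a\<bar> <= \<bar>a - b\<bar>" "F a - F b = F' z * (a - b)" "min a b <= z" "z <= max a b"
proof (cases a b rule: linorder_cases)
 case less
 then obtain z where "a < z" "z < b" "F b - F a = (b - a) * F' z" using MVT2[of a b F F'] assms by blast
 thus ?thesis by (intro that[of z]) (auto simp: algebra_simps)
next
 case greater
 then obtain z where "b < z" "z < a" "F a - F b = (a - b) * F' z" using MVT2[of b a F F'] assms by blast
 thus ?thesis by (intro that[of z]) (auto simp: algebra_simps)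
qed (use that[of a] in auto)

lemma chain_dom:
 assumes F: "!!x. (F has_real_derivative F' x) (at x)" and F': "continuous_on UNIV F'"
  and f: "f \<in> fdom S"
 shows "(%x. F (f x)) \<in> fdom S"
  and D_chain: "AE x in M. D (%x. F (f x)) x = F' (f x) * D f x"
proof -
 have F'c: "continuous_on (carr S) (%x. F' (f x))" by (rule continuous_on_compose2[OF F' dom_cont[OF f]]) auto
 have "(%x. F (f x)) \<in> fdom S &
  (AE x in M. D (%x. F (f x)) x = (\<Sum>(a, f)\<leftarrow>[(%x. F' (f x), f)]. a x * D f x))"
 proof (rule calc)
  fix e :: real assume e: "e > 0"
  obtain B where B: "B > 0" "!!x. x \<in> carr S ==> \<bar>f x\<bar> <= B" using cont_bdd[OF dom_cont[OF f]] by blast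
  have "uniformly_continuous_on {-B..B} F'"
   by (intro compact_uniformly_continuous continuous_on_subset[OF F']) auto
  then obtain r where r: "r > 0" "!!s t. s \<in> {-B..B} ==> t \<in> {-B..B} ==> dist t s < r ==> dist (F' t) (F' s) < e"
   using e unfolding uniformly_continuous_on_def by blast
  obtain d where d: "d > 0"
   "!!x y. x \<in> carr S ==> y \<in> carr S ==> dist x y < d ==> \<bar>f x - f y\<bar> < r"
   using unif_cont[OF dom_cont[OF f] r(1)] by blast
  show "\<exists>d>0. \<forall>x\<in>carr S. \<forall>y\<in>carr S. dist x y < d -->
   \<bar>F (f x) - F (f y) - (\<Sum>(a, f)\<leftarrow>[(%x. F' (f x), f)]. a x * (f x - f y))\<bar>
   <= e * (\<Sum>(a, f)\<leftarrow>[(%x. F' (f x), f)]. \<bar>f x - f y\<bar>)"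
  proof (intro exI conjI ballI impI)
   fix x y assume xy: "x \<in> carr S" "y \<in> carr S" "dist x y < d"
   obtain z where z: "\<bar>z - f x\<bar> <= \<bar>f x - f y\<bar>" "F (f x) - F (f y) = F' z * (f x - f y)"
     "min (f x) (f y) <= z" "z <= max (f x) (f y)" using real_mean_value[OF F] by blast
   have "dist (F' z) (F' (f x)) < e"
    using B(2)[OF xy(1)] B(2)[OF xy(2)] d(2)[OF xy] z by (intro r) (auto simp: dist_real_def)
   hence "\<bar>F' z - F' (f x)\<bar> * \<bar>f x - f y\<bar> <= e * \<bar>f x - f y\<bar>"
    by (intro mult_right_mono) (auto simp: dist_real_def)
   thus "\<bar>F (f x) - F (f y) - (\<Sum>(a, f)\<leftarrow>[(%x. F' (f x), f)]. a x * (f x - f y))\<bar>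
   <= e * (\<Sum>(a, f)\<leftarrow>[(%x. F' (f x), f)]. \<bar>f x - f y\<bar>)" by (simp add: z(2) left_diff_distrib[symmetric] abs_mult)
  qed (use d in auto)
 qed (use f F'c in "auto simp: form_terms_def cont_funs_def")
 thus "(%x. F (f x)) \<in> fdom S"
  "AE x in M. D (%x. F (f x)) x = F' (f x) * D f x" by auto
qed

text \<open>Stone-Weierstrass: the domain is an algebra with constants that separates
  points.\<close>

lemma dense_cont:
 assumes "continuous_on (carr S) \<phi>"
 obtains F where "!!n. F n \<in> fdom S" "uniform_limit (carr S) F \<phi> sequentially"
proof -
 interpret function_ring_on "fdom S" "carr S"
  by unfold_locales (auto intro: cpt dom_cont add_dom mult_dom const_dom separate)
 show ?thesis using Stone_Weierstrass[OF assms] that by (auto simp: Pi_iff)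
qed

lemma unif_lim_integral:
 fixes \<phi> :: "'a => real"
 assumes N: "radon_on S N" and F: "!!n. continuous_on (carr S) (F n)"
  and lim: "uniform_limit (carr S) F \<phi> sequentially"
 shows "(%n. LINT x|N. F n x) \<longlonglongrightarrow> (LINT x|N. \<phi> x)"
proof -
 interpret N: finite_measure N using N unfolding radon_on_def by blast
 have \<phi>: "continuous_on (carr S) \<phi>" by (rule uniform_limit_theorem[OF always_eventually lim]) (auto intro: F)
 obtain B where B: "B > 0" "!!x. x \<in> carr S ==> \<bar>\<phi> x\<bar> <= B" using cont_bdd[OF \<phi>] by blast
 have "eventually (%n. \<forall>x\<in>carr S. dist (F n x) (\<phi> x) < 1) sequentially"
  using lim unfolding uniform_limit_iff by simp
 then obtain n0 where n0: "!!n x. n >= n0 ==> x \<in> carr S ==> dist (F n x) (\<phi> x) < 1"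
  by (auto simp: eventually_sequentially)
 have "(%n. LINT x|N. F (n + n0) x) \<longlonglongrightarrow> (LINT x|N. \<phi> x)"
 proof (rule integral_dominated_convergence[where w="%_. B + 1"])
  show "AE x in N. (%n. F (n + n0) x) \<longlonglongrightarrow> \<phi> x"
   using tendsto_uniform_limitI[OF lim] by (auto intro!: AE_I2 LIMSEQ_ignore_initial_segment simp: radon_on_space[OF N])
  show "AE x in N. norm (F (n + n0) x) <= B + 1" for n
  proof (rule AE_I2)
   fix x assume "x \<in> space N"
   thus "norm (F (n + n0) x) <= B + 1"
    using n0[of "n + n0" x] B(2)[of x] by (auto simp: radon_on_space[OF N] dist_real_def)
  qed
 qed (auto intro: radon_on_measurable[OF N] F \<phi>)
 thus ?thesis by (rule LIMSEQ_offset)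
qed

text \<open>Signed measures are represented by differences, as in \<open>energy_int\<close>. Since
  the domain is uniformly dense in the continuous functions, the value of \<open>energy_int\<close>
  does not depend on the pair of measures chosen.\<close>

lemma integral_determined:
 fixes g :: "'a => real"
 assumes "radon_on S M1" "radon_on S N1" "radon_on S M2" "radon_on S N2"
  and eq: "!!\<phi>. \<phi> \<in> fdom S ==> (LINT x|M1. \<phi> x) - (LINT x|N1. \<phi> x) = (LINT x|M2. \<phi> x) - (LINT x|N2. \<phi> x)"
  and g: "continuous_on (carr S) g"
 shows "(LINT x|M1. g x) - (LINT x|N1. g x) = (LINT x|M2. g x) - (LINT x|N2. g x)"
proof -
 obtain F where F: "!!n. F n \<in> fdom S" "uniform_limit (carr S) F g sequentially" using dense_cont[OF g] by blast
 have Fc: "!!n. continuous_on (carr S) (F n)" by (rule dom_cont[OF F(1)])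
 have "(%n. (LINT x|M1. F n x) - (LINT x|N1. F n x)) \<longlonglongrightarrow> (LINT x|M1. g x) - (LINT x|N1. g x)"
  by (intro tendsto_diff unif_lim_integral assms Fc F(2))
 moreover have "(%n. (LINT x|M2. F n x) - (LINT x|N2. F n x)) \<longlonglongrightarrow> (LINT x|M2. g x) - (LINT x|N2. g x)"
  by (intro tendsto_diff unif_lim_integral assms Fc F(2))
 ultimately show ?thesis using eq[OF F(1)] LIMSEQ_unique by simp
qed

lemma integral_determined_zero:
 assumes k: "k \<in> L2 M" and eq: "!!\<phi>. \<phi> \<in> fdom S ==> (LINT x|M. k x * \<phi> x) = 0"
 shows "AE x in M. k x = 0"
proof (rule radon_integral_zero_AE[OF radon cpt L2_integrable[OF k]])
 fix f :: "'a => real" assume f: "continuous_on (carr S) f"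
 have kI: "integrable M k" "integrable M (%x. - k x)" using L2_integrable[OF k] by auto
 have "(\<integral>x. f x \<partial>density M (%x. ennreal (k x))) - (\<integral>x. f x \<partial>density M (%x. ennreal (- k x)))
  = (LINT x|M. f x) - (LINT x|M. f x)" by (rule integral_determined)
   (auto intro!: radon_on_density[OF radon] kI radon f simp: radon_on_density_diff[OF radon cpt kI(1) dom_cont] eq)
 thus "(LINT x|M. k x * f x) = 0" by (simp add: radon_on_density_diff[OF radon cpt kI(1) f])
qed

text \<open>By the Leibniz rule all terms containing \<open>D \<phi>\<close> cancel, which leaves
  the density D f1 * D f2.\<close>

lemma energy_functional_eq:
 assumes f: "f1 \<in> fdom S" "f2 \<in> fdom S" and \<phi>: "\<phi> \<in> fdom S"
 shows "energy_functional S f1 f2 \<phi> = (LINT x|M. (D f1 x * D f2 x) * \<phi> x)"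
proof -
 have m: "(%x. a x * (D u x * D v x)) \<in> borel_measurable M"
  "integrable M (%x. a x * (D u x * D v x))"
  if "a \<in> fdom S" "u \<in> fdom S" "v \<in> fdom S" for a u v
  using L2_mult_integrable[OF cont_mult_L2[OF dom_cont[OF that(1)] D_L2[OF that(2)]] D_L2[OF that(3)]]
  by (auto simp: mult.assoc)
 have e: "energy S (%x. u x * v x) w = (LINT x|M. v x * (D u x * D w x)) + (LINT x|M. u x * (D v x * D w x))"
  if "u \<in> fdom S" "v \<in> fdom S" "w \<in> fdom S" for u v w
 proof -
  have "energy S (%x. u x * v x) w = (LINT x|M. D (%x. u x * v x) x * D w x)"
   using that by (simp add: energy_eq mult_dom)
  also have "\<dots> = (LINT x|M. v x * (D u x * D w x) + u x * (D v x * D w x))"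
  proof (rule integral_cong_AE)
   show "AE x in M. D (%x. u x * v x) x * D w x = v x * (D u x * D w x) + u x * (D v x * D w x)"
    using D_mult[OF that(1,2)] by eventually_elim (simp add: algebra_simps)
  qed (use m[OF that(1,2,3)] m[OF that(2,1,3)] D_meas[OF mult_dom(1)[OF that(1,2)]] D_meas[OF that(3)]
    D_meas[OF that(1)] D_meas[OF that(2)] dom_meas[OF that(1)] dom_meas[OF that(2)] in auto)
  also have "\<dots> = (LINT x|M. v x * (D u x * D w x)) + (LINT x|M. u x * (D v x * D w x))"
   by (intro Bochner_Integration.integral_add m that)
  finally show ?thesis .
 qed
 have s: "energy S u v = energy S v u" if "u \<in> fdom S" "v \<in> fdom S" for u v
  using that by (simp add: energy_eq mult.commute)
 have "energy S f1 (%x. f2 x * \<phi> x) = energy S (%x. f2 x * \<phi> x) f1" by (intro s mult_dom f \<phi>)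
 hence "energy_functional S f1 f2 \<phi> = (LINT x|M. \<phi> x * (D f1 x * D f2 x))"
  unfolding energy_functional_def by (simp add: e f \<phi> mult.commute mult.left_commute)
 thus ?thesis by (simp add: mult.commute)
qed

text \<open>The density (D h)^2 of the energy measure of h with respect to M is 1.\<close>

lemma energy_measure_eq: "energy_measure S h = M" unfolding energy_measure_def
proof (rule the_equality)
 have D1: "(LINT x|M. (D h x * D h x) * \<phi> x) = (LINT x|M. \<phi> x)" if "\<phi> \<in> fdom S" for \<phi>
 proof (rule integral_cong_AE)
  show "AE x in M. (D h x * D h x) * \<phi> x = \<phi> x" using D_h by eventually_elim simp
 qed (use that D_meas[OF h_dom] dom_meas[OF that] in auto)
 thus "radon_on S M & (\<forall>\<phi>\<in>fdom S. (LINT x|M. \<phi> x) = energy_functional S h h \<phi>)"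
  by (simp add: radon energy_functional_eq h_dom)
 fix N assume N: "radon_on S N & (\<forall>\<phi>\<in>fdom S. (LINT x|N. \<phi> x) = energy_functional S h h \<phi>)"
 show "N = M"
 proof (rule radon_eqI[OF _ radon cpt])
  fix f :: "'a => real" assume f: "continuous_on (carr S) f"
  have "(LINT x|N. f x) - (LINT x|M. f x) = (LINT x|M. f x) - (LINT x|M. f x)"
   by (rule integral_determined[OF _ radon radon radon _ f])
    (use N in "auto simp: energy_functional_eq h_dom D1")
  thus "(LINT x|N. f x) = (LINT x|M. f x)" by simp
 qed (use N in blast)
qed

lemma energy_int_eq:
 assumes f: "f1 \<in> fdom S" "f2 \<in> fdom S" and g: "continuous_on (carr S) g"
 shows "energy_int S f1 f2 g = (LINT x|M. (D f1 x * D f2 x) * g x)" unfolding energy_int_def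
proof (rule the_equality)
 let ?k = "%x. D f1 x * D f2 x"
 have k: "integrable M ?k" "integrable M (%x. - ?k x)"
  using L2_mult_integrable[OF D_L2[OF f(1)] D_L2[OF f(2)]] by auto
 have ex: "(\<integral>x. \<phi> x \<partial>density M (%x. ennreal (?k x))) - (\<integral>x. \<phi> x \<partial>density M (%x. ennreal (- ?k x)))
  = (LINT x|M. ?k x * \<phi> x)" if "continuous_on (carr S) \<phi>" for \<phi>
  by (rule radon_on_density_diff[OF radon cpt k(1) that])
 show "\<exists>M' N. radon_on S M' & radon_on S N &
    (\<forall>\<phi>\<in>fdom S. (\<integral>x. \<phi> x \<partial>M') - (LINT x|N. \<phi> x) = energy_functional S f1 f2 \<phi>) &
    (LINT x|M. ?k x * g x) = (\<integral>x. g x \<partial>M') - (LINT x|N. g x)"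
  by (rule exI[of _ "density M (%x. ennreal (?k x))"], rule exI[of _ "density M (%x. ennreal (- ?k x))"])
   (auto simp: ex g dom_cont energy_functional_eq f intro!: radon_on_density[OF radon] k)
 fix c assume "\<exists>M' N. radon_on S M' & radon_on S N &
    (\<forall>\<phi>\<in>fdom S. (\<integral>x. \<phi> x \<partial>M') - (LINT x|N. \<phi> x) = energy_functional S f1 f2 \<phi>) &
    c = (\<integral>x. g x \<partial>M') - (LINT x|N. g x)"
 then obtain M' N where MN: "radon_on S M'" "radon_on S N"
  "!!\<phi>. \<phi> \<in> fdom S ==> (\<integral>x. \<phi> x \<partial>M') - (LINT x|N. \<phi> x) = energy_functional S f1 f2 \<phi>"
  and c: "c = (\<integral>x. g x \<partial>M') - (LINT x|N. g x)" by blast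
 have "(\<integral>x. g x \<partial>M') - (LINT x|N. g x)
  = (\<integral>x. g x \<partial>density M (%x. ennreal (?k x))) - (\<integral>x. g x \<partial>density M (%x. ennreal (- ?k x)))"
  by (rule integral_determined[OF MN(1,2) radon_on_density[OF radon k(1)] radon_on_density[OF radon k(2)] _ g])
   (simp add: MN(3) ex dom_cont energy_functional_eq f)
 thus "c = (LINT x|M. ?k x * g x)" using c ex[OF g] by simp
qed

text \<open>The set of limits of domain functions is a closed subspace, closedness being a diagonal
  argument. The difference of f and its projection is orthogonal to the domain, hence zero by
  \<open>integral_determined_zero\<close>.\<close>

lemma L2_dense:
 assumes f: "f \<in> L2 M"
 obtains F where "!!n. F n \<in> fdom S" "L2_lim M F f"
proof -
 define W where "W = {\<xi>. \<exists>F. (\<forall>n. F n \<in> fdom S) & L2_lim M F \<xi>}"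
 have WI: "u \<in> W" if "u \<in> fdom S" for u using that L2_lim_const[OF dom_L2[OF that]] unfolding W_def
  by (intro CollectI exI[of _ "%_. u"]) simp
 have "\<exists>w\<in>W. \<forall>v\<in>W. (LINT x|M. (f x - w x) * v x) = 0"
 proof (rule L2_projection[OF _ _ _ _ _ f, of W])
  show "W \<subseteq> L2 M" by (auto simp: W_def L2_lim_def)
  show "W ~= {}" using WI[OF const_dom] by blast
  show "(%x. u x + v x) \<in> W" if uv: "u \<in> W" "v \<in> W" for u v
  proof -
   obtain F where F: "\<forall>n. F n \<in> fdom S" "L2_lim M F u" using uv(1) by (auto simp: W_def)
   obtain G where G: "\<forall>n. G n \<in> fdom S" "L2_lim M G v" using uv(2) by (auto simp: W_def)
   from F G show ?thesis unfolding W_def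
    by (intro CollectI exI[of _ "%n x. F n x + G n x"]) (auto intro: L2_lim_add add_dom)
  qed
  show "(%x. c * u x) \<in> W" if u: "u \<in> W" for c u
  proof -
   obtain F where "\<forall>n. F n \<in> fdom S" "L2_lim M F u" using u by (auto simp: W_def)
   thus ?thesis unfolding W_def
    by (intro CollectI exI[of _ "%n x. c * F n x"]) (auto intro: L2_lim_cmult cmult_dom)
  qed
  fix F \<xi> assume FW: "!!n. F n \<in> W" and lim: "L2_lim M F \<xi>"
  have "\<exists>g. g \<in> fdom S & L2_norm M (%x. g x - F n x) < 1 / (real n + 1)" for n
  proof -
   obtain G where G: "\<forall>n. G n \<in> fdom S" "L2_lim M G (F n)" using FW[of n] by (auto simp: W_def)
   have "eventually (%k. L2_norm M (%x. G k x - F n x) < 1 / (real n + 1)) sequentially"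
    using G(2) by (intro order_tendstoD(2)[where y=0]) (auto simp: L2_lim_def)
   thus ?thesis using G(1) by (auto simp: eventually_sequentially)
  qed
  then obtain g where g: "!!n. g n \<in> fdom S" "!!n. L2_norm M (%x. g n x - F n x) < 1 / (real n + 1)" by metis
  have "L2_lim M g \<xi>"
  proof (rule L2_lim_I[where b="%n. 1 / (real n + 1) + L2_norm M (%x. F n x - \<xi> x)"])
   fix n
   have "L2_norm M (%x. g n x - \<xi> x) <= L2_norm M (%x. g n x - F n x) + L2_norm M (%x. F n x - \<xi> x)"
    by (rule L2_norm_triangle) (use lim g in "auto simp: L2_lim_def intro: dom_L2")
   thus "L2_norm M (%x. g n x - \<xi> x) <= 1 / (real n + 1) + L2_norm M (%x. F n x - \<xi> x)" using g(2)[of n] by simp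
  next
   have "(%n. 1 / (real n + 1) + L2_norm M (%x. F n x - \<xi> x)) \<longlonglongrightarrow> 0 + 0"
    by (intro tendsto_add) (use lim LIMSEQ_inverse_real_of_nat in
     "auto simp: L2_lim_def inverse_eq_divide add.commute")
   thus "(%n. 1 / (real n + 1) + L2_norm M (%x. F n x - \<xi> x)) \<longlonglongrightarrow> 0" by simp
  qed (use lim g in "auto simp: L2_lim_def intro: dom_L2")
  thus "\<xi> \<in> W" using g(1) unfolding W_def by blast
 qed blast
 then obtain w where w: "w \<in> W" "!!v. v \<in> W ==> (LINT x|M. (f x - w x) * v x) = 0" by blast
 obtain F where F: "!!n. F n \<in> fdom S" "L2_lim M F w" using w(1) by (auto simp: W_def)
 have wL: "w \<in> L2 M" using F by (auto simp: L2_lim_def)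
 have "AE x in M. f x - w x = 0" by (rule integral_determined_zero[OF L2_diff[OF f wL]]) (auto intro: w(2) WI)
 hence "AE x in M. w x = f x" by eventually_elim simp
 hence "L2_lim M F f" by (intro L2_lim_cong_AE[OF F(2)]) (use F f in "auto intro: dom_L2")
 thus ?thesis using that F(1) by blast
qed

end

section \<open>The Hilbert space of one-forms as L2 of the energy measure of h\<close>

context one_dim_energy begin

text \<open>The coefficient of the sum of the a df with respect to dh, because df = D f *
  dh.\<close>

definition form_val :: "(('a => real) \<times> ('a => real)) list => 'a => real" where
 "form_val ps x = (\<Sum>(a, f)\<leftarrow>ps. a x * D f x)"

text \<open>A one-form is a function on pairs of points and does not remember its list; by
  \<open>form_val_cong\<close> any admissible list gives the same coefficient up to a null
  set.\<close>

definition form_rep :: "'a one_form => 'a => real" where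
 "form_rep \<omega> = form_val (SOME ps. ps \<in> form_terms S & form_of S ps = \<omega>)"

text \<open>The element f dh of the Hilbert space, as a set of Cauchy sequences. The maps
  \<open>star\<close> and \<open>grad\<close> and the space \<open>hilb\<close> are all expressed
  through it.\<close>

definition L2_class :: "('a => real) => (nat => 'a one_form) set" where
 "L2_class f = {s \<in> form_cauchy S. L2_lim M (%n. form_rep (s n)) f}"

lemma form_terms_Cons: "p # ps \<in> form_terms S \<longleftrightarrow>
  continuous_on (carr S) (fst p) & snd p \<in> fdom S & ps \<in> form_terms S"
 by (cases p) (auto simp: form_terms_def cont_funs_def)

lemma form_terms_Nil: "[] \<in> form_terms S" by (simp add: form_terms_def)

lemma form_val_L2: "ps \<in> form_terms S ==> form_val ps \<in> L2 M"
proof (induction ps)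
 case Nil
 thus ?case by (simp add: form_val_def L2_zero)
next
 case (Cons p ps)
 have "(%x. fst p x * D (snd p) x + form_val ps x) \<in> L2 M"
  using Cons by (intro L2_add cont_mult_L2 D_L2) (auto simp: form_terms_Cons)
 thus ?case by (simp add: form_val_def split_beta)
qed

lemma unif_cont_list:
 assumes "ps \<in> form_terms S" "e > 0"
 shows "\<exists>d>0. \<forall>x\<in>carr S. \<forall>y\<in>carr S. dist x y < d --> (\<forall>(a, f)\<in>set ps. \<bar>a x - a y\<bar> < e)" using assms(1)
proof (induction ps)
 case Nil
 thus ?case by (auto intro: exI[of _ 1])
next
 case (Cons p ps)
 then obtain d1 where d1: "d1 > 0" "\<forall>x\<in>carr S. \<forall>y\<in>carr S. dist x y < d1 --> (\<forall>(a, f)\<in>set ps. \<bar>a x - a y\<bar> < e)"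
  by (auto simp: form_terms_Cons)
 obtain d2 where d2: "d2 > 0" "!!x y. x \<in> carr S ==> y \<in> carr S ==> dist x y < d2 ==> \<bar>fst p x - fst p y\<bar> < e"
  using unif_cont[of "fst p" e] Cons.prems assms(2) by (auto simp: form_terms_Cons)
 show ?case
 proof (intro exI[of _ "min d1 d2"] conjI ballI impI)
  fix x y z assume "x \<in> carr S" "y \<in> carr S" "dist x y < min d1 d2" "z \<in> set (p # ps)"
  thus "case z of (a, f) => \<bar>a x - a y\<bar> < e" using d1(2)[rule_format, of x y z] d2(2)[of x y] by (cases z) auto
 qed (use d1 d2 in simp)
qed

text \<open>Passes between the symmetric weights (a x + a y) / 2 of \<open>form_of\<close> and the
  one-sided weights a x of \<open>calc\<close>; they differ by half an increment of a.\<close>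

lemma sum_list_diff_bound:
 fixes ps :: "(('a => real) \<times> ('a => real)) list"
 assumes "\<forall>(a, f)\<in>set ps. \<bar>a x - a y\<bar> < e"
 shows "\<bar>(\<Sum>(a, f)\<leftarrow>ps. a x * (f x - f y)) - (\<Sum>(a, f)\<leftarrow>ps. (a x + a y) / 2 * (f x - f y))\<bar>
  <= e * (\<Sum>(a, f)\<leftarrow>ps. \<bar>f x - f y\<bar>)" using assms
proof (induction ps)
 case (Cons p ps)
 obtain a f where p: "p = (a, f)" by (cases p)
 have a: "\<bar>a x - a y\<bar> < e" using Cons.prems p by auto
 have "\<bar>a x * (f x - f y) - (a x + a y) / 2 * (f x - f y)\<bar> = \<bar>a x - a y\<bar> / 2 * \<bar>f x - f y\<bar>"
 proof -
  have "a x * (f x - f y) - (a x + a y) / 2 * (f x - f y) = (a x - a y) / 2 * (f x - f y)"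
   by (simp add: field_simps)
  thus ?thesis by (simp only: abs_mult abs_divide abs_numeral)
 qed
 also have "\<dots> <= e * \<bar>f x - f y\<bar>" using a by (intro mult_right_mono) auto
 finally have "\<bar>a x * (f x - f y) - (a x + a y) / 2 * (f x - f y)\<bar> <= e * \<bar>f x - f y\<bar>" .
 thus ?case using Cons p by (simp add: distrib_left)
qed simp

text \<open>The difference of the two lists has symmetric sum zero. By uniform continuity of the
  coefficients its one-sided sum is then negligible against the increments, so \<open>calc\<close>
  applies with the zero function in place of u.\<close>

lemma form_val_cong:
 assumes ps: "ps \<in> form_terms S" and qs: "qs \<in> form_terms S" and eq: "form_of S ps = form_of S qs"
 shows "AE x in M. form_val ps x = form_val qs x"
proof -
 define ns where "ns = map (%(a, f). ((%x. - a x), f)) qs"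
 have ns: "ns \<in> form_terms S"
  using qs by (auto simp: ns_def form_terms_def cont_funs_def intro!: continuous_intros)
 hence pn: "ps @ ns \<in> form_terms S" using ps by (auto simp: form_terms_def)
 have neg1: "(\<Sum>(a, f)\<leftarrow>ns. (a x + a y) / 2 * (f x - f y)) = - (\<Sum>(a, f)\<leftarrow>qs. (a x + a y) / 2 * (f x - f y))" for x y
  unfolding ns_def by (induction qs) (auto simp: field_simps)
 have neg2: "(\<Sum>(a, f)\<leftarrow>ns. a x * D f x) = - (\<Sum>(a, f)\<leftarrow>qs. a x * D f x)" for x
  unfolding ns_def by (induction qs) auto
 have "(%_. 0) \<in> fdom S & (AE x in M. D (%_. 0) x = (\<Sum>(a, f)\<leftarrow>ps @ ns. a x * D f x))"
 proof (rule calc[OF pn])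
  fix e :: real assume "e > 0"
  then obtain d where d: "d > 0" "\<forall>x\<in>carr S. \<forall>y\<in>carr S. dist x y < d --> (\<forall>(a, f)\<in>set (ps @ ns). \<bar>a x - a y\<bar> < e)"
   using unif_cont_list[OF pn] by blast
  show "\<exists>d>0. \<forall>x\<in>carr S. \<forall>y\<in>carr S. dist x y < d -->
   \<bar>0 - 0 - (\<Sum>(a, f)\<leftarrow>ps @ ns. a x * (f x - f y))\<bar> <= e * (\<Sum>(a, f)\<leftarrow>ps @ ns. \<bar>f x - f y\<bar>)"
  proof (intro exI[of _ d] conjI ballI impI)
   fix x y assume xy: "x \<in> carr S" "y \<in> carr S" "dist x y < d"
   have "form_of S ps (x, y) = form_of S qs (x, y)" by (simp add: eq)
   hence "(\<Sum>(a, f)\<leftarrow>ps @ ns. (a x + a y) / 2 * (f x - f y)) = 0" using xy neg1[of x y] by (simp add: form_of_def)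
   thus "\<bar>0 - 0 - (\<Sum>(a, f)\<leftarrow>ps @ ns. a x * (f x - f y))\<bar> <= e * (\<Sum>(a, f)\<leftarrow>ps @ ns. \<bar>f x - f y\<bar>)"
    using sum_list_diff_bound[of "ps @ ns" x y e] d(2) xy by (simp only:) simp
  qed (use d in simp)
 qed
 hence "AE x in M. D (%_. 0) x = (\<Sum>(a, f)\<leftarrow>ps @ ns. a x * D f x)" by blast
 thus ?thesis using D_const[of 0]
 proof eventually_elim
  case (elim x)
  thus ?case using neg2[of x] by (simp add: form_val_def)
 qed
qed

lemma form_val_inner:
 assumes "ps \<in> form_terms S" "qs \<in> form_terms S"
 shows "(\<Sum>(g1, f1)\<leftarrow>ps. \<Sum>(g2, f2)\<leftarrow>qs. energy_int S f1 f2 (%x. g1 x * g2 x))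
  = (LINT x|M. form_val ps x * form_val qs x)"
proof -
 have in1: "(\<Sum>(g2, f2)\<leftarrow>qs. energy_int S f1 f2 (%x. g1 x * g2 x)) = (LINT x|M. (g1 x * D f1 x) * form_val qs x)"
  if g1: "continuous_on (carr S) g1" and f1: "f1 \<in> fdom S" for g1 f1 using assms(2)
 proof (induction qs)
  case Nil
  thus ?case by (simp add: form_val_def)
 next
  case (Cons p qs)
  obtain g2 f2 where p: "p = (g2, f2)" by (cases p)
  have c: "continuous_on (carr S) g2" "f2 \<in> fdom S" "qs \<in> form_terms S"
   using Cons.prems p by (auto simp: form_terms_Cons)
  have i1: "integrable M (%x. (g1 x * D f1 x) * (g2 x * D f2 x))"
   by (intro L2_mult_integrable cont_mult_L2 D_L2 c g1 f1)
  have i2: "integrable M (%x. (g1 x * D f1 x) * form_val qs x)"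
   by (intro L2_mult_integrable cont_mult_L2 D_L2 form_val_L2 c g1 f1)
  have "energy_int S f1 f2 (%x. g1 x * g2 x) = (LINT x|M. (D f1 x * D f2 x) * (g1 x * g2 x))"
   by (intro energy_int_eq f1 c continuous_intros g1)
  also have "\<dots> = (LINT x|M. (g1 x * D f1 x) * (g2 x * D f2 x))" by (simp add: mult_ac)
  finally have "(\<Sum>(g2, f2)\<leftarrow>p # qs. energy_int S f1 f2 (%x. g1 x * g2 x))
   = (LINT x|M. (g1 x * D f1 x) * (g2 x * D f2 x) + (g1 x * D f1 x) * form_val qs x)"
   using Cons.IH[OF c(3)] p by (simp add: Bochner_Integration.integral_add[OF i1 i2])
  thus ?case by (simp add: form_val_def p distrib_left)
 qed
 show ?thesis using assms(1)
 proof (induction ps)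
  case Nil
  thus ?case by (simp add: form_val_def)
 next
  case (Cons p ps)
  obtain g1 f1 where p: "p = (g1, f1)" by (cases p)
  have c: "continuous_on (carr S) g1" "f1 \<in> fdom S" "ps \<in> form_terms S"
   using Cons.prems p by (auto simp: form_terms_Cons)
  have i1: "integrable M (%x. (g1 x * D f1 x) * form_val qs x)"
   by (intro L2_mult_integrable cont_mult_L2 D_L2 form_val_L2 c assms(2))
  have i2: "integrable M (%x. form_val ps x * form_val qs x)"
   by (intro L2_mult_integrable form_val_L2 c assms(2))
  have "(\<Sum>(g1, f1)\<leftarrow>p # ps. \<Sum>(g2, f2)\<leftarrow>qs. energy_int S f1 f2 (%x. g1 x * g2 x))
   = (LINT x|M. (g1 x * D f1 x) * form_val qs x + form_val ps x * form_val qs x)"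
   using Cons.IH[OF c(3)] p in1[OF c(1,2)] by (simp add: Bochner_Integration.integral_add[OF i1 i2])
  thus ?case by (simp add: form_val_def p distrib_right)
 qed
qed

lemma integral_mult_cong_AE:
 assumes "a \<in> L2 M" "a' \<in> L2 M" "b \<in> L2 M" "b' \<in> L2 M"
  and "AE x in M. a x = a' x" "AE x in M. b x = b' x"
 shows "(LINT x|M. a x * b x) = (LINT x|M. a' x * b' x)"
proof (rule integral_cong_AE)
 show "AE x in M. a x * b x = a' x * b' x" using assms(5,6) by eventually_elim simp
qed (use assms in "auto simp: L2_def")

lemma form_rep_of:
 assumes "ps \<in> form_terms S"
 shows "form_rep (form_of S ps) \<in> L2 M" "AE x in M. form_rep (form_of S ps) x = form_val ps x"
proof -
 let ?qs = "SOME qs. qs \<in> form_terms S & form_of S qs = form_of S ps"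
 have qs: "?qs \<in> form_terms S & form_of S ?qs = form_of S ps" by (rule someI_ex) (use assms in blast)
 thus "form_rep (form_of S ps) \<in> L2 M" by (simp add: form_rep_def form_val_L2)
 show "AE x in M. form_rep (form_of S ps) x = form_val ps x"
  unfolding form_rep_def using qs assms by (intro form_val_cong) auto
qed

lemma form_rep_L2: "\<omega> \<in> one_forms S ==> form_rep \<omega> \<in> L2 M" by (auto simp: one_forms_def form_rep_of)

lemma form_ip_eq:
 assumes "\<omega> \<in> one_forms S" "\<eta> \<in> one_forms S"
 shows "form_ip S \<omega> \<eta> = (LINT x|M. form_rep \<omega> x * form_rep \<eta> x)"
proof -
 have all: "(\<Sum>(g1, f1)\<leftarrow>ps. \<Sum>(g2, f2)\<leftarrow>qs. energy_int S f1 f2 (%x. g1 x * g2 x))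
   = (LINT x|M. form_rep \<omega> x * form_rep \<eta> x)"
  if "ps \<in> form_terms S" "qs \<in> form_terms S" "form_of S ps = \<omega>" "form_of S qs = \<eta>" for ps qs
 proof -
  have "(LINT x|M. form_val ps x * form_val qs x) = (LINT x|M. form_rep \<omega> x * form_rep \<eta> x)"
  proof (rule integral_mult_cong_AE)
   show "AE x in M. form_val ps x = form_rep \<omega> x"
    using form_rep_of(2)[OF that(1)] unfolding that(3) by eventually_elim simp
   show "AE x in M. form_val qs x = form_rep \<eta> x"
    using form_rep_of(2)[OF that(2)] unfolding that(4) by eventually_elim simp
  qed (auto intro: form_val_L2 form_rep_L2 that assms)
  thus ?thesis by (simp add: form_val_inner that)
 qed
 obtain ps qs where pq: "ps \<in> form_terms S" "qs \<in> form_terms S" "form_of S ps = \<omega>" "form_of S qs = \<eta>"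
  using assms by (auto simp: one_forms_def)
 show ?thesis unfolding form_ip_def
 proof (rule the_equality)
  show "\<exists>ps\<in>form_terms S. \<exists>qs\<in>form_terms S. form_of S ps = \<omega> & form_of S qs = \<eta> &
   (LINT x|M. form_rep \<omega> x * form_rep \<eta> x)
    = (\<Sum>(g1, f1)\<leftarrow>ps. \<Sum>(g2, f2)\<leftarrow>qs. energy_int S f1 f2 (%x. g1 x * g2 x))"
   using all[OF pq] pq by (intro bexI[of _ ps] bexI[of _ qs]) auto
  fix c assume "\<exists>ps\<in>form_terms S. \<exists>qs\<in>form_terms S. form_of S ps = \<omega> & form_of S qs = \<eta> &
   c = (\<Sum>(g1, f1)\<leftarrow>ps. \<Sum>(g2, f2)\<leftarrow>qs. energy_int S f1 f2 (%x. g1 x * g2 x))"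
  thus "c = (LINT x|M. form_rep \<omega> x * form_rep \<eta> x)" using all by blast
 qed
qed

lemma form_dist2_eq:
 assumes "\<omega> \<in> one_forms S" "\<eta> \<in> one_forms S"
 shows "form_dist2 S \<omega> \<eta> = (L2_norm M (%x. form_rep \<omega> x - form_rep \<eta> x))^2"
 unfolding form_dist2_def L2_norm_diff_sq[OF form_rep_L2[OF assms(1)] form_rep_L2[OF assms(2)]]
 unfolding L2_norm_sq form_ip_eq[OF assms] form_ip_eq[OF assms(1,1)] form_ip_eq[OF assms(2,2)]
 by (simp add: power2_eq_square)

lemma form_cauchy_iff:
 "s \<in> form_cauchy S \<longleftrightarrow> (\<forall>n. s n \<in> one_forms S) & L2_Cauchy M (%n. form_rep (s n))"
proof (cases "\<forall>n. s n \<in> one_forms S")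
 case True
 have "(\<forall>e>0. \<exists>N. ALL m>=N. ALL n>=N. form_dist2 S (s m) (s n) < e) \<longleftrightarrow>
  (\<forall>e>0. \<exists>N. ALL m>=N. ALL n>=N. L2_norm M (%x. form_rep (s m) x - form_rep (s n) x) < e)"
 proof safe
  fix e :: real assume *: "\<forall>e>0. \<exists>N. ALL m>=N. ALL n>=N. form_dist2 S (s m) (s n) < e" "e > 0"
  then obtain N where N: "ALL m>=N. ALL n>=N. form_dist2 S (s m) (s n) < e^2" by (meson zero_less_power)
  show "\<exists>N. ALL m>=N. ALL n>=N. L2_norm M (%x. form_rep (s m) x - form_rep (s n) x) < e"
  proof (intro exI[of _ N] allI impI)
   fix m n assume "N <= m" "N <= n"
   hence "(L2_norm M (%x. form_rep (s m) x - form_rep (s n) x))^2 < e^2"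
    using N True by (simp add: form_dist2_eq)
   thus "L2_norm M (%x. form_rep (s m) x - form_rep (s n) x) < e"
    using \<open>e > 0\<close> by (simp add: power2_less_imp_less)
  qed
 next
  fix e :: real assume *: "\<forall>e>0. \<exists>N. ALL m>=N. ALL n>=N. L2_norm M (%x. form_rep (s m) x - form_rep (s n) x) < e" "e > 0"
  then obtain N where N: "ALL m>=N. ALL n>=N. L2_norm M (%x. form_rep (s m) x - form_rep (s n) x) < sqrt e"
   by (meson real_sqrt_gt_zero)
  show "\<exists>N. ALL m>=N. ALL n>=N. form_dist2 S (s m) (s n) < e"
  proof (intro exI[of _ N] allI impI)
   fix m n assume "N <= m" "N <= n"
   hence "(L2_norm M (%x. form_rep (s m) x - form_rep (s n) x))^2 < (sqrt e)^2"
    using N by (intro power_strict_mono) auto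
   thus "form_dist2 S (s m) (s n) < e" using \<open>e > 0\<close> True by (simp add: form_dist2_eq)
  qed
 qed
 thus ?thesis using True by (simp add: form_cauchy_def L2_Cauchy_def form_rep_L2)
qed (auto simp: form_cauchy_def)

lemma form_class_eq:
 assumes s: "s \<in> form_cauchy S" and lim: "L2_lim M (%n. form_rep (s n)) f"
 shows "form_class S s = L2_class f"
proof -
 have "(%n. form_dist2 S (s n) (t n)) \<longlonglongrightarrow> 0 \<longleftrightarrow> L2_lim M (%n. form_rep (t n)) f"
  if t: "t \<in> form_cauchy S" for t
 proof -
  have o: "s n \<in> one_forms S" "t n \<in> one_forms S" for n using s t by (auto simp: form_cauchy_def)
  note L = form_rep_L2[OF o(1)] form_rep_L2[OF o(2)]
  have fL: "f \<in> L2 M" by (rule L2_lim_L2(1)[OF lim])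
  have lim0: "(%n. L2_norm M (%x. form_rep (s n) x - f x)) \<longlonglongrightarrow> 0" using lim by (simp add: L2_lim_def)
  have "(%n. form_dist2 S (s n) (t n)) \<longlonglongrightarrow> 0 \<longleftrightarrow>
    (%n. L2_norm M (%x. form_rep (s n) x - form_rep (t n) x)) \<longlonglongrightarrow> 0"
  proof
   assume "(%n. form_dist2 S (s n) (t n)) \<longlonglongrightarrow> 0"
   hence "(%n. sqrt (form_dist2 S (s n) (t n))) \<longlonglongrightarrow> sqrt 0" by (rule tendsto_real_sqrt)
   thus "(%n. L2_norm M (%x. form_rep (s n) x - form_rep (t n) x)) \<longlonglongrightarrow> 0" by (simp add: form_dist2_eq o)
  next
   assume "(%n. L2_norm M (%x. form_rep (s n) x - form_rep (t n) x)) \<longlonglongrightarrow> 0"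
   from tendsto_power[OF this, of 2] show "(%n. form_dist2 S (s n) (t n)) \<longlonglongrightarrow> 0" by (simp add: form_dist2_eq o)
  qed
  also have "\<dots> \<longleftrightarrow> L2_lim M (%n. form_rep (t n)) f"
  proof
   assume l: "(%n. L2_norm M (%x. form_rep (s n) x - form_rep (t n) x)) \<longlonglongrightarrow> 0"
   show "L2_lim M (%n. form_rep (t n)) f"
   proof (rule L2_lim_I)
    show "L2_norm M (%x. form_rep (t n) x - f x) <= L2_norm M (%x. form_rep (s n) x - form_rep (t n) x)
     + L2_norm M (%x. form_rep (s n) x - f x)" for n using L2_norm_triangle[OF L(2,1) fL, of n n]
      L2_norm_minus_commute[of M "form_rep (t n)" "form_rep (s n)"] by linarith
    show "(%n. L2_norm M (%x. form_rep (s n) x - form_rep (t n) x)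
     + L2_norm M (%x. form_rep (s n) x - f x)) \<longlonglongrightarrow> 0" using tendsto_add[OF l lim0] by simp
   qed (use L fL in auto)
  next
   assume "L2_lim M (%n. form_rep (t n)) f"
   hence "L2_lim M (%n x. form_rep (s n) x - form_rep (t n) x) (%x. f x - f x)" by (rule L2_lim_diff[OF lim])
   from L2_lim_norm[OF this]
   show "(%n. L2_norm M (%x. form_rep (s n) x - form_rep (t n) x)) \<longlonglongrightarrow> 0" by (simp add: L2_norm_def)
  qed
  finally show ?thesis .
 qed
 thus ?thesis by (auto simp: form_class_def L2_class_def)
qed

lemma one_formI: "continuous_on (carr S) g ==> f \<in> fdom S ==> form_of S [(g, f)] \<in> one_forms S"
 by (auto simp: one_forms_def form_terms_Cons form_terms_Nil)

lemma form_rep_single: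
 assumes "continuous_on (carr S) g" "f \<in> fdom S"
 shows "AE x in M. form_rep (form_of S [(g, f)]) x = g x * D f x"
 using form_rep_of(2)[of "[(g, f)]"] assms by (simp add: form_terms_Cons form_terms_Nil form_val_def)

lemma form_rep_h:
 assumes "continuous_on (carr S) g"
 shows "AE x in M. form_rep (form_of S [(g, h)]) x = g x"
 using form_rep_single[OF assms h_dom] D_h by eventually_elim simp

lemma L2_lim_form_h:
 assumes g: "!!n. continuous_on (carr S) (g n)" and lim: "L2_lim M g f"
 shows "L2_lim M (%n. form_rep (form_of S [(g n, h)])) f"
proof (rule L2_lim_cong_AE[OF lim])
 show "form_rep (form_of S [(g n, h)]) \<in> L2 M" for n by (intro form_rep_L2 one_formI g h_dom)
 show "AE x in M. g n x = form_rep (form_of S [(g n, h)]) x" for n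
  using form_rep_h[OF g, of n] by eventually_elim simp
qed (use lim in "auto simp: L2_lim_def")

lemma form_class_h:
 assumes g: "!!n. continuous_on (carr S) (g n)" and lim: "L2_lim M g f"
 shows "form_class S (%n. form_of S [(g n, h)]) = L2_class f"
  and "(%n. form_of S [(g n, h)]) \<in> L2_class f"
proof -
 have l: "L2_lim M (%n. form_rep (form_of S [(g n, h)])) f" by (rule L2_lim_form_h[OF assms])
 hence "(%n. form_of S [(g n, h)]) \<in> form_cauchy S"
  by (auto simp: form_cauchy_iff intro: one_formI g h_dom L2_lim_Cauchy)
 thus "form_class S (%n. form_of S [(g n, h)]) = L2_class f"
  "(%n. form_of S [(g n, h)]) \<in> L2_class f" using l form_class_eq by (auto simp: L2_class_def)
qed

text \<open>Continuous coefficients tending to f, which exist by \<open>L2_dense\<close>, give a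
  representing sequence.\<close>

lemma L2_class_nonempty:
 assumes "f \<in> L2 M" shows "L2_class f ~= {}"
proof -
 obtain F where F: "!!n. F n \<in> fdom S" "L2_lim M F f" using L2_dense[OF assms] by blast
 show ?thesis using form_class_h(2)[OF dom_cont[OF F(1)] F(2)] by blast
qed

lemma L2_class_eq_iff:
 assumes "f \<in> L2 M" "g \<in> L2 M"
 shows "L2_class f = L2_class g \<longleftrightarrow> (AE x in M. f x = g x)"
proof
 assume eq: "L2_class f = L2_class g"
 obtain s where "s \<in> L2_class f" using L2_class_nonempty[OF assms(1)] by blast
 thus "AE x in M. f x = g x"
  using eq by (intro L2_lim_unique[of M "%n. form_rep (s n)"]) (auto simp: L2_class_def)
next
 assume ae: "AE x in M. f x = g x"
 have "L2_lim M F f \<longleftrightarrow> L2_lim M F g" for F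
  using L2_lim_cong_AE[of M F f F g] L2_lim_cong_AE[of M F g F f] ae assms by (auto simp: L2_lim_def eq_commute)
 thus "L2_class f = L2_class g" by (simp add: L2_class_def)
qed

lemma star_eq:
 assumes f: "f \<in> L2 M" shows "star S h f = L2_class f" unfolding star_def energy_measure_eq
proof (rule the_equality)
 obtain F where F: "!!n. F n \<in> fdom S" "L2_lim M F f" using L2_dense[OF f] by blast
 show "\<exists>g. (\<forall>n. g n \<in> cont_funs S) & (%n. L2_norm M (%x. g n x - f x)) \<longlonglongrightarrow> 0 &
   L2_class f = form_class S (%n. form_of S [(g n, h)])" using F form_class_h(1)[OF dom_cont[OF F(1)] F(2)]
  by (intro exI[of _ F]) (auto simp: cont_funs_def dom_cont L2_lim_def)
 fix v assume "\<exists>g. (\<forall>n. g n \<in> cont_funs S) & (%n. L2_norm M (%x. g n x - f x)) \<longlonglongrightarrow> 0 &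
   v = form_class S (%n. form_of S [(g n, h)])"
 then obtain g where g: "!!n. continuous_on (carr S) (g n)"
  "(%n. L2_norm M (%x. g n x - f x)) \<longlonglongrightarrow> 0" "v = form_class S (%n. form_of S [(g n, h)])"
  by (auto simp: cont_funs_def)
 have "L2_lim M g f" using g f by (auto simp: L2_lim_def intro: cont_L2)
 thus "v = L2_class f" using form_class_h(1)[OF g(1)] g(3) by simp
qed

lemma grad_eq:
 assumes u: "u \<in> fdom S" shows "grad S u = L2_class (D u)"
proof -
 let ?w = "form_of S [(%_. 1, u)]"
 have o: "?w \<in> one_forms S" by (intro one_formI u continuous_intros)
 have "AE x in M. form_rep ?w x = D u x" using form_rep_single[of "%_. 1", OF _ u] by simp
 hence l: "L2_lim M (%_. form_rep ?w) (D u)"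
  by (intro L2_lim_cong_AE[OF L2_lim_const[OF form_rep_L2[OF o]]]) (auto intro: form_rep_L2 o D_L2 u)
 hence "(%_. ?w) \<in> form_cauchy S" using o by (auto simp: form_cauchy_iff intro: L2_lim_Cauchy)
 thus ?thesis unfolding grad_def using l by (rule form_class_eq)
qed

text \<open>Completeness of L2 supplies a limit for every Cauchy sequence of forms, density a
  sequence for every limit.\<close>

lemma hilb_eq: "hilb S = L2_class ` L2 M"
proof
 show "hilb S \<subseteq> L2_class ` L2 M"
 proof
  fix v assume "v \<in> hilb S"
  then obtain s where s: "s \<in> form_cauchy S" "v = form_class S s" by (auto simp: hilb_def)
  then obtain f where f: "L2_lim M (%n. form_rep (s n)) f" using L2_complete by (auto simp: form_cauchy_iff)
  thus "v \<in> L2_class ` L2 M" using form_class_eq[OF s(1) f] s(2) L2_lim_L2(1)[OF f] by auto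
 qed
 show "L2_class ` L2 M \<subseteq> hilb S"
 proof
  fix v assume "v \<in> L2_class ` L2 M"
  then obtain f where f: "f \<in> L2 M" "v = L2_class f" by auto
  obtain s where s: "s \<in> L2_class f" using L2_class_nonempty[OF f(1)] by blast
  hence "form_class S s = L2_class f" by (intro form_class_eq) (auto simp: L2_class_def)
  thus "v \<in> hilb S" using s f(2) by (auto simp: hilb_def L2_class_def)
 qed
qed

lemma hilb_ip_eq:
 assumes f: "f \<in> L2 M" and g: "g \<in> L2 M"
 shows "hilb_ip S (L2_class f) (L2_class g) = (LINT x|M. f x * g x)" unfolding hilb_ip_def
proof (rule the_equality)
 have lim: "(%n. form_ip S (s n) (t n)) \<longlonglongrightarrow> (LINT x|M. f x * g x)"
  if st: "s \<in> L2_class f" "t \<in> L2_class g" for s t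
 proof -
  have "(%n. LINT x|M. form_rep (s n) x * form_rep (t n) x) \<longlonglongrightarrow> (LINT x|M. f x * g x)"
   using st by (intro L2_lim_inner) (auto simp: L2_class_def)
  moreover have "s n \<in> one_forms S" "t n \<in> one_forms S" for n
   using st by (auto simp: L2_class_def form_cauchy_def)
  ultimately show ?thesis by (simp add: form_ip_eq)
 qed
 obtain s t where "s \<in> L2_class f" "t \<in> L2_class g"
  using L2_class_nonempty[OF f] L2_class_nonempty[OF g] by blast
 thus "\<exists>s\<in>L2_class f. \<exists>t\<in>L2_class g. (%n. form_ip S (s n) (t n)) \<longlonglongrightarrow> (LINT x|M. f x * g x)" using lim by blast
 fix c assume "\<exists>s\<in>L2_class f. \<exists>t\<in>L2_class g. (%n. form_ip S (s n) (t n)) \<longlonglongrightarrow> c"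
 thus "c = (LINT x|M. f x * g x)" using lim LIMSEQ_unique by blast
qed

lemma star_inv_class:
 assumes f: "f \<in> L2 M"
 shows "star_inv S h (L2_class f) \<in> L2 M" "AE x in M. star_inv S h (L2_class f) x = f x"
proof -
 let ?g = "star_inv S h (L2_class f)"
 have g: "?g \<in> L2 M & star S h ?g = L2_class f" unfolding star_inv_def energy_measure_eq
  by (rule someI[of _ f]) (use f star_eq in auto)
 thus "?g \<in> L2 M" by blast
 hence "L2_class ?g = L2_class f" using g star_eq by auto
 thus "AE x in M. ?g x = f x" using g f by (simp add: L2_class_eq_iff)
qed

lemma star_inv_grad:
 assumes "u \<in> fdom S"
 shows "star_inv S h (grad S u) \<in> L2 M" "AE x in M. star_inv S h (grad S u) x = D u x"
 using star_inv_class[OF D_L2[OF assms]] by (auto simp: grad_eq[OF assms])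

text \<open>Turns adjoints into plain integrals against M; from here on the classes of sequences are
  hidden behind \<open>L2_class\<close>.\<close>

lemma is_adj_iff:
 assumes "f \<in> L2 M" "U \<subseteq> fdom S"
 shows "is_adj S h U (L2_class f) k \<longleftrightarrow> k \<in> L2 M & (\<forall>u\<in>U. (LINT x|M. f x * D u x) = (LINT x|M. k x * u x))"
proof -
 have "hilb_ip S (L2_class f) (grad S u) = (LINT x|M. f x * D u x)" if "u \<in> U" for u
  using that assms by (simp add: subset_iff grad_eq hilb_ip_eq D_L2)
 thus ?thesis unfolding is_adj_def energy_measure_eq by auto
qed

end

context one_dim_energy begin

section \<open>Boundary terms and the canonical representation\<close>

text \<open>\<open>D\<close> does not see constants, so the functions are fixed at a point p. The
  Poincare inequality then converts L2 convergence of the derivatives into uniform convergence, and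
  \<open>closed_D\<close> identifies the limit.\<close>

lemma D_lim_normalized:
 assumes u: "!!n. u n \<in> fdom S" "!!n. u n p = 0" and p: "p \<in> carr S"
  and lim: "L2_lim M (%n. D (u n)) \<xi>"
 obtains v where "v \<in> fdom S" "uniform_limit (carr S) u v sequentially" "AE x in M. D v x = \<xi> x"
proof -
 obtain c where c: "c >= 0" "!!f x y. f \<in> fdom S ==> x \<in> carr S ==> y \<in> carr S ==>
   \<bar>f x - f y\<bar> <= c * L2_norm M (D f)" using poincare by blast
 have "L2_Cauchy M (%n. D (u n))" by (rule L2_lim_Cauchy[OF lim])
 have est: "\<bar>u m x - u n x\<bar> <= c * L2_norm M (%x. D (u m) x - D (u n) x)" if "x \<in> carr S" for m n x
 proof -
  have "\<bar>(u m x - u n x) - (u m p - u n p)\<bar> <= c * L2_norm M (D (%x. u m x - u n x))"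
   using c(2)[OF diff_dom[OF u(1)[of m] u(1)[of n]] that p] by simp
  also have "L2_norm M (D (%x. u m x - u n x)) = L2_norm M (%x. D (u m) x - D (u n) x)"
   by (intro L2_norm_cong_AE D_diff L2_measurable L2_diff D_L2 diff_dom u)
  finally show ?thesis using u(2) by simp
 qed
 have "uniformly_Cauchy_on (carr S) u" unfolding uniformly_Cauchy_on_def
 proof (intro allI impI)
  fix e :: real assume e: "e > 0"
  obtain N where N: "ALL m>=N. ALL n>=N. L2_norm M (%x. D (u m) x - D (u n) x) < e / (c + 1)"
   using L2_lim_Cauchy[OF lim] e c(1) unfolding L2_Cauchy_def
   by (meson add_nonneg_pos divide_pos_pos zero_less_one)
  show "\<exists>M. \<forall>x\<in>carr S. ALL m>=M. ALL n>=M. dist (u m x) (u n x) < e"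
  proof (intro exI[of _ N] ballI allI impI)
   fix x m n assume x: "x \<in> carr S" and mn: "m >= N" "n >= N"
   have "\<bar>u m x - u n x\<bar> <= c * L2_norm M (%x. D (u m) x - D (u n) x)" by (rule est[OF x])
   also have "\<dots> <= c * (e / (c + 1))" using N mn c(1) by (intro mult_left_mono) (auto intro: less_imp_le)
   also have "\<dots> < e" using e c(1) by (simp add: field_simps)
   finally show "dist (u m x) (u n x) < e" by (simp add: dist_real_def)
  qed
 qed
 hence "uniformly_convergent_on (carr S) u" by (rule Cauchy_uniformly_convergent)
 then obtain v where v: "uniform_limit (carr S) u v sequentially" by (auto simp: uniformly_convergent_on_def)
 thus ?thesis using closed_D[OF u(1) v lim] that by blast
qed

lemma dom_eq_const:
 assumes f: "f \<in> fdom S" and "AE x in M. D f x = 0" and "x \<in> carr S" "y \<in> carr S"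
 shows "f x = f y"
proof -
 obtain c where c: "!!f x y. f \<in> fdom S ==> x \<in> carr S ==> y \<in> carr S ==>
   \<bar>f x - f y\<bar> <= c * L2_norm M (D f)" using poincare by blast
 have "L2_norm M (D f) = 0" using assms by (simp add: L2_norm_eq_0 D_L2)
 thus ?thesis using c[OF f assms(3,4)] by simp
qed

definition ran_D :: "('a => real) set => ('a => real) set" where
 "ran_D U = {\<xi> \<in> L2 M. \<exists>u\<in>U. AE x in M. D u x = \<xi> x}"

lemma ran_D_I: "u \<in> U ==> u \<in> fdom S ==> D u \<in> ran_D U" by (auto simp: ran_D_def D_L2)

text \<open>The range of \<open>D\<close> is closed by \<open>D_lim_normalized\<close>, so the
  orthogonal projection onto it exists. The normalisation point is taken on the boundary, so that
  functions vanishing there are left unchanged by it.\<close>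

lemma ran_D_projection:
 assumes U: "U = fdom S | U = fdom_bdry S" and f: "f \<in> L2 M"
 obtains u where "u \<in> U" "u \<in> fdom S" "!!v. v \<in> U ==> (LINT x|M. (f x - D u x) * D v x) = 0"
proof -
 have Usub: "U \<subseteq> fdom S" using U by (auto simp: fdom_bdry_def)
 obtain p where p: "p \<in> bdry S" using bdry_ne by blast
 have pc: "p \<in> carr S" using p bdry_sub by blast
 have "\<exists>w\<in>ran_D U. \<forall>v\<in>ran_D U. (LINT x|M. (f x - w x) * v x) = 0"
 proof (rule L2_projection[OF _ _ _ _ _ f, of "ran_D U"])
  show "ran_D U \<subseteq> L2 M" by (auto simp: ran_D_def)
  have "(%_. 0) \<in> U" using U const_dom by (auto simp: fdom_bdry_def)
  thus "ran_D U ~= {}" using ran_D_I const_dom by blast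
  show "(%x. a x + b x) \<in> ran_D U" if ab: "a \<in> ran_D U" "b \<in> ran_D U" for a b
  proof -
   obtain u v where uv: "u \<in> U" "AE x in M. D u x = a x" "v \<in> U" "AE x in M. D v x = b x"
    using ab by (auto simp: ran_D_def)
   have uv': "u \<in> fdom S" "v \<in> fdom S" using uv Usub by auto
   have "AE x in M. D (%x. u x + v x) x = a x + b x" using D_add[OF uv'] uv(2,4) by eventually_elim simp
   moreover have "(%x. u x + v x) \<in> U" using U uv(1,3) add_dom by (auto simp: fdom_bdry_def)
   ultimately show ?thesis using ab by (auto simp: ran_D_def L2_add)
  qed
  show "(%x. c * a x) \<in> ran_D U" if ab: "a \<in> ran_D U" for c a
  proof -
   obtain u where uv: "u \<in> U" "AE x in M. D u x = a x" using ab by (auto simp: ran_D_def)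
   have uv': "u \<in> fdom S" using uv Usub by auto
   have "AE x in M. D (%x. c * u x) x = c * a x" using D_cmult[OF uv', of c] uv(2) by eventually_elim simp
   moreover have "(%x. c * u x) \<in> U" using U uv(1) cmult_dom by (auto simp: fdom_bdry_def)
   ultimately show ?thesis using ab by (auto simp: ran_D_def L2_cmult)
  qed
  fix F \<xi> assume F: "!!n. F n \<in> ran_D U" and lim: "L2_lim M F \<xi>"
  obtain u where u: "!!n. u n \<in> U" "!!n. AE x in M. D (u n) x = F n x"
  proof -
   have "\<forall>n. \<exists>v. v \<in> U & (AE x in M. D v x = F n x)" using F unfolding ran_D_def by blast
   from choice[OF this] show ?thesis using that by blast
  qed
  define u' where "u' n x = u n x - u n p" for n x
  have u'd: "u' n \<in> fdom S" for n unfolding u'_def using u(1) Usub by (intro diff_dom const_dom) auto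
  have u'D: "AE x in M. D (u' n) x = F n x" for n
   using D_diff[of "u n" "%_. u n p"] D_const[of "u n p"] u(2)[of n] u(1)[of n] Usub
   unfolding u'_def by (auto simp: const_dom subset_iff)
  have lim': "L2_lim M (%n. D (u' n)) \<xi>"
  proof (rule L2_lim_cong_AE[OF lim])
   show "AE x in M. F n x = D (u' n) x" for n using u'D[of n] by eventually_elim simp
  qed (use lim in "auto simp: L2_lim_def intro: D_L2 u'd")
  obtain v where v: "v \<in> fdom S" "uniform_limit (carr S) u' v sequentially" "AE x in M. D v x = \<xi> x"
   using D_lim_normalized[OF u'd _ pc lim'] by (auto simp: u'_def)
  have "v \<in> U"
  proof (cases "U = fdom S")
   case False
   hence UB: "U = fdom_bdry S" using U by blast
   have "v q = 0" if q: "q \<in> bdry S" for q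
   proof -
    have "(%n. u' n q) \<longlonglongrightarrow> v q" using q bdry_sub by (intro tendsto_uniform_limitI[OF v(2)]) auto
    moreover have "u' n q = 0" for n using u(1)[of n] q p by (auto simp: UB fdom_bdry_def u'_def)
    ultimately show ?thesis by (simp add: LIMSEQ_const_iff)
   qed
   thus ?thesis using UB v(1) by (simp add: fdom_bdry_def)
  qed (use v in simp)
  thus "\<xi> \<in> ran_D U" using v(3) L2_lim_L2(1)[OF lim] by (auto simp: ran_D_def)
 qed blast
 then obtain w where w: "w \<in> ran_D U" "!!v. v \<in> ran_D U ==> (LINT x|M. (f x - w x) * v x) = 0" by blast
 then obtain u where u: "u \<in> U" "AE x in M. D u x = w x" "w \<in> L2 M" by (auto simp: ran_D_def)
 have ud: "u \<in> fdom S" using u Usub by blast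
 show ?thesis
 proof (rule that[OF u(1) ud])
  fix v assume v: "v \<in> U"
  hence vd: "v \<in> fdom S" using Usub by blast
  have "(LINT x|M. (f x - D u x) * D v x) = (LINT x|M. (f x - w x) * D v x)"
  proof (rule integral_mult_cong_AE)
   show "AE x in M. f x - D u x = f x - w x" using u(2) by eventually_elim simp
  qed (auto intro: L2_diff f D_L2 ud vd u)
  thus "(LINT x|M. (f x - D u x) * D v x) = 0" using w(2)[OF ran_D_I[OF v vd]] by simp
 qed
qed

text \<open>Each further point a is treated by a factor that is 0 at a and 1 at q.\<close>

lemma interpolate:
 assumes "finite P" "P \<subseteq> carr S" "q \<in> carr S" "q \<notin> P"
 shows "\<exists>\<phi>\<in>fdom S. \<phi> q = 1 & (\<forall>p\<in>P. \<phi> p = 0)" using assms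
proof (induction P)
 case empty
 thus ?case using const_dom[of 1] by (intro bexI[of _ "%_. 1"]) auto
next
 case (insert a P)
 then obtain \<phi> where \<phi>: "\<phi> \<in> fdom S" "\<phi> q = 1" "\<forall>p\<in>P. \<phi> p = 0" by auto
 obtain s where s: "s \<in> fdom S" "s a ~= s q" using separate[of a q] insert.prems by auto
 have "(%x. \<phi> x * ((1 / (s q - s a)) * (s x - s a))) \<in> fdom S"
  by (intro mult_dom cmult_dom diff_dom const_dom \<phi> s)
 thus ?case using \<phi> s by (intro bexI[of _ "%x. \<phi> x * ((1 / (s q - s a)) * (s x - s a))"]) auto
qed

text \<open>Dirichlet's principle: an interpolating function minus the function whose derivative is
  the projection onto the derivatives of \<open>fdom_bdry S\<close> is harmonic with the same
  boundary values. This provides the witness for the choice in the definition.\<close>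

lemma bdry_harmonic:
 assumes q: "q \<in> bdry S"
 shows "bdry_harmonic S q \<in> fdom S" "bdry_harmonic S q q = 1"
  "!!p. p \<in> bdry S ==> p ~= q ==> bdry_harmonic S q p = 0"
proof -
 obtain \<phi> where \<phi>: "\<phi> \<in> fdom S" "\<phi> q = 1" "\<forall>p\<in>bdry S - {q}. \<phi> p = 0"
  using interpolate[of "bdry S - {q}" q] fin_bdry bdry_sub q by auto
 obtain u where u: "u \<in> fdom_bdry S" "u \<in> fdom S"
  "!!v. v \<in> fdom_bdry S ==> (LINT x|M. (D \<phi> x - D u x) * D v x) = 0"
  using ran_D_projection[OF _ D_L2[OF \<phi>(1)], of "fdom_bdry S"] by blast
 define \<psi> where "\<psi> x = \<phi> x - u x" for x
 have \<psi>d: "\<psi> \<in> fdom S" unfolding \<psi>_def by (intro diff_dom \<phi> u)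
 have "energy S \<psi> v = 0" if v: "v \<in> fdom_bdry S" for v
 proof -
  have vd: "v \<in> fdom S" using v by (simp add: fdom_bdry_def)
  have "energy S \<psi> v = (LINT x|M. D \<psi> x * D v x)" by (rule energy_eq[OF \<psi>d vd])
  also have "\<dots> = (LINT x|M. (D \<phi> x - D u x) * D v x)" using D_diff[OF \<phi>(1) u(2)] \<psi>d unfolding \<psi>_def
   by (intro integral_mult_cong_AE) (auto intro: D_L2 L2_diff \<phi> u vd)
  finally show ?thesis using u(3)[OF v] by simp
 qed
 hence "\<exists>\<psi>. \<psi> \<in> fdom S & \<psi> q = 1 & (\<forall>p\<in>bdry S - {q}. \<psi> p = 0) & (\<forall>\<phi>\<in>fdom_bdry S. energy S \<psi> \<phi> = 0)"
  using \<psi>d \<phi> u(1) q by (intro exI[of _ \<psi>]) (auto simp: \<psi>_def fdom_bdry_def)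
 from someI_ex[OF this] show "bdry_harmonic S q \<in> fdom S" "bdry_harmonic S q q = 1"
  "!!p. p \<in> bdry S ==> p ~= q ==> bdry_harmonic S q p = 0" unfolding bdry_harmonic_def by auto
qed

lemma bdry_sum:
 "p \<in> bdry S ==> (\<Sum>q\<in>bdry S. a q * bdry_harmonic S q p) = a p"
proof -
 assume p: "p \<in> bdry S"
 have "(\<Sum>q\<in>bdry S. a q * bdry_harmonic S q p) = (\<Sum>q\<in>bdry S. if q = p then a q else 0)"
  using p by (intro sum.cong) (auto simp: bdry_harmonic)
 thus ?thesis using p fin_bdry by simp
qed

lemma sub_bdry_dom:
 assumes "\<phi> \<in> fdom S"
 shows "(%x. \<phi> x - (\<Sum>q\<in>bdry S. \<phi> q * bdry_harmonic S q x)) \<in> fdom_bdry S"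
  "(%x. \<Sum>q\<in>bdry S. \<phi> q * bdry_harmonic S q x) \<in> fdom S"
proof -
 show "(%x. \<Sum>q\<in>bdry S. \<phi> q * bdry_harmonic S q x) \<in> fdom S" by (intro sum_dom fin_bdry cmult_dom bdry_harmonic)
 thus "(%x. \<phi> x - (\<Sum>q\<in>bdry S. \<phi> q * bdry_harmonic S q x)) \<in> fdom_bdry S"
  by (auto simp: fdom_bdry_def diff_dom assms bdry_sum)
qed

text \<open>The domain functions vanishing on the boundary form an ideal, so p k = 0 almost
  everywhere for each of them. Correcting approximations of the distance to the boundary by their
  boundary values gives such p n whose limit is positive off the boundary, and the boundary is a
  null set.\<close>

lemma fdom_bdry_determined_zero:
 assumes k: "k \<in> L2 M" and eq: "!!\<phi>. \<phi> \<in> fdom_bdry S ==> (LINT x|M. k x * \<phi> x) = 0"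
 shows "AE x in M. k x = 0"
proof -
 obtain F where F: "!!n. F n \<in> fdom S" "uniform_limit (carr S) F (%x. infdist x (bdry S)) sequentially"
  using dense_cont[of "%x. infdist x (bdry S)"] continuous_on_infdist[OF continuous_on_id] by blast
 have Flim: "(%n. F n x) \<longlonglongrightarrow> infdist x (bdry S)" if "x \<in> carr S" for x
  by (rule tendsto_uniform_limitI[OF F(2) that])
 define p where "p n x = F n x - (\<Sum>q\<in>bdry S. F n q * bdry_harmonic S q x)" for n x
 have p: "p n \<in> fdom_bdry S" for n unfolding p_def by (rule sub_bdry_dom[OF F(1)])
 have pd: "p n \<in> fdom S" for n using p by (simp add: fdom_bdry_def)
 have "AE x in M. p n x * k x = 0" for n
 proof (rule integral_determined_zero)
  show "(%x. p n x * k x) \<in> L2 M" by (intro cont_mult_L2 dom_cont pd k)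
  fix \<phi> assume \<phi>: "\<phi> \<in> fdom S"
  have "(%x. p n x * \<phi> x) \<in> fdom_bdry S" using p[of n] \<phi> by (auto simp: fdom_bdry_def mult_dom)
  from eq[OF this] show "(LINT x|M. p n x * k x * \<phi> x) = 0" by (simp add: mult_ac)
 qed
 hence all: "AE x in M. \<forall>n. p n x * k x = 0" by (simp only: AE_all_countable simp_thms)
 have "k x = 0" if x: "x \<in> carr S" "x \<notin> bdry S" and kx: "\<forall>n. p n x * k x = 0" for x
 proof (rule ccontr)
  assume "k x ~= 0"
  hence p0: "p n x = 0" for n using kx by (metis mult_eq_0_iff)
  have "(%n. F n q) \<longlonglongrightarrow> 0" if "q \<in> bdry S" for q using Flim[of q] that bdry_sub by auto
  hence "(%n. p n x) \<longlonglongrightarrow> infdist x (bdry S) - (\<Sum>q\<in>bdry S. 0 * bdry_harmonic S q x)"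
   unfolding p_def using x by (intro tendsto_intros Flim) auto
  hence "infdist x (bdry S) = 0" by (simp add: p0 LIMSEQ_const_iff)
  thus False using x finite_imp_closed[OF fin_bdry] bdry_ne by (auto simp: in_closed_iff_infdist_zero)
 qed
 hence "AE x in M. x \<notin> bdry S --> (\<forall>n. p n x * k x = 0) --> k x = 0" by (intro AE_I2) (auto simp only: space_M)
 thus ?thesis using all bdry_null by eventually_elim blast
qed

text \<open>Says that f lies in the domain of \<open>perp\<close> taken with
  \<open>fdom_bdry S\<close> and is mapped to k. As a relation it avoids the arbitrary
  representative chosen by \<open>adj\<close>.\<close>

definition div_B :: "('a => real) => ('a => real) => bool" where
 "div_B f k \<longleftrightarrow> f \<in> L2 M & k \<in> L2 M &
  (\<forall>u\<in>fdom_bdry S. (LINT x|M. f x * D u x) = - (LINT x|M. k x * u x))"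

definition ker_D :: "('a => real) set" where
 "ker_D = {w \<in> L2 M. \<forall>u\<in>fdom S. (LINT x|M. w x * D u x) = 0}"

abbreviation perp_B :: "('a => real) => 'a => real" where
 "perp_B \<equiv> perp S h (fdom_bdry S)"

definition nrm :: "('a => real) => 'a => real" where
 "nrm f = normal_part S h (L2_class f)"

abbreviation nb :: "'a => real" where
 "nb \<equiv> normal_part S h (grad S h)"

lemma fdom_bdry_sub: "fdom_bdry S \<subseteq> fdom S" by (auto simp: fdom_bdry_def)

lemma div_B_is_adj:
 assumes "f \<in> L2 M"
 shows "is_adj S h (fdom_bdry S) (L2_class f) k \<longleftrightarrow> div_B f (%x. - k x)"
 using assms L2_uminus[of k M] L2_uminus[of "%x. - k x" M]
 by (auto simp: is_adj_iff[OF assms fdom_bdry_sub] div_B_def)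

lemma div_B_unique:
 assumes "div_B f k" "div_B f k'" shows "AE x in M. k x = k' x"
proof -
 have k: "k \<in> L2 M" "k' \<in> L2 M" using assms by (auto simp: div_B_def)
 have "AE x in M. k x - k' x = 0"
 proof (rule fdom_bdry_determined_zero[OF L2_diff[OF k]])
  fix \<phi> assume \<phi>: "\<phi> \<in> fdom_bdry S"
  hence \<phi>L: "\<phi> \<in> L2 M" using fdom_bdry_sub dom_L2 by blast
  show "(LINT x|M. (k x - k' x) * \<phi> x) = 0"
   using assms \<phi> L2_mult_integrable[OF k(1) \<phi>L] L2_mult_integrable[OF k(2) \<phi>L]
   by (auto simp: div_B_def left_diff_distrib)
 qed
 thus ?thesis by eventually_elim simp
qed

lemma adj_div_B:
 assumes "div_B f k"
 shows "div_B f (%x. - adj S h (fdom_bdry S) (L2_class f) x)"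
  "AE x in M. adj S h (fdom_bdry S) (L2_class f) x = - k x"
proof -
 have f: "f \<in> L2 M" using assms by (simp add: div_B_def)
 have "is_adj S h (fdom_bdry S) (L2_class f) (%x. - k x)" using assms by (simp add: div_B_is_adj[OF f])
 hence "is_adj S h (fdom_bdry S) (L2_class f) (adj S h (fdom_bdry S) (L2_class f))"
  unfolding adj_def by (rule someI[of "is_adj S h (fdom_bdry S) (L2_class f)"])
 thus d: "div_B f (%x. - adj S h (fdom_bdry S) (L2_class f) x)" by (simp add: div_B_is_adj[OF f])
 show "AE x in M. adj S h (fdom_bdry S) (L2_class f) x = - k x"
  using div_B_unique[OF d assms] by eventually_elim auto
qed

lemma perp_dom_iff: "f \<in> perp_dom S h (fdom_bdry S) \<longleftrightarrow> (\<exists>k. div_B f k)"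
proof
 assume "f \<in> perp_dom S h (fdom_bdry S)"
 thus "\<exists>k. div_B f k" by (auto simp: perp_dom_def energy_measure_eq star_eq adj_dom_def div_B_is_adj)
next
 assume "\<exists>k. div_B f k"
 then obtain k where k: "div_B f k" by blast
 hence f: "f \<in> L2 M" by (simp add: div_B_def)
 have "is_adj S h (fdom_bdry S) (L2_class f) (%x. - k x)" using k by (simp add: div_B_is_adj[OF f])
 thus "f \<in> perp_dom S h (fdom_bdry S)"
  using f by (auto simp: perp_dom_def energy_measure_eq star_eq adj_dom_def hilb_eq)
qed

lemma perp_B_eq:
 assumes "div_B f k" shows "div_B f (perp_B f)" "AE x in M. perp_B f x = k x"
proof -
 have f: "f \<in> L2 M" using assms by (simp add: div_B_def)
 show "div_B f (perp_B f)" using adj_div_B(1)[OF assms] by (simp add: perp_def star_eq[OF f])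
 show "AE x in M. perp_B f x = k x" using adj_div_B(2)[OF assms] by (auto simp: perp_def star_eq[OF f])
qed

lemma nrm_eq:
 assumes "div_B f k" "q \<in> bdry S"
 shows "nrm f q = (LINT x|M. f x * D (bdry_harmonic S q) x) + (LINT x|M. k x * bdry_harmonic S q x)"
proof -
 let ?a = "adj S h (fdom_bdry S) (L2_class f)"
 have f: "f \<in> L2 M" "k \<in> L2 M" using assms by (auto simp: div_B_def)
 have b: "bdry_harmonic S q \<in> fdom S" by (rule bdry_harmonic(1)[OF assms(2)])
 have a: "?a \<in> L2 M" using adj_div_B(1)[OF assms(1)] L2_uminus[of "%x. - ?a x" M] by (simp add: div_B_def)
 have "(LINT x|M. ?a x * bdry_harmonic S q x) = (LINT x|M. (- k x) * bdry_harmonic S q x)"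
  by (rule integral_mult_cong_AE[OF a L2_uminus[OF f(2)] dom_L2[OF b] dom_L2[OF b] adj_div_B(2)[OF assms(1)]]) simp
 thus ?thesis unfolding nrm_def normal_part_def energy_measure_eq
  by (simp add: grad_eq[OF b] hilb_ip_eq f D_L2 b)
qed

text \<open>Both sides of the definition of \<open>div_B\<close> differ by a functional that
  vanishes on \<open>fdom_bdry S\<close> and so depends on boundary values only. Hence \<phi> may be
  replaced by the combination of the functions \<open>bdry_harmonic\<close>, on which the functional
  is the normal part.\<close>

lemma Green:
 assumes "div_B f k" and \<phi>: "\<phi> \<in> fdom S"
 shows "(LINT x|M. f x * D \<phi> x) + (LINT x|M. k x * \<phi> x) = (\<Sum>q\<in>bdry S. nrm f q * \<phi> q)"
proof -
 define \<Lambda> where "\<Lambda> u = (LINT x|M. f x * D u x) + (LINT x|M. k x * u x)" for u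
 have f: "f \<in> L2 M" "k \<in> L2 M" using assms by (auto simp: div_B_def)
 have lin: "\<Lambda> (%x. a * u x + b * v x) = a * \<Lambda> u + b * \<Lambda> v" if uv: "u \<in> fdom S" "v \<in> fdom S" for a b u v
 proof -
  have "(LINT x|M. f x * D (%x. a * u x + b * v x) x) = (LINT x|M. f x * (a * D u x + b * D v x))"
   by (rule integral_mult_cong_AE[OF f(1) f(1)])
    (auto intro: f D_L2 lin_dom uv D_lin simp: L2_add L2_cmult D_L2 uv)
  also have "\<dots> = (LINT x|M. a * (f x * D u x) + b * (f x * D v x))" by (simp add: algebra_simps)
  also have "\<dots> = a * (LINT x|M. f x * D u x) + b * (LINT x|M. f x * D v x)"
   using L2_mult_integrable[OF f(1) D_L2[OF uv(1)]] L2_mult_integrable[OF f(1) D_L2[OF uv(2)]] by simp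
  finally have 1: "(LINT x|M. f x * D (%x. a * u x + b * v x) x)
   = a * (LINT x|M. f x * D u x) + b * (LINT x|M. f x * D v x)" .
  have "(LINT x|M. k x * (a * u x + b * v x)) = (LINT x|M. a * (k x * u x) + b * (k x * v x))"
   by (simp add: algebra_simps)
  also have "\<dots> = a * (LINT x|M. k x * u x) + b * (LINT x|M. k x * v x)"
   using L2_mult_integrable[OF f(2) dom_L2[OF uv(1)]] L2_mult_integrable[OF f(2) dom_L2[OF uv(2)]] by simp
  finally show ?thesis using 1 by (simp add: \<Lambda>_def distrib_left)
 qed
 have zero: "\<Lambda> (%_. 0) = 0" using lin[OF const_dom[of 0] const_dom[of 0], of 0 0] by simp
 have sumL: "\<Lambda> (%x. \<Sum>q\<in>I. a q * u q x) = (\<Sum>q\<in>I. a q * \<Lambda> (u q))"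
  if "finite I" "!!q. q \<in> I ==> u q \<in> fdom S" for I and a :: "'a => real" and u using that
 proof (induction I)
  case empty
  thus ?case by (simp add: zero)
 next
  case (insert i I)
  have "\<Lambda> (%x. a i * u i x + 1 * (\<Sum>q\<in>I. a q * u q x)) = a i * \<Lambda> (u i) + 1 * \<Lambda> (%x. \<Sum>q\<in>I. a q * u q x)"
   by (intro lin sum_dom cmult_dom insert) (use insert in auto)
  thus ?case using insert by simp
 qed
 let ?s = "%x. \<Sum>q\<in>bdry S. \<phi> q * bdry_harmonic S q x"
 have "\<Lambda> (%x. \<phi> x - ?s x) = 0" using assms(1) sub_bdry_dom(1)[OF \<phi>] by (simp add: \<Lambda>_def div_B_def)
 moreover have "\<Lambda> (%x. 1 * \<phi> x + (-1) * ?s x) = 1 * \<Lambda> \<phi> + (-1) * \<Lambda> ?s" by (intro lin \<phi> sub_bdry_dom(2))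
 ultimately have "\<Lambda> \<phi> = \<Lambda> ?s" by simp
 also have "\<dots> = (\<Sum>q\<in>bdry S. \<phi> q * \<Lambda> (bdry_harmonic S q))" by (intro sumL fin_bdry bdry_harmonic)
 also have "\<dots> = (\<Sum>q\<in>bdry S. nrm f q * \<phi> q)"
  by (intro sum.cong refl) (simp add: nrm_eq[OF assms(1)] \<Lambda>_def mult.commute)
 finally show ?thesis by (simp add: \<Lambda>_def)
qed

text \<open>The chosen adjoint vanishes almost everywhere, so its defining equation becomes
  orthogonality to all gradients; conversely 0 is an adjoint, and adjoints are unique up to null
  sets.\<close>

lemma ker_perp_eq: "ker_perp S h = ker_D"
proof -
 have adjU: "is_adj S h (fdom S) (L2_class f) k \<longleftrightarrow> k \<in> L2 M & (\<forall>u\<in>fdom S. (LINT x|M. f x * D u x) = (LINT x|M. k x * u x))"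
  if "f \<in> L2 M" for f k by (rule is_adj_iff[OF that]) simp
 have uniq: "AE x in M. k x = k' x"
  if f: "f \<in> L2 M" and "is_adj S h (fdom S) (L2_class f) k" "is_adj S h (fdom S) (L2_class f) k'" for f k k'
 proof -
  have "div_B f (%x. - k x)" "div_B f (%x. - k' x)"
   using that fdom_bdry_sub L2_uminus by (auto simp: adjU div_B_def)
  from div_B_unique[OF this] show ?thesis by simp
 qed
 show ?thesis
 proof (intro set_eqI iffI)
  fix f assume "f \<in> ker_perp S h"
  hence f: "f \<in> L2 M" and ex: "\<exists>k. is_adj S h (fdom S) (L2_class f) k"
   and ae: "AE x in M. adj S h (fdom S) (L2_class f) x = 0"
   unfolding ker_perp_def perp_dom_def energy_measure_eq by (auto simp: star_eq adj_dom_def perp_def)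
  let ?a = "adj S h (fdom S) (L2_class f)"
  have a: "is_adj S h (fdom S) (L2_class f) ?a" unfolding adj_def by (rule someI_ex[OF ex])
  have "(LINT x|M. f x * D u x) = 0" if u: "u \<in> fdom S" for u
  proof -
   have aL: "?a \<in> L2 M" using a f by (simp add: adjU)
   have "(LINT x|M. f x * D u x) = (LINT x|M. ?a x * u x)" using a f u by (simp add: adjU)
   also have "\<dots> = (LINT x|M. 0 * u x)"
    by (rule integral_mult_cong_AE[OF aL L2_zero dom_L2[OF u] dom_L2[OF u] ae]) simp
   finally show ?thesis by simp
  qed
  thus "f \<in> ker_D" using f by (simp add: ker_D_def)
 next
  fix f assume "f \<in> ker_D"
  hence f: "f \<in> L2 M" and 0: "is_adj S h (fdom S) (L2_class f) (%_. 0)" by (auto simp: ker_D_def adjU L2_zero)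
  hence "is_adj S h (fdom S) (L2_class f) (adj S h (fdom S) (L2_class f))"
   unfolding adj_def by (intro someI[of "is_adj S h (fdom S) (L2_class f)"])
  from uniq[OF f this 0] show "f \<in> ker_perp S h" using f 0 unfolding ker_perp_def perp_dom_def energy_measure_eq
   by (auto simp: star_eq adj_dom_def perp_def hilb_eq)
 qed
qed

end

section \<open>Decompositions into gradients and elements of the kernel\<close>

context one_dim_energy begin

text \<open>The canonical representation in terms of \<open>D\<close>, with k and z as explicit
  data: k is split into gradient and kernel part, and so is f - g. The weak equation for u is a
  consequence, see \<open>decomp_energy\<close>.\<close>

definition decomp :: "('a => real) => ('a => real) => ('a => real) => ('a => real) => ('a => real) =>
  ('a => real) => bool" where
 "decomp f k g u w z \<longleftrightarrow> div_B f k & g \<in> fdom S & u \<in> fdom S & w \<in> ker_D & z \<in> ker_D &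
  (AE x in M. k x = D g x + z x) & (AE x in M. f x = g x + D u x + w x)"

lemma ker_D_orth: "w \<in> ker_D ==> u \<in> fdom S ==> (LINT x|M. w x * D u x) = 0" by (simp add: ker_D_def)

lemma ker_D_L2: "w \<in> ker_D ==> w \<in> L2 M" by (simp add: ker_D_def)

lemma ker_D_diff: assumes "w \<in> ker_D" "z \<in> ker_D" shows "(%x. w x - z x) \<in> ker_D"
proof -
 have "(LINT x|M. (w x - z x) * D u x) = 0" if u: "u \<in> fdom S" for u
  using L2_mult_integrable[OF ker_D_L2[OF assms(1)] D_L2[OF u]]
   L2_mult_integrable[OF ker_D_L2[OF assms(2)] D_L2[OF u]] ker_D_orth[OF assms(1) u] ker_D_orth[OF assms(2) u]
  by (simp add: left_diff_distrib)
 thus ?thesis using assms by (simp add: ker_D_def L2_diff)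
qed

lemma ker_D_cong_AE:
 assumes "w \<in> ker_D" "w' \<in> L2 M" "AE x in M. w x = w' x" shows "w' \<in> ker_D"
proof -
 have "(LINT x|M. w' x * D u x) = 0" if u: "u \<in> fdom S" for u
 proof -
  have "(LINT x|M. w x * D u x) = (LINT x|M. w' x * D u x)"
   by (rule integral_mult_cong_AE[OF ker_D_L2[OF assms(1)] assms(2) D_L2[OF u] D_L2[OF u] assms(3)]) simp
  thus ?thesis using ker_D_orth[OF assms(1) u] by simp
 qed
 thus ?thesis using assms by (simp add: ker_D_def)
qed

text \<open>\<open>ker_D\<close> is the orthogonal complement of the closed space of
  gradients.\<close>

lemma L2_decompose:
 assumes f: "f \<in> L2 M"
 obtains u where "u \<in> fdom S" "(%x. f x - D u x) \<in> ker_D"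
proof -
 obtain u where u: "u \<in> fdom S" "!!v. v \<in> fdom S ==> (LINT x|M. (f x - D u x) * D v x) = 0"
  using ran_D_projection[OF _ f, of "fdom S"] by blast
 thus ?thesis using that[OF u(1)] by (simp add: ker_D_def L2_diff f D_L2)
qed

lemma decomp_exists:
 assumes "div_B f k"
 obtains g u w z where "decomp f k g u w z"
proof -
 have f: "f \<in> L2 M" "k \<in> L2 M" using assms by (auto simp: div_B_def)
 obtain g where g: "g \<in> fdom S" "(%x. k x - D g x) \<in> ker_D" by (rule L2_decompose[OF f(2)])
 obtain u where u: "u \<in> fdom S" "(%x. (f x - g x) - D u x) \<in> ker_D"
  by (rule L2_decompose[OF L2_diff[OF f(1) dom_L2[OF g(1)]]])
 have "decomp f k g u (%x. (f x - g x) - D u x) (%x. k x - D g x)" using assms g u by (simp add: decomp_def)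
 thus ?thesis by (rule that)
qed

lemma div_B_diff:
 assumes a: "div_B f k" "div_B f' k'"
 shows "div_B (%x. f x - f' x) (%x. k x - k' x)"
  and nrm_diff: "q \<in> bdry S ==> nrm (%x. f x - f' x) q = nrm f q - nrm f' q"
proof -
 have L: "f \<in> L2 M" "k \<in> L2 M" "f' \<in> L2 M" "k' \<in> L2 M" using a by (auto simp: div_B_def)
 have i: "(LINT x|M. (f x - f' x) * D u x) = (LINT x|M. f x * D u x) - (LINT x|M. f' x * D u x)"
  "(LINT x|M. (k x - k' x) * u x) = (LINT x|M. k x * u x) - (LINT x|M. k' x * u x)"
  if "u \<in> fdom S" for u
  using L2_mult_integrable[OF L(1) D_L2[OF that]] L2_mult_integrable[OF L(3) D_L2[OF that]]
   L2_mult_integrable[OF L(2) dom_L2[OF that]] L2_mult_integrable[OF L(4) dom_L2[OF that]]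
  by (simp_all add: left_diff_distrib)
 show d: "div_B (%x. f x - f' x) (%x. k x - k' x)"
  using a fdom_bdry_sub by (auto simp: div_B_def L2_diff i subset_iff)
 show "nrm (%x. f x - f' x) q = nrm f q - nrm f' q" if q: "q \<in> bdry S"
  by (simp add: nrm_eq[OF d q] nrm_eq[OF a(1) q] nrm_eq[OF a(2) q] i bdry_harmonic(1)[OF q])
qed

text \<open>Dissipativity concerns differences of two elements of the domain. Subtracting their
  decompositions avoids choosing a new representation, which could differ by a constant.\<close>

lemma decomp_diff:
 assumes "decomp f k g u w z" "decomp f' k' g' u' w' z'"
 shows "decomp (%x. f x - f' x) (%x. k x - k' x) (%x. g x - g' x) (%x. u x - u' x)
  (%x. w x - w' x) (%x. z x - z' x)"
proof -
 have g: "g \<in> fdom S" "g' \<in> fdom S" and u: "u \<in> fdom S" "u' \<in> fdom S" using assms by (auto simp: decomp_def)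
 have k: "AE x in M. k x = D g x + z x" "AE x in M. k' x = D g' x + z' x"
  and f: "AE x in M. f x = g x + D u x + w x" "AE x in M. f' x = g' x + D u' x + w' x"
  using assms by (auto simp: decomp_def)
 have "AE x in M. k x - k' x = D (%x. g x - g' x) x + (z x - z' x)" using k D_diff[OF g] by eventually_elim simp
 moreover have "AE x in M. f x - f' x = (g x - g' x) + D (%x. u x - u' x) x + (w x - w' x)"
  using f D_diff[OF u] by eventually_elim simp
 ultimately show ?thesis using assms by (auto simp: decomp_def div_B_diff ker_D_diff diff_dom)
qed

end

text \<open>Harmonicity of h enters through its Gauss-Green formula, in which n turns out to be the
  normal part of the field dh (\<open>nb_eq\<close>).\<close>

locale one_dim_harmonic = one_dim_energy +
 fixes n :: "'a => real"
 assumes energy_h: "\<phi> \<in> fdom S ==> energy S h \<phi> = (\<Sum>q\<in>bdry S. n q * \<phi> q)"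
begin

text \<open>Because D h = 1, the integral is the energy of h and \<phi>.\<close>

lemma integral_D:
 assumes "\<phi> \<in> fdom S" shows "(LINT x|M. D \<phi> x) = (\<Sum>q\<in>bdry S. n q * \<phi> q)"
proof -
 have "(LINT x|M. D \<phi> x) = (LINT x|M. 1 * D \<phi> x)" by simp
 also have "\<dots> = (LINT x|M. D h x * D \<phi> x)"
  by (rule integral_mult_cong_AE[OF L2_const D_L2[OF h_dom] D_L2[OF assms] D_L2[OF assms]])
   (use D_h in "auto elim!: eventually_mono")
 also have "\<dots> = energy S h \<phi>" by (simp add: energy_eq h_dom assms)
 finally show ?thesis using energy_h[OF assms] by simp
qed

lemma div_B_Dh: "div_B (D h) (%_. 0)"
proof -
 have "(LINT x|M. D h x * D u x) = 0" if u: "u \<in> fdom_bdry S" for u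
 proof -
  have ud: "u \<in> fdom S" using u fdom_bdry_sub by blast
  have "(LINT x|M. D h x * D u x) = (\<Sum>q\<in>bdry S. n q * u q)" using energy_h[OF ud] energy_eq[OF h_dom ud] by simp
  also have "\<dots> = 0" using u by (simp add: fdom_bdry_def)
  finally show ?thesis .
 qed
 thus ?thesis by (simp add: div_B_def D_L2 h_dom L2_zero)
qed

lemma nb_eq: assumes q: "q \<in> bdry S" shows "nb q = n q"
proof -
 have b: "bdry_harmonic S q \<in> fdom S" by (rule bdry_harmonic(1)[OF q])
 have "nb q = nrm (D h) q" by (simp add: nrm_def grad_eq h_dom)
 also have "\<dots> = (LINT x|M. D h x * D (bdry_harmonic S q) x)" by (simp add: nrm_eq[OF div_B_Dh q])
 also have "\<dots> = (\<Sum>p\<in>bdry S. n p * bdry_harmonic S q p)" using energy_h[OF b] energy_eq[OF h_dom b] by simp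
 also have "\<dots> = (\<Sum>p\<in>bdry S. if p = q then n p else 0)" using q by (intro sum.cong) (auto simp: bdry_harmonic)
 also have "\<dots> = n q" using q fin_bdry by simp
 finally show ?thesis .
qed

lemma integral_parts:
 assumes "g \<in> fdom S" "\<phi> \<in> fdom S"
 shows "(LINT x|M. g x * D \<phi> x) + (LINT x|M. D g x * \<phi> x) = (\<Sum>q\<in>bdry S. n q * (g q * \<phi> q))"
proof -
 have i: "integrable M (%x. g x * D \<phi> x)" "integrable M (%x. D g x * \<phi> x)"
  by (intro L2_mult_integrable dom_L2 D_L2 assms)+
 have "(LINT x|M. g x * D \<phi> x) + (LINT x|M. D g x * \<phi> x) = (LINT x|M. g x * D \<phi> x + D g x * \<phi> x)"
  using i by simp
 also have "\<dots> = (LINT x|M. D (%x. g x * \<phi> x) x)"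
 proof (rule integral_cong_AE)
  show "AE x in M. g x * D \<phi> x + D g x * \<phi> x = D (%x. g x * \<phi> x) x"
   using D_mult[OF assms] by eventually_elim simp
  show "(%x. g x * D \<phi> x + D g x * \<phi> x) \<in> borel_measurable M" using i by auto
 qed (intro D_meas mult_dom assms)
 finally show ?thesis using integral_D[OF mult_dom(1)[OF assms]] by simp
qed

text \<open>Green's formula for f minus the integration by parts for g; the term with w drops out by
  orthogonality, and what remains is the weak equation for u.\<close>

lemma decomp_energy:
 assumes d: "decomp f k g u w z" and \<phi>: "\<phi> \<in> fdom S"
 shows "energy S u \<phi> = (\<Sum>q\<in>bdry S. (nrm f q - g q * n q) * \<phi> q) - (LINT x|M. z x * \<phi> x)"
proof -
 have dom: "div_B f k" "g \<in> fdom S" "u \<in> fdom S" "w \<in> ker_D" "z \<in> ker_D"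
  and ae: "AE x in M. k x = D g x + z x" "AE x in M. f x = g x + D u x + w x" using d by (auto simp: decomp_def)
 have L: "f \<in> L2 M" "k \<in> L2 M" using dom(1) by (auto simp: div_B_def)
 note LL = L2_add L2_diff D_L2 dom_L2 ker_D_L2 dom L \<phi>
 have "(LINT x|M. f x * D \<phi> x) = (LINT x|M. (g x + D u x + w x) * D \<phi> x)"
  by (rule integral_mult_cong_AE) (use ae in "simp_all add: LL")
 also have "\<dots> = (LINT x|M. g x * D \<phi> x) + (LINT x|M. D u x * D \<phi> x) + (LINT x|M. w x * D \<phi> x)"
  using L2_mult_integrable[OF dom_L2[OF dom(2)] D_L2[OF \<phi>]] L2_mult_integrable[OF D_L2[OF dom(3)] D_L2[OF \<phi>]]
   L2_mult_integrable[OF ker_D_L2[OF dom(4)] D_L2[OF \<phi>]] by (simp add: distrib_right)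
 finally have 1: "(LINT x|M. f x * D \<phi> x) = (LINT x|M. g x * D \<phi> x) + energy S u \<phi>"
  using ker_D_orth[OF dom(4) \<phi>] energy_eq[OF dom(3) \<phi>] by simp
 have "(LINT x|M. k x * \<phi> x) = (LINT x|M. (D g x + z x) * \<phi> x)"
  by (rule integral_mult_cong_AE) (use ae in "simp_all add: LL")
 also have "\<dots> = (LINT x|M. D g x * \<phi> x) + (LINT x|M. z x * \<phi> x)"
  using L2_mult_integrable[OF D_L2[OF dom(2)] dom_L2[OF \<phi>]] L2_mult_integrable[OF ker_D_L2[OF dom(5)] dom_L2[OF \<phi>]]
  by (simp add: distrib_right)
 finally have 2: "(LINT x|M. k x * \<phi> x) = (LINT x|M. D g x * \<phi> x) + (LINT x|M. z x * \<phi> x)" .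
 have "(\<Sum>q\<in>bdry S. (nrm f q - g q * n q) * \<phi> q)
   = (\<Sum>q\<in>bdry S. nrm f q * \<phi> q) - (\<Sum>q\<in>bdry S. n q * (g q * \<phi> q))"
  by (simp add: sum_subtractf[symmetric] algebra_simps)
 thus ?thesis using Green[OF dom(1) \<phi>] 1 2 integral_parts[OF dom(2) \<phi>] by simp
qed

text \<open>The weak equation tested with the constant 1. The integral of z is zero because 1 = D h
  and z is orthogonal to gradients.\<close>

lemma decomp_sum:
 assumes d: "decomp f k g u w z"
 shows "(\<Sum>q\<in>bdry S. nrm f q - g q * n q) = 0"
proof -
 have dom: "u \<in> fdom S" "z \<in> ker_D" using d by (auto simp: decomp_def)
 have "energy S u (%_. 1) = (LINT x|M. D u x * D (%_. 1) x)" by (rule energy_eq[OF dom(1) const_dom])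
 also have "\<dots> = (LINT x|M. D u x * 0)"
  by (rule integral_mult_cong_AE) (auto intro: D_L2 dom const_dom L2_zero D_const)
 finally have 1: "energy S u (%_. 1) = 0" by simp
 have "(LINT x|M. z x * 1) = (LINT x|M. z x * D h x)"
  by (rule integral_mult_cong_AE) (use D_h in "auto intro: D_L2 dom L2_const ker_D_L2 h_dom elim!: eventually_mono")
 also have "\<dots> = 0" by (rule ker_D_orth[OF dom(2) h_dom])
 finally show ?thesis using decomp_energy[OF d const_dom[of 1]] 1 by simp
qed

text \<open>Expand (g + D u + w) (D g + z). The products z D u and w D g integrate to zero, z g + D
  u D g is the weak equation tested with g, and g D g is half a total derivative. Only boundary
  terms and w z survive.\<close>

lemma decomp_quad:
 assumes d: "decomp f k g u w z"
 shows "(LINT x|M. f x * k x) = (\<Sum>q\<in>bdry S. nrm f q * g q - n q * (g q)^2 / 2) + (LINT x|M. w x * z x)"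
proof -
 have dom: "div_B f k" "g \<in> fdom S" "u \<in> fdom S" "w \<in> ker_D" "z \<in> ker_D"
  and ae: "AE x in M. k x = D g x + z x" "AE x in M. f x = g x + D u x + w x" using d by (auto simp: decomp_def)
 have L: "f \<in> L2 M" "k \<in> L2 M" using dom(1) by (auto simp: div_B_def)
 note LL = L2_add L2_diff D_L2 dom_L2 ker_D_L2 dom L
 have "(LINT x|M. f x * k x) = (LINT x|M. (g x + D u x + w x) * (D g x + z x))"
  by (rule integral_mult_cong_AE) (use ae in "simp_all add: LL")
 also have "\<dots> = (LINT x|M. g x * D g x + z x * g x + D u x * D g x + z x * D u x + w x * D g x + w x * z x)"
  by (simp add: algebra_simps)
 also have "\<dots> = (LINT x|M. g x * D g x) + (LINT x|M. z x * g x) + (LINT x|M. D u x * D g x)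
   + (LINT x|M. z x * D u x) + (LINT x|M. w x * D g x) + (LINT x|M. w x * z x)"
  using L2_mult_integrable[OF dom_L2[OF dom(2)] D_L2[OF dom(2)]]
   L2_mult_integrable[OF ker_D_L2[OF dom(5)] dom_L2[OF dom(2)]]
   L2_mult_integrable[OF D_L2[OF dom(3)] D_L2[OF dom(2)]]
   L2_mult_integrable[OF ker_D_L2[OF dom(5)] D_L2[OF dom(3)]]
   L2_mult_integrable[OF ker_D_L2[OF dom(4)] D_L2[OF dom(2)]]
   L2_mult_integrable[OF ker_D_L2[OF dom(4)] ker_D_L2[OF dom(5)]] by simp
 also have "\<dots> = (LINT x|M. g x * D g x) + (\<Sum>q\<in>bdry S. (nrm f q - g q * n q) * g q) + (LINT x|M. w x * z x)"
  using decomp_energy[OF d dom(2)] energy_eq[OF dom(3,2)] ker_D_orth[OF dom(5,3)] ker_D_orth[OF dom(4,2)]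
  by simp
 also have "(LINT x|M. g x * D g x) = (\<Sum>q\<in>bdry S. n q * (g q * g q)) / 2"
  using integral_parts[OF dom(2,2)] by (simp add: mult.commute)
 also have "(\<Sum>q\<in>bdry S. n q * (g q * g q)) / 2 + (\<Sum>q\<in>bdry S. (nrm f q - g q * n q) * g q)
   = (\<Sum>q\<in>bdry S. nrm f q * g q - n q * (g q)^2 / 2)" unfolding sum_divide_distrib sum.distrib[symmetric]
  by (intro sum.cong refl) (simp add: power2_eq_square field_simps)
 finally show ?thesis .
qed

lemma nrm_grad:
 assumes u: "u \<in> fdom S" and z: "z \<in> L2 M" and q: "q \<in> bdry S"
  and eq: "!!\<phi>. \<phi> \<in> fdom S ==> energy S u \<phi> = (\<Sum>q\<in>bdry S. G q * \<phi> q) - (LINT x|M. z x * \<phi> x)"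
 shows "normal_part S h (grad S u) q = G q"
proof -
 have e: "(LINT x|M. D u x * D \<phi> x) = (\<Sum>q\<in>bdry S. G q * \<phi> q) - (LINT x|M. z x * \<phi> x)"
  if "\<phi> \<in> fdom S" for \<phi> using eq[OF that] energy_eq[OF u that] by simp
 have "div_B (D u) z" using e fdom_bdry_sub by (auto simp: div_B_def D_L2 u z subset_iff fdom_bdry_def)
 hence "nrm (D u) q = (\<Sum>p\<in>bdry S. G p * bdry_harmonic S q p)"
  using e[OF bdry_harmonic(1)[OF q]] by (simp add: nrm_eq[OF _ q])
 also have "\<dots> = (\<Sum>p\<in>bdry S. if p = q then G p else 0)" using q by (intro sum.cong) (auto simp: bdry_harmonic)
 also have "\<dots> = G q" using q fin_bdry by simp
 finally show ?thesis by (simp add: nrm_def grad_eq[OF u])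
qed

lemma rep_z_AE:
 assumes k: "div_B f k" and g: "g \<in> fdom S"
 shows "rep_z S h f g \<in> L2 M" "AE x in M. rep_z S h f g x = k x - D g x"
proof -
 show "rep_z S h f g \<in> L2 M" unfolding rep_z_def using perp_B_eq(1)[OF k] star_inv_grad(1)[OF g]
  by (intro L2_diff) (auto simp: div_B_def)
 show "AE x in M. rep_z S h f g x = k x - D g x"
  unfolding rep_z_def using perp_B_eq(2)[OF k] star_inv_grad(2)[OF g] by eventually_elim simp
qed

lemma nrm_star: "f \<in> L2 M ==> normal_part S h (star S h f) q = nrm f q" by (simp add: nrm_def star_eq)

text \<open>\<open>decomp_exists\<close> supplies a witness for the choice, and whatever triple is
  chosen is again a decomposition; no particular triple has to be computed.\<close>

lemma canonical_rep:
 assumes k: "div_B f k" and r: "canonical_rep S h f = (g, u, w)"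
 shows "decomp f (perp_B f) g u w (rep_z S h f g)"
  "q \<in> bdry S ==> normal_part S h (grad S u) q = nrm f q - g q * n q"
proof -
 have f: "f \<in> L2 M" using k by (simp add: div_B_def)
 have weak: "weak_solution S h z (%q. normal_part S h (star S h f) q - g q * nb q) u \<longleftrightarrow>
  u \<in> fdom S & z \<in> L2 M & (\<forall>\<phi>\<in>fdom S. energy S u \<phi> =
    (\<Sum>q\<in>bdry S. (nrm f q - g q * n q) * \<phi> q) - (LINT x|M. z x * \<phi> x))" for z g u
  unfolding weak_solution_def energy_measure_eq by (simp add: nrm_star[OF f] nb_eq cong: sum.cong)
 obtain g0 u0 w0 z0 where d0: "decomp f k g0 u0 w0 z0" using decomp_exists[OF k] by blast
 have dom0: "g0 \<in> fdom S" "u0 \<in> fdom S" "w0 \<in> ker_D" "z0 \<in> ker_D" using d0 by (auto simp: decomp_def)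
 have zz: "AE x in M. z0 x = rep_z S h f g0 x" using rep_z_AE(2)[OF k dom0(1)] d0 by (auto simp: decomp_def)
 have zi: "(LINT x|M. rep_z S h f g0 x * \<phi> x) = (LINT x|M. z0 x * \<phi> x)" if "\<phi> \<in> fdom S" for \<phi>
  by (rule integral_mult_cong_AE) (use zz in "auto intro: rep_z_AE(1)[OF k dom0(1)] ker_D_L2 dom0 dom_L2 that elim!: eventually_mono")
 have "is_canonical_rep S h f (g0, u0, w0)" unfolding is_canonical_rep.simps weak ker_perp_eq energy_measure_eq
 proof (intro conjI ballI)
  show "rep_z S h f g0 \<in> ker_D" by (rule ker_D_cong_AE[OF dom0(4) rep_z_AE(1)[OF k dom0(1)] zz])
  show "AE x in M. f x = g0 x + star_inv S h (grad S u0) x + w0 x"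
   using star_inv_grad(2)[OF dom0(2)] d0 by (auto simp: decomp_def)
  show "energy S u0 \<phi> = (\<Sum>q\<in>bdry S. (nrm f q - g0 q * n q) * \<phi> q) - (LINT x|M. rep_z S h f g0 x * \<phi> x)"
   if "\<phi> \<in> fdom S" for \<phi> using decomp_energy[OF d0 that] zi[OF that] by simp
 qed (use dom0 rep_z_AE(1)[OF k dom0(1)] in auto)
 hence "is_canonical_rep S h f (canonical_rep S h f)"
  unfolding canonical_rep_def by (rule someI[of "is_canonical_rep S h f"])
 hence c: "g \<in> fdom S" "rep_z S h f g \<in> ker_D" "w \<in> ker_D" "u \<in> fdom S"
  "!!\<phi>. \<phi> \<in> fdom S ==> energy S u \<phi> = (\<Sum>q\<in>bdry S. (nrm f q - g q * n q) * \<phi> q) - (LINT x|M. rep_z S h f g x * \<phi> x)"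
  "AE x in M. f x = g x + star_inv S h (grad S u) x + w x"
  unfolding r is_canonical_rep.simps weak ker_perp_eq energy_measure_eq by auto
 have "AE x in M. perp_B f x = D g x + rep_z S h f g x"
  using star_inv_grad(2)[OF c(1)] unfolding rep_z_def by eventually_elim simp
 moreover have "AE x in M. f x = g x + D u x + w x" using c(6) star_inv_grad(2)[OF c(4)] by eventually_elim simp
 ultimately show "decomp f (perp_B f) g u w (rep_z S h f g)"
  using perp_B_eq(1)[OF k] c by (simp add: decomp_def)
 show "normal_part S h (grad S u) q = nrm f q - g q * n q" if "q \<in> bdry S"
  by (rule nrm_grad[OF c(4) ker_D_L2[OF c(2)] that c(5)])
qed

end

section \<open>The Cauchy problem\<close>

text \<open>\<open>dh\<close> is the error of the difference quotient, so w s = w t + (s - t) (w' t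
  + dh s). Expanding the squared norm leaves the remainder \<open>?R\<close>, which tends to 0
  together with \<open>dh\<close>. At t = 0 the derivative is one-sided.\<close>

lemma L2_norm_sq_has_derivative:
 assumes w: "!!t. t >= 0 ==> w t \<in> L2 M" "!!t. t >= 0 ==> w' t \<in> L2 M" and t: "t >= 0"
  and lim: "((%s. L2_norm M (%x. (w s x - w t x) / (s - t) - w' t x)) \<longlongrightarrow> 0) (at t within {0..})"
 shows "((%s. LINT x|M. (w s x)^2) has_real_derivative 2 * (LINT x|M. w t x * w' t x)) (at t within {0..})"
proof -
 define dh where "dh s x = (w s x - w t x) / (s - t) - w' t x" for s x
 define N where "N s = (LINT x|M. (w s x)^2)" for s
 have dhL: "dh s \<in> L2 M" if "s >= 0" for s
  using L2_diff[OF L2_cmult[OF L2_diff[OF w(1)[OF that] w(1)[OF t]], of "1 / (s - t)"] w(2)[OF t]]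
  by (simp add: dh_def[abs_def])
 let ?R = "%s. 2 * (LINT x|M. w t x * dh s x) + (s - t) * (L2_norm M (%x. w' t x + dh s x))^2"
 have N: "(N s - N t) / (s - t) - 2 * (LINT x|M. w t x * w' t x) = ?R s" if s: "s >= 0" "s ~= t" for s
 proof -
  have ws: "w s = (%x. w t x + (s - t) * (w' t x + dh s x))" using s by (auto simp: dh_def)
  have L: "(%x. w' t x + dh s x) \<in> L2 M" using w(2)[OF t] dhL[OF s(1)] by (rule L2_add)
  have "N s = (L2_norm M (w s))^2" by (simp add: N_def L2_norm_sq)
  also have "\<dots> = (L2_norm M (%x. w t x + (s - t) * (w' t x + dh s x)))^2" by (subst ws) simp
  also have "\<dots> = N t + 2 * (LINT x|M. w t x * ((s - t) * (w' t x + dh s x)))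
    + (s - t)^2 * (L2_norm M (%x. w' t x + dh s x))^2"
   unfolding L2_norm_add_sq[OF w(1)[OF t] L2_cmult[OF L]] L2_norm_cmult
   by (simp add: N_def L2_norm_sq power_mult_distrib)
  also have "(LINT x|M. w t x * ((s - t) * (w' t x + dh s x)))
    = (LINT x|M. (s - t) * (w t x * w' t x) + (s - t) * (w t x * dh s x))" by (simp add: algebra_simps)
  also have "\<dots> = (s - t) * (LINT x|M. w t x * w' t x) + (s - t) * (LINT x|M. w t x * dh s x)"
   using L2_mult_integrable[OF w(1)[OF t] w(2)[OF t]] L2_mult_integrable[OF w(1)[OF t] dhL[OF s(1)]] by simp
  finally have Ns: "N s - N t = (s - t) * (2 * (LINT x|M. w t x * w' t x) + ?R s)"
   by (simp add: power2_eq_square algebra_simps)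
  have "(N s - N t) / (s - t) = 2 * (LINT x|M. w t x * w' t x) + ?R s"
   unfolding Ns using s(2) by (intro nonzero_mult_div_cancel_left) simp
  thus ?thesis by simp
 qed
 have d0: "((%s. L2_norm M (dh s)) \<longlongrightarrow> 0) (at t within {0..})" using lim by (simp add: dh_def[abs_def])
 have "(?R \<longlongrightarrow> 0) (at t within {0..})"
 proof (rule Lim_null_comparison)
  show "\<forall>\<^sub>F s in at t within {0..}. norm (?R s)
   <= 2 * (L2_norm M (w t) * L2_norm M (dh s)) + \<bar>s - t\<bar> * (L2_norm M (w' t) + L2_norm M (dh s))^2"
   unfolding eventually_at
  proof (intro exI[of _ 1] conjI ballI impI)
   fix s :: real assume "s \<in> {0..}"
   hence dh: "dh s \<in> L2 M" using dhL by simp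
   have "(L2_norm M (%x. w' t x + dh s x))^2 <= (L2_norm M (w' t) + L2_norm M (dh s))^2"
    by (intro power_mono L2_norm_add w t dh) simp
   hence "\<bar>(s - t) * (L2_norm M (%x. w' t x + dh s x))^2\<bar>
     <= \<bar>s - t\<bar> * (L2_norm M (w' t) + L2_norm M (dh s))^2" by (simp add: abs_mult mult_left_mono)
   moreover have "\<bar>2 * (LINT x|M. w t x * dh s x)\<bar> <= 2 * (L2_norm M (w t) * L2_norm M (dh s))"
    using L2_norm_CS[OF w(1)[OF t] dh] by (simp add: abs_mult)
   ultimately show "norm (?R s) <= 2 * (L2_norm M (w t) * L2_norm M (dh s))
     + \<bar>s - t\<bar> * (L2_norm M (w' t) + L2_norm M (dh s))^2" by (simp only: real_norm_def)
  qed simp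
  have "((%s. 2 * (L2_norm M (w t) * L2_norm M (dh s)) + \<bar>s - t\<bar> * (L2_norm M (w' t) + L2_norm M (dh s))^2)
   \<longlongrightarrow> 2 * (L2_norm M (w t) * 0) + \<bar>t - t\<bar> * (L2_norm M (w' t) + 0)^2) (at t within {0..})"
   by (intro tendsto_intros d0)
  thus "((%s. 2 * (L2_norm M (w t) * L2_norm M (dh s)) + \<bar>s - t\<bar> * (L2_norm M (w' t) + L2_norm M (dh s))^2)
   \<longlongrightarrow> 0) (at t within {0..})" by simp
 qed
 moreover have "\<forall>\<^sub>F s in at t within {0..}. ?R s = (N s - N t) / (s - t) - 2 * (LINT x|M. w t x * w' t x)"
  unfolding eventually_at by (intro exI[of _ 1]) (auto simp: N)
 ultimately have "((%s. (N s - N t) / (s - t) - 2 * (LINT x|M. w t x * w' t x)) \<longlongrightarrow> 0) (at t within {0..})"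
  by (rule Lim_transform_eventually)
 hence "((%s. (N s - N t) / (s - t)) \<longlongrightarrow> 2 * (LINT x|M. w t x * w' t x)) (at t within {0..})"
  by (rule LIM_zero_cancel)
 thus ?thesis by (simp add: has_field_derivative_iff N_def)
qed

context one_dim_harmonic begin

lemma perp_dom_div_B: "f \<in> perp_dom S h (fdom_bdry S) ==> div_B f (perp_B f)"
 using perp_B_eq(1) by (auto simp: perp_dom_iff)

lemma gen_dom_div_B: "f \<in> gen_dom S h \<Theta> ==> div_B f (perp_B f)" by (simp add: gen_dom_def perp_dom_div_B)

lemma cauchy_unique:
 assumes diss: "!!f1 f2. f1 \<in> gen_dom S h \<Theta> ==> f2 \<in> gen_dom S h \<Theta> ==>
   0 <= (LINT x|M. (f1 x - f2 x) * (perp_B f1 x - perp_B f2 x))"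
  and 1: "cauchy_solution S h \<Theta> v0 v1" and 2: "cauchy_solution S h \<Theta> v0 v2" and t: "t >= 0"
 shows "AE x in M. v1 t x = v2 t x"
proof -
 have dom: "!!t. t >= 0 ==> v1 t \<in> gen_dom S h \<Theta>" "!!t. t >= 0 ==> v2 t \<in> gen_dom S h \<Theta>"
  and init: "AE x in M. v1 0 x = v0 x" "AE x in M. v2 0 x = v0 x"
  using 1 2 by (auto simp: cauchy_solution_def energy_measure_eq Let_def)
 have L: "v1 t \<in> L2 M" "v2 t \<in> L2 M" "perp_B (v1 t) \<in> L2 M" "perp_B (v2 t) \<in> L2 M" if "t >= 0" for t
  using gen_dom_div_B[OF dom(1)[OF that]] gen_dom_div_B[OF dom(2)[OF that]] by (auto simp: div_B_def)
 obtain v1' where v1': "!!t. t >= 0 ==> v1' t \<in> L2 M"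
  "!!t. t >= 0 ==> ((%s. L2_norm M (%x. (v1 s x - v1 t x) / (s - t) - v1' t x)) \<longlongrightarrow> 0) (at t within {0..})"
  "!!t. t >= 0 ==> AE x in M. v1' t x = gen S h (v1 t) x"
  using 1 unfolding cauchy_solution_def energy_measure_eq Let_def by blast
 obtain v2' where v2': "!!t. t >= 0 ==> v2' t \<in> L2 M"
  "!!t. t >= 0 ==> ((%s. L2_norm M (%x. (v2 s x - v2 t x) / (s - t) - v2' t x)) \<longlongrightarrow> 0) (at t within {0..})"
  "!!t. t >= 0 ==> AE x in M. v2' t x = gen S h (v2 t) x"
  using 2 unfolding cauchy_solution_def energy_measure_eq Let_def by blast
 define w where "w t x = v1 t x - v2 t x" for t x
 define w' where "w' t x = v1' t x - v2' t x" for t x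
 have wL: "w t \<in> L2 M" "w' t \<in> L2 M" if "t >= 0" for t
  unfolding w_def w'_def by (intro L2_diff L that v1'(1) v2'(1))+
 define N where "N s = (LINT x|M. (w s x)^2)" for s
 have der: "(N has_real_derivative 2 * (LINT x|M. w t x * w' t x)) (at t within {0..})" if t: "t >= 0" for t
  unfolding N_def
 proof (rule L2_norm_sq_has_derivative[OF wL t])
  show "((%s. L2_norm M (%x. (w s x - w t x) / (s - t) - w' t x)) \<longlongrightarrow> 0) (at t within {0..})"
  proof (rule Lim_null_comparison)
   let ?d1 = "%s x. (v1 s x - v1 t x) / (s - t) - v1' t x" and ?d2 = "%s x. (v2 s x - v2 t x) / (s - t) - v2' t x"
   show "((%s. L2_norm M (?d1 s) + L2_norm M (?d2 s)) \<longlongrightarrow> 0) (at t within {0..})"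
    using tendsto_add[OF v1'(2)[OF t] v2'(2)[OF t]] by simp
   show "\<forall>\<^sub>F s in at t within {0..}. norm (L2_norm M (%x. (w s x - w t x) / (s - t) - w' t x))
     <= L2_norm M (?d1 s) + L2_norm M (?d2 s)" unfolding eventually_at
   proof (intro exI[of _ 1] conjI ballI impI)
    fix s :: real assume "s \<in> {0..}"
    hence s: "s >= 0" by simp
    have "?d1 s \<in> L2 M"
     using L2_diff[OF L2_cmult[OF L2_diff[OF L(1)[OF s] L(1)[OF t]], of "1 / (s - t)"] v1'(1)[OF t]] by simp
    moreover have "?d2 s \<in> L2 M"
     using L2_diff[OF L2_cmult[OF L2_diff[OF L(2)[OF s] L(2)[OF t]], of "1 / (s - t)"] v2'(1)[OF t]] by simp
    ultimately have "L2_norm M (%x. ?d1 s x - ?d2 s x) <= L2_norm M (?d1 s) + L2_norm M (?d2 s)"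
     by (rule L2_norm_diff)
    moreover have "(%x. ?d1 s x - ?d2 s x) = (%x. (w s x - w t x) / (s - t) - w' t x)"
     by (rule ext) (simp add: w_def w'_def diff_divide_distrib)
    ultimately show "norm (L2_norm M (%x. (w s x - w t x) / (s - t) - w' t x))
     <= L2_norm M (?d1 s) + L2_norm M (?d2 s)" by simp
   qed simp
  qed
 qed
 have neg: "2 * (LINT x|M. w t x * w' t x) <= 0" if t: "t >= 0" for t
 proof -
  have "(LINT x|M. w t x * w' t x) = (LINT x|M. w t x * (- (perp_B (v1 t) x - perp_B (v2 t) x)))"
  proof (rule integral_mult_cong_AE)
   show "AE x in M. w' t x = - (perp_B (v1 t) x - perp_B (v2 t) x)"
    using v1'(3)[OF t] v2'(3)[OF t] by eventually_elim (simp add: w'_def gen_def)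
  qed (use wL[OF t] L[OF t] in "auto intro: L2_diff")
  also have "\<dots> = - (LINT x|M. (v1 t x - v2 t x) * (perp_B (v1 t) x - perp_B (v2 t) x))"
   unfolding w_def by (simp only: mult_minus_right Bochner_Integration.integral_minus)
  finally show ?thesis using diss[OF dom(1)[OF t] dom(2)[OF t]] by simp
 qed
 have N0: "N 0 = 0"
 proof -
  have "N 0 = (LINT x|M. 0)" unfolding N_def
  proof (rule integral_cong_AE)
   show "AE x in M. (w 0 x)^2 = 0" using init by eventually_elim (simp add: w_def)
  qed (use wL[of 0] in "auto simp: L2_def")
  thus ?thesis by simp
 qed
 have "N t <= 0"
 proof (cases "t = 0")
  case False
  hence t0: "0 < t" using t by simp
  have "N t <= N 0"
  proof (rule DERIV_nonpos_imp_decreasing_open[OF less_imp_le[OF t0]])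
   fix s :: real assume s: "0 < s" "s < t"
   \<comment> \<open>Inside the interval the derivative within the half-line is the two-sided one
     required by the monotonicity criterion.\<close>
   have "at s within {0..} = at s" using s by (intro at_within_interior) simp
   thus "\<exists>y. (N has_real_derivative y) (at s) & y <= 0"
    using der[of s] neg[of s] s by (intro exI[of _ "2 * (LINT x|M. w s x * w' s x)"]) auto
  next
   have "continuous_on {0..} N"
    using der by (auto simp: continuous_on_eq_continuous_within intro: DERIV_continuous)
   thus "continuous_on {0..t} N" by (rule continuous_on_subset) auto
  qed
  thus ?thesis using N0 by simp
 qed (use N0 in simp)
 hence "L2_norm M (w t) = 0" by (simp add: L2_norm_def N_def order_antisym)
 hence "AE x in M. w t x = 0" using wL[OF t] by (simp add: L2_norm_eq_0)
 thus ?thesis by eventually_elim (simp add: w_def)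
qed

text \<open>The chain rule and D h = 1 give D (F(h)) = F'(h); integration by parts against a test
  function then shows both the divergence and the boundary term.\<close>

lemma div_B_compose:
 assumes F: "!!x. (F has_real_derivative F' x) (at x)" and F': "continuous_on UNIV F'"
 shows "div_B (%x. F (h x)) (%x. F' (h x))"
  and nrm_compose: "q \<in> bdry S ==> nrm (%x. F (h x)) q = n q * F (h q)"
  and D_compose: "AE x in M. D (%x. F (h x)) x = F' (h x)"
proof -
 have Fd: "(%x. F (h x)) \<in> fdom S" by (rule chain_dom[OF F F' h_dom])
 have F'c: "continuous_on (carr S) (%x. F' (h x))"
  by (rule continuous_on_compose2[OF F' dom_cont[OF h_dom]]) auto
 show DF: "AE x in M. D (%x. F (h x)) x = F' (h x)" using D_chain[OF F F' h_dom] D_h by eventually_elim simp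
 have e: "(LINT x|M. F (h x) * D u x) + (LINT x|M. F' (h x) * u x) = (\<Sum>q\<in>bdry S. n q * (F (h q) * u q))"
  if u: "u \<in> fdom S" for u
 proof -
  have "(LINT x|M. D (%x. F (h x)) x * u x) = (LINT x|M. F' (h x) * u x)"
   by (rule integral_mult_cong_AE[OF D_L2[OF Fd] cont_L2[OF F'c] dom_L2[OF u] dom_L2[OF u] DF]) simp
  thus ?thesis using integral_parts[OF Fd u] by simp
 qed
 show d: "div_B (%x. F (h x)) (%x. F' (h x))" unfolding div_B_def
 proof (intro conjI ballI dom_L2[OF Fd] cont_L2[OF F'c])
  fix u assume u: "u \<in> fdom_bdry S"
  hence "(\<Sum>q\<in>bdry S. n q * (F (h q) * u q)) = 0" by (simp add: fdom_bdry_def)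
  thus "(LINT x|M. F (h x) * D u x) = - (LINT x|M. F' (h x) * u x)" using e[of u] u fdom_bdry_sub by auto
 qed
 show "nrm (%x. F (h x)) q = n q * F (h q)" if q: "q \<in> bdry S"
 proof -
  have "nrm (%x. F (h x)) q = (\<Sum>p\<in>bdry S. n p * (F (h p) * bdry_harmonic S q p))"
   using e[OF bdry_harmonic(1)[OF q]] by (simp add: nrm_eq[OF d q])
  also have "\<dots> = (\<Sum>p\<in>bdry S. if p = q then n p * F (h p) else 0)"
   using q by (intro sum.cong) (auto simp: bdry_harmonic)
  also have "\<dots> = n q * F (h q)" using q fin_bdry by simp
  finally show ?thesis .
 qed
qed

text \<open>The function G = g - F(h) has derivative - z. Since z is orthogonal to all gradients, D
  G is orthogonal to itself, so z = 0 and G is constant.\<close>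

lemma canonical_compose:
 assumes F: "!!x. (F has_real_derivative F' x) (at x)" and F': "continuous_on UNIV F'"
  and r: "canonical_rep S h (%x. F (h x)) = (g, u, w)"
 shows "\<exists>c. \<forall>x\<in>carr S. g x = F (h x) + c" "AE x in M. rep_z S h (%x. F (h x)) g x = 0"
proof -
 let ?f = "%x. F (h x)" and ?z = "rep_z S h (%x. F (h x)) g"
 note d = div_B_compose(1)[OF F F']
 have fd: "?f \<in> fdom S" by (rule chain_dom[OF F F' h_dom])
 have dec: "decomp ?f (perp_B ?f) g u w ?z" by (rule canonical_rep(1)[OF d r])
 hence g: "g \<in> fdom S" and z: "?z \<in> ker_D" by (auto simp: decomp_def)
 have "AE x in M. F' (h x) = D g x + ?z x" using dec perp_B_eq(2)[OF d] by (auto simp: decomp_def)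
 hence ae: "AE x in M. D (%x. g x - ?f x) x = - ?z x"
  using D_diff[OF g fd] D_compose[OF F F'] by eventually_elim simp
 let ?G = "%x. g x - ?f x"
 have Gd: "?G \<in> fdom S" by (rule diff_dom[OF g fd])
 have "(LINT x|M. D ?G x * D ?G x) = (LINT x|M. - ?z x * D ?G x)"
  by (rule integral_mult_cong_AE[OF D_L2[OF Gd] L2_uminus[OF ker_D_L2[OF z]] D_L2[OF Gd] D_L2[OF Gd] ae]) simp
 also have "\<dots> = 0" using ker_D_orth[OF z Gd] by simp
 finally have "L2_norm M (D ?G) = 0" by (simp add: L2_norm_def power2_eq_square)
 hence DG: "AE x in M. D ?G x = 0" using D_L2[OF Gd] by (simp add: L2_norm_eq_0)
 show "AE x in M. ?z x = 0" using DG ae by eventually_elim simp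
 obtain p where p: "p \<in> carr S" using bdry_ne bdry_sub by blast
 show "\<exists>c. \<forall>x\<in>carr S. g x = F (h x) + c"
  using dom_eq_const[OF Gd DG _ p] by (intro exI[of _ "g p - F (h p)"]) (auto simp: algebra_simps)
qed

lemma L2_norm_le_sup:
 assumes "continuous_on (carr S) f" "!!x. x \<in> carr S ==> \<bar>f x\<bar> <= e"
 shows "L2_norm M f <= e * L2_norm M (%_. 1)"
proof -
 obtain p where p: "p \<in> carr S" using bdry_ne bdry_sub by blast
 have e: "e >= 0" using assms(2)[OF p] by simp
 have "(LINT x|M. (f x)^2) <= (LINT x|M. e^2)"
 proof (rule integral_mono_AE)
  show "AE x in M. (f x)^2 <= e^2"
   using assms(2) e by (intro AE_I2) (simp add: space_M abs_le_square_iff[symmetric])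
 qed (use L2_square_integrable[OF cont_L2[OF assms(1)]] in auto)
 hence "(L2_norm M f)^2 <= (e * L2_norm M (%_. 1))^2" by (simp add: L2_norm_sq power_mult_distrib mult.commute)
 thus ?thesis by (rule power2_le_imp_le) (simp add: e)
qed

lemma L2_norm_tendsto_sup:
 assumes c: "!!s. continuous_on (carr S) (f s)"
  and e: "!!e. e > 0 ==> \<exists>d>0. \<forall>s\<in>A. s ~= t & dist s t < d --> (\<forall>x\<in>carr S. \<bar>f s x\<bar> <= e)"
 shows "((%s. L2_norm M (f s)) \<longlongrightarrow> 0) (at t within A)"
proof (rule tendstoI)
 fix e :: real assume "e > 0"
 define b where "b = L2_norm M (%_. 1)"
 have b: "b >= 0" by (simp add: b_def)
 obtain d where d: "d > 0" "\<forall>s\<in>A. s ~= t & dist s t < d --> (\<forall>x\<in>carr S. \<bar>f s x\<bar> <= e / (b + 1))"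
  using e[of "e / (b + 1)"] \<open>e > 0\<close> b by auto
 show "\<forall>\<^sub>F s in at t within A. dist (L2_norm M (f s)) 0 < e" unfolding eventually_at
 proof (intro exI[of _ d] conjI ballI impI d)
  fix s assume "s \<in> A" "s ~= t & dist s t < d"
  hence "L2_norm M (f s) <= e / (b + 1) * b"
   unfolding b_def[symmetric] using d(2) L2_norm_le_sup[OF c, of s "e / (b + 1)"] by (simp add: b_def)
  also have "\<dots> < e" using \<open>e > 0\<close> b by (simp add: field_simps)
  finally show "dist (L2_norm M (f s)) 0 < e" by (simp add: dist_real_def)
 qed
qed

text \<open>The time derivative - V'(h - t) equals the value of the generator by
  \<open>div_B_compose\<close>. Uniform continuity of V' makes all limits in time uniform on the
  space, and the measure is finite, so they hold in L2.\<close>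

lemma transport_solution:
 assumes V: "!!x. (V has_real_derivative V' x) (at x)" and V': "uniformly_continuous_on UNIV V'"
  and dom: "!!t. t >= 0 ==> (%x. V (h x - t)) \<in> gen_dom S h \<Theta>"
 shows "cauchy_solution S h \<Theta> (V \<circ> h) (%t x. V (h x - t))"
proof -
 have V'c: "continuous_on UNIV V'" by (rule uniformly_continuous_imp_continuous[OF V'])
 have Vc: "continuous_on UNIV V" using V by (meson DERIV_continuous_on has_field_derivative_at_within)
 have hc: "continuous_on (carr S) h" by (rule dom_cont[OF h_dom])
 have c: "continuous_on (carr S) (%x. V (h x - t))" "continuous_on (carr S) (%x. V' (h x - t))" for t
 proof -
  have "continuous_on (carr S) (%x. h x - t)" by (intro continuous_intros hc)
  thus "continuous_on (carr S) (%x. V (h x - t))" "continuous_on (carr S) (%x. V' (h x - t))"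
   using continuous_on_compose2[OF Vc, of "carr S" "%x. h x - t"]
    continuous_on_compose2[OF V'c, of "carr S" "%x. h x - t"] by auto
 qed
 have Vt: "((%x. V (x - t)) has_real_derivative V' (x - t)) (at x)" for x t
  using V[of "x - t"] DERIV_shift[of V "V' (x - t)" x "- t"] by simp
 have V't: "continuous_on UNIV (%x. V' (x - t))" for t
  by (rule continuous_on_compose2[OF V'c, of _ "%x. x - t"]) (auto intro!: continuous_intros)
 have gen: "AE x in M. gen S h (%x. V (h x - t)) x = - V' (h x - t)" for t
  using perp_B_eq(2)[OF div_B_compose(1)[OF Vt V't]] by (auto simp: gen_def)
 have genm: "gen S h (%x. V (h x - t)) \<in> borel_measurable M" for t
  using perp_B_eq(1)[OF div_B_compose(1)[OF Vt V't, of t]] by (auto simp: gen_def[abs_def] div_B_def L2_def)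
 have uc: "\<exists>d>0. \<forall>x y. \<bar>x - y\<bar> < d --> \<bar>V' x - V' y\<bar> < e" if "e > 0" for e
  using V' that unfolding uniformly_continuous_on_def dist_real_def by (metis UNIV_I abs_minus_commute)
 have lim': "((%s. L2_norm M (%x. - V' (h x - s) - - V' (h x - t))) \<longlongrightarrow> 0) (at t within {0..})" for t
 proof (rule L2_norm_tendsto_sup)
  fix e :: real assume "e > 0"
  from uc[OF this] obtain d where d: "d > 0" "!!x y. \<bar>x - y\<bar> < d ==> \<bar>V' x - V' y\<bar> < e" by blast
  show "\<exists>d>0. \<forall>s\<in>{0..}. s ~= t & dist s t < d --> (\<forall>x\<in>carr S. \<bar>- V' (h x - s) - - V' (h x - t)\<bar> <= e)"
   by (intro exI[of _ d] conjI d ballI impI order.strict_implies_order)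
    (use d(2)[of "h _ - t" "h _ - _"] in "simp add: dist_real_def")
 qed (intro continuous_intros c)
 have limq: "((%s. L2_norm M (%x. (V (h x - s) - V (h x - t)) / (s - t) - - V' (h x - t))) \<longlongrightarrow> 0) (at t within {0..})" for t
 proof (rule L2_norm_tendsto_sup)
  fix e :: real assume "e > 0"
  from uc[OF this] obtain d where d: "d > 0" "!!x y. \<bar>x - y\<bar> < d ==> \<bar>V' x - V' y\<bar> < e" by blast
  show "\<exists>d>0. \<forall>s\<in>{0..}. s ~= t & dist s t < d -->
    (\<forall>x\<in>carr S. \<bar>(V (h x - s) - V (h x - t)) / (s - t) - - V' (h x - t)\<bar> <= e)"
  proof (intro exI[of _ d] conjI d ballI impI)
   fix s :: real and x assume s: "s ~= t & dist s t < d"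
   obtain z where z: "\<bar>z - (h x - t)\<bar> <= \<bar>(h x - t) - (h x - s)\<bar>"
     "V (h x - t) - V (h x - s) = V' z * ((h x - t) - (h x - s))"
    using real_mean_value[OF V, of "h x - t" "h x - s"] by blast
   have "(V (h x - s) - V (h x - t)) / (s - t) = - V' z" using z(2) s by (simp add: field_simps)
   moreover have "\<bar>V' z - V' (h x - t)\<bar> < e" using z(1) s by (intro d(2)) (auto simp: dist_real_def)
   ultimately show "\<bar>(V (h x - s) - V (h x - t)) / (s - t) - - V' (h x - t)\<bar> <= e" by simp
  qed
 qed (unfold divide_inverse, intro continuous_intros c)
 have limv: "((%s. L2_norm M (%x. V (h x - s) - V (h x - t))) \<longlongrightarrow> 0) (at t within {0..})" for t
 proof (rule L2_norm_tendsto_sup)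
  fix e :: real assume e: "e > 0"
  obtain B where B: "B > 0" "!!x. x \<in> carr S ==> \<bar>V' (h x - t)\<bar> <= B" using cont_bdd[OF c(2)] by blast
  from uc[of 1] obtain d where d: "d > 0" "!!x y. \<bar>x - y\<bar> < d ==> \<bar>V' x - V' y\<bar> < 1" by auto
  show "\<exists>d>0. \<forall>s\<in>{0..}. s ~= t & dist s t < d --> (\<forall>x\<in>carr S. \<bar>V (h x - s) - V (h x - t)\<bar> <= e)"
  proof (intro exI[of _ "min d (e / (B + 1))"] conjI ballI impI)
   show "0 < min d (e / (B + 1))" using d B e by simp
   fix s :: real and x assume s: "s ~= t & dist s t < min d (e / (B + 1))" and x: "x \<in> carr S"
   obtain z where z: "\<bar>z - (h x - t)\<bar> <= \<bar>(h x - t) - (h x - s)\<bar>"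
     "V (h x - t) - V (h x - s) = V' z * ((h x - t) - (h x - s))"
    using real_mean_value[OF V, of "h x - t" "h x - s"] by blast
   have "\<bar>V' z - V' (h x - t)\<bar> < 1" using z(1) s by (intro d(2)) (auto simp: dist_real_def)
   hence "\<bar>V' z\<bar> <= B + 1" using B(2)[OF x] by simp
   moreover have "\<bar>s - t\<bar> <= e / (B + 1)" using s by (simp add: dist_real_def)
   ultimately have "\<bar>V' z\<bar> * \<bar>s - t\<bar> <= (B + 1) * (e / (B + 1))" by (intro mult_mono) auto
   hence "\<bar>V' z * (s - t)\<bar> <= e" using B(1) by (simp add: abs_mult)
   thus "\<bar>V (h x - s) - V (h x - t)\<bar> <= e" using z(2) by (simp add: abs_minus_commute)
  qed
 qed (intro continuous_intros c)
 have gdiff: "L2_norm M (%x. gen S h (%x. V (h x - s)) x - gen S h (%x. V (h x - t)) x)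
   = L2_norm M (%x. - V' (h x - s) - - V' (h x - t))" for s t
 proof (rule L2_norm_cong_AE)
  show "AE x in M. gen S h (%x. V (h x - s)) x - gen S h (%x. V (h x - t)) x = - V' (h x - s) - - V' (h x - t)"
   using gen[of s] gen[of t] by eventually_elim simp
 qed (use genm cont_meas[OF c(2)] in auto)
 show ?thesis unfolding cauchy_solution_def energy_measure_eq Let_def
 proof (intro conjI exI[of _ "%t x. - V' (h x - t)"] allI impI)
  show "(%x. - V' (h x - t)) \<in> L2 M" for t by (intro cont_L2 continuous_intros c)
  show "AE x in M. - V' (h x - t) = gen S h (%x. V (h x - t)) x" for t using gen[of t] by eventually_elim simp
  show "((%s. L2_norm M (%x. V (h x - s) - V (h x - t))
    + L2_norm M (%x. gen S h (%x. V (h x - s)) x - gen S h (%x. V (h x - t)) x)) \<longlongrightarrow> 0) (at t within {0..})" for t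
   unfolding gdiff using tendsto_add[OF limv lim'] by simp
 qed (use dom limq lim' in auto)
qed

text \<open>The set where f and g differ is relatively open; if it were nonempty,
  \<open>supp\<close> would give it positive measure.\<close>

lemma cont_AE_eq:
 assumes f: "continuous_on (carr S) f" and g: "continuous_on (carr S) (g :: 'a => real)"
  and ae: "AE x in M. f x = g x" and x: "x \<in> carr S"
 shows "f x = g x"
proof (rule ccontr)
 assume ne: "f x ~= g x"
 have "continuous_on (carr S) (%x. f x - g x)" by (intro continuous_intros f g)
 then obtain U where U: "open U" "U \<inter> carr S = (%x. f x - g x) -` (- {0}) \<inter> carr S"
  using continuous_on_open_invariant[THEN iffD1, rule_format, of "carr S" "%x. f x - g x" "- {0}"] by auto
 have "U \<inter> carr S ~= {}" using ne x U(2) by auto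
 hence "emeasure M (U \<inter> carr S) ~= 0" using supp[OF U(1)] by blast
 moreover have "AE x in M. x \<notin> U \<inter> carr S" using ae unfolding U(2) by eventually_elim auto
 hence "emeasure M (U \<inter> carr S) = 0" by (intro AE_iff_measurable[THEN iffD1, rotated 2])
   (use U(1) radon in "auto simp: radon_on_def sets_restrict_space space_M")
 ultimately show False by blast
qed

lemma the_solution_transport:
 assumes V: "!!x. (V has_real_derivative V' x) (at x)" and V': "uniformly_continuous_on UNIV V'"
  and dom: "!!t. t >= 0 ==> (%x. V (h x - t)) \<in> gen_dom S h \<Theta>"
  and diss: "!!f1 f2. f1 \<in> gen_dom S h \<Theta> ==> f2 \<in> gen_dom S h \<Theta> ==>
   0 <= (LINT x|M. (f1 x - f2 x) * (perp_B f1 x - perp_B f2 x))"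
 shows "the_solution S h \<Theta> (V \<circ> h) (%t x. V (h x - t))"
  and "the_solution S h \<Theta> (V \<circ> h) v ==> t >= 0 ==> x \<in> carr S ==> v t x = V (h x - t)"
proof -
 have sol: "cauchy_solution S h \<Theta> (V \<circ> h) (%t x. V (h x - t))" by (rule transport_solution[OF V V' dom])
 have Vc: "continuous_on UNIV V" using V by (meson DERIV_continuous_on has_field_derivative_at_within)
 have c: "continuous_on (carr S) (%x. V (h x - t))" for t
  by (rule continuous_on_compose2[OF Vc, of _ "%x. h x - t"])
   (auto intro!: continuous_intros dom_cont[OF h_dom])
 show "the_solution S h \<Theta> (V \<circ> h) (%t x. V (h x - t))"
  unfolding the_solution_def energy_measure_eq using sol c cauchy_unique[OF diss _ sol] by blast
 assume v: "the_solution S h \<Theta> (V \<circ> h) v" and t: "t >= 0" and x: "x \<in> carr S"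
 have "AE x in M. V (h x - t) = v t x" using v sol t unfolding the_solution_def energy_measure_eq by blast
 moreover have "continuous_on (carr S) (v t)" using v t unfolding the_solution_def by blast
 ultimately show "v t x = V (h x - t)" using cont_AE_eq[OF c _ _ x] by force
qed

end

section \<open>The boundary conditions\<close>

text \<open>The constant c is the common scale of the boundary fluxes, which are (0, - c, c) in item
  (i) and (- 2 c, c, c) in item (ii). The gasket and its graphs differ in this scale.\<close>

locale one_dim_bdry3 = one_dim_harmonic S h M D n
 for S :: "(real^2) energy_space" and h M D n +
 fixes q :: "nat => real^2" and c :: real
 assumes bdry3: "bdry S = {q 0, q 1, q 2}" "q 0 ~= q 1" "q 0 ~= q 2" "q 1 ~= q 2" and c: "c > 0"
begin

lemma q_bdry: "q 0 \<in> bdry S" "q 1 \<in> bdry S" "q 2 \<in> bdry S" by (auto simp: bdry3)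

lemma sum_bdry: "(\<Sum>p\<in>bdry S. f p) = f (q 0) + (f (q 1) + f (q 2))" using bdry3 by simp

lemma decomp_sum3:
 assumes "div_B f k" "canonical_rep S h f = (g, u, w)"
 shows "nrm f (q 0) - g (q 0) * n (q 0) + (nrm f (q 1) - g (q 1) * n (q 1) + (nrm f (q 2) - g (q 2) * n (q 2))) = 0"
 using decomp_sum[OF canonical_rep(1)[OF assms]] by (simp add: sum_bdry)

text \<open>Both boundary maps leave the kernel component unchanged, so this component of the
  boundary condition reads w + z = w - z.\<close>

lemma AE_plus_minus:
 "(AE x in M. (w x + z x) / sqrt 2 = (w x - z x) / sqrt 2) \<longleftrightarrow> (AE x in M. z x = (0::real))"
proof -
 have "((w x + z x) / sqrt 2 = (w x - z x) / sqrt 2) \<longleftrightarrow> z x = 0" for x by (auto simp: divide_cancel_right)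
 thus ?thesis by simp
qed

lemma decomp_quad3:
 assumes "div_B f1 k1" "canonical_rep S h f1 = (g1, u1, w1)" "AE x in M. rep_z S h f1 g1 x = 0"
  and "div_B f2 k2" "canonical_rep S h f2 = (g2, u2, w2)" "AE x in M. rep_z S h f2 g2 x = 0"
 shows "(LINT x|M. (f1 x - f2 x) * (perp_B f1 x - perp_B f2 x)) =
  (let Q = (%p. (nrm f1 p - nrm f2 p) * (g1 p - g2 p) - n p * (g1 p - g2 p)^2 / 2)
  in Q (q 0) + (Q (q 1) + Q (q 2)))"
proof -
 note d1 = canonical_rep(1)[OF assms(1,2)] and d2 = canonical_rep(1)[OF assms(4,5)]
 have L: "w1 \<in> L2 M" "w2 \<in> L2 M" "rep_z S h f1 g1 \<in> L2 M" "rep_z S h f2 g2 \<in> L2 M"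
  and p: "div_B f1 (perp_B f1)" "div_B f2 (perp_B f2)" using d1 d2 by (auto simp: decomp_def ker_D_L2)
 have "(LINT x|M. (w1 x - w2 x) * (rep_z S h f1 g1 x - rep_z S h f2 g2 x)) = (LINT x|M. (w1 x - w2 x) * 0)"
  by (rule integral_mult_cong_AE)
   (use assms(3,6) L in "auto intro: L2_diff L2_zero")
 hence "(LINT x|M. (f1 x - f2 x) * (perp_B f1 x - perp_B f2 x)) =
   (\<Sum>p\<in>bdry S. nrm (%x. f1 x - f2 x) p * (g1 p - g2 p) - n p * (g1 p - g2 p)^2 / 2)"
  using decomp_quad[OF decomp_diff[OF d1 d2]] by simp
 thus ?thesis by (simp add: sum_bdry nrm_diff[OF p] q_bdry Let_def)
qed

lemma G_val:
 assumes k: "div_B f k" and r: "canonical_rep S h f = (g, u, w)"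
 shows "G_minus S h f = bvec_proj S h (e_minus S h)
   (%q. let n = nb q; nf = normal_part S h (star S h f) q;
        du = normal_part S h (grad S u) q in
     if n = 0 then (g q + nf) / sqrt 2 else if n < 0 then du / \<bar>n\<bar> else nf / \<bar>n\<bar>,
    %p. (w p + rep_z S h f g p) / sqrt 2)"
  "G_plus S h f = bvec_proj S h (e_plus S h)
   (%q. let n = nb q; nf = normal_part S h (star S h f) q;
        du = normal_part S h (grad S u) q in
     if n = 0 then (g q - nf) / sqrt 2 else if n < 0 then nf / \<bar>n\<bar> else du / \<bar>n\<bar>,
    %p. (w p - rep_z S h f g p) / sqrt 2)" by (simp_all add: G_minus_def G_plus_def r)

lemma bvec_eq_M: "bvec_eq S h (x, w) (x', w') \<longleftrightarrow> (\<forall>p\<in>bdry S. x p = x' p) & (AE p in M. w p = w' p)"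
 by (simp only: bvec_eq.simps energy_measure_eq)

lemma sqrt2_facts: "1 / sqrt 2 * (1 / sqrt 2) = (1/2::real)" "a / sqrt 2 * (1 / sqrt 2) = a / (2::real)"
 by (simp_all add: field_simps)

section \<open>The boundary condition of item (i)\<close>

context
 assumes n_i: "n (q 0) = 0" "n (q 1) = - c" "n (q 2) = c"
begin

text \<open>The projections subtract l times \<open>e_minus\<close> and m times
  \<open>e_plus\<close>. The balance \<open>decomp_sum3\<close> gives l = m, so these terms drop out
  of the comparison at q 0; at q 1 and q 2 the two equations give opposite fluxes and then equal
  values of g.\<close>

lemma gen_dom_i_iff:
 assumes k: "div_B f k" and r: "canonical_rep S h f = (g, u, w)"
 shows "f \<in> gen_dom S h (Theta_i q) \<longleftrightarrow> nrm f (q 0) = 0 & nrm f (q 1) + nrm f (q 2) = 0 &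
  g (q 1) = g (q 2) & (AE x in M. rep_z S h f g x = 0)"
proof -
 define a0 a1 a2 where "a0 = nrm f (q 0)" and "a1 = nrm f (q 1)" and "a2 = nrm f (q 2)"
 define g0 g1 g2 where "g0 = g (q 0)" and "g1 = g (q 1)" and "g2 = g (q 2)"
 have f: "f \<in> L2 M" using k by (simp add: div_B_def)
 have nb: "nb (q 0) = 0" "nb (q 1) = - c" "nb (q 2) = c" using nb_eq n_i q_bdry by auto
 note nf = nrm_star[OF f] and du = canonical_rep(2)[OF k r]
 \<comment> \<open>The coefficients of the two projections. The squared length of
   \<open>e_minus\<close> and of \<open>e_plus\<close> is 1/2 + c: the vertex q 0 contributes 1/2,
   the one other vertex in the support its weight c.\<close>
 define l where "l = ((g0 + a0) / 2 + (a1 + g1 * c)) / (1/2 + c)"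
 define m where "m = ((g0 - a0) / 2 - (a2 - g2 * c)) / (1/2 + c)"
 have Gm: "fst (G_minus S h f) (q 0) = (g0 + a0) / sqrt 2 - l * (1 / sqrt 2)"
  "fst (G_minus S h f) (q 1) = (a1 + g1 * c) / c - l" "fst (G_minus S h f) (q 2) = a2 / c"
  "snd (G_minus S h f) = (%p. (w p + rep_z S h f g p) / sqrt 2)"
  unfolding G_val[OF k r] bvec_proj_def e_minus_def bvec_ip.simps energy_measure_eq bdry_weight_def sum_bdry Let_def
   fst_conv snd_conv nb nf du[OF q_bdry(1)] du[OF q_bdry(2)] du[OF q_bdry(3)] n_i l_def a0_def a1_def a2_def g0_def g1_def g2_def
  using c by (simp_all add: sqrt2_facts)
 have Gp: "fst (G_plus S h f) (q 0) = (g0 - a0) / sqrt 2 - m * (1 / sqrt 2)"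
  "fst (G_plus S h f) (q 1) = a1 / c" "fst (G_plus S h f) (q 2) = (a2 - g2 * c) / c + m"
  "snd (G_plus S h f) = (%p. (w p - rep_z S h f g p) / sqrt 2)"
  unfolding G_val[OF k r] bvec_proj_def e_plus_def bvec_ip.simps energy_measure_eq bdry_weight_def sum_bdry Let_def
   fst_conv snd_conv nb nf du[OF q_bdry(1)] du[OF q_bdry(2)] du[OF q_bdry(3)] n_i m_def a0_def a1_def a2_def g0_def g1_def g2_def
  using c by (simp_all add: sqrt2_facts)
 have sum: "a0 + (a1 + g1 * c + (a2 - g2 * c)) = 0"
  using decomp_sum3[OF k r] by (simp add: n_i a0_def a1_def a2_def g0_def g1_def g2_def del: One_nat_def)
 have lm: "l = m"
 proof -
  have "(g0 + a0) / 2 + (a1 + g1 * c) = (g0 - a0) / 2 - (a2 - g2 * c)" using sum by (simp add: field_simps)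
  thus ?thesis by (simp add: l_def m_def)
 qed
 have e0: "(g0 + a0) / sqrt 2 - l * (1 / sqrt 2) = (g0 - a0) / sqrt 2 - m * (1 / sqrt 2) \<longleftrightarrow> a0 = 0"
  by (simp add: lm divide_cancel_right)
 have e1: "- (a2 / c) = a1 / c \<longleftrightarrow> a1 + a2 = 0" using c by (auto simp: field_simps)
 have e2: "- ((a1 + g1 * c) / c - l) = (a2 - g2 * c) / c + m \<longleftrightarrow> a1 + a2 + c * (g1 - g2) = 0"
 proof -
  have "(a1 + a2 + c * (g1 - g2)) / c = (a1 + g1 * c) / c + (a2 - g2 * c) / c"
   by (simp add: add_divide_distrib[symmetric] algebra_simps)
  hence "- ((a1 + g1 * c) / c - l) = (a2 - g2 * c) / c + m \<longleftrightarrow> (a1 + a2 + c * (g1 - g2)) / c = 0" using lm by auto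
  thus ?thesis using c by simp
 qed
 have "bvec_eq S h (Theta_i q (G_minus S h f)) (G_plus S h f) \<longleftrightarrow>
   a0 = 0 & a1 + a2 = 0 & a1 + a2 + c * (g1 - g2) = 0 & (AE x in M. rep_z S h f g x = 0)"
  unfolding e0[symmetric] e1[symmetric] e2[symmetric] AE_plus_minus[symmetric, of w] using Gm Gp bdry3
  by (cases "G_minus S h f"; cases "G_plus S h f") (simp add: Theta_i_def bvec_eq_M del: bvec_eq.simps One_nat_def)
 also have "\<dots> \<longleftrightarrow> a0 = 0 & a1 + a2 = 0 & g1 = g2 & (AE x in M. rep_z S h f g x = 0)" using c by auto
 finally show ?thesis using k perp_dom_iff by (auto simp: gen_dom_def a0_def a1_def a2_def g1_def g2_def)
qed

lemma theta_i:
 assumes h01: "h (q 1) = 0" "h (q 2) = 1"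
  and V: "!!x. (V has_real_derivative V' x) (at x)" and V': "uniformly_continuous_on UNIV V'"
  and per: "!!x. V (x + 1) = V x"
 shows "the_solution S h (Theta_i q) (V \<circ> h) (%t x. V (h x - t))"
  and "the_solution S h (Theta_i q) (V \<circ> h) v ==> t >= 0 ==> x \<in> carr S ==> v t x = V (h x - t)"
proof -
 have V'c: "continuous_on UNIV V'" by (rule uniformly_continuous_imp_continuous[OF V'])
 have dom: "(%x. V (h x - t)) \<in> gen_dom S h (Theta_i q)" for t
 proof -
  have Vt: "((%x. V (x - t)) has_real_derivative V' (x - t)) (at x)" for x
   using V[of "x - t"] DERIV_shift[of V "V' (x - t)" x "- t"] by simp
  have V't: "continuous_on UNIV (%x. V' (x - t))"
   by (rule continuous_on_compose2[OF V'c, of _ "%x. x - t"]) (auto intro!: continuous_intros)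
  \<comment> \<open>The only use of periodicity: the values at the inflow vertex, where h = 0, and
    at the outflow vertex, where h = 1, agree at all times.\<close>
  have p: "V (1 - t) = V (- t)" using per[of "- t"] by (simp add: add.commute)
  obtain g u w where r: "canonical_rep S h (%x. V (h x - t)) = (g, u, w)"
   by (cases "canonical_rep S h (%x. V (h x - t))") auto
  obtain d where d: "!!x. x \<in> carr S ==> g x = V (h x - t) + d" using canonical_compose(1)[OF Vt V't r] by blast
  show ?thesis unfolding gen_dom_i_iff[OF div_B_compose(1)[OF Vt V't] r]
   using canonical_compose(2)[OF Vt V't r] nrm_compose[OF Vt V't] q_bdry bdry_sub
   by (auto simp: n_i h01 p d subset_iff simp del: One_nat_def)
 qed
 have diss: "0 <= (LINT x|M. (f1 x - f2 x) * (perp_B f1 x - perp_B f2 x))"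
  if f: "f1 \<in> gen_dom S h (Theta_i q)" "f2 \<in> gen_dom S h (Theta_i q)" for f1 f2
 proof -
  obtain g1 u1 w1 where r1: "canonical_rep S h f1 = (g1, u1, w1)" by (cases "canonical_rep S h f1") auto
  obtain g2 u2 w2 where r2: "canonical_rep S h f2 = (g2, u2, w2)" by (cases "canonical_rep S h f2") auto
  note k1 = gen_dom_div_B[OF f(1)] and k2 = gen_dom_div_B[OF f(2)]
  have m1: "nrm f1 (q 0) = 0" "nrm f1 (q 2) = - nrm f1 (q 1)" "g1 (q 2) = g1 (q 1)" "AE x in M. rep_z S h f1 g1 x = 0"
   using f(1) unfolding gen_dom_i_iff[OF k1 r1] by auto
  have m2: "nrm f2 (q 0) = 0" "nrm f2 (q 2) = - nrm f2 (q 1)" "g2 (q 2) = g2 (q 1)" "AE x in M. rep_z S h f2 g2 x = 0"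
   using f(2) unfolding gen_dom_i_iff[OF k2 r2] by auto
  \<comment> \<open>The fluxes at q 1 and q 2 are opposite and g takes equal values there, so all
    boundary terms cancel and the form is 0.\<close>
  show ?thesis unfolding decomp_quad3[OF k1 r1 m1(4) k2 r2 m2(4)] Let_def
   by (simp add: n_i m1 m2 algebra_simps del: One_nat_def)
 qed
 show "the_solution S h (Theta_i q) (V \<circ> h) (%t x. V (h x - t))"
  by (rule the_solution_transport(1)[OF V V' dom diss])
 show "the_solution S h (Theta_i q) (V \<circ> h) v ==> t >= 0 ==> x \<in> carr S ==> v t x = V (h x - t)"
  by (rule the_solution_transport(2)[OF V V' dom diss])
qed

end

section \<open>The boundary condition of item (ii)\<close>

context
 assumes n_ii: "n (q 0) = - 2 * c" "n (q 1) = c" "n (q 2) = c"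
begin

text \<open>\<open>e_minus\<close> is supported at q 0, so \<open>G_minus\<close> contributes only
  the fluxes at q 1 and q 2. The equation at q 0 says that the total flux is zero. At q 1 and q 2
  the image of \<open>Theta_ii\<close> is 0, which makes the normal derivatives of u equal
  there.\<close>

lemma gen_dom_ii_iff:
 assumes k: "div_B f k" and r: "canonical_rep S h f = (g, u, w)"
 shows "f \<in> gen_dom S h (Theta_ii q) \<longleftrightarrow> nrm f (q 0) + nrm f (q 1) + nrm f (q 2) = 0 &
  nrm f (q 1) - c * g (q 1) = nrm f (q 2) - c * g (q 2) & (AE x in M. rep_z S h f g x = 0)"
proof -
 define a0 a1 a2 where "a0 = nrm f (q 0)" and "a1 = nrm f (q 1)" and "a2 = nrm f (q 2)"
 define g0 g1 g2 where "g0 = g (q 0)" and "g1 = g (q 1)" and "g2 = g (q 2)"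
 have f: "f \<in> L2 M" using k by (simp add: div_B_def)
 have nb: "nb (q 0) = - 2 * c" "nb (q 1) = c" "nb (q 2) = c" using nb_eq n_ii q_bdry by auto
 note nf = nrm_star[OF f] and du = canonical_rep(2)[OF k r]
 \<comment> \<open>The squared length of \<open>e_plus\<close> is 2 c. Projecting leaves two
   opposite numbers at q 1 and q 2, which vanish exactly if the unprojected ones were equal.\<close>
 define m where "m = - ((a1 - g1 * c) + (a2 - g2 * c)) / (2 * c)"
 have Gm: "fst (G_minus S h f) (q 1) = a1 / c" "fst (G_minus S h f) (q 2) = a2 / c"
  "snd (G_minus S h f) = (%p. (w p + rep_z S h f g p) / sqrt 2)"
  unfolding G_val[OF k r] bvec_proj_def e_minus_def bvec_ip.simps energy_measure_eq bdry_weight_def sum_bdry Let_def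
   fst_conv snd_conv nb nf du[OF q_bdry(1)] du[OF q_bdry(2)] du[OF q_bdry(3)] n_ii a1_def a2_def g1_def g2_def
  using c by simp_all
 have Gp: "fst (G_plus S h f) (q 0) = a0 / (2 * c)"
  "fst (G_plus S h f) (q 1) = (a1 - g1 * c) / c + m" "fst (G_plus S h f) (q 2) = (a2 - g2 * c) / c + m"
  "snd (G_plus S h f) = (%p. (w p - rep_z S h f g p) / sqrt 2)"
  unfolding G_val[OF k r] bvec_proj_def e_plus_def bvec_ip.simps energy_measure_eq bdry_weight_def sum_bdry Let_def
   fst_conv snd_conv nb nf du[OF q_bdry(1)] du[OF q_bdry(2)] du[OF q_bdry(3)] n_ii m_def a0_def a1_def a2_def g0_def g1_def g2_def
  using c by (simp_all add: add_divide_distrib diff_divide_distrib)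
 have e0: "- 1 / 2 * (a1 / c + a2 / c) = a0 / (2 * c) \<longleftrightarrow> a0 + a1 + a2 = 0"
 proof -
  have "- 1 / 2 * (a1 / c + a2 / c) = a0 / (2 * c) \<longleftrightarrow> - (a1 + a2) = a0" using c by (simp add: divide_simps)
  thus ?thesis by auto
 qed
 have e12: "0 = (a1 - g1 * c) / c + m & 0 = (a2 - g2 * c) / c + m \<longleftrightarrow> a1 - c * g1 = a2 - c * g2"
 proof -
  have "m = - ((a1 - g1 * c) / c + (a2 - g2 * c) / c) / 2" unfolding m_def using c by (simp add: field_simps)
  moreover have "(0 = x + y & 0 = x' + y) \<longleftrightarrow> x = x'" if "y = - (x + x') / 2" for x x' y :: real
   using that by auto
  ultimately have "0 = (a1 - g1 * c) / c + m & 0 = (a2 - g2 * c) / c + m \<longleftrightarrow> (a1 - g1 * c) / c = (a2 - g2 * c) / c"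
   by blast
  thus ?thesis using c by (simp add: mult.commute divide_cancel_right)
 qed
 have "bvec_eq S h (Theta_ii q (G_minus S h f)) (G_plus S h f) \<longleftrightarrow>
   a0 + a1 + a2 = 0 & a1 - c * g1 = a2 - c * g2 & (AE x in M. rep_z S h f g x = 0)"
  unfolding e0[symmetric] e12[symmetric] AE_plus_minus[symmetric, of w] using Gm Gp bdry3
  by (cases "G_minus S h f"; cases "G_plus S h f") (simp add: Theta_ii_def bvec_eq_M eq_commute[of "q 1" "q 0"] eq_commute[of "q 2" "q 0"] del: bvec_eq.simps One_nat_def)
 thus ?thesis using k perp_dom_iff by (auto simp: gen_dom_def a0_def a1_def a2_def g1_def g2_def)
qed

lemma theta_ii:
 assumes h01: "h (q 0) = 0" "h (q 1) = 1" "h (q 2) = 1"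
  and V: "!!x. (V has_real_derivative V' x) (at x)" and V': "uniformly_continuous_on UNIV V'"
  and per: "!!x. V (x + 1) = V x"
 shows "the_solution S h (Theta_ii q) (V \<circ> h) (%t x. V (h x - t))"
  and "the_solution S h (Theta_ii q) (V \<circ> h) v ==> t >= 0 ==> x \<in> carr S ==> v t x = V (h x - t)"
proof -
 have V'c: "continuous_on UNIV V'" by (rule uniformly_continuous_imp_continuous[OF V'])
 have dom: "(%x. V (h x - t)) \<in> gen_dom S h (Theta_ii q)" for t
 proof -
  have Vt: "((%x. V (x - t)) has_real_derivative V' (x - t)) (at x)" for x
   using V[of "x - t"] DERIV_shift[of V "V' (x - t)" x "- t"] by simp
  have V't: "continuous_on UNIV (%x. V' (x - t))"
   by (rule continuous_on_compose2[OF V'c, of _ "%x. x - t"]) (auto intro!: continuous_intros)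
  have p: "V (1 - t) = V (- t)" using per[of "- t"] by (simp add: add.commute)
  obtain g u w where r: "canonical_rep S h (%x. V (h x - t)) = (g, u, w)"
   by (cases "canonical_rep S h (%x. V (h x - t))") auto
  obtain d where d: "!!x. x \<in> carr S ==> g x = V (h x - t) + d" using canonical_compose(1)[OF Vt V't r] by blast
  show ?thesis unfolding gen_dom_ii_iff[OF div_B_compose(1)[OF Vt V't] r]
   using canonical_compose(2)[OF Vt V't r] nrm_compose[OF Vt V't] q_bdry bdry_sub
   by (auto simp: n_ii h01 p d subset_iff algebra_simps simp del: One_nat_def)
 qed
 have diss: "0 <= (LINT x|M. (f1 x - f2 x) * (perp_B f1 x - perp_B f2 x))"
  if f: "f1 \<in> gen_dom S h (Theta_ii q)" "f2 \<in> gen_dom S h (Theta_ii q)" for f1 f2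
 proof -
  obtain g1 u1 w1 where r1: "canonical_rep S h f1 = (g1, u1, w1)" by (cases "canonical_rep S h f1") auto
  obtain g2 u2 w2 where r2: "canonical_rep S h f2 = (g2, u2, w2)" by (cases "canonical_rep S h f2") auto
  note k1 = gen_dom_div_B[OF f(1)] and k2 = gen_dom_div_B[OF f(2)]
  have m1: "nrm f1 (q 0) + nrm f1 (q 1) + nrm f1 (q 2) = 0"
   "nrm f1 (q 1) - c * g1 (q 1) = nrm f1 (q 2) - c * g1 (q 2)" "AE x in M. rep_z S h f1 g1 x = 0"
   using f(1) unfolding gen_dom_ii_iff[OF k1 r1] by auto
  have m2: "nrm f2 (q 0) + nrm f2 (q 1) + nrm f2 (q 2) = 0"
   "nrm f2 (q 1) - c * g2 (q 1) = nrm f2 (q 2) - c * g2 (q 2)" "AE x in M. rep_z S h f2 g2 x = 0"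
   using f(2) unfolding gen_dom_ii_iff[OF k2 r2] by auto
  define A0 A1 A2 where "A0 = nrm f1 (q 0) - nrm f2 (q 0)" and "A1 = nrm f1 (q 1) - nrm f2 (q 1)"
   and "A2 = nrm f1 (q 2) - nrm f2 (q 2)"
  define G0 G1 G2 where "G0 = g1 (q 0) - g2 (q 0)" and "G1 = g1 (q 1) - g2 (q 1)" and "G2 = g1 (q 2) - g2 (q 2)"
  have s: "A0 + A1 + A2 = 0" "A1 - c * G1 = A2 - c * G2"
   using m1(1,2) m2(1,2) by (auto simp: A0_def A1_def A2_def G1_def G2_def algebra_simps simp del: One_nat_def)
  have "A0 - G0 * (- 2 * c) + (A1 - G1 * c + (A2 - G2 * c)) = 0"
   using decomp_sum3[OF k1 r1] decomp_sum3[OF k2 r2]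
   by (simp add: n_ii A0_def A1_def A2_def G0_def G1_def G2_def algebra_simps del: One_nat_def)
  with s have "c * (2 * G0 - G1 - G2) = 0" by (simp add: algebra_simps)
  \<comment> \<open>The inflow value is the mean of the outflow values. Together with the flux
    conditions this makes the boundary form the square c (G1 - G2)^2 / 4, so in contrast to item (i)
    it can be positive.\<close>
  hence G0: "G0 = (G1 + G2) / 2" using c by simp
  have A0: "A0 = - A1 - A2" and A2: "A2 = A1 - c * (G1 - G2)" using s by (auto simp: algebra_simps)
  have eq: "A0 * G0 - (- 2 * c) * G0^2 / 2 + (A1 * G1 - c * G1^2 / 2 + (A2 * G2 - c * G2^2 / 2)) = c * (G1 - G2)^2 / 4"
   unfolding A0 A2 G0 by (simp add: power2_eq_square field_simps)
  show ?thesis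
   unfolding decomp_quad3[OF k1 r1 m1(3) k2 r2 m2(3)] Let_def n_ii A0_def[symmetric] A1_def[symmetric] A2_def[symmetric]
    G0_def[symmetric] G1_def[symmetric] G2_def[symmetric] eq using c by simp
 qed
 show "the_solution S h (Theta_ii q) (V \<circ> h) (%t x. V (h x - t))"
  by (rule the_solution_transport(1)[OF V V' dom diss])
 show "the_solution S h (Theta_ii q) (V \<circ> h) v ==> t >= 0 ==> x \<in> carr S ==> v t x = V (h x - t)"
  by (rule the_solution_transport(2)[OF V V' dom diss])
qed

end

end

declare One_nat_def [simp del]

section \<open>Geometry of the gasket\<close>

lemma words_0: "words 0 = {[]}" by (auto simp: words_def)

lemma words_Suc: "words (Suc n) = (%(i, w). i # w) ` ({0,1,2} \<times> words n)"
proof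
 show "words (Suc n) \<subseteq> (%(i, w). i # w) ` ({0,1,2} \<times> words n)"
 proof
  fix w assume w: "w \<in> words (Suc n)"
  then obtain i v where "w = i # v" by (cases w) (auto simp: words_def)
  thus "w \<in> (%(i, w). i # w) ` ({0,1,2} \<times> words n)" using w by (auto simp: words_def image_iff)
 qed
qed (auto simp: words_def)

lemma words_length: "w \<in> words n ==> length w = n" by (simp add: words_def)

lemma words_append: "v \<in> words n ==> w \<in> words k ==> v @ w \<in> words (n + k)" by (auto simp: words_def)

lemma words_snoc: "v \<in> words n ==> i \<in> {0,1,2} ==> v @ [i] \<in> words (Suc n)" by (auto simp: words_def)

lemma finite_words [simp]: "finite (words n)" by (induction n) (simp_all add: words_0 words_Suc)

lemma sum_words_Suc: "(\<Sum>w\<in>words (Suc n). f w) = (\<Sum>i\<in>{0,1,2}. \<Sum>w\<in>words n. f (i # w))"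
proof -
 have "(\<Sum>w\<in>words (Suc n). f w) = (\<Sum>(i, w)\<in>{0,1,2} \<times> words n. f (i # w))"
  unfolding words_Suc by (subst sum.reindex) (auto simp: inj_on_def case_prod_unfold)
 thus ?thesis by (simp only: sum.cartesian_product)
qed

lemma sum_words_add: "(\<Sum>w\<in>words (n + k). f w) = (\<Sum>v\<in>words n. \<Sum>w\<in>words k. f (v @ w))"
proof (induction n arbitrary: f)
 case (Suc n)
 have "(\<Sum>w\<in>words (Suc n + k). f w) = (\<Sum>i\<in>{0,1,2}. \<Sum>w\<in>words (n + k). f (i # w))"
  using sum_words_Suc[of f "n + k"] by (simp only: add_Suc)
 also have "\<dots> = (\<Sum>i\<in>{0,1,2}. \<Sum>v\<in>words n. \<Sum>w\<in>words k. f (i # v @ w))" by (intro sum.cong refl Suc.IH)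
 also have "\<dots> = (\<Sum>v\<in>words (Suc n). \<Sum>w\<in>words k. f (v @ w))"
  using sum_words_Suc[of "%v. \<Sum>w\<in>words k. f (v @ w)" n] by (simp only: append_Cons)
 finally show ?case .
qed (simp add: words_0)

lemma sum_words_1: "(\<Sum>w\<in>words 1. f w) = (\<Sum>i\<in>{0,1,2}. f [i])"
 using sum_words_Suc[of f 0] by (simp only: One_nat_def words_0 sum.insert finite.emptyI sum.empty empty_iff)
  simp

lemma sum_words_snoc: "(\<Sum>w\<in>words (Suc n). f w) = (\<Sum>v\<in>words n. \<Sum>i\<in>{0,1,2}. f (v @ [i]))"
proof -
 have "(\<Sum>w\<in>words (Suc n). f w) = (\<Sum>w\<in>words (n + 1). f w)" by (simp only: Suc_eq_plus1)
 also have "\<dots> = (\<Sum>v\<in>words n. \<Sum>w\<in>words 1. f (v @ w))" by (rule sum_words_add)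
 also have "\<dots> = (\<Sum>v\<in>words n. \<Sum>i\<in>{0,1,2}. f (v @ [i]))" by (intro sum.cong refl sum_words_1)
 finally show ?thesis .
qed

lemma sgFw_Nil [simp]: "sgFw q [] x = x" by (simp add: sgFw_def)

lemma sgFw_Cons [simp]: "sgFw q (i # w) x = sgF q i (sgFw q w x)" by (simp add: sgFw_def)

lemma sgFw_append: "sgFw q (v @ w) x = sgFw q v (sgFw q w x)" by (induction v) auto

lemma sgFw_replicate: "sgFw q (replicate m i) x = (sgF q i ^^ m) x" by (induction m) auto

lemma sgF_eq: "sgF q i x = (1/2) *\<^sub>R (x + q i)" by (simp add: sgF_def vec_eq_iff field_simps)

lemma dist_sgF: "dist (sgF q i x) (sgF q i y) = dist x y / 2"
proof -
 have "sgF q i x - sgF q i y = (1/2) *\<^sub>R (x - y)" by (simp add: sgF_def algebra_simps)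
 thus ?thesis by (simp add: dist_norm)
qed

lemma dist_sgFw: "dist (sgFw q w x) (sgFw q w y) = dist x y / 2 ^ length w"
 by (induction w) (auto simp: dist_sgF)

lemma sgF_inj: "sgF q i x = sgF q i y \<longleftrightarrow> x = y"
 by (metis dist_eq_0_iff dist_sgF divide_eq_0_iff zero_neq_numeral)

lemma sgFw_inj: "sgFw q w x = sgFw q w y \<longleftrightarrow> x = y" by (induction w) (auto simp: sgF_inj)

lemma sgF_fix [simp]: "sgF q i (q i) = q i" by (simp add: sgF_def)

lemma sgF_commute: "sgF q i (q j) = sgF q j (q i)" by (simp add: sgF_eq add.commute)

lemma sgV_eq: "sgV q n = (\<Union>w\<in>words n. sgFw q w ` {q 0, q 1, q 2})"
proof (induction n)
 case 0
 thus ?case by (auto simp: words_0)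
next
 case (Suc n)
 have c: "sgFw q (i # w) = (%x. sgF q i (sgFw q w x))" for i w by (rule ext) simp
 have "sgV q (Suc n) = (\<Union>i\<in>{0,1,2}. \<Union>w\<in>words n. sgFw q (i # w) ` {q 0, q 1, q 2})"
  by (simp only: sgV.simps Suc image_UN image_image c)
 also have "\<dots> = (\<Union>(i, w)\<in>{0,1,2} \<times> words n. sgFw q (i # w) ` {q 0, q 1, q 2})" by blast
 also have "\<dots> = (\<Union>w\<in>words (Suc n). sgFw q w ` {q 0, q 1, q 2})"
  by (simp only: words_Suc image_image case_prod_unfold)
 finally show ?case .
qed

lemma continuous_on_sgF [continuous_intros]: "continuous_on A (sgF q i)"
 unfolding sgF_def by (intro continuous_intros)

lemma continuous_on_sgFw [continuous_intros]: "continuous_on A (sgFw q w)"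
proof (induction w)
 case (Cons i w)
 have "continuous_on A (%x. sgF q i (sgFw q w x))"
  by (rule continuous_on_compose2[OF continuous_on_sgF[of UNIV] Cons]) auto
 thus ?case by (simp add: sgFw_def comp_def)
qed (simp add: sgFw_def)

locale gasket_geom =
 fixes q :: "nat => real^2"
 assumes equil: "equilateral q"
begin

abbreviation "F \<equiv> sgF q"
abbreviation "Fw \<equiv> sgFw q"
abbreviation "K \<equiv> gasket q"

definition side where "side = dist (q 0) (q 1)"
definition ctr where "ctr = (1/3) *\<^sub>R (q 0 + q 1 + q 2)"
text \<open>Barycentric coordinates. For an equilateral triangle the vectors q i - ctr have squared
  length side^2 / 3 and mutual inner products - side^2 / 6, so the coordinates are inner products
  with them.\<close>

definition bc where "bc i x = 1/3 + 2 / side^2 * ((x - ctr) \<bullet> (q i - ctr))"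
definition T where "T = convex hull {q 0, q 1, q 2}"

lemma side_pos: "side > 0" using equil by (simp add: equilateral_def side_def)

lemma bc_vertex: "i \<in> {0,1,2} ==> j \<in> {0,1,2} ==> bc i (q j) = (if i = j then 1 else 0)"
proof -
 assume ij: "i \<in> {0,1,2}" "j \<in> {0,1,2}"
 define p where "p i = q i - ctr" for i
 have s0: "p 0 + p 1 + p 2 = 0" unfolding p_def ctr_def by (simp add: vec_eq_iff) (simp add: field_simps)
 have d: "(norm (p 0 - p 1))^2 = side^2" "(norm (p 1 - p 2))^2 = side^2" "(norm (p 2 - p 0))^2 = side^2"
  using equil by (auto simp: equilateral_def side_def p_def dist_norm)
 define r where "r i j = p i \<bullet> p j" for i j
 have rc: "r i j = r j i" for i j by (simp add: r_def inner_commute)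
 have e: "r 0 0 + r 1 1 - 2 * r 0 1 = side^2" "r 1 1 + r 2 2 - 2 * r 1 2 = side^2" "r 2 2 + r 0 0 - 2 * r 2 0 = side^2"
  using d unfolding r_def power2_norm_eq_inner by (simp_all add: inner_diff_left inner_diff_right inner_commute)
 have "p i \<bullet> (p 0 + p 1 + p 2) = 0" for i by (simp add: s0)
 hence z: "r i 0 + r i 1 + r i 2 = 0" for i by (simp add: r_def inner_add_right)
 have "r 0 0 = side^2 / 3" "r 1 1 = side^2 / 3" "r 2 2 = side^2 / 3" "r 0 1 = - (side^2) / 6" "r 1 2 = - (side^2) / 6" "r 2 0 = - (side^2) / 6"
  using e z[of 0] z[of 1] z[of 2] rc[of 1 0] rc[of 2 1] rc[of 0 2] by linarith+
 thus ?thesis using ij side_pos rc[of 1 0] rc[of 2 1] rc[of 0 2]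
  unfolding bc_def p_def[symmetric] r_def[symmetric] by (auto simp: field_simps)
qed

lemma bc_affine: "u + v = 1 ==> bc i (u *\<^sub>R x + v *\<^sub>R y) = u * bc i x + v * bc i y"
proof -
 assume uv: "u + v = 1"
 have "u *\<^sub>R x + v *\<^sub>R y - ctr = u *\<^sub>R (x - ctr) + v *\<^sub>R (y - ctr)"
  using uv by (simp add: algebra_simps) (metis scaleR_add_left scaleR_one)
 hence "bc i (u *\<^sub>R x + v *\<^sub>R y) = (u + v) * (1/3) + 2 / side^2 * (u * ((x - ctr) \<bullet> (q i - ctr)) + v * ((y - ctr) \<bullet> (q i - ctr)))"
  using uv by (simp add: bc_def inner_add_left)
 thus ?thesis unfolding bc_def by (simp only: distrib_left distrib_right mult.left_commute)
qed

lemma bc_cont [continuous_intros]: "continuous_on A (bc i)" unfolding bc_def by (intro continuous_intros)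

lemma bc_F: "i \<in> {0,1,2} ==> j \<in> {0,1,2} ==> bc i (F j x) = bc i x / 2 + (if i = j then 1/2 else 0)"
proof -
 assume ij: "i \<in> {0,1,2}" "j \<in> {0,1,2}"
 have "F j x = (1/2) *\<^sub>R x + (1/2) *\<^sub>R q j" by (simp add: sgF_eq scaleR_add_right)
 hence "bc i (F j x) = 1/2 * bc i x + 1/2 * bc i (q j)" using bc_affine[of "1/2" "1/2" i x "q j"] by simp
 thus ?thesis using bc_vertex[OF ij] by simp
qed

lemma T_iff: "x \<in> T \<longleftrightarrow> bc 0 x >= 0 & bc 1 x >= 0 & bc 2 x >= 0 & bc 0 x + bc 1 x + bc 2 x = 1 &
  x = bc 0 x *\<^sub>R q 0 + bc 1 x *\<^sub>R q 1 + bc 2 x *\<^sub>R q 2"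
proof
 assume "x \<in> T"
 then obtain u v w where uvw: "0 <= u" "0 <= v" "0 <= w" "u + v + w = 1" and x: "x = u *\<^sub>R q 0 + v *\<^sub>R q 1 + w *\<^sub>R q 2"
  by (auto simp: T_def convex_hull_3)
 have "bc i x = u * bc i (q 0) + v * bc i (q 1) + w * bc i (q 2)" for i
 proof -
  have "x - ctr = u *\<^sub>R (q 0 - ctr) + v *\<^sub>R (q 1 - ctr) + w *\<^sub>R (q 2 - ctr)"
  proof -
   have "ctr = (u + v + w) *\<^sub>R ctr" using uvw by simp
   thus ?thesis unfolding x by (simp add: algebra_simps)
  qed
  hence "bc i x = (u + v + w) * (1/3) + 2 / side^2 * (u * ((q 0 - ctr) \<bullet> (q i - ctr)) + v * ((q 1 - ctr) \<bullet> (q i - ctr)) + w * ((q 2 - ctr) \<bullet> (q i - ctr)))"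
   using uvw by (simp add: bc_def inner_add_left)
  thus ?thesis unfolding bc_def by (simp only: distrib_left distrib_right mult.left_commute)
 qed
 hence "bc 0 x = u" "bc 1 x = v" "bc 2 x = w" using bc_vertex by simp_all
 thus "bc 0 x >= 0 & bc 1 x >= 0 & bc 2 x >= 0 & bc 0 x + bc 1 x + bc 2 x = 1 &
  x = bc 0 x *\<^sub>R q 0 + bc 1 x *\<^sub>R q 1 + bc 2 x *\<^sub>R q 2" using uvw x by simp
next
 assume "bc 0 x >= 0 & bc 1 x >= 0 & bc 2 x >= 0 & bc 0 x + bc 1 x + bc 2 x = 1 &
  x = bc 0 x *\<^sub>R q 0 + bc 1 x *\<^sub>R q 1 + bc 2 x *\<^sub>R q 2"
 thus "x \<in> T" unfolding T_def convex_hull_3 by blast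
qed

lemma q_distinct: "q 0 ~= q 1" "q 0 ~= q 2" "q 1 ~= q 2" using equil by (auto simp: equilateral_def)

lemma q_inj: "i \<in> {0,1,2} ==> j \<in> {0,1,2} ==> q i = q j \<longleftrightarrow> i = j" using q_distinct by auto

lemma q_T: "i \<in> {0,1,2} ==> q i \<in> T" unfolding T_def by (rule hull_inc) auto

lemma bc_nonneg: "x \<in> T ==> i \<in> {0,1,2} ==> 0 <= bc i x" by (auto simp: T_iff)

lemma bc_le_1: "x \<in> T ==> i \<in> {0,1,2} ==> bc i x <= 1" by (auto simp: T_iff)

lemma bc_eq_1: "x \<in> T ==> i \<in> {0,1,2} ==> bc i x = 1 ==> x = q i"
proof -
 assume x: "x \<in> T" and i: "i \<in> {0,1,2}" and 1: "bc i x = 1"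
 note t = x[unfolded T_iff]
 have z: "bc j x = 0" if "j \<in> {0,1,2}" "j ~= i" for j using t 1 i that by auto
 consider "i = 0" | "i = 1" | "i = 2" using i by auto
 hence "bc 0 x *\<^sub>R q 0 + bc 1 x *\<^sub>R q 1 + bc 2 x *\<^sub>R q 2 = q i"
  by cases (use z[of 0] z[of 1] z[of 2] 1 in simp_all)
 moreover have "x = bc 0 x *\<^sub>R q 0 + bc 1 x *\<^sub>R q 1 + bc 2 x *\<^sub>R q 2" using t by blast
 ultimately show "x = q i" by (rule trans[rotated])
qed

lemma F_T: "x \<in> T ==> i \<in> {0,1,2} ==> F i x \<in> T"
proof -
 assume x: "x \<in> T" and i: "i \<in> {0,1,2}"
 have "F i x = (1/2) *\<^sub>R x + (1/2) *\<^sub>R q i" by (simp add: sgF_eq scaleR_add_right)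
 moreover have "convex T" unfolding T_def by (rule convex_convex_hull)
 ultimately show ?thesis using x q_T[OF i] by (simp add: convex_def)
qed

lemma Fw_T: "x \<in> T ==> set w \<subseteq> {0,1,2} ==> Fw w x \<in> T" by (induction w) (auto intro: F_T)

lemma Fw_T': "x \<in> T ==> w \<in> words n ==> Fw w x \<in> T" by (rule Fw_T) (auto simp: words_def)

lemma compact_T: "compact T" unfolding T_def by (intro finite_imp_compact_convex_hull) simp

text \<open>Every map halves the coordinate \<open>bc j\<close>, and only F j adds 1/2 to it. The
  value 1 is therefore reached only through F j, applied to a point where the coordinate is already
  1.\<close>

lemma Fw_eq_q:
 "set w \<subseteq> {0,1,2} ==> x \<in> T ==> j \<in> {0,1,2} ==> Fw w x = q j ==> x = q j & set w \<subseteq> {j}"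
proof (induction w)
 case (Cons i w)
 have i: "i \<in> {0,1,2}" and w: "set w \<subseteq> {0,1,2}" using Cons.prems by auto
 have y: "Fw w x \<in> T" by (rule Fw_T[OF Cons.prems(2) w])
 have "bc j (F i (Fw w x)) = 1" using Cons.prems bc_vertex[OF Cons.prems(3) Cons.prems(3)] by simp
 hence "bc j (Fw w x) / 2 + (if j = i then 1/2 else 0) = 1" using bc_F[OF Cons.prems(3) i] by simp
 hence ji: "j = i" and b: "bc j (Fw w x) = 1" using bc_le_1[OF y Cons.prems(3)] by (simp_all split: if_splits)
 have "Fw w x = q j" by (rule bc_eq_1[OF y Cons.prems(3) b])
 from Cons.IH[OF w Cons.prems(2,3) this] have "x = q j" "set w \<subseteq> {j}" by blast+
 thus ?case unfolding ji by (intro conjI) (simp_all only: list.set insert_subset singletonI simp_thms)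
next
 case Nil
 thus ?case by (simp only: sgFw_Nil list.set simp_thms empty_subsetI)
qed

text \<open>On the cell F i the coordinate \<open>bc i\<close> is at least 1/2, on F j at most 1/2.
  At a common point there is equality, and likewise for \<open>bc j\<close>, which forces both
  preimages to be corners.\<close>

lemma F_meet:
 assumes ij: "i \<in> {0,1,2}" "j \<in> {0,1,2}" "i ~= j" and x: "x \<in> T" and y: "y \<in> T" and eq: "F i x = F j y"
 shows "x = q j & y = q i"
proof -
 have e: "bc i (F i x) = bc i x / 2 + 1/2" "bc i (F j y) = bc i y / 2"
  "bc j (F j y) = bc j y / 2 + 1/2" "bc j (F i x) = bc j x / 2"
  unfolding bc_F[OF ij(1,1)] bc_F[OF ij(1,2)] bc_F[OF ij(2,2)] bc_F[OF ij(2,1)] using ij(3) by auto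
 have 1: "bc i x / 2 + 1/2 = bc i y / 2" and 2: "bc j y / 2 + 1/2 = bc j x / 2"
  using e unfolding eq by linarith+
 have "bc i y = 1" "bc j x = 1"
  using 1 2 bc_le_1[OF y ij(1)] bc_nonneg[OF x ij(1)] bc_le_1[OF x ij(2)] bc_nonneg[OF y ij(2)] by linarith+
 thus ?thesis using bc_eq_1[OF x ij(2)] bc_eq_1[OF y ij(1)] by blast
qed

text \<open>After the common prefix has been stripped, \<open>F_meet\<close> applies to the first
  letters that differ, and \<open>Fw_eq_q\<close> carries the corner found there down to the smaller
  cells.\<close>

lemma cells_meet:
 "w \<in> words n ==> w' \<in> words n ==> w ~= w' ==> x \<in> T ==> x' \<in> T ==> Fw w x = Fw w' x' ==>
  \<exists>i\<in>{0,1,2}. \<exists>j\<in>{0,1,2}. x = q i & x' = q j"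
proof (induction n arbitrary: w w')
 case 0
 thus ?case by (simp add: words_0)
next
 case (Suc n)
 obtain i u where w: "w = i # u" "i \<in> {0,1,2}" "u \<in> words n" using Suc.prems(1) by (auto simp: words_Suc)
 obtain j u' where w': "w' = j # u'" "j \<in> {0,1,2}" "u' \<in> words n" using Suc.prems(2) by (auto simp: words_Suc)
 show ?case
 proof (cases "i = j")
  case True
  thus ?thesis using Suc.prems Suc.IH[OF w(3) w'(3)] by (auto simp: w w' sgF_inj)
 next
  case False
  have "Fw u x = q j & Fw u' x' = q i"
   using F_meet[OF w(2) w'(2) False Fw_T'[OF Suc.prems(4) w(3)] Fw_T'[OF Suc.prems(5) w'(3)]] Suc.prems(6)
   by (simp add: w w')
  thus ?thesis using Fw_eq_q[of u x j] Fw_eq_q[of u' x' i] w w' Suc.prems(4,5) unfolding words_def by blast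
 qed
qed

lemma cells_meet_once:
 "w \<in> words n ==> w' \<in> words n ==> w ~= w' ==> x \<in> T ==> x' \<in> T ==> y \<in> T ==> y' \<in> T ==>
  Fw w x = Fw w' x' ==> Fw w y = Fw w' y' ==> x = y"
proof (induction n arbitrary: w w')
 case 0
 thus ?case by (simp add: words_0)
next
 case (Suc n)
 obtain i u where w: "w = i # u" "i \<in> {0,1,2}" "u \<in> words n" using Suc.prems(1) by (auto simp: words_Suc)
 obtain j u' where w': "w' = j # u'" "j \<in> {0,1,2}" "u' \<in> words n" using Suc.prems(2) by (auto simp: words_Suc)
 show ?case
 proof (cases "i = j")
  case True
  thus ?thesis using Suc.prems Suc.IH[OF w(3) w'(3)] by (auto simp: w w' sgF_inj)
 next
  case False
  have "Fw u x = q j"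
   using F_meet[OF w(2) w'(2) False Fw_T'[OF Suc.prems(4) w(3)] Fw_T'[OF Suc.prems(5) w'(3)]] Suc.prems(8)
   by (simp add: w w')
  moreover have "Fw u y = q j"
   using F_meet[OF w(2) w'(2) False Fw_T'[OF Suc.prems(6) w(3)] Fw_T'[OF Suc.prems(7) w'(3)]] Suc.prems(9)
   by (simp add: w w')
  ultimately show ?thesis by (metis sgFw_inj)
 qed
qed

fun Tn :: "nat => (real^2) set" where
 "Tn 0 = T"
| "Tn (Suc n) = (\<Union>i\<in>{0,1,2}. F i ` Tn n)"

lemma Tn_compact: "compact (Tn n)"
 by (induction n) (auto intro!: compact_T compact_UN compact_continuous_image continuous_intros)

lemma Tn_sub: "Tn (Suc n) \<subseteq> Tn n"
proof (induction n)
 case 0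
 thus ?case using F_T by auto
next
 case (Suc n)
 thus ?case unfolding Tn.simps(2)[of "Suc n"] Tn.simps(2)[of n] by (meson UN_mono image_mono subset_refl)
qed

lemma Tn_mono: "m <= n ==> Tn n \<subseteq> Tn m" by (rule lift_Suc_antimono_le[of Tn, OF Tn_sub])

lemma q_Tn: "i \<in> {0,1,2} ==> q i \<in> Tn n"
proof (induction n)
 case (Suc n)
 thus ?case unfolding Tn.simps by (intro UN_I[of i] image_eqI[of _ _ "q i"]) auto
qed (simp add: q_T)

definition KT where "KT = (\<Inter>n. Tn n)"

lemma KT_compact: "compact KT"
proof -
 have "closed KT" unfolding KT_def by (intro closed_INT ballI compact_imp_closed Tn_compact)
 moreover have "KT = Tn 0 \<inter> KT" unfolding KT_def by blast
 ultimately show ?thesis using compact_Int_closed[OF Tn_compact] by metis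
qed

lemma KT_selfsim: "KT = (\<Union>i\<in>{0,1,2}. F i ` KT)"
proof
 show "(\<Union>i\<in>{0,1,2}. F i ` KT) \<subseteq> KT"
 proof
  fix x assume "x \<in> (\<Union>i\<in>{0,1,2}. F i ` KT)"
  then obtain i y where "i \<in> {0,1,2}" "x = F i y" "y \<in> KT" by blast
  hence "x \<in> Tn (Suc n)" for n unfolding Tn.simps KT_def by blast
  thus "x \<in> KT" unfolding KT_def using Tn_sub by blast
 qed
 show "KT \<subseteq> (\<Union>i\<in>{0,1,2}. F i ` KT)"
 proof
  fix x assume x: "x \<in> KT"
  have "\<exists>i\<in>{0,1,2}. \<forall>n. x \<in> F i ` Tn n"
  \<comment> \<open>Pigeonhole over the three maps: since \<open>Tn\<close> decreases, a failure of
    each map at some level would be a failure of all of them at the largest of these levels.\<close>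
  proof (rule ccontr)
   assume "~ (\<exists>i\<in>{0,1,2}. \<forall>n. x \<in> F i ` Tn n)"
   hence "\<forall>i\<in>{0,1,2}. \<exists>n. x \<notin> F i ` Tn n" by blast
   then obtain m where m: "!!i. i \<in> {0,1,2} ==> x \<notin> F i ` Tn (m i)" by metis
   define N where "N = max (m 0) (max (m 1) (m 2))"
   have "x \<in> Tn (Suc N)" using x unfolding KT_def by blast
   then obtain i where i: "i \<in> {0,1,2}" "x \<in> F i ` Tn N" unfolding Tn.simps by blast
   have "m i <= N" using i(1) by (auto simp: N_def)
   hence "x \<in> F i ` Tn (m i)" using i(2) Tn_mono by blast
   thus False using m[OF i(1)] by blast
  qed
  then obtain i where i: "i \<in> {0,1,2}" "!!n. x \<in> F i ` Tn n" by blast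
  obtain y where y: "x = F i y" "y \<in> Tn 0" using i(2)[of 0] by blast
  have "y \<in> Tn n" for n
  proof -
   obtain z where "x = F i z" "z \<in> Tn n" using i(2)[of n] by blast
   thus ?thesis using y sgF_inj by metis
  qed
  thus "x \<in> (\<Union>i\<in>{0,1,2}. F i ` KT)" using i(1) y(1) by (auto simp: KT_def)
 qed
qed

text \<open>The largest distance of a point of A from B is attained, and self-similarity bounds it
  by half of itself. Used in both directions it gives the uniqueness of the gasket.\<close>

lemma selfsim_sub:
 assumes A: "A ~= {}" "compact A" "A = (\<Union>i\<in>{0,1,2}. F i ` A)"
  and B: "B ~= {}" "compact B" "B = (\<Union>i\<in>{0,1,2}. F i ` B)"
 shows "A \<subseteq> B"
proof -
 obtain x where x: "x \<in> A" "!!y. y \<in> A ==> infdist y B <= infdist x B"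
  using continuous_attains_sup[OF A(2,1), of "%y. infdist y B"] continuous_on_infdist[OF continuous_on_id] by blast
 obtain i y where iy: "i \<in> {0,1,2}" "y \<in> A" "x = F i y" using x(1) A(3) by blast
 obtain b where b: "b \<in> B" "infdist y B = dist y b"
  using infdist_attains_inf[OF compact_imp_closed[OF B(2)] B(1), of y] by blast
 have "F i b \<in> B" using B(3) b iy(1) by blast
 hence "infdist x B <= dist x (F i b)" by (rule infdist_le)
 also have "\<dots> = infdist y B / 2" by (simp add: iy dist_sgF b)
 finally have "infdist x B <= 0" using x(2)[OF iy(2)] infdist_nonneg[of y B] by simp
 hence "infdist z B = 0" if "z \<in> A" for z using x(2)[OF that] infdist_nonneg[of z B] by simp
 thus ?thesis using in_closed_iff_infdist_zero[OF compact_imp_closed[OF B(2)] B(1)] by blast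
qed

lemma K_eq: "K = KT" unfolding gasket_def
proof (rule the_equality)
 have ne: "KT ~= {}" using q_Tn[of 0] by (auto simp: KT_def)
 show "KT ~= {} & compact KT & KT = (\<Union>i\<in>{0, 1, 2}. F i ` KT)" using ne KT_compact KT_selfsim by blast
 fix A assume "A ~= {} & compact A & A = (\<Union>i\<in>{0, 1, 2}. F i ` A)"
 thus "A = KT" using selfsim_sub ne KT_compact KT_selfsim by (metis subset_antisym)
qed

lemma K_compact: "compact K" by (simp add: K_eq KT_compact)

lemma K_T: "x \<in> K ==> x \<in> T" unfolding K_eq KT_def using Tn.simps(1) by blast

lemma q_K: "i \<in> {0,1,2} ==> q i \<in> K" unfolding K_eq KT_def using q_Tn by blast

lemma F_K: "x \<in> K ==> i \<in> {0,1,2} ==> F i x \<in> K" using KT_selfsim unfolding K_eq by blast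

lemma Fw_K: "x \<in> K ==> w \<in> words n ==> Fw w x \<in> K"
proof (induction n arbitrary: w)
 case (Suc n)
 obtain i v where "w = i # v" "i \<in> {0,1,2}" "v \<in> words n"
  using Suc.prems(2) unfolding words_Suc by (elim imageE) (simp add: case_prod_unfold mem_Times_iff)
 thus ?case using F_K[OF Suc.IH[OF Suc.prems(1)]] by simp
qed (simp add: words_0)

lemma K_cases: "x \<in> K ==> \<exists>i\<in>{0,1,2}. \<exists>y\<in>K. x = F i y" using KT_selfsim unfolding K_eq by blast

lemma K_cell: "x \<in> K ==> \<exists>w\<in>words n. \<exists>y\<in>K. x = Fw w y"
proof (induction n arbitrary: x)
 case (Suc n)
 obtain i y where i: "i \<in> {0,1,2}" "y \<in> K" "x = F i y" using K_cases[OF Suc.prems] by blast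
 obtain w z where "w \<in> words n" "z \<in> K" "y = Fw w z" using Suc.IH[OF i(2)] by blast
 thus ?case using i by (intro bexI[of _ "i # w"] bexI[of _ z]) (auto simp: words_Suc)
qed (auto simp: words_0)

text \<open>Each half of a side is the image of the whole side under one of the two maps, so the
  side lies in every \<open>Tn\<close>.\<close>

lemma segment_K:
 assumes "i \<in> {0,1,2}" "j \<in> {0,1,2}" "t \<in> {0..1}" shows "edge_pt (q i) (q j) t \<in> K"
proof -
 have "edge_pt (q i) (q j) t \<in> Tn n" if "t \<in> {0..1}" for n t using that
 proof (induction n arbitrary: t)
  case 0
  have "convex T" unfolding T_def by (rule convex_convex_hull)
  thus ?case using 0 q_T assms by (auto simp: edge_pt_def convex_def)
 next
  case (Suc n)
  show ?case
  proof (cases "t <= 1/2")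
   case True
   have "edge_pt (q i) (q j) t = F i (edge_pt (q i) (q j) (2 * t))"
    unfolding edge_pt_def sgF_eq by (simp add: vec_eq_iff) (simp add: algebra_simps)
   moreover have "edge_pt (q i) (q j) (2 * t) \<in> Tn n" using Suc True by auto
   ultimately show ?thesis using assms(1) unfolding Tn.simps by blast
  next
   case False
   have "edge_pt (q i) (q j) t = F j (edge_pt (q i) (q j) (2 * t - 1))"
    unfolding edge_pt_def sgF_eq by (simp add: vec_eq_iff) (simp add: algebra_simps)
   moreover have "edge_pt (q i) (q j) (2 * t - 1) \<in> Tn n" using Suc False by auto
   ultimately show ?thesis using assms(2) unfolding Tn.simps by blast
  qed
 qed
 thus ?thesis using assms(3) by (auto simp: K_eq KT_def)
qed

definition diam where "diam = diameter T"

lemma diam: "x \<in> T ==> y \<in> T ==> dist x y <= diam"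
 unfolding diam_def by (rule diameter_bounded_bound[OF compact_imp_bounded[OF compact_T]])

lemma diam_nonneg: "0 <= diam" using diam[OF q_T[of 0] q_T[of 0]] by simp

lemma cell_diam: "w \<in> words n ==> x \<in> T ==> y \<in> T ==> dist (Fw w x) (Fw w y) <= diam / 2 ^ n"
 by (simp add: dist_sgFw words_length divide_right_mono diam)

lemma cells_small: "e > 0 ==> \<exists>N. ALL n>=N. diam / 2 ^ n < e"
proof -
 assume e: "e > 0"
 have "(%n. diam * (1/2) ^ n) \<longlonglongrightarrow> diam * 0" by (intro tendsto_intros LIMSEQ_power_zero) simp
 hence "eventually (%n. diam * (1/2) ^ n < e) sequentially" using e by (intro order_tendstoD(2)[of _ 0]) auto
 moreover have "diam * (1/2) ^ n = diam / 2 ^ n" for n by (simp add: power_divide)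
 ultimately show ?thesis by (simp only: eventually_sequentially)
qed

definition P3 :: "(nat \<times> nat) set" where "P3 = {(0,1), (0,2), (1,0), (1,2), (2,0), (2,1)}"

lemma P3_iff: "(i, j) \<in> P3 \<longleftrightarrow> i \<in> {0,1,2} & j \<in> {0,1,2} & i ~= j" by (auto simp: P3_def)

lemma sg_edges_eq: "sg_edges q n = (%(w, i, j). (Fw w (q i), Fw w (q j))) ` (words n \<times> P3)"
proof (intro set_eqI iffI)
 fix e assume "e \<in> sg_edges q n"
 then obtain x y w where e: "e = (x, y)" "x ~= y" "w \<in> words n" "x \<in> Fw w ` sgV q 0" "y \<in> Fw w ` sgV q 0"
  by (auto simp: sg_edges_def sg_nbr_def)
 then obtain i j where "i \<in> {0,1,2}" "j \<in> {0,1,2}" "x = Fw w (q i)" "y = Fw w (q j)" by (auto simp del: One_nat_def)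
 thus "e \<in> (%(w, i, j). (Fw w (q i), Fw w (q j))) ` (words n \<times> P3)"
  using e by (intro image_eqI[of _ _ "(w, i, j)"]) (auto simp: P3_iff)
next
 fix e assume "e \<in> (%(w, i, j). (Fw w (q i), Fw w (q j))) ` (words n \<times> P3)"
 then obtain w i j where e: "e = (Fw w (q i), Fw w (q j))" "w \<in> words n" "(i, j) \<in> P3" by auto
 hence ij: "i \<in> {0,1,2}" "j \<in> {0,1,2}" "i ~= j" by (auto simp: P3_iff)
 hence "Fw w (q i) ~= Fw w (q j)" using q_inj by (simp only: sgFw_inj) simp
 moreover have "q i \<in> sgV q 0" "q j \<in> sgV q 0" using ij by auto
 ultimately have "sg_nbr q n (Fw w (q i)) (Fw w (q j))" unfolding sg_nbr_def using e(2) by blast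
 thus "e \<in> sg_edges q n" by (simp add: sg_edges_def e(1))
qed

text \<open>Two cells of the same level have at most one common point
  (\<open>cells_meet_once\<close>), so an edge determines its cell. Sums over edges thereby become
  sums over words.\<close>

lemma sg_edges_inj: "inj_on (%(w, i, j). (Fw w (q i), Fw w (q j))) (words n \<times> P3)"
proof (rule inj_onI)
 fix a b assume ab: "a \<in> words n \<times> P3" "b \<in> words n \<times> P3"
  and eq: "(%(w, i, j). (Fw w (q i), Fw w (q j))) a = (%(w, i, j). (Fw w (q i), Fw w (q j))) b"
 obtain w i j where a: "a = (w, i, j)" by (cases a) auto
 obtain w' i' j' where b: "b = (w', i', j')" by (cases b) auto
 have ij: "i \<in> {0,1,2}" "j \<in> {0,1,2}" "i ~= j" "i' \<in> {0,1,2}" "j' \<in> {0,1,2}" "w \<in> words n" "w' \<in> words n"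
  using ab by (auto simp: a b P3_iff)
 have e: "Fw w (q i) = Fw w' (q i')" "Fw w (q j) = Fw w' (q j')" using eq by (auto simp: a b)
 have "w = w'"
 proof (rule ccontr)
  assume "w ~= w'"
  hence "q i = q j"
   using cells_meet_once[OF ij(6,7) _ q_T[OF ij(1)] q_T[OF ij(4)] q_T[OF ij(2)] q_T[OF ij(5)] e] by blast
  thus False using q_inj[OF ij(1,2)] ij(3) by blast
 qed
 hence "q i = q i'" "q j = q j'" using e by (simp_all only: sgFw_inj)
 hence "i = i'" "j = j'" using q_inj[OF ij(1,4)] q_inj[OF ij(2,5)] by blast+
 thus "a = b" using \<open>w = w'\<close> by (simp only: a b)
qed

lemma sum_edges: "(\<Sum>(x, y)\<in>sg_edges q n. G x y) = (\<Sum>w\<in>words n. \<Sum>(i, j)\<in>P3. G (Fw w (q i)) (Fw w (q j)))"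
proof -
 have "(\<Sum>(x, y)\<in>sg_edges q n. G x y) = (\<Sum>(w, i, j)\<in>words n \<times> P3. G (Fw w (q i)) (Fw w (q j)))"
  unfolding sg_edges_eq by (subst sum.reindex[OF sg_edges_inj]) (simp add: case_prod_unfold)
 thus ?thesis by (simp add: sum.cartesian_product case_prod_unfold)
qed

lemma finite_sg_edges: "finite (sg_edges q n)" unfolding sg_edges_eq by (simp add: P3_def)

end

section \<open>Harmonic extension and discrete energies\<close>

definition E0 :: "(nat => real) => (nat => real) => real" where
 "E0 a b = (a 0 - a 1) * (b 0 - b 1) + (a 1 - a 2) * (b 1 - b 2) + (a 0 - a 2) * (b 0 - b 2)"

text \<open>
 The ``one fifth -- two fifths'' rule: the values on \<open>F\<^sub>i(V\<^sub>0)\<close> of the harmonic function with values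
 \<open>a\<close> on \<open>V\<^sub>0\<close>.
\<close>

definition hext :: "nat => (nat => real) => nat => real" where
 "hext i a j = (if j = i then a i else (a 0 + a 1 + a 2 + a i + a j) / 5)"

definition hexts :: "nat list => (nat => real) => nat => real" where
 "hexts w a = fold hext w a"

text \<open>The area spanned by \<open>a\<close> and \<open>b\<close> modulo constants; \<open>3 W(a,b)^2\<close> is their Gram determinant.\<close>

definition W2 :: "(nat => real) => (nat => real) => real" where
 "W2 a b = (a 1 - a 0) * (b 2 - b 0) - (a 2 - a 0) * (b 1 - b 0)"

lemma hexts_Nil [simp]: "hexts [] a = a"
 and hexts_Cons [simp]: "hexts (i # w) a = hexts w (hext i a)"
 and hexts_append: "hexts (v @ w) a = hexts w (hexts v a)" by (simp_all add: hexts_def)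

lemma E0_commute: "E0 a b = E0 b a" by (simp add: E0_def mult.commute)

lemma E0_add: "E0 (%j. a j + a' j) b = E0 a b + E0 a' b"
 and E0_diff: "E0 (%j. a j - a' j) b = E0 a b - E0 a' b"
 and E0_cmult: "E0 (%j. c * a j) b = c * E0 a b" by (simp_all add: E0_def algebra_simps)

lemma E0_nonneg [simp]: "0 <= E0 a a" by (simp add: E0_def)

lemma E0_eq_0_iff: "E0 a a = 0 \<longleftrightarrow> a 0 = a 1 & a 1 = a 2"
proof -
 have "E0 a a = (a 0 - a 1)^2 + (a 1 - a 2)^2 + (a 0 - a 2)^2" by (simp add: E0_def power2_eq_square)
 thus ?thesis by (auto simp: add_nonneg_eq_0_iff)
qed

lemma E0_edge: "i \<in> {0,1,2} ==> j \<in> {0,1,2} ==> (a i - a j)^2 <= E0 a a"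
proof -
 assume ij: "i \<in> {0,1,2}" "j \<in> {0,1,2}"
 have e: "E0 a a = (a 0 - a 1)^2 + (a 1 - a 2)^2 + (a 0 - a 2)^2" by (simp add: E0_def power2_eq_square)
 have "(a 0 - a 1)^2 >= 0" "(a 1 - a 2)^2 >= 0" "(a 0 - a 2)^2 >= 0" by auto
 thus ?thesis using ij unfolding e by (auto simp: power2_commute)
qed

lemma E0_gram: "E0 a a * E0 b b - (E0 a b)^2 = 3 * (W2 a b)^2"
 by (simp add: E0_def W2_def power2_eq_square algebra_simps)

lemma E0_CS: "(E0 a b)^2 <= E0 a a * E0 b b" using E0_gram[of a b] by (smt (verit) zero_le_power2)

lemma sum012: "(\<Sum>i\<in>{0,1,2::nat}. f i) = f 0 + f 1 + f 2" by (simp add: add.assoc)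

lemma hext_vals:
 "hext 0 a 0 = a 0" "hext 0 a 1 = (2 * a 0 + 2 * a 1 + a 2) / 5" "hext 0 a 2 = (2 * a 0 + a 1 + 2 * a 2) / 5"
 "hext 1 a 0 = (2 * a 0 + 2 * a 1 + a 2) / 5" "hext 1 a 1 = a 1" "hext 1 a 2 = (a 0 + 2 * a 1 + 2 * a 2) / 5"
 "hext 2 a 0 = (2 * a 0 + a 1 + 2 * a 2) / 5" "hext 2 a 1 = (a 0 + 2 * a 1 + 2 * a 2) / 5" "hext 2 a 2 = a 2"
 by (simp_all add: hext_def)

text \<open>Modulo constants \<open>hext i\<close> has the eigenvalues 3/5 and 1/5; the factor is
  its determinant.\<close>

lemma W2_hext: "i \<in> {0,1,2} ==> W2 (hext i a) (hext i b) = 3/25 * W2 a b"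
 by (auto simp: W2_def hext_vals field_simps)

lemma W2_hexts: "w \<in> words n ==> W2 (hexts w a) (hexts w b) = (3/25) ^ n * W2 a b"
proof (induction n arbitrary: w a b)
 case (Suc n)
 obtain i v where iv: "w = i # v" "i \<in> {0,1,2}" "v \<in> words n"
  using Suc.prems unfolding words_Suc by (elim imageE) (simp add: case_prod_unfold mem_Times_iff)
 thus ?case by (simp add: Suc.IH W2_hext)
qed (simp add: words_0)

lemma hext_E0_nz: "i \<in> {0,1,2} ==> E0 b b > 0 ==> E0 (hext i b) (hext i b) > 0"
proof -
 assume i: "i \<in> {0,1,2}" and b: "E0 b b > 0"
 have "E0 (hext i b) (hext i b) ~= 0"
 proof
  assume "E0 (hext i b) (hext i b) = 0"
  hence "b 0 = b 1 & b 1 = b 2" using i unfolding E0_eq_0_iff by (auto simp: hext_vals)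
  thus False using b E0_eq_0_iff[of b] by simp
 qed
 thus ?thesis using E0_nonneg[of "hext i b"] by linarith
qed

lemma hexts_E0_pos: "w \<in> words n ==> E0 b b > 0 ==> E0 (hexts w b) (hexts w b) > 0"
proof (induction n arbitrary: w b)
 case (Suc n)
 obtain i v where iv: "w = i # v" "i \<in> {0,1,2}" "v \<in> words n"
  using Suc.prems(1) unfolding words_Suc by (elim imageE) (simp add: case_prod_unfold mem_Times_iff)
 thus ?case by (simp add: Suc.IH hext_E0_nz Suc.prems(2))
qed (simp add: words_0)

lemma E0_hext_le: "i \<in> {0,1,2} ==> E0 (hext i a) (hext i a) <= 9/25 * E0 a a"
proof -
 assume i: "i \<in> {0,1,2}"
 have "E0 (hext 0 a) (hext 0 a) = 9/25 * E0 a a - 12/25 * (a 1 - a 2)^2"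
  "E0 (hext 1 a) (hext 1 a) = 9/25 * E0 a a - 12/25 * (a 0 - a 2)^2"
  "E0 (hext 2 a) (hext 2 a) = 9/25 * E0 a a - 12/25 * (a 0 - a 1)^2"
  by (simp_all add: E0_def hext_vals power2_eq_square field_simps)
 thus ?thesis using i by auto
qed

text \<open>
 The gluing condition says that the three vectors \<open>c i\<close> are the values of a function on the three
 cells of level one with corner values \<open>a\<close>.
\<close>

lemma E0_hext_sum:
 assumes "!!i j. i \<in> {0,1,2} ==> j \<in> {0,1,2} ==> c i j = c j i" "!!i. i \<in> {0,1,2} ==> c i i = a i"
 shows "5/3 * (\<Sum>i\<in>{0,1,2}. E0 (c i) (hext i b)) = E0 a b"
proof -
 have "c 1 0 = c 0 1" "c 2 0 = c 0 2" "c 2 1 = c 1 2" "c 0 0 = a 0" "c 1 1 = a 1" "c 2 2 = a 2"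
  using assms by auto
 thus ?thesis unfolding sum012 E0_def hext_vals by (simp add: field_simps)
qed

lemma hext_sym: "i \<in> {0,1,2} ==> j \<in> {0,1,2} ==> hext i a j = hext j a i" by (auto simp: hext_vals)

lemma hext_diag: "hext i a i = a i" by (simp add: hext_def)

text \<open>S is the energy of a triple with differences p and r, and X, Y, Z are 25 times the
  energies of its three subcells. The two sides of the first inequality differ by 64 times a perfect
  square, which vanishes when one of the values is the mean of the other two.\<close>

lemma contraction_aux:
 fixes p r :: real
 defines "S \<equiv> 2 * p^2 + 2 * r^2 - 2 * p * r"
 defines "X \<equiv> 6 * (p^2 + r^2 + p * r)" and "Y \<equiv> 6 * (p^2 + (p - r)^2 - p * (r - p))"
  and "Z \<equiv> 6 * (r^2 + (p - r)^2 + r * (r - p))"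
 shows "49 * S ^ 3 <= X * Y * Z" and "X * Y + Y * Z + X * Z = 63 * S^2"
proof -
 have "X * Y * Z - 49 * S ^ 3 = 64 * ((p + r) * (p - 2 * r) * (r - 2 * p))^2"
  unfolding S_def X_def Y_def Z_def by (simp add: power2_eq_square power3_eq_cube algebra_simps)
 thus "49 * S ^ 3 <= X * Y * Z" by (smt (verit) zero_le_power2)
 show "X * Y + Y * Z + X * Z = 63 * S^2"
  unfolding S_def X_def Y_def Z_def by (simp add: power2_eq_square algebra_simps)
qed

text \<open>The sum of reciprocals is the quotient of the two symmetric functions in
  \<open>contraction_aux\<close>, whence 225/7 = 25 * 63 / 49.\<close>

lemma E0_hext_inverse_sum:
 assumes "E0 b b > 0"
 shows "(\<Sum>i\<in>{0,1,2}. 1 / E0 (hext i b) (hext i b)) <= 225 / 7 / E0 b b"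
proof -
 define p r where "p = b 1 - b 0" and "r = b 2 - b 0"
 define S X Y Z where "S = 2 * p^2 + 2 * r^2 - 2 * p * r" and "X = 6 * (p^2 + r^2 + p * r)"
  and "Y = 6 * (p^2 + (p - r)^2 - p * (r - p))" and "Z = 6 * (r^2 + (p - r)^2 + r * (r - p))"
 have e: "E0 b b = S" "E0 (hext 0 b) (hext 0 b) = X / 25" "E0 (hext 1 b) (hext 1 b) = Y / 25" "E0 (hext 2 b) (hext 2 b) = Z / 25"
  unfolding S_def X_def Y_def Z_def p_def r_def E0_def hext_vals by (simp_all add: power2_eq_square field_simps)
 have pos: "S > 0" "X > 0" "Y > 0" "Z > 0"
  using assms hext_E0_nz[of 0 b] hext_E0_nz[of 1 b] hext_E0_nz[of 2 b] e by auto
 have 1: "49 * S ^ 3 <= X * Y * Z" and 2: "X * Y + Y * Z + X * Z = 63 * S^2"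
  unfolding S_def X_def Y_def Z_def by (rule contraction_aux)+
 have "1 / X + 1 / Y + 1 / Z = (X * Y + Y * Z + X * Z) / (X * Y * Z)" using pos by (simp add: field_simps)
 also have "\<dots> <= 63 * S^2 / (49 * S ^ 3)" unfolding 2 using pos 1 by (intro divide_left_mono) auto
 also have "\<dots> = 9 / 7 / S" using pos by (simp add: power2_eq_square power3_eq_cube)
 finally have "25 * (1 / X + 1 / Y + 1 / Z) <= 25 * (9 / 7 / S)" by simp
 thus ?thesis unfolding sum012 e by simp
qed

text \<open>The weight 3/125 is 5/3 * (3/25)^2, the factor of a renormalised squared area per level.
  Multiplied by 225/7 it gives 27/35.\<close>

lemma E0_hexts_inverse_sum:
 assumes "E0 b b > 0"
 shows "(\<Sum>w\<in>words n. (3/125) ^ n / E0 (hexts w b) (hexts w b)) <= (27/35) ^ n / E0 b b" using assms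
proof (induction n arbitrary: b)
 case (Suc n)
 have "(\<Sum>w\<in>words (Suc n). (3/125) ^ Suc n / E0 (hexts w b) (hexts w b))
   = 3/125 * (\<Sum>i\<in>{0,1,2}. \<Sum>w\<in>words n. (3/125) ^ n / E0 (hexts w (hext i b)) (hexts w (hext i b)))"
  unfolding sum_words_Suc sum_distrib_left by (intro sum.cong refl) simp
 also have "\<dots> <= 3/125 * (\<Sum>i\<in>{0,1,2}. (27/35) ^ n / E0 (hext i b) (hext i b))"
  by (intro mult_left_mono sum_mono Suc.IH hext_E0_nz Suc.prems) auto
 also have "\<dots> = 3/125 * (27/35) ^ n * (\<Sum>i\<in>{0,1,2}. 1 / E0 (hext i b) (hext i b))"
  by (simp add: sum_distrib_left del: sum.insert)
 also have "\<dots> <= 3/125 * (27/35) ^ n * (225 / 7 / E0 b b)"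
  by (intro mult_left_mono E0_hext_inverse_sum Suc.prems) auto
 also have "\<dots> = (27/35) ^ Suc n / E0 b b" by simp
 finally show ?case .
qed (simp add: words_0)

lemma E0_hexts_sum: "(\<Sum>v\<in>words k. (5/3) ^ k * E0 (hexts v a) (hexts v b)) = E0 a b"
proof (induction k arbitrary: a b)
 case (Suc k)
 have "(\<Sum>v\<in>words (Suc k). (5/3) ^ Suc k * E0 (hexts v a) (hexts v b))
   = 5/3 * (\<Sum>i\<in>{0,1,2}. \<Sum>v\<in>words k. (5/3) ^ k * E0 (hexts v (hext i a)) (hexts v (hext i b)))"
  unfolding sum_words_Suc sum_distrib_left by (intro sum.cong refl) simp
 also have "\<dots> = 5/3 * (\<Sum>i\<in>{0,1,2}. E0 (hext i a) (hext i b))" by (simp only: Suc.IH)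
 also have "\<dots> = E0 a b" by (rule E0_hext_sum) (auto simp: hext_diag intro: hext_sym)
 finally show ?case .
qed (simp add: words_0)

context gasket_geom begin

definition cv :: "(real^2 => real) => nat list => nat => real" where
 "cv f w j = f (Fw w (q j))"

definition En :: "nat => (real^2 => real) => (real^2 => real) => real" where
 "En n f g = (5/3) ^ n * (\<Sum>w\<in>words n. E0 (cv f w) (cv g w))"

lemma cv_snoc: "cv f (w @ [i]) j = cv f (w @ [j]) i" "cv f (w @ [i]) i = cv f w i"
 by (simp_all add: cv_def sgFw_append sgF_commute[of q i j])

text \<open>A discrete Gauss-Green formula: against the harmonic extension of b only the corner
  values of f count, since \<open>E0_hext_sum\<close> removes one level at a time.\<close>

lemma cell_energy: "(\<Sum>v\<in>words k. (5/3) ^ k * E0 (cv f (w @ v)) (hexts v b)) = E0 (cv f w) b"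
proof (induction k arbitrary: w b)
 case (Suc k)
 have "(\<Sum>v\<in>words (Suc k). (5/3) ^ Suc k * E0 (cv f (w @ v)) (hexts v b))
   = 5/3 * (\<Sum>i\<in>{0,1,2}. \<Sum>v\<in>words k. (5/3) ^ k * E0 (cv f ((w @ [i]) @ v)) (hexts v (hext i b)))"
  unfolding sum_words_Suc sum_distrib_left by (intro sum.cong refl) simp
 also have "\<dots> = 5/3 * (\<Sum>i\<in>{0,1,2}. E0 (cv f (w @ [i])) (hext i b))" by (simp only: Suc.IH)
 also have "\<dots> = E0 (cv f w) b" by (rule E0_hext_sum) (auto simp: cv_snoc)
 finally show ?case .
qed (simp add: words_0)

text \<open>By \<open>cell_energy\<close>, f minus the harmonic extension of its corner values is
  orthogonal to that extension.\<close>

lemma cell_energy_pyth: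
 "(\<Sum>v\<in>words k. (5/3) ^ k * E0 (%j. cv f (w @ v) j - hexts v (cv f w) j) (%j. cv f (w @ v) j - hexts v (cv f w) j))
  = (\<Sum>v\<in>words k. (5/3) ^ k * E0 (cv f (w @ v)) (cv f (w @ v))) - E0 (cv f w) (cv f w)"
proof -
 have e: "E0 (%j. c j - b j) (%j. c j - b j) = E0 c c - 2 * E0 c b + E0 b b" for b c
  by (simp add: E0_def algebra_simps)
 have "(\<Sum>v\<in>words k. (5/3) ^ k * E0 (%j. cv f (w @ v) j - hexts v (cv f w) j) (%j. cv f (w @ v) j - hexts v (cv f w) j))
  = (\<Sum>v\<in>words k. (5/3) ^ k * E0 (cv f (w @ v)) (cv f (w @ v)))
   - 2 * (\<Sum>v\<in>words k. (5/3) ^ k * E0 (cv f (w @ v)) (hexts v (cv f w)))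
   + (\<Sum>v\<in>words k. (5/3) ^ k * E0 (hexts v (cv f w)) (hexts v (cv f w)))"
  unfolding e sum_distrib_left sum_subtractf[symmetric] sum.distrib[symmetric]
  by (intro sum.cong refl) (simp add: algebra_simps)
 thus ?thesis unfolding cell_energy E0_hexts_sum by simp
qed

lemma En_add_eq: "En (n + k) f g = (5/3) ^ n * (\<Sum>w\<in>words n. \<Sum>v\<in>words k. (5/3) ^ k * E0 (cv f (w @ v)) (cv g (w @ v)))"
 unfolding En_def sum_words_add by (simp add: power_add sum_distrib_left mult.assoc)

lemma En_pyth:
 "(5/3) ^ n * (\<Sum>w\<in>words n. \<Sum>v\<in>words k. (5/3) ^ k *
   E0 (%j. cv f (w @ v) j - hexts v (cv f w) j) (%j. cv f (w @ v) j - hexts v (cv f w) j))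
  = En (n + k) f f - En n f f" unfolding cell_energy_pyth sum_subtractf unfolding En_add_eq unfolding En_def
 by (simp add: right_diff_distrib)

lemma En_mono: "n <= m ==> En n f f <= En m f f"
proof -
 assume "n <= m"
 then obtain k where m: "m = n + k" using le_Suc_ex by blast
 have "0 <= En (n + k) f f - En n f f"
  unfolding En_pyth[symmetric] by (intro mult_nonneg_nonneg sum_nonneg) auto
 thus ?thesis by (simp add: m)
qed

lemma En_nonneg: "0 <= En n f f" unfolding En_def by (intro mult_nonneg_nonneg sum_nonneg) auto

lemma En_cell: "w \<in> words n ==> E0 (cv f w) (cv f w) <= (3/5) ^ n * En n f f"
proof -
 assume w: "w \<in> words n"
 have "E0 (cv f w) (cv f w) <= (\<Sum>w\<in>words n. E0 (cv f w) (cv f w))" by (rule member_le_sum[OF w]) auto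
 also have "\<dots> = (3/5) ^ n * En n f f"
  unfolding En_def by (simp add: power_mult_distrib[symmetric] mult.assoc[symmetric])
 finally show ?thesis .
qed

lemma En_add: "En n (%x. f x + g x) (%x. f x + g x) = En n f f + 2 * En n f g + En n g g"
 and En_diff: "En n (%x. f x - g x) (%x. f x - g x) = En n f f - 2 * En n f g + En n g g"
 and En_diff_left: "En n (%x. f x - g x) k = En n f k - En n g k"
proof -
 have p: "E0 (cv (%x. f x + g x) w) (cv (%x. f x + g x) w) = E0 (cv f w) (cv f w) + 2 * E0 (cv f w) (cv g w) + E0 (cv g w) (cv g w)"
  "E0 (cv (%x. f x - g x) w) (cv (%x. f x - g x) w) = E0 (cv f w) (cv f w) - 2 * E0 (cv f w) (cv g w) + E0 (cv g w) (cv g w)"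
  "E0 (cv (%x. f x - g x) w) (cv k w) = E0 (cv f w) (cv k w) - E0 (cv g w) (cv k w)" for w
  by (simp_all add: E0_def cv_def algebra_simps)
 show "En n (%x. f x + g x) (%x. f x + g x) = En n f f + 2 * En n f g + En n g g"
  "En n (%x. f x - g x) (%x. f x - g x) = En n f f - 2 * En n f g + En n g g"
  "En n (%x. f x - g x) k = En n f k - En n g k"
  unfolding En_def p by (simp_all add: sum.distrib sum_subtractf sum_distrib_left algebra_simps)
qed

lemma sum_P3: "(\<Sum>(i, j)\<in>P3. G i j) = G 0 1 + G 0 2 + G 1 0 + G 1 2 + G 2 0 + G 2 1"
 by (simp add: P3_def add.assoc)

text \<open>Every edge belongs to one cell and occurs with two orientations; the latter cancels the
  factor 1/2 of \<open>sgE\<close>.\<close>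

lemma sgE_eq: "sgE q n u = En n u u"
proof -
 have fin: "finite (sgV q n)" unfolding sgV_eq by auto
 have sub: "x \<in> sgV q n & y \<in> sgV q n" if "sg_nbr q n x y" for x y
  using that unfolding sg_nbr_def sgV.simps sgV_eq[of q n] by blast
 have sym: "sg_nbr q n x y \<longleftrightarrow> sg_nbr q n y x" for x y unfolding sg_nbr_def by auto
 have "(\<Sum>x\<in>sgV q n. \<Sum>y\<in>{y \<in> sgV q n. sg_nbr q n y x}. (u x - u y)^2)
   = (\<Sum>(x, y)\<in>Sigma (sgV q n) (%x. {y \<in> sgV q n. sg_nbr q n y x}). (u x - u y)^2)"
  by (rule sum.Sigma) (use fin in auto)
 also have "Sigma (sgV q n) (%x. {y \<in> sgV q n. sg_nbr q n y x}) = sg_edges q n"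
  unfolding sg_edges_def using sub sym by blast
 also have "(\<Sum>(x, y)\<in>sg_edges q n. (u x - u y)^2) = (\<Sum>w\<in>words n. 2 * E0 (cv u w) (cv u w))"
  unfolding sum_edges sum_P3 by (intro sum.cong refl) (simp add: E0_def cv_def power2_eq_square algebra_simps)
 finally show ?thesis unfolding sgE_def En_def by (simp add: sum_distrib_left[symmetric])
qed

abbreviation "SG \<equiv> sg_space q"

lemma SG_simps: "carr SG = K" "bdry SG = {q 0, q 1, q 2}"
 "f \<in> fdom SG \<longleftrightarrow> continuous_on K f & convergent (%n. En n f f)" by (simp_all add: sg_space_def sgE_eq)

lemma En_convergent_iff: "convergent (%n. En n f f) \<longleftrightarrow> (\<exists>B. \<forall>n. En n f f <= B)"
proof
 assume "convergent (%n. En n f f)"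
 hence "Bseq (%n. En n f f)" by (rule convergent_imp_Bseq)
 then obtain B where B: "!!n. norm (En n f f) <= B" unfolding Bseq_def by blast
 have "En n f f <= B" for n using B[of n] by (simp add: abs_le_iff)
 thus "\<exists>B. \<forall>n. En n f f <= B" by blast
next
 assume "\<exists>B. \<forall>n. En n f f <= B"
 then obtain B where "!!n. En n f f <= B" by blast
 hence "bdd_above (range (%n. En n f f))" by (rule bdd_aboveI2)
 moreover have "incseq (%n. En n f f)" by (simp add: incseq_def En_mono)
 ultimately have "(%n. En n f f) \<longlonglongrightarrow> (SUP n. En n f f)" by (rule LIMSEQ_incseq_SUP)
 thus "convergent (%n. En n f f)" by (rule convergentI)
qed

lemma SG_domI: "continuous_on K f ==> (!!n. En n f f <= B) ==> f \<in> fdom SG"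
 by (auto simp: SG_simps En_convergent_iff)

definition Elim :: "(real^2 => real) => real" where "Elim f = lim (%n. En n f f)"

lemma Elim: "f \<in> fdom SG ==> (%n. En n f f) \<longlonglongrightarrow> Elim f" by (simp add: SG_simps Elim_def convergent_LIMSEQ_iff)

lemma En_le_Elim: "f \<in> fdom SG ==> En n f f <= Elim f"
 by (rule incseq_le[OF _ Elim]) (auto simp: incseq_def En_mono)

lemma Elim_nonneg: "f \<in> fdom SG ==> 0 <= Elim f" using En_le_Elim[of f 0] En_nonneg[of 0 f] by linarith

lemma SG_add: assumes "f \<in> fdom SG" "g \<in> fdom SG"
 shows "(%x. f x + g x) \<in> fdom SG" "(%x. f x - g x) \<in> fdom SG"
proof -
 have par: "En n (%x. f x + g x) (%x. f x + g x) + En n (%x. f x - g x) (%x. f x - g x) <= 2 * Elim f + 2 * Elim g" for n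
  unfolding En_add En_diff using En_le_Elim[OF assms(1), of n] En_le_Elim[OF assms(2), of n] by simp
 have "En n (%x. f x + g x) (%x. f x + g x) <= 2 * Elim f + 2 * Elim g"
  "En n (%x. f x - g x) (%x. f x - g x) <= 2 * Elim f + 2 * Elim g" for n
  using par[of n] En_nonneg[of n "%x. f x + g x"] En_nonneg[of n "%x. f x - g x"] by linarith+
 moreover have "continuous_on K (%x. f x + g x)" "continuous_on K (%x. f x - g x)"
  using assms by (auto intro!: continuous_intros simp: SG_simps(3))
 ultimately show "(%x. f x + g x) \<in> fdom SG" "(%x. f x - g x) \<in> fdom SG" by (blast intro: SG_domI)+
qed

lemma SG_energy: "energy SG f g = (Elim (%x. f x + g x) - Elim (%x. f x - g x)) / 4"
 by (simp add: sg_space_def sg_energy_def Elim_def sgE_eq)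

lemma SG_energy_lim:
 assumes "f \<in> fdom SG" "g \<in> fdom SG"
 shows "(%n. En n f g) \<longlonglongrightarrow> energy SG f g"
proof -
 have "(%n. (En n (%x. f x + g x) (%x. f x + g x) - En n (%x. f x - g x) (%x. f x - g x)) / 4) \<longlonglongrightarrow> energy SG f g"
  unfolding SG_energy by (intro tendsto_intros Elim SG_add assms) simp
 thus ?thesis unfolding En_add En_diff by simp
qed

text \<open>A cell shares the corner i with its parent, so descending one level costs one edge, on
  which the increment is at most (3/5)^(n/2) times the root of the energy. Since 3/5 < (4/5)^2, this
  is dominated by a geometric series of ratio 4/5, whose partial sums appear in the bound.\<close>

lemma vertex_bound:
 assumes f: "f \<in> fdom SG" and j: "j \<in> {0,1,2}"
 shows "w \<in> words n ==> \<bar>cv f w j - f (q 0)\<bar> <= 5 * (1 - (4/5) ^ Suc n) * sqrt (Elim f)" using j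
proof (induction n arbitrary: w j)
 case 0
 have "(cv f w j - cv f w 0)^2 <= Elim f"
  using E0_edge[OF 0(2), of 0 "cv f w"] En_cell[OF 0(1), of f] En_le_Elim[OF f, of 0] by simp
 hence "sqrt ((cv f w j - cv f w 0)^2) <= sqrt (Elim f)" by (rule real_sqrt_le_mono)
 thus ?case using 0 by (simp add: words_0 cv_def)
next
 case (Suc n)
 obtain v i where v: "w = v @ [i]" "v \<in> words n" "i \<in> {0,1,2}"
  using Suc.prems(1) by (cases w rule: rev_cases) (auto simp: words_def)
 have "(cv f w j - cv f w i)^2 <= (3/5) ^ Suc n * En (Suc n) f f"
  using E0_edge[OF Suc.prems(2) v(3), of "cv f w"] En_cell[OF Suc.prems(1), of f] by linarith
 also have "\<dots> <= ((4/5)^2) ^ Suc n * Elim f"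
  by (intro mult_mono power_mono En_le_Elim f En_nonneg) (auto simp: power2_eq_square)
 finally have "sqrt ((cv f w j - cv f w i)^2) <= sqrt (((4/5) ^ Suc n)^2 * Elim f)"
  by (intro real_sqrt_le_mono) (simp only: power_mult[symmetric] mult.commute)
 hence 1: "\<bar>cv f w j - cv f w i\<bar> <= (4/5) ^ Suc n * sqrt (Elim f)" by (simp add: real_sqrt_mult)
 have 2: "\<bar>cv f w i - f (q 0)\<bar> <= 5 * (1 - (4/5) ^ Suc n) * sqrt (Elim f)"
  using Suc.IH[OF v(2,3)] by (simp only: v(1) cv_snoc)
 have "\<bar>cv f w j - f (q 0)\<bar> <= (4/5) ^ Suc n * sqrt (Elim f) + 5 * (1 - (4/5) ^ Suc n) * sqrt (Elim f)"
  using 1 2 by linarith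
 also have "\<dots> = 5 * (1 - (4/5) ^ Suc (Suc n)) * sqrt (Elim f)" by (simp add: algebra_simps)
 finally show ?case .
qed

text \<open>Every point is a limit of vertices, so the bound with 5 = 1 / (1 - 4/5) extends to the
  gasket; two points are joined through q 0.\<close>

lemma SG_poincare:
 assumes f: "f \<in> fdom SG" and xy: "x \<in> K" "y \<in> K"
 shows "\<bar>f x - f y\<bar> <= 10 * sqrt (Elim f)"
proof -
 have fc: "continuous_on K f" using f by (simp add: SG_simps)
 have one: "\<bar>f x - f (q 0)\<bar> <= 5 * sqrt (Elim f)" if x: "x \<in> K" for x
 proof -
  have "\<exists>y. y \<in> K & dist y x <= diam / 2 ^ n & \<bar>f y - f (q 0)\<bar> <= 5 * sqrt (Elim f)" for n
  proof -
   obtain w z where w: "w \<in> words n" "z \<in> K" "x = Fw w z" using K_cell[OF x] by blast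
   have "\<bar>cv f w 0 - f (q 0)\<bar> <= 5 * (1 - (4/5) ^ Suc n) * sqrt (Elim f)"
    by (rule vertex_bound[OF f _ w(1)]) simp
   also have "\<dots> <= 5 * 1 * sqrt (Elim f)"
    by (intro mult_right_mono mult_left_mono) (auto simp: Elim_nonneg[OF f])
   finally have "\<bar>f (Fw w (q 0)) - f (q 0)\<bar> <= 5 * sqrt (Elim f)" by (simp add: cv_def)
   moreover have "dist (Fw w (q 0)) x <= diam / 2 ^ n" unfolding w(3) by (intro cell_diam w K_T q_K) simp
   ultimately show ?thesis using Fw_K[OF q_K w(1)] by (intro exI[of _ "Fw w (q 0)"]) simp
  qed
  then obtain y where y: "!!n. y n \<in> K" "!!n. dist (y n) x <= diam / 2 ^ n" "!!n. \<bar>f (y n) - f (q 0)\<bar> <= 5 * sqrt (Elim f)"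
   by metis
  have d0: "(%n. diam * (1/2) ^ n) \<longlonglongrightarrow> diam * 0" by (intro tendsto_intros LIMSEQ_power_zero) simp
  have "(%n. dist (y n) x) \<longlonglongrightarrow> 0"
  proof (rule Lim_null_comparison)
   show "\<forall>\<^sub>F n in sequentially. norm (dist (y n) x) <= diam * (1/2) ^ n" using y(2) by (simp add: power_divide)
  qed (use d0 in simp)
  hence "y \<longlonglongrightarrow> x" by (rule tendsto_dist_iff[THEN iffD2])
  hence "(%n. f (y n)) \<longlonglongrightarrow> f x" by (rule continuous_on_tendsto_compose[OF fc _ x]) (simp add: y(1))
  hence "(%n. \<bar>f (y n) - f (q 0)\<bar>) \<longlonglongrightarrow> \<bar>f x - f (q 0)\<bar>" by (intro tendsto_intros)
  thus ?thesis by (rule LIMSEQ_le_const2) (use y(3) in auto)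
 qed
 show ?thesis using one[OF xy(1)] one[OF xy(2)] by linarith
qed

end

section \<open>Harmonic functions on the gasket\<close>

lemma E0_cong: "(!!j. j \<in> {0,1,2} ==> a j = a' j) ==> (!!j. j \<in> {0,1,2} ==> b j = b' j) ==> E0 a b = E0 a' b'"
 by (simp add: E0_def)

lemma hext_bounds:
 assumes "i \<in> {0,1,2}" "j \<in> {0,1,2}" "!!k. k \<in> {0,1,2} ==> m <= a k" "!!k. k \<in> {0,1,2} ==> a k <= (M::real)"
 shows "m <= hext i a j" "hext i a j <= M"
proof -
 have "m <= a 0" "m <= a 1" "m <= a 2" "a 0 <= M" "a 1 <= M" "a 2 <= M" using assms by auto
 thus "m <= hext i a j" "hext i a j <= M" using assms(1,2) by (auto simp: hext_vals)
qed

lemma hext_osc: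
 assumes "i \<in> {0,1,2}" and d: "!!k l. k \<in> {0,1,2} ==> l \<in> {0,1,2} ==> \<bar>a k - a l\<bar> <= d"
  and "k \<in> {0,1,2}" "l \<in> {0,1,2}"
 shows "\<bar>hext i a k - hext i a l\<bar> <= 3/5 * d"
proof -
 have "\<bar>a 0 - a 1\<bar> <= d" "\<bar>a 0 - a 2\<bar> <= d" "\<bar>a 1 - a 2\<bar> <= d" "0 <= d"
  using d[of 0 1] d[of 0 2] d[of 1 2] d[of 0 0] by auto
 thus ?thesis using assms(1,3,4) by (auto simp: hext_vals abs_le_iff field_simps)
qed

context gasket_geom begin

definition Gi :: "nat => real^2 => real^2" where "Gi i x = 2 *\<^sub>R x - q i"

lemma Gi_F [simp]: "Gi i (F i x) = x" by (simp add: Gi_def sgF_eq)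

text \<open>Harmonic extension for n levels followed by affine interpolation. The case distinction
  picks one cell containing x; at a common corner of two cells the choice is irrelevant by
  \<open>hfn_F_aux\<close>.\<close>

fun hfn :: "nat => (nat => real) => real^2 => real" where
 "hfn 0 a x = a 0 * bc 0 x + a 1 * bc 1 x + a 2 * bc 2 x"
| "hfn (Suc n) a x = (if bc 0 x >= 1/2 then hfn n (hext 0 a) (Gi 0 x)
  else if bc 1 x >= 1/2 then hfn n (hext 1 a) (Gi 1 x) else hfn n (hext 2 a) (Gi 2 x))"

lemma hfn_q: "i \<in> {0,1,2} ==> hfn n a (q i) = a i"
proof (induction n arbitrary: a)
 case 0
 thus ?case using bc_vertex by auto
next
 case (Suc n)
 have G: "Gi i (q i) = q i" using Gi_F[of i "q i"] by simp
 have "hfn (Suc n) a (q i) = hfn n (hext i a) (Gi i (q i))"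
  using Suc.prems bc_vertex[of 0 i] bc_vertex[of 1 i] by auto
 thus ?case unfolding G using Suc.IH[OF Suc.prems] by (simp add: hext_diag)
qed

text \<open>Two cells meet in one corner, where the harmonic extensions agree by
  \<open>hext_sym\<close>.\<close>

lemma hfn_F_aux:
 assumes i: "i \<in> {0,1,2}" and j: "j \<in> {0,1,2}" and x: "x \<in> K" and b: "bc j (F i x) >= 1/2"
 shows "hfn n (hext j a) (Gi j (F i x)) = hfn n (hext i a) x"
proof (cases "i = j")
 case False
 hence "bc j x = 1" using b bc_F[OF j i, of x] bc_le_1[OF K_T[OF x] j] by simp
 hence xj: "x = q j" by (rule bc_eq_1[OF K_T[OF x] j])
 hence "Gi j (F i x) = q i" using sgF_commute[of q i j] by simp
 thus ?thesis using hfn_q[OF i] hfn_q[OF j] hext_sym[OF i j] xj by simp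
qed simp

lemma hfn_F:
 assumes i: "i \<in> {0,1,2}" and x: "x \<in> K"
 shows "hfn (Suc n) a (F i x) = hfn n (hext i a) x"
proof -
 have bi: "bc i (F i x) >= 1/2" using bc_F[OF i i, of x] bc_nonneg[OF K_T[OF x] i] by simp
 consider "bc 0 (F i x) >= 1/2" | "~ bc 0 (F i x) >= 1/2" "bc 1 (F i x) >= 1/2"
  | "~ bc 0 (F i x) >= 1/2" "~ bc 1 (F i x) >= 1/2" "bc 2 (F i x) >= 1/2" using bi i by auto
 thus ?thesis by cases (simp_all add: hfn_F_aux[OF i _ x])
qed

lemma hfn_bounds:
 assumes "x \<in> K" "!!k. k \<in> {0,1,2} ==> m <= a k" "!!k. k \<in> {0,1,2} ==> a k <= M"
 shows "m <= hfn n a x & hfn n a x <= M" using assms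
proof (induction n arbitrary: a x)
 case 0
 have t: "bc 0 x >= 0" "bc 1 x >= 0" "bc 2 x >= 0" "bc 0 x + bc 1 x + bc 2 x = 1"
  using K_T[OF 0(1)] by (auto simp: T_iff)
 have "m * (bc 0 x + bc 1 x + bc 2 x) <= a 0 * bc 0 x + a 1 * bc 1 x + a 2 * bc 2 x"
  unfolding distrib_left using 0(2) t by (intro add_mono mult_right_mono) auto
 moreover have "a 0 * bc 0 x + a 1 * bc 1 x + a 2 * bc 2 x <= M * (bc 0 x + bc 1 x + bc 2 x)"
  unfolding distrib_left using 0(3) t by (intro add_mono mult_right_mono) auto
 ultimately show ?case using t by simp
next
 case (Suc n)
 obtain i y where i: "i \<in> {0,1,2}" "y \<in> K" "x = F i y" using K_cases[OF Suc.prems(1)] by blast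
 have "m <= hfn n (hext i a) y & hfn n (hext i a) y <= M"
  by (rule Suc.IH[OF i(2)]) (use hext_bounds[OF i(1), of _ m a M] Suc.prems in blast)+
 thus ?case unfolding i(3) hfn_F[OF i(1,2)] .
qed

text \<open>Every level reduces the oscillation of the boundary values by 3/5
  (\<open>hext_osc\<close>), and at the bottom both functions lie between the extreme boundary
  values.\<close>

lemma hfn_step:
 assumes "x \<in> K" "!!k l. k \<in> {0,1,2} ==> l \<in> {0,1,2} ==> \<bar>a k - a l\<bar> <= d"
 shows "\<bar>hfn (Suc n) a x - hfn n a x\<bar> <= (3/5) ^ n * d" using assms
proof (induction n arbitrary: a x d)
 case 0
 define m M where "m = min (a 0) (min (a 1) (a 2))" and "M = max (a 0) (max (a 1) (a 2))"
 have mM: "!!k. k \<in> {0,1,2} ==> m <= a k" "!!k. k \<in> {0,1,2} ==> a k <= M" by (auto simp: m_def M_def)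
 have "M - m <= d"
  using 0(2)[of 0 0] 0(2)[of 0 1] 0(2)[of 0 2] 0(2)[of 1 2] by (simp add: m_def M_def min_def max_def abs_le_iff)
 thus ?case
  using hfn_bounds[of x m a M 0, OF 0(1) mM] hfn_bounds[of x m a M "Suc 0", OF 0(1) mM] by (simp add: abs_le_iff del: hfn.simps)
next
 case (Suc n)
 obtain i y where i: "i \<in> {0,1,2}" "y \<in> K" "x = F i y" using K_cases[OF Suc.prems(1)] by blast
 have "\<bar>hfn (Suc n) (hext i a) y - hfn n (hext i a) y\<bar> <= (3/5) ^ n * (3/5 * d)"
  by (rule Suc.IH[OF i(2)]) (rule hext_osc[OF i(1) Suc.prems(2)])
 thus ?case unfolding i(3) hfn_F[OF i(1,2)] by simp
qed

lemma K_union: "K = F 0 ` K \<union> F 1 ` K \<union> F 2 ` K" using K_cases F_K by blast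

lemma F_closed: "closed (F i ` K)"
 by (intro compact_imp_closed compact_continuous_image continuous_intros K_compact)

lemma hfn_cont: "continuous_on K (hfn n a)"
proof (induction n arbitrary: a)
 case 0
 have "continuous_on K (%x. a 0 * bc 0 x + a 1 * bc 1 x + a 2 * bc 2 x)" by (intro continuous_intros)
 thus ?case by (simp add: fun_eq_iff cong: continuous_on_cong)
next
 case (Suc n)
 have c: "continuous_on (F i ` K) (hfn (Suc n) a)" if i: "i \<in> {0,1,2}" for i
 proof -
  have "continuous_on (F i ` K) (Gi i)" unfolding Gi_def by (intro continuous_intros)
  hence "continuous_on (F i ` K) (%x. hfn n (hext i a) (Gi i x))"
   by (rule continuous_on_compose2[OF Suc.IH]) auto
  thus ?thesis by (rule continuous_on_eq) (auto simp: hfn_F[OF i] simp del: hfn.simps)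
 qed
 have "continuous_on (F 0 ` K \<union> F 1 ` K \<union> F 2 ` K) (hfn (Suc n) a)"
  by (intro continuous_on_closed_Un closed_Un F_closed c) auto
 thus ?case using K_union by simp
qed

text \<open>The limit of \<open>hfn\<close>, written as a telescoping series for the Weierstrass
  M-test.\<close>

definition hf :: "(nat => real) => real^2 => real" where
 "hf a x = hfn 0 a x + (\<Sum>n. hfn (Suc n) a x - hfn n a x)"

lemma hf_limit: "uniform_limit K (%n. hfn n a) (hf a) sequentially"
proof -
 define d where "d = \<bar>a 0 - a 1\<bar> + \<bar>a 0 - a 2\<bar> + \<bar>a 1 - a 2\<bar>"
 have d: "\<bar>a k - a l\<bar> <= d" if "k \<in> {0,1,2}" "l \<in> {0,1,2}" for k l using that by (auto simp: d_def)
 have "uniform_limit K (%n x. \<Sum>i<n. hfn (Suc i) a x - hfn i a x) (%x. \<Sum>n. hfn (Suc n) a x - hfn n a x) sequentially"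
 proof (rule Weierstrass_m_test)
  show "norm (hfn (Suc n) a x - hfn n a x) <= (3/5) ^ n * d" if "x \<in> K" for n x
   unfolding real_norm_def by (rule hfn_step[OF that d])
  show "summable (%n. (3/5) ^ n * d)" by (intro summable_mult2 summable_geometric) simp
 qed
 hence "uniform_limit K (%n x. hfn 0 a x + (\<Sum>i<n. hfn (Suc i) a x - hfn i a x)) (hf a) sequentially"
  unfolding hf_def[abs_def] by (intro uniform_limit_intros)
 moreover have "(%n x. hfn 0 a x + (\<Sum>i<n. hfn (Suc i) a x - hfn i a x)) = (%n. hfn n a)"
  using sum_lessThan_telescope[of "%i. hfn i a _"] by (intro ext) simp
 ultimately show ?thesis by (simp only:)
qed

lemma hf_lim: "x \<in> K ==> (%n. hfn n a x) \<longlonglongrightarrow> hf a x" by (rule tendsto_uniform_limitI[OF hf_limit])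

lemma hf_cont: "continuous_on K (hf a)"
 by (rule uniform_limit_theorem[OF always_eventually hf_limit]) (auto intro: hfn_cont)

lemma hf_q: "i \<in> {0,1,2} ==> hf a (q i) = a i"
 using hf_lim[OF q_K, of i a] by (simp add: hfn_q LIMSEQ_const_iff del: hfn.simps)

lemma hf_F: "i \<in> {0,1,2} ==> x \<in> K ==> hf a (F i x) = hf (hext i a) x"
proof -
 assume i: "i \<in> {0,1,2}" and x: "x \<in> K"
 have "(%n. hfn (Suc n) a (F i x)) \<longlonglongrightarrow> hf a (F i x)" by (rule LIMSEQ_Suc[OF hf_lim[OF F_K[OF x i]]])
 hence "(%n. hfn n (hext i a) x) \<longlonglongrightarrow> hf a (F i x)" by (simp only: hfn_F[OF i x])
 thus ?thesis using LIMSEQ_unique[OF _ hf_lim[OF x]] by blast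
qed

lemma hf_Fw: "w \<in> words n ==> x \<in> K ==> hf a (Fw w x) = hf (hexts w a) x"
proof (induction n arbitrary: w a)
 case (Suc n)
 obtain i v where iv: "w = i # v" "i \<in> {0,1,2}" "v \<in> words n"
  using Suc.prems(1) unfolding words_Suc by (elim imageE) (simp add: case_prod_unfold mem_Times_iff)
 thus ?case using Suc.IH[OF iv(3) Suc.prems(2)] hf_F[OF iv(2) Fw_K[OF Suc.prems(2) iv(3)]] by simp
qed (simp add: words_0)

lemma cv_hf: "w \<in> words n ==> j \<in> {0,1,2} ==> cv (hf a) w j = hexts w a j" by (simp add: cv_def hf_Fw q_K hf_q)

lemma hf_ge: "x \<in> K ==> (!!k. k \<in> {0,1,2} ==> m <= a k) ==> m <= hf a x"
proof -
 assume x: "x \<in> K" and m: "!!k. k \<in> {0,1,2} ==> m <= a k"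
 have "m <= hfn n a x" for n
 proof -
  have "!!k. k \<in> {0,1,2} ==> a k <= max (a 0) (max (a 1) (a 2))" by auto
  thus ?thesis using hfn_bounds[of x m a "max (a 0) (max (a 1) (a 2))" n, OF x m] by blast
 qed
 thus ?thesis by (intro LIMSEQ_le_const[OF hf_lim[OF x]]) auto
qed

text \<open>All discrete energies against a harmonic function coincide, by
  \<open>cell_energy\<close> with the empty prefix.\<close>

lemma En_hf: "En n (hf a) f = E0 a (cv f [])"
proof -
 have "En n (hf a) f = (\<Sum>v\<in>words n. (5/3) ^ n * E0 (cv f ([] @ v)) (hexts v a))"
  unfolding En_def sum_distrib_left
 proof (intro sum.cong refl)
  fix w assume w: "w \<in> words n"
  have "E0 (cv (hf a) w) (cv f w) = E0 (hexts w a) (cv f w)" by (intro E0_cong) (simp_all add: cv_hf[OF w])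
  thus "(5/3) ^ n * E0 (cv (hf a) w) (cv f w) = (5/3) ^ n * E0 (cv f ([] @ w)) (hexts w a)"
   by (simp add: E0_commute[of "hexts w a"])
 qed
 thus ?thesis unfolding cell_energy by (simp add: E0_commute[of a])
qed

lemma hf_dom: "hf a \<in> fdom SG" by (rule SG_domI[OF hf_cont, of _ "E0 a (cv (hf a) [])"]) (simp add: En_hf)

lemma hf_energy: "f \<in> fdom SG ==> energy SG (hf a) f = E0 a (cv f [])"
 using LIMSEQ_unique[OF SG_energy_lim[OF hf_dom]] by (simp add: En_hf)

text \<open>The difference \<phi> of the two functions vanishes on the boundary and is orthogonal to
  both, so its energy is 0, and the Poincare inequality makes it constant.\<close>

lemma harmonic_eq_hf:
 assumes h: "harmonic SG h" and x: "x \<in> K"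
 shows "h x = hf (%j. h (q j)) x"
proof -
 define a where "a = (%j. h (q j))"
 have hd: "h \<in> fdom SG" and h0: "!!\<phi>. \<phi> \<in> fdom_bdry SG ==> energy SG h \<phi> = 0"
  using h by (auto simp: harmonic_def)
 define \<phi> where "\<phi> x = h x - hf a x" for x
 have \<phi>d: "\<phi> \<in> fdom SG" unfolding \<phi>_def by (rule SG_add(2)[OF hd hf_dom])
 have \<phi>q: "\<phi> (q i) = 0" if "i \<in> {0,1,2}" for i using that by (simp add: \<phi>_def hf_q a_def)
 hence \<phi>0: "\<phi> \<in> fdom_bdry SG" using \<phi>d by (simp add: fdom_bdry_def SG_simps(2))
 have "(%n. En n h \<phi> - En n (hf a) \<phi>) \<longlonglongrightarrow> energy SG h \<phi> - energy SG (hf a) \<phi>"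
  by (intro tendsto_diff SG_energy_lim hd hf_dom \<phi>d)
 moreover have "En n h \<phi> - En n (hf a) \<phi> = En n \<phi> \<phi>" for n unfolding \<phi>_def by (rule En_diff_left[symmetric])
 moreover have "energy SG (hf a) \<phi> = 0" unfolding hf_energy[OF \<phi>d] using \<phi>q by (simp add: E0_def cv_def)
 ultimately have "(%n. En n \<phi> \<phi>) \<longlonglongrightarrow> 0" using h0[OF \<phi>0] by simp
 hence "Elim \<phi> = 0" using LIMSEQ_unique[OF Elim[OF \<phi>d]] by blast
 hence "\<bar>\<phi> x - \<phi> (q 0)\<bar> <= 0" using SG_poincare[OF \<phi>d x q_K[of 0]] by simp
 thus ?thesis using \<phi>q[of 0] by (simp add: \<phi>_def a_def)
qed

text \<open>A strong minimum principle. In a cell away from q j all corner values are at least a l /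
  5 > 0, so a zero lies in the cell at q j, where the hypotheses hold again on a smaller
  scale.\<close>

lemma hf_zero_vertex:
 assumes j: "j \<in> {0,1,2}"
 shows "x \<in> K ==> a j = 0 ==> (!!k. k \<in> {0,1,2} ==> k ~= j ==> a k > 0) ==> hf a x = 0 ==>
  dist x (q j) <= diam / 2 ^ n"
proof (induction n arbitrary: a x)
 case 0
 thus ?case using diam[OF K_T q_T[OF j]] by simp
next
 case (Suc n)
 obtain l y where l: "l \<in> {0,1,2}" "y \<in> K" "x = F l y" using K_cases[OF Suc.prems(1)] by blast
 have a0: "a 0 >= 0" "a 1 >= 0" "a 2 >= 0"
  using Suc.prems(2) Suc.prems(3)[of 0] Suc.prems(3)[of 1] Suc.prems(3)[of 2] by (cases "j = 0"; cases "j = 1"; cases "j = 2"; force)+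
 have lj: "l = j"
 proof (rule ccontr)
  assume "l ~= j"
  hence al: "a l > 0" using Suc.prems(3) l(1) by blast
  have pos: "hext l a k >= a l / 5" if "k \<in> {0,1,2}" for k
  proof (cases "k = l")
   case True thus ?thesis using al by (simp add: hext_diag)
  next
   case False
   have "a k >= 0" using that a0 by auto
   moreover have "hext l a k = (a 0 + a 1 + a 2 + a l + a k) / 5" using False by (simp add: hext_def)
   ultimately show ?thesis using a0 by simp
  qed
  have "a l / 5 <= hf (hext l a) y" by (rule hf_ge[OF l(2) pos])
  thus False using Suc.prems(4) al hf_F[OF l(1,2)] l(3) by simp
 qed
 have p: "hext j a k > 0" if k: "k \<in> {0,1,2}" "k ~= j" for k
 proof -
  have "a k > 0" using Suc.prems(3) k by blast
  moreover have "hext j a k = (a 0 + a 1 + a 2 + a j + a k) / 5" using k by (simp add: hext_def)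
  ultimately show ?thesis using a0 Suc.prems(2) by simp
 qed
 have "dist y (q j) <= diam / 2 ^ n"
  by (rule Suc.IH[OF l(2) _ p]) (use Suc.prems hf_F[OF l(1,2)] l(3) lj in "auto simp: hext_diag")
 moreover have "dist x (q j) = dist y (q j) / 2" using dist_sgF[of q j y "q j"] l(3) lj by simp
 ultimately show ?case by simp
qed

lemma hf_zero_vertex_eq:
 assumes "j \<in> {0,1,2}" "x \<in> K" "a j = 0" "!!k. k \<in> {0,1,2} ==> k ~= j ==> a k > 0" "hf a x = 0"
 shows "x = q j"
proof (rule ccontr)
 assume "x ~= q j"
 then obtain n where "diam / 2 ^ n < dist x (q j)" using cells_small[of "dist x (q j)"] by auto
 thus False using hf_zero_vertex[OF assms, of n] by simp
qed

text \<open>Since \<open>hext i\<close> is invertible, every harmonic function on a cell extends to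
  the whole gasket; this is what makes rescaling possible in \<open>hf_separates\<close>.\<close>

lemma hext_surj:
 assumes "i \<in> {0,1,2}" obtains a where "!!k. k \<in> {0,1,2} ==> hext i a k = b k"
proof -
 consider "i = 0" | "i = 1" | "i = 2" using assms by auto
 thus ?thesis
 proof cases
  case 1
  show ?thesis by (rule that[of "%k. if k = 0 then b 0 else if k = 1 then (10 * b 1 - 5 * b 2 - 2 * b 0) / 3
   else (10 * b 2 - 5 * b 1 - 2 * b 0) / 3"]) (use 1 in "auto simp: hext_vals field_simps")
 next
  case 2
  show ?thesis by (rule that[of "%k. if k = 1 then b 1 else if k = 0 then (10 * b 0 - 5 * b 2 - 2 * b 1) / 3
   else (10 * b 2 - 5 * b 0 - 2 * b 1) / 3"]) (use 2 in "auto simp: hext_vals field_simps")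
 next
  case 3
  show ?thesis by (rule that[of "%k. if k = 2 then b 2 else if k = 0 then (10 * b 0 - 5 * b 1 - 2 * b 2) / 3
   else (10 * b 1 - 5 * b 0 - 2 * b 2) / 3"]) (use 3 in "auto simp: hext_vals field_simps")
 qed
qed

lemma hfn_cong: "(!!k. k \<in> {0,1,2} ==> a k = b k) ==> hfn n a x = hfn n b x"
proof (induction n arbitrary: a b x)
 case (Suc n)
 have "hext i a k = hext i b k" if "i \<in> {0,1,2}" "k \<in> {0,1,2}" for i k
  using Suc.prems that by (simp add: hext_def)
 hence "hfn n (hext i a) y = hfn n (hext i b) y" if "i \<in> {0,1,2}" for i y using that by (intro Suc.IH) auto
 thus ?case by simp
qed simp

lemma hf_cong: "(!!k. k \<in> {0,1,2} ==> a k = b k) ==> hf a x = hf b x"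
 unfolding hf_def by (simp only: hfn_cong[of a b])

text \<open>
 Points in different cells \<open>F\<^sub>i K\<close> and \<open>F\<^sub>j K\<close> are separated by the harmonic function with boundary
 values \<open>e\<^sub>i - e\<^sub>j\<close>; otherwise one may rescale.
\<close>

lemma hf_separates:
 "x \<in> K ==> y \<in> K ==> (!!a. hf a x = hf a y) ==> dist x y <= diam / 2 ^ n"
proof (induction n arbitrary: x y)
 case 0
 thus ?case using diam[OF K_T K_T] by simp
next
 case (Suc n)
 obtain i x' where i: "i \<in> {0,1,2}" "x' \<in> K" "x = F i x'" using K_cases[OF Suc.prems(1)] by blast
 obtain j y' where j: "j \<in> {0,1,2}" "y' \<in> K" "y = F j y'" using K_cases[OF Suc.prems(2)] by blast
 show ?case
 proof (cases "i = j")
  case True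
  have "hf b x' = hf b y'" for b
  proof -
   obtain a where a: "!!k. k \<in> {0,1,2} ==> hext i a k = b k" using hext_surj[OF i(1)] by blast
   have "hf b x' = hf (hext i a) x'" "hf b y' = hf (hext i a) y'" by (rule hf_cong, simp add: a)+
   thus ?thesis using Suc.prems(3)[of a] hf_F[OF i(1,2)] hf_F[OF i(1) j(2)] i(3) j(3) True by simp
  qed
  hence "dist x' y' <= diam / 2 ^ n" by (rule Suc.IH[OF i(2) j(2)])
  thus ?thesis using i(3) j(3) True by (simp add: dist_sgF)
 next
  case False
  define a :: "nat => real" where "a k = (if k = i then 1 else if k = j then -1 else 0)" for k
  have sum0: "a 0 + a 1 + a 2 = 0" using i(1) j(1) False by (auto simp: a_def)
  have ai: "hext i a k = (if k = i then 1 else if k = j then 0 else 1/5)" if "k \<in> {0,1,2}" for k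
   unfolding hext_def sum0 using False by (simp add: a_def)
  have aj: "hext j (%k. - a k) k = (if k = j then 1 else if k = i then 0 else 1/5)" if "k \<in> {0,1,2}" for k
  proof -
   have "- a 0 + - a 1 + - a 2 = 0" using sum0 by simp
   thus ?thesis unfolding hext_def using False by (simp add: a_def)
  qed
  have nonneg: "0 <= hf (hext i a) x'" "0 <= hf (hext j (%k. - a k)) y'"
   by (rule hf_ge[OF i(2)], simp add: ai) (rule hf_ge[OF j(2)], simp add: aj)
  have neg: "hf (%k. - a k) z = - hf a z" if z: "z \<in> K" for z
  proof -
   have h: "hfn n (%k. - b k) z = - hfn n b z" for n b z
   proof (induction n arbitrary: b z)
    case (Suc n)
    have "hext i (%k. - b k) = (%k. - hext i b k)" for i by (auto simp: hext_def field_simps)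
    thus ?case using Suc.IH by simp
   qed (simp add: algebra_simps)
   have "(%n. - hfn n a z) \<longlonglongrightarrow> - hf a z" by (intro tendsto_minus hf_lim z)
   thus ?thesis using LIMSEQ_unique hf_lim[OF z, of "%k. - a k"] unfolding h by blast
  qed
  have eq: "hf (hext i a) x' = hf a y" "hf (hext j (%k. - a k)) y' = - hf a y"
   using Suc.prems(3)[of a] hf_F[OF i(1,2), of a] hf_F[OF j(1,2), of "%k. - a k"] neg[OF Suc.prems(2)] i(3) j(3) by auto
  \<comment> \<open>The function is nonnegative on the one cell and nonpositive on the other, so the
    common value is 0. By the minimum principle it is taken only at the corner shared by the two
    cells.\<close>
  hence z: "hf (hext i a) x' = 0" "hf (hext j (%k. - a k)) y' = 0" using nonneg by linarith+
  have "x' = q j" by (rule hf_zero_vertex_eq[OF j(1) i(2) _ _ z(1)]) (use ai j(1) False in auto)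
  moreover have "y' = q i" by (rule hf_zero_vertex_eq[OF i(1) j(2) _ _ z(2)]) (use aj i(1) False in auto)
  ultimately have "x = y" using i(3) j(3) sgF_commute by simp
  thus ?thesis using diam_nonneg by simp
 qed
qed

lemma SG_separate:
 assumes "x \<in> K" "y \<in> K" "x ~= y" shows "\<exists>f\<in>fdom SG. f x ~= f y"
proof (rule ccontr)
 assume "~ (\<exists>f\<in>fdom SG. f x ~= f y)"
 hence "hf a x = hf a y" for a using hf_dom by blast
 hence "dist x y <= diam / 2 ^ n" for n by (rule hf_separates[OF assms(1,2)])
 moreover obtain n where "diam / 2 ^ n < dist x y" using cells_small[of "dist x y"] assms(3) by auto
 ultimately show False by (meson not_less)
qed

end

section \<open>The energy measure of a harmonic function\<close>

text \<open>h and \<open>hf a\<close> are kept apart because they are only known to agree on the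
  gasket.\<close>

locale gasket_harmonic = gasket_geom +
 fixes a :: "nat => real" and h :: "real^2 => real"
 assumes nondeg: "E0 a a > 0" and h_hf: "!!x. x \<in> K ==> h x = hf a x"
begin

abbreviation "ha w \<equiv> hexts w a"

definition pm :: "nat list => real" where "pm w = (5/3) ^ length w * E0 (ha w) (ha w)"

lemma pm_pos: "w \<in> words n ==> pm w > 0" unfolding pm_def by (intro mult_pos_pos hexts_E0_pos nondeg) auto

lemma pm_nonneg: "0 <= pm w" by (simp add: pm_def)

lemma pm_split: "pm w = pm (w @ [0]) + pm (w @ [1]) + pm (w @ [2])"
proof -
 have "5/3 * (\<Sum>i\<in>{0,1,2}. E0 (hext i (ha w)) (hext i (ha w))) = E0 (ha w) (ha w)"
  by (rule E0_hext_sum) (auto simp: hext_diag intro: hext_sym)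
 hence "pm w = (5/3) ^ length w * (5/3 * (E0 (hext 0 (ha w)) (hext 0 (ha w))
   + E0 (hext 1 (ha w)) (hext 1 (ha w)) + E0 (hext 2 (ha w)) (hext 2 (ha w))))" unfolding sum012 pm_def by simp
 thus ?thesis by (simp add: pm_def hexts_append distrib_left)
qed

lemma pm_le: "w \<in> words n ==> pm w <= (3/5) ^ n * E0 a a"
proof (induction n arbitrary: w)
 case 0
 thus ?case by (simp add: words_0 pm_def)
next
 case (Suc n)
 obtain v i where v: "w = v @ [i]" "v \<in> words n" "i \<in> {0,1,2}"
  using Suc.prems by (cases w rule: rev_cases) (auto simp: words_def)
 have "pm w = (5/3) ^ Suc (length v) * E0 (hext i (ha v)) (hext i (ha v))"
  by (simp add: v(1) pm_def hexts_append)
 also have "\<dots> <= (5/3) ^ Suc (length v) * (9/25 * E0 (ha v) (ha v))" by (intro mult_left_mono E0_hext_le v) auto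
 also have "\<dots> = 3/5 * pm v" by (simp add: pm_def)
 also have "\<dots> <= 3/5 * ((3/5) ^ n * E0 a a)" using Suc.IH[OF v(2)] by simp
 finally show ?case by simp
qed

text \<open>
 The measure is the image of Lebesgue measure under the coding map that subdivides the interval
 \<open>[0, pm [])\<close> in the proportions prescribed by the cell masses \<open>pm\<close>.
\<close>

primrec lft_rev :: "nat list => real" where
 "lft_rev [] = 0"
| "lft_rev (i # r) = lft_rev r + (\<Sum>j<i. pm (rev r @ [j]))"

definition lft :: "nat list => real" where "lft w = lft_rev (rev w)"

text \<open>Half-open, so that the intervals of the three subcells partition the interval of the
  cell, and every point has exactly one code.\<close>

definition Iv :: "nat list => real set" where "Iv w = {lft w ..< lft w + pm w}"

lemma lft_snoc: "lft (w @ [i]) = lft w + (\<Sum>j<i. pm (w @ [j]))" by (simp add: lft_def)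

lemma lft_012: "lft (w @ [0]) = lft w" "lft (w @ [1]) = lft w + pm (w @ [0])"
 "lft (w @ [2]) = lft w + pm (w @ [0]) + pm (w @ [1])"
proof -
 have "{..<1::nat} = {0}" "{..<2::nat} = {0,1}" by auto
 thus "lft (w @ [0]) = lft w" "lft (w @ [1]) = lft w + pm (w @ [0])"
  "lft (w @ [2]) = lft w + pm (w @ [0]) + pm (w @ [1])" by (simp_all add: lft_snoc)
qed

definition digit :: "nat list => real => nat" where
 "digit w t = (if t < lft (w @ [1]) then 0 else if t < lft (w @ [2]) then 1 else 2)"

primrec code :: "real => nat => nat list" where
 "code t 0 = []"
| "code t (Suc n) = code t n @ [digit (code t n) t]"

lemma Iv_snoc: "i \<in> {0,1,2} ==> t \<in> Iv (w @ [i]) \<longleftrightarrow> t \<in> Iv w & digit w t = i"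
proof -
 assume i: "i \<in> {0,1,2}"
 have p: "pm (w @ [0]) >= 0" "pm (w @ [1]) >= 0" "pm (w @ [2]) >= 0" by (rule pm_nonneg)+
 consider "i = 0" | "i = 1" | "i = 2" using i by auto
 thus ?thesis by cases (use p pm_split[of w] in "auto simp: Iv_def digit_def lft_012")
qed

lemma digit_mem: "digit w t \<in> {0,1,2}" by (simp add: digit_def)

lemma code_mem: "t \<in> Iv [] ==> code t n \<in> words n & t \<in> Iv (code t n)"
proof (induction n)
 case (Suc n)
 thus ?case using words_snoc[OF _ digit_mem] Iv_snoc[OF digit_mem, of t "code t n" "code t n"] by simp
qed (simp add: words_0)

lemma code_unique: "w \<in> words n ==> t \<in> Iv w ==> code t n = w & t \<in> Iv []"
proof (induction n arbitrary: w)
 case (Suc n)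
 obtain v i where v: "w = v @ [i]" "v \<in> words n" "i \<in> {0,1,2}"
  using Suc.prems by (cases w rule: rev_cases) (auto simp: words_def)
 thus ?case using Suc.prems(2) Suc.IH[OF v(2)] Iv_snoc[OF v(3), of t v] by simp
qed (simp add: words_0)

lemma code_append: "\<exists>v. code t (n + k) = code t n @ v" by (induction k) auto

definition pt :: "real => real^2" where "pt t = lim (%n. Fw (code t n) (q 0))"

lemma Fw_cell_closed: "closed (Fw w ` K)"
 by (intro compact_imp_closed compact_continuous_image continuous_on_sgFw K_compact)

lemma pt_lim:
 assumes t: "t \<in> Iv []"
 shows "(%n. Fw (code t n) (q 0)) \<longlonglongrightarrow> pt t" and pt_cell: "pt t \<in> Fw (code t n) ` K"
proof -
 have in_cell: "Fw (code t (n + k)) (q 0) \<in> Fw (code t n) ` K" for n k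
 proof -
  obtain v where v: "code t (n + k) = code t n @ v" using code_append by blast
  have "set v \<subseteq> {0,1,2}" using code_mem[OF t, of "n + k"] v by (auto simp: words_def)
  hence "v \<in> words (length v)" by (simp add: words_def)
  thus ?thesis unfolding v sgFw_append by (intro imageI Fw_K q_K) auto
 qed
 have "Cauchy (%n. Fw (code t n) (q 0))"
 proof (rule metric_CauchyI)
  fix e :: real assume "e > 0"
  then obtain N where N: "diam / 2 ^ N < e" using cells_small by blast
  have "dist (Fw (code t m) (q 0)) (Fw (code t n) (q 0)) < e" if mn: "m >= N" "n >= N" for m n
  proof -
   obtain x y where "x \<in> K" "Fw (code t m) (q 0) = Fw (code t N) x" "y \<in> K" "Fw (code t n) (q 0) = Fw (code t N) y"
    using in_cell[of N "m - N"] in_cell[of N "n - N"] mn by auto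
   thus ?thesis using cell_diam[of "code t N" N x y] code_mem[OF t, of N] K_T N by auto
  qed
  thus "\<exists>N. ALL m>=N. ALL n>=N. dist (Fw (code t m) (q 0)) (Fw (code t n) (q 0)) < e" by blast
 qed
 thus lim: "(%n. Fw (code t n) (q 0)) \<longlonglongrightarrow> pt t"
  unfolding pt_def by (simp add: Cauchy_convergent_iff convergent_LIMSEQ_iff)
 show "pt t \<in> Fw (code t n) ` K"
 proof (rule closed_sequentially[OF Fw_cell_closed])
  show "Fw (code t (k + n)) (q 0) \<in> Fw (code t n) ` K" for k using in_cell[of n k] by (simp add: add.commute)
  show "(%k. Fw (code t (k + n)) (q 0)) \<longlonglongrightarrow> pt t" using lim by (rule LIMSEQ_ignore_initial_segment)
 qed
qed

lemma pt_K: "t \<in> Iv [] ==> pt t \<in> K" using pt_cell[of t 0] by simp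

definition base :: "real measure" where "base = restrict_space lborel (Iv [])"

lemma pt_measurable: "pt \<in> measurable base (restrict_space borel K)"
proof (rule measurable_restrict_space2)
 show "pt \<in> space base \<rightarrow> K" by (auto simp: base_def space_restrict_space pt_K)
 show "pt \<in> borel_measurable base"
 proof (rule borel_measurable_LIMSEQ_metric)
  fix n
  \<comment> \<open>The corner of the cell coded by t is a step function on the intervals
    \<open>Iv w\<close>; measurability of \<open>pt\<close> follows in the limit.\<close>
  have "(%t. \<Sum>w\<in>words n. indicator (Iv w) t *\<^sub>R Fw w (q 0)) \<in> borel_measurable base" unfolding base_def
   by (intro measurable_restrict_space1 borel_measurable_sum borel_measurable_scaleR
     borel_measurable_indicator borel_measurable_const) (simp add: Iv_def)
  moreover have "(\<Sum>w\<in>words n. indicator (Iv w) t *\<^sub>R Fw w (q 0)) = Fw (code t n) (q 0)" if "t \<in> space base" for t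
  proof -
   have t: "t \<in> Iv []" using that by (simp add: base_def space_restrict_space)
   have "(\<Sum>w\<in>words n. indicator (Iv w) t *\<^sub>R Fw w (q 0)) = (\<Sum>w\<in>words n. if w = code t n then Fw w (q 0) else 0)"
   proof (intro sum.cong refl)
    fix w assume w: "w \<in> words n"
    have "t \<in> Iv w \<longleftrightarrow> w = code t n" using code_unique[OF w, of t] code_mem[OF t, of n] by blast
    thus "indicator (Iv w) t *\<^sub>R Fw w (q 0) = (if w = code t n then Fw w (q 0) else 0)"
     by (simp add: indicator_def)
   qed
   also have "\<dots> = Fw (code t n) (q 0)"
    using code_mem[OF t, of n] by (simp only: sum.delta' sum.delta finite_words if_True)
   finally show ?thesis .
  qed
  ultimately show "(%t. Fw (code t n) (q 0)) \<in> borel_measurable base" by (simp cong: measurable_cong)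
 next
  fix t assume "t \<in> space base"
  thus "(%n. Fw (code t n) (q 0)) \<longlonglongrightarrow> pt t" by (intro pt_lim) (simp add: base_def space_restrict_space)
 qed
qed

definition Mh :: "(real^2) measure" where "Mh = distr base (restrict_space borel K) pt"

lemma Iv_sets [measurable]: "Iv w \<in> sets borel" by (simp add: Iv_def)

lemma Iv_measure: "emeasure lborel (Iv w) = ennreal (pm w)" by (simp add: Iv_def pm_nonneg)

lemma sets_Mh: "sets Mh = sets (restrict_space borel K)" and space_Mh: "space Mh = K"
 by (simp_all add: Mh_def space_restrict_space)

lemma Mh_emeasure:
 assumes A: "A \<in> sets (restrict_space borel K)"
 shows "emeasure Mh A = emeasure lborel (pt -` A \<inter> Iv [])" "pt -` A \<inter> Iv [] \<in> sets borel"
proof -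
 have s: "pt -` A \<inter> Iv [] \<in> sets base"
  using measurable_sets[OF pt_measurable A] by (simp add: base_def space_restrict_space)
 thus "pt -` A \<inter> Iv [] \<in> sets borel" by (auto simp: base_def sets_restrict_space)
 have "emeasure Mh A = emeasure base (pt -` A \<inter> Iv [])"
  unfolding Mh_def using emeasure_distr[OF pt_measurable A] by (simp add: base_def space_restrict_space)
 thus "emeasure Mh A = emeasure lborel (pt -` A \<inter> Iv [])"
  unfolding base_def by (subst (asm) emeasure_restrict_space) auto
qed

lemma Mh_radon: "radon_on SG Mh"
proof -
 have KK: "K \<in> sets (restrict_space borel K)"
  using sets.top[of "restrict_space borel K"] by (simp add: space_restrict_space)
 have "pt -` K \<inter> Iv [] = Iv []" using pt_K by auto
 hence "emeasure Mh K = ennreal (pm [])" using Mh_emeasure(1)[OF KK] Iv_measure by simp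
 hence "finite_measure Mh" by (intro finite_measureI) (simp add: space_Mh)
 thus ?thesis by (simp add: radon_on_def SG_simps sets_Mh)
qed

sublocale Mh: finite_measure Mh using Mh_radon unfolding radon_on_def by blast

lemma Mh_total: "measure Mh K = pm []"
proof -
 have KK: "K \<in> sets (restrict_space borel K)"
  using sets.top[of "restrict_space borel K"] by (simp add: space_restrict_space)
 have "pt -` K \<inter> Iv [] = Iv []" using pt_K by auto
 hence "emeasure Mh K = ennreal (pm [])" using Mh_emeasure(1)[OF KK] Iv_measure by simp
 thus ?thesis by (simp add: measure_def pm_nonneg)
qed

lemma closed_sets_Mh: "closed A ==> A \<subseteq> K ==> A \<in> sets Mh"
 unfolding sets_Mh sets_restrict_space by (intro image_eqI[of _ _ A]) auto

text \<open>If x lies in two first-level cells, then \<open>F_meet\<close> and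
  \<open>Fw_eq_q\<close> force its words to have the form k l l ... l, of which there are 9.
  Otherwise the first letter is determined and can be removed.\<close>

lemma cells_at_point: "card {w \<in> words n. x \<in> Fw w ` T} <= 9"
proof (induction n arbitrary: x)
 case 0
 have "card {w \<in> words 0. x \<in> Fw w ` T} <= card {[] :: nat list}" by (rule card_mono) (auto simp: words_0)
 thus ?case by simp
next
 case (Suc n)
 let ?A = "{w \<in> words (Suc n). x \<in> Fw w ` T}"
 have dec: "\<exists>i\<in>{0,1,2}. \<exists>v\<in>words n. \<exists>y\<in>T. w = i # v & x = F i (Fw v y)" if "w \<in> ?A" for w
  using that unfolding words_Suc by auto
 show ?case
 proof (cases "\<exists>i\<in>{0,1,2}. \<exists>j\<in>{0,1,2}. i ~= j & x \<in> F i ` T & x \<in> F j ` T")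
  case True
  then obtain i j where ij: "i \<in> {0,1,2}" "j \<in> {0,1,2}" "i ~= j" "x \<in> F i ` T" "x \<in> F j ` T" by blast
  have "?A \<subseteq> (%(k, l). k # replicate n l) ` ({0,1,2} \<times> {0,1,2::nat})"
  proof
   fix w assume "w \<in> ?A"
   then obtain k v y where k: "k \<in> {0,1,2}" "v \<in> words n" "y \<in> T" "w = k # v" "x = F k (Fw v y)" using dec by blast
   obtain l z where l: "l \<in> {0,1,2}" "k ~= l" "z \<in> T" "x = F l z" using ij by (cases "k = i") blast+
   have "Fw v y = q l" using F_meet[OF k(1) l(1,2) Fw_T'[OF k(3,2)] l(3)] k(5) l(4) by simp
   hence "set v \<subseteq> {l}" using Fw_eq_q[OF _ k(3) l(1)] k(2) by (auto simp: words_def)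
   hence "v = replicate n l" using words_length[OF k(2)] by (metis replicate_eqI singletonD subsetD)
   thus "w \<in> (%(k, l). k # replicate n l) ` ({0,1,2} \<times> {0,1,2::nat})" using k(1,4) l(1) by auto
  qed
  hence "card ?A <= card ((%(k, l). k # replicate n l) ` ({0,1,2} \<times> {0,1,2::nat}))" by (intro card_mono) auto
  also have "\<dots> <= card ({0,1,2::nat} \<times> {0,1,2::nat})" by (rule card_image_le) auto
  finally show ?thesis by (simp add: card_cartesian_product)
 next
  case False
  show ?thesis
  proof (cases "?A = {}")
   case True
   thus ?thesis by (simp only: card.empty)
  next
   case ne: False
   then obtain w0 where "w0 \<in> ?A" by blast
   then obtain i v0 y0 where i: "i \<in> {0,1,2}" "v0 \<in> words n" "y0 \<in> T" "x = F i (Fw v0 y0)" using dec by blast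
   have "?A \<subseteq> (#) i ` {v \<in> words n. Fw v0 y0 \<in> Fw v ` T}"
   proof
    fix w assume "w \<in> ?A"
    then obtain k v y where k: "k \<in> {0,1,2}" "v \<in> words n" "y \<in> T" "w = k # v" "x = F k (Fw v y)" using dec by blast
    have "x \<in> F i ` T" using Fw_T'[OF i(3,2)] i(4) by blast
    moreover have "x \<in> F k ` T" using Fw_T'[OF k(3,2)] k(5) by blast
    ultimately
    have "k = i" using False i(1) k(1) by blast
    hence "Fw v0 y0 = Fw v y" using i(4) k(5) by (simp add: sgF_inj)
    thus "w \<in> (#) i ` {v \<in> words n. Fw v0 y0 \<in> Fw v ` T}" using k \<open>k = i\<close> by blast
   qed
   hence "card ?A <= card ((#) i ` {v \<in> words n. Fw v0 y0 \<in> Fw v ` T})" by (intro card_mono) auto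
   also have "\<dots> <= card {v \<in> words n. Fw v0 y0 \<in> Fw v ` T}" by (rule card_image_le) auto
   finally show ?thesis using Suc.IH[of "Fw v0 y0"] by linarith
  qed
 qed
qed

text \<open>At most 9 cells of level n contain x, and each has mass at most (3/5)^n times the total
  energy.\<close>

lemma Mh_point: "x \<in> K ==> emeasure Mh {x} = 0"
proof -
 assume x: "x \<in> K"
 have xs: "{x} \<in> sets Mh" using x by (intro closed_sets_Mh) auto
 have le: "measure Mh {x} <= 9 * E0 a a * (3/5) ^ n" for n
 proof -
  let ?C = "{w \<in> words n. x \<in> Fw w ` T}"
  have "pt -` {x} \<inter> Iv [] \<subseteq> (\<Union>w\<in>?C. Iv w)"
  proof
   fix t assume "t \<in> pt -` {x} \<inter> Iv []"
   hence t: "t \<in> Iv []" "pt t = x" by auto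
   have "x \<in> Fw (code t n) ` T" using pt_cell[OF t(1), of n] t(2) K_T by blast
   thus "t \<in> (\<Union>w\<in>?C. Iv w)" using code_mem[OF t(1), of n] by blast
  qed
  hence "emeasure Mh {x} <= emeasure lborel (\<Union>w\<in>?C. Iv w)"
   using xs unfolding sets_Mh by (subst Mh_emeasure(1)) (auto intro!: emeasure_mono)
  also have "\<dots> <= (\<Sum>w\<in>?C. emeasure lborel (Iv w))" by (rule emeasure_subadditive_finite) auto
  also have "\<dots> = ennreal (\<Sum>w\<in>?C. pm w)" unfolding Iv_measure by (rule sum_ennreal) (rule pm_nonneg)
  finally have "measure Mh {x} <= (\<Sum>w\<in>?C. pm w)" by (simp add: Mh.emeasure_eq_measure sum_nonneg pm_nonneg)
  also have "\<dots> <= of_nat (card ?C) * ((3/5) ^ n * E0 a a)" by (rule sum_bounded_above) (auto intro: pm_le)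
  also have "\<dots> <= 9 * ((3/5) ^ n * E0 a a)" using cells_at_point[of n x] nondeg by (intro mult_right_mono) auto
  finally show ?thesis by (simp add: mult_ac)
 qed
 have "(%n. 9 * E0 a a * (3/5) ^ n) \<longlonglongrightarrow> 9 * E0 a a * 0" by (intro tendsto_intros LIMSEQ_power_zero) simp
 hence "measure Mh {x} <= 0" using le by (intro LIMSEQ_le_const[where X="%n. 9 * E0 a a * (3/5) ^ n"]) auto
 thus ?thesis by (simp add: Mh.emeasure_eq_measure order_antisym)
qed

lemma finite_sgV: "finite (sgV q n)" unfolding sgV_eq by auto

lemma sgV_K: "sgV q n \<subseteq> K" unfolding sgV_eq using Fw_K[OF q_K] by auto

lemma sgV_null: "AE x in Mh. x \<notin> sgV q n"
proof -
 have "(\<Union>x\<in>sgV q n. {x}) \<in> null_sets Mh"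
  by (intro null_sets_UN' countable_finite finite_sgV null_setsI Mh_point closed_sets_Mh)
   (use sgV_K in auto)
 hence "sgV q n \<in> null_sets Mh" by simp
 thus ?thesis by (rule AE_not_in)
qed

text \<open>Cells without the vertices of their level: these are disjoint within a level, and only a
  null set is lost.\<close>

definition Kc :: "nat list => (real^2) set" where "Kc w = Fw w ` K - sgV q (length w)"

lemma Kc_sets [measurable]: "w \<in> words n ==> Kc w \<in> sets Mh"
proof -
 assume w: "w \<in> words n"
 have "Fw w ` K \<in> sets Mh" using Fw_K[OF _ w] by (intro closed_sets_Mh Fw_cell_closed) auto
 moreover have "sgV q (length w) \<in> sets Mh" by (intro closed_sets_Mh finite_imp_closed finite_sgV sgV_K)
 ultimately show ?thesis unfolding Kc_def by auto
qed

lemma Kc_disjoint: "w \<in> words n ==> w' \<in> words n ==> x \<in> Kc w ==> x \<in> Kc w' ==> w = w'"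
proof (rule ccontr)
 assume w: "w \<in> words n" "w' \<in> words n" and x: "x \<in> Kc w" "x \<in> Kc w'" and ne: "w ~= w'"
 obtain y where y: "y \<in> K" "x = Fw w y" using x(1) by (auto simp: Kc_def)
 obtain z where z: "z \<in> K" "x = Fw w' z" using x(2) by (auto simp: Kc_def)
 obtain i where "i \<in> {0,1,2}" "y = q i" using cells_meet[OF w ne K_T[OF y(1)] K_T[OF z(1)]] y z by auto
 hence "x \<in> sgV q n" unfolding y(2) sgV_eq using w(1) by blast
 thus False using x(1) words_length[OF w(1)] by (simp add: Kc_def)
qed

lemma sgV_mono: "sgV q n \<subseteq> sgV q (n + k)"
proof
 fix x assume "x \<in> sgV q n"
 then obtain w j where w: "w \<in> words n" "j \<in> {0,1,2}" "x = Fw w (q j)" unfolding sgV_eq by blast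
 have "(F j ^^ k) (q j) = q j" by (induction k) auto
 hence "x = Fw (w @ replicate k j) (q j)" using w(3) by (simp add: sgFw_append sgFw_replicate)
 moreover have "w @ replicate k j \<in> words (n + k)" using w by (auto simp: words_def)
 ultimately show "x \<in> sgV q (n + k)" unfolding sgV_eq using w(2) by blast
qed

lemma Kc_nested: "w \<in> words n ==> v \<in> words k ==> Kc (w @ v) \<subseteq> Kc w"
proof
 fix x assume w: "w \<in> words n" and v: "v \<in> words k" and x: "x \<in> Kc (w @ v)"
 then obtain y where "y \<in> K" "x = Fw w (Fw v y)" by (auto simp: Kc_def sgFw_append)
 hence "x \<in> Fw w ` K" using Fw_K[OF _ v] by blast
 moreover have "x \<notin> sgV q (length w)" using x sgV_mono[of "length w" "length v"] by (auto simp: Kc_def)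
 ultimately show "x \<in> Kc w" by (simp add: Kc_def)
qed

lemma Kc_cover: "AE x in Mh. \<exists>w\<in>words n. x \<in> Kc w" using sgV_null[of n] AE_space
proof eventually_elim
 case (elim x)
 obtain w y where "w \<in> words n" "y \<in> K" "x = Fw w y" using K_cell[of x n] elim(2) by (auto simp: space_Mh)
 thus ?case using elim(1) words_length by (auto simp: Kc_def)
qed

lemma pm_sum: "(\<Sum>w\<in>words n. pm w) = pm []"
proof (induction n)
 case (Suc n)
 have "(\<Sum>w\<in>words (Suc n). pm w) = (\<Sum>v\<in>words n. pm v)"
  unfolding sum_words_snoc sum012 by (intro sum.cong refl pm_split[symmetric])
 thus ?case using Suc by simp
qed (simp add: words_0)

lemma Kc_measure_ge: "w \<in> words n ==> pm w <= measure Mh (Kc w)"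
proof -
 assume w: "w \<in> words n"
 have s: "Fw w ` K \<in> sets Mh" using Fw_K[OF _ w] by (intro closed_sets_Mh Fw_cell_closed) auto
 have "Iv w \<subseteq> pt -` (Fw w ` K) \<inter> Iv []"
 proof
  fix t assume "t \<in> Iv w"
  hence "code t n = w" "t \<in> Iv []" using code_unique[OF w] by auto
  thus "t \<in> pt -` (Fw w ` K) \<inter> Iv []" using pt_cell[of t n] by auto
 qed
 hence "emeasure lborel (Iv w) <= emeasure Mh (Fw w ` K)"
  using s unfolding sets_Mh by (subst Mh_emeasure(1)) (auto intro!: emeasure_mono Mh_emeasure(2))
 also have "emeasure Mh (Fw w ` K) = emeasure Mh (Kc w)"
  by (rule emeasure_eq_AE) (use sgV_null[of "length w"] s Kc_sets[OF w] in "auto simp: Kc_def")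
 finally show ?thesis by (simp add: Iv_measure Mh.emeasure_eq_measure)
qed

text \<open>The measures are at least \<open>pm w\<close>, while their sum is at most the total
  mass, which is the sum of the \<open>pm w\<close>; so no inequality is strict.\<close>

lemma Kc_measure: assumes w: "w \<in> words n" shows "measure Mh (Kc w) = pm w"
proof -
 have "(\<Sum>w\<in>words n. measure Mh (Kc w)) = measure Mh (\<Union>w\<in>words n. Kc w)"
  by (rule Mh.finite_measure_finite_Union[symmetric])
   (use Kc_sets Kc_disjoint in "auto simp: disjoint_family_on_def")
 also have "\<dots> <= measure Mh (space Mh)" by (rule Mh.bounded_measure)
 finally have "(\<Sum>w\<in>words n. measure Mh (Kc w) - pm w) <= 0"
  unfolding sum_subtractf pm_sum by (simp add: Mh_total space_Mh)
 moreover have "0 <= measure Mh (Kc v) - pm v" if "v \<in> words n" for v using Kc_measure_ge[OF that] by simp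
 ultimately have "\<forall>v\<in>words n. measure Mh (Kc v) - pm v = 0"
  by (metis (no_types, lifting) finite_words order_antisym sum_nonneg sum_nonneg_eq_0_iff)
 thus ?thesis using w by auto
qed

end

section \<open>The derivative with respect to a harmonic function\<close>

lemma W2_add_sq: "(W2 (%j. c j + r j) b)^2 <= 2 * (W2 c b)^2 + 2 * (W2 r b)^2"
proof -
 have "W2 (%j. c j + r j) b = W2 c b + W2 r b" by (simp add: W2_def algebra_simps)
 moreover have "(x + y)^2 <= 2 * x^2 + 2 * y^2" for x y :: real
  using sum_squares_bound[of x y] by (simp add: power2_sum)
 ultimately show ?thesis by simp
qed

lemma sum_list_sq_le:
 fixes f :: "'b => real"
 shows "(\<Sum>b\<leftarrow>bs. f b)^2 <= length bs * (\<Sum>b\<leftarrow>bs. (f b)^2)"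
proof -
 have "(\<Sum>i<length bs. f (bs ! i))^2 <= length bs * (\<Sum>i<length bs. (f (bs ! i))^2)"
  using sum_squared_le_sum_of_squares[of "%i. f (bs ! i)" "{..<length bs}"] by (simp add: mult.commute)
 thus ?thesis by (simp add: sum_list_sum_nth atLeast0LessThan mult.commute)
qed

lemma E0_list_bound:
 assumes "\<beta> >= 0" "!!i j. i \<in> {0,1,2} ==> j \<in> {0,1,2} ==> \<bar>c i - c j\<bar> <= \<beta> * (\<Sum>b\<leftarrow>bs. \<bar>b i - b j\<bar>)"
 shows "E0 c c <= \<beta>^2 * (real (length bs) * (\<Sum>b\<leftarrow>bs. E0 b b))"
proof -
 have e: "E0 b b = (b 0 - b 1)^2 + (b 1 - b 2)^2 + (b 0 - b 2)^2" for b by (simp add: E0_def power2_eq_square)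
 have "(c i - c j)^2 <= \<beta>^2 * (real (length bs) * (\<Sum>b\<leftarrow>bs. (b i - b j)^2))" if "i \<in> {0,1,2}" "j \<in> {0,1,2}" for i j
 proof -
  have "\<bar>c i - c j\<bar>^2 <= (\<beta> * (\<Sum>b\<leftarrow>bs. \<bar>b i - b j\<bar>))^2" by (rule power_mono[OF assms(2)[OF that]]) simp
  hence "(c i - c j)^2 <= (\<beta> * (\<Sum>b\<leftarrow>bs. \<bar>b i - b j\<bar>))^2" by simp
  also have "\<dots> = \<beta>^2 * (\<Sum>b\<leftarrow>bs. \<bar>b i - b j\<bar>)^2" by (simp add: power_mult_distrib)
  also have "\<dots> <= \<beta>^2 * (real (length bs) * (\<Sum>b\<leftarrow>bs. \<bar>b i - b j\<bar>^2))"
   by (intro mult_left_mono sum_list_sq_le) auto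
  finally show ?thesis by simp
 qed
 from this[of 0 1] this[of 1 2] this[of 0 2]
 have "E0 c c <= \<beta>^2 * (real (length bs) * ((\<Sum>b\<leftarrow>bs. (b 0 - b 1)^2) + (\<Sum>b\<leftarrow>bs. (b 1 - b 2)^2) + (\<Sum>b\<leftarrow>bs. (b 0 - b 2)^2)))"
  unfolding e[of c] by (simp add: distrib_left)
 also have "(\<Sum>b\<leftarrow>bs. (b 0 - b 1)^2) + (\<Sum>b\<leftarrow>bs. (b 1 - b 2)^2) + (\<Sum>b\<leftarrow>bs. (b 0 - b 2)^2) = (\<Sum>b\<leftarrow>bs. E0 b b)"
  by (simp add: e sum_list_addf)
 finally show ?thesis .
qed

context gasket_harmonic begin

definition stp :: "nat => (nat list => real) => real^2 => real" where
 "stp n c x = (\<Sum>w\<in>words n. c w * indicator (Kc w) x)"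

lemma stp_at: "w \<in> words n ==> x \<in> Kc w ==> stp n c x = c w"
proof -
 assume w: "w \<in> words n" and x: "x \<in> Kc w"
 have "stp n c x = (\<Sum>v\<in>words n. if v = w then c v else 0)" unfolding stp_def
 proof (intro sum.cong refl)
  fix v assume v: "v \<in> words n"
  have "x \<in> Kc v \<longleftrightarrow> v = w" using Kc_disjoint[OF v w _ x] x by blast
  thus "c v * indicator (Kc v) x = (if v = w then c v else 0)" by (simp add: indicator_def)
 qed
 also have "\<dots> = c w" using w by simp
 finally show ?thesis .
qed

lemma stp_meas: "stp n c \<in> borel_measurable Mh"
 unfolding stp_def by (intro borel_measurable_sum borel_measurable_times borel_measurable_const
  borel_measurable_indicator Kc_sets)

lemma stp_integral: "(LINT x|Mh. stp n c x) = (\<Sum>w\<in>words n. c w * pm w)"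
proof -
 have "(LINT x|Mh. stp n c x) = (\<Sum>w\<in>words n. LINT x|Mh. c w * indicator (Kc w) x)"
  unfolding stp_def by (rule Bochner_Integration.integral_sum)
   (intro integrable_mult_right integrable_real_indicator Kc_sets, simp_all add: Mh.emeasure_eq_measure)
 also have "\<dots> = (\<Sum>w\<in>words n. c w * pm w)" using Kc_measure Kc_sets by (intro sum.cong refl) simp
 finally show ?thesis .
qed

lemma stp_AE: "(!!w x. w \<in> words n ==> x \<in> Kc w ==> P x) ==> AE x in Mh. P x"
 using Kc_cover[of n] by (rule AE_mp) (auto intro!: AE_I2)

lemma stp_L2: "stp n c \<in> L2 Mh"
proof (rule Mh.L2_bounded[OF stp_meas])
 show "AE x in Mh. \<bar>stp n c x\<bar> <= (\<Sum>w\<in>words n. \<bar>c w\<bar>)"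
 proof (rule stp_AE)
  fix w x assume w: "w \<in> words n" "x \<in> Kc w"
  have "\<bar>c w\<bar> <= (\<Sum>w\<in>words n. \<bar>c w\<bar>)" by (rule member_le_sum[OF w(1)]) auto
  thus "\<bar>stp n c x\<bar> <= (\<Sum>w\<in>words n. \<bar>c w\<bar>)" by (simp add: stp_at[OF w])
 qed
qed

lemma stp_inner: "(LINT x|Mh. stp n c x * stp n d x) = (\<Sum>w\<in>words n. c w * d w * pm w)"
proof -
 have "(LINT x|Mh. stp n c x * stp n d x) = (LINT x|Mh. stp n (%w. c w * d w) x)"
 proof (rule integral_cong_AE)
  show "AE x in Mh. stp n c x * stp n d x = stp n (%w. c w * d w) x" by (rule stp_AE[of n]) (simp add: stp_at)
 qed (auto intro!: borel_measurable_times stp_meas)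
 thus ?thesis by (simp add: stp_integral)
qed

lemma stp_norm: "(L2_norm Mh (stp n c))^2 = (\<Sum>w\<in>words n. (c w)^2 * pm w)"
 unfolding L2_norm_sq unfolding power2_eq_square by (rule stp_inner)

lemma stp_refine: "AE x in Mh. stp n c x = stp (n + k) (%w. c (take n w)) x"
proof (rule stp_AE[of "n + k"])
 fix w x assume w: "w \<in> words (n + k)" "x \<in> Kc w"
 have t: "take n w \<in> words n" "drop n w \<in> words k"
  using w(1) set_take_subset[of n w] set_drop_subset[of n w] by (auto simp: words_def)
 have "x \<in> Kc (take n w)" using Kc_nested[OF t] w(2) by auto
 thus "stp n c x = stp (n + k) (%w. c (take n w)) x" by (simp add: stp_at[OF t(1)] stp_at[OF w])
qed

lemma stp_diff: "stp n (%w. c w - d w) x = stp n c x - stp n d x"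
 by (simp add: stp_def left_diff_distrib sum_subtractf)

lemma stp_add: "stp n (%w. c w + d w) x = stp n c x + stp n d x"
 by (simp add: stp_def distrib_right sum.distrib)

text \<open>The coefficient of the orthogonal projection of the increments of f onto those of h in
  the cell w.\<close>

definition xi :: "(real^2 => real) => nat list => real" where
 "xi f w = E0 (cv f w) (ha w) / E0 (ha w) (ha w)"

definition Xn :: "nat => (real^2 => real) => real^2 => real" where
 "Xn n f = stp n (xi f)"

lemma Xn_L2: "Xn n f \<in> L2 Mh" by (simp add: Xn_def stp_L2)

lemma ha_pos: "w \<in> words n ==> E0 (ha w) (ha w) > 0" by (rule hexts_E0_pos[OF _ nondeg])

lemma xi_pm: "w \<in> words n ==> xi f w * pm w = (5/3) ^ n * E0 (cv f w) (ha w)"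
 using ha_pos[of w n] words_length[of w n] by (simp add: xi_def pm_def)

text \<open>The martingale property as an inner product: by \<open>cell_energy\<close>, the values
  of \<open>xi\<close> on the subcells, weighted with their masses, average to the value on the
  cell.\<close>

lemma Xn_martingale: "(LINT x|Mh. Xn n f x * Xn (n + k) f x) = (L2_norm Mh (Xn n f))^2"
proof -
 have "(LINT x|Mh. Xn n f x * Xn (n + k) f x)
   = (LINT x|Mh. stp (n + k) (%w. xi f (take n w)) x * stp (n + k) (xi f) x)" unfolding Xn_def
 proof (rule integral_cong_AE)
  show "AE x in Mh. stp n (xi f) x * stp (n + k) (xi f) x
    = stp (n + k) (%w. xi f (take n w)) x * stp (n + k) (xi f) x"
   using stp_refine[of n "xi f" k] by eventually_elim simp
 qed (auto intro!: borel_measurable_times stp_meas)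
 also have "\<dots> = (\<Sum>w\<in>words n. \<Sum>v\<in>words k. xi f (take n (w @ v)) * xi f (w @ v) * pm (w @ v))"
  unfolding stp_inner sum_words_add ..
 also have "\<dots> = (\<Sum>w\<in>words n. (xi f w)^2 * pm w)"
 proof (intro sum.cong refl)
  fix w assume w: "w \<in> words n"
  have "(\<Sum>v\<in>words k. xi f (take n (w @ v)) * xi f (w @ v) * pm (w @ v))
    = (\<Sum>v\<in>words k. xi f w * (5/3) ^ n * ((5/3) ^ k * E0 (cv f (w @ v)) (hexts v (ha w))))"
  proof (intro sum.cong refl)
   fix v assume v: "v \<in> words k"
   have "take n (w @ v) = w" using words_length[OF w] by simp
   thus "xi f (take n (w @ v)) * xi f (w @ v) * pm (w @ v)
     = xi f w * (5/3) ^ n * ((5/3) ^ k * E0 (cv f (w @ v)) (hexts v (ha w)))"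
    using xi_pm[OF words_append[OF w v], of f] by (simp add: hexts_append power_add mult.assoc)
  qed
  also have "\<dots> = xi f w * (5/3) ^ n * E0 (cv f w) (ha w)"
   by (simp only: sum_distrib_left[symmetric, where r="xi f w * (5/3) ^ n"] cell_energy)
  also have "\<dots> = (xi f w)^2 * pm w" using xi_pm[OF w, of f] by (simp add: power2_eq_square mult.assoc)
  finally show "(\<Sum>v\<in>words k. xi f (take n (w @ v)) * xi f (w @ v) * pm (w @ v)) = (xi f w)^2 * pm w" .
 qed
 finally show ?thesis by (simp add: Xn_def stp_norm)
qed

lemma Xn_diff_norm: "(L2_norm Mh (%x. Xn (n + k) f x - Xn n f x))^2 = (L2_norm Mh (Xn (n + k) f))^2 - (L2_norm Mh (Xn n f))^2"
 unfolding L2_norm_diff_sq[OF Xn_L2 Xn_L2] using Xn_martingale[of n f k] by (simp add: mult.commute)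

text \<open>What \<open>Xn\<close> misses in a cell is the part of the increments of f orthogonal to
  those of h; by the Gram identity its energy is 3 W2^2 divided by the energy of h.\<close>

lemma defect: "En n f f - (L2_norm Mh (Xn n f))^2
  = (5/3) ^ n * (\<Sum>w\<in>words n. 3 * (W2 (cv f w) (ha w))^2 / E0 (ha w) (ha w))"
proof -
 have "(L2_norm Mh (Xn n f))^2 = (\<Sum>w\<in>words n. (5/3) ^ n * ((E0 (cv f w) (ha w))^2 / E0 (ha w) (ha w)))"
  unfolding Xn_def stp_norm
 proof (intro sum.cong refl)
  fix w assume w: "w \<in> words n"
  have "(xi f w)^2 * pm w = xi f w * ((5/3) ^ n * E0 (cv f w) (ha w))"
   using xi_pm[OF w, of f] by (simp add: power2_eq_square mult.assoc)
  thus "(xi f w)^2 * pm w = (5/3) ^ n * ((E0 (cv f w) (ha w))^2 / E0 (ha w) (ha w))"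
   by (simp add: xi_def power2_eq_square)
 qed
 moreover have "E0 (cv f w) (cv f w) - (E0 (cv f w) (ha w))^2 / E0 (ha w) (ha w)
   = 3 * (W2 (cv f w) (ha w))^2 / E0 (ha w) (ha w)" if "w \<in> words n" for w
  using E0_gram[of "cv f w" "ha w"] ha_pos[OF that] by (simp add: field_simps)
 hence "(\<Sum>w\<in>words n. (5/3) ^ n * (3 * (W2 (cv f w) (ha w))^2 / E0 (ha w) (ha w)))
   = (\<Sum>w\<in>words n. (5/3) ^ n * (E0 (cv f w) (cv f w) - (E0 (cv f w) (ha w))^2 / E0 (ha w) (ha w)))"
  by (intro sum.cong refl) (simp only:)
 ultimately show ?thesis unfolding En_def sum_distrib_left by (simp only: right_diff_distrib sum_subtractf)
qed

lemma Xn_norm_le: "(L2_norm Mh (Xn n f))^2 <= En n f f"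
proof -
 have "0 <= En n f f - (L2_norm Mh (Xn n f))^2" unfolding defect by (intro mult_nonneg_nonneg sum_nonneg) auto
 thus ?thesis by simp
qed

text \<open>
 The area form shrinks by \<open>3/25\<close> in every step, which makes the defect of harmonic functions decay
 geometrically: this is why the gradient of every function is a multiple of \<open>\<partial>h\<close>.
\<close>

lemma defect_le: "En (n + k) f f - (L2_norm Mh (Xn (n + k) f))^2
  <= 2 * (27/35) ^ k * En n f f + 2 * (En (n + k) f f - En n f f)"
proof -
 \<comment> \<open>The values of f on a subcell are the harmonic extension of those on the level n
   cell plus \<open>?r\<close>. The area of the first part shrinks by 3/25 per level; the total
   energy of the second is the gain En (n + k) - En n by \<open>En_pyth\<close>.\<close>
 let ?r = "%w v j. cv f (w @ v) j - hexts v (cv f w) j"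
 have cell: "(5/3) ^ k * (3 * (W2 (cv f (w @ v)) (ha (w @ v)))^2 / E0 (ha (w @ v)) (ha (w @ v)))
   <= 6 * (W2 (cv f w) (ha w))^2 * ((3/125) ^ k / E0 (hexts v (ha w)) (hexts v (ha w)))
    + 2 * ((5/3) ^ k * E0 (?r w v) (?r w v))" if w: "w \<in> words n" and v: "v \<in> words k" for w v
 proof -
  define b where "b = hexts v (ha w)"
  have b: "ha (w @ v) = b" by (simp add: b_def hexts_append)
  have bp: "E0 b b > 0" using ha_pos[OF words_append[OF w v]] b by simp
  have "(W2 (cv f (w @ v)) b)^2 <= 2 * (W2 (hexts v (cv f w)) b)^2 + 2 * (W2 (?r w v) b)^2"
   using W2_add_sq[of "hexts v (cv f w)" "?r w v" b] by simp
  moreover have "W2 (hexts v (cv f w)) b = (3/25) ^ k * W2 (cv f w) (ha w)"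
   unfolding b_def by (rule W2_hexts[OF v])
  moreover have "3 * (W2 (?r w v) b)^2 <= E0 (?r w v) (?r w v) * E0 b b"
   using E0_gram[of "?r w v" b] by (smt (verit) zero_le_power2)
  ultimately have "3 * (W2 (cv f (w @ v)) b)^2
    <= 6 * ((3/25) ^ k * W2 (cv f w) (ha w))^2 + 2 * (E0 (?r w v) (?r w v) * E0 b b)" by simp
  hence "3 * (W2 (cv f (w @ v)) b)^2 / E0 b b
    <= (6 * ((3/25) ^ k * W2 (cv f w) (ha w))^2 + 2 * (E0 (?r w v) (?r w v) * E0 b b)) / E0 b b"
   using bp by (intro divide_right_mono) auto
  also have "\<dots> = 6 * ((3/25) ^ k * W2 (cv f w) (ha w))^2 / E0 b b + 2 * E0 (?r w v) (?r w v)"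
   using bp by (simp add: add_divide_distrib)
  finally have "(5/3) ^ k * (3 * (W2 (cv f (w @ v)) b)^2 / E0 b b)
    <= (5/3) ^ k * (6 * ((3/25) ^ k * W2 (cv f w) (ha w))^2 / E0 b b + 2 * E0 (?r w v) (?r w v))"
   by (intro mult_left_mono) auto
  also have "\<dots> = 6 * (W2 (cv f w) (ha w))^2 * (((5/3) ^ k * ((3/25) ^ k)^2) / E0 b b) + 2 * ((5/3) ^ k * E0 (?r w v) (?r w v))"
   by (simp add: power_mult_distrib distrib_left mult_ac)
  also have "(5/3) ^ k * ((3/25) ^ k)^2 = (3/125::real) ^ k"
   by (simp add: power2_eq_square power_mult_distrib[symmetric])
  finally show ?thesis by (simp add: b b_def[symmetric])
 qed
 have s: "(\<Sum>v\<in>words k. (5/3) ^ k * (3 * (W2 (cv f (w @ v)) (ha (w @ v)))^2 / E0 (ha (w @ v)) (ha (w @ v))))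
   <= 2 * (27/35) ^ k * E0 (cv f w) (cv f w) + 2 * (\<Sum>v\<in>words k. (5/3) ^ k * E0 (?r w v) (?r w v))"
  if w: "w \<in> words n" for w
 proof -
  have "(\<Sum>v\<in>words k. (5/3) ^ k * (3 * (W2 (cv f (w @ v)) (ha (w @ v)))^2 / E0 (ha (w @ v)) (ha (w @ v))))
   <= (\<Sum>v\<in>words k. 6 * (W2 (cv f w) (ha w))^2 * ((3/125) ^ k / E0 (hexts v (ha w)) (hexts v (ha w)))
    + 2 * ((5/3) ^ k * E0 (?r w v) (?r w v)))" by (intro sum_mono cell w)
  also have "\<dots> = 6 * (W2 (cv f w) (ha w))^2 * (\<Sum>v\<in>words k. (3/125) ^ k / E0 (hexts v (ha w)) (hexts v (ha w)))
    + 2 * (\<Sum>v\<in>words k. (5/3) ^ k * E0 (?r w v) (?r w v))" by (simp only: sum.distrib sum_distrib_left)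
  also have "6 * (W2 (cv f w) (ha w))^2 * (\<Sum>v\<in>words k. (3/125) ^ k / E0 (hexts v (ha w)) (hexts v (ha w)))
    <= 6 * (W2 (cv f w) (ha w))^2 * ((27/35) ^ k / E0 (ha w) (ha w))"
   by (intro mult_left_mono E0_hexts_inverse_sum ha_pos[OF w]) auto
  also have "\<dots> = 2 * (27/35) ^ k * (3 * (W2 (cv f w) (ha w))^2 / E0 (ha w) (ha w))" by simp
  also have "3 * (W2 (cv f w) (ha w))^2 / E0 (ha w) (ha w) <= E0 (cv f w) (cv f w)"
  proof -
   have "3 * (W2 (cv f w) (ha w))^2 <= E0 (cv f w) (cv f w) * E0 (ha w) (ha w)"
    using E0_gram[of "cv f w" "ha w"] by (smt (verit) zero_le_power2)
   thus ?thesis using ha_pos[OF w] by (simp add: divide_le_eq)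
  qed
  finally show ?thesis by simp
 qed
 have "En (n + k) f f - (L2_norm Mh (Xn (n + k) f))^2
  = (5/3) ^ n * (\<Sum>w\<in>words n. \<Sum>v\<in>words k. (5/3) ^ k * (3 * (W2 (cv f (w @ v)) (ha (w @ v)))^2 / E0 (ha (w @ v)) (ha (w @ v))))"
  unfolding defect sum_words_add by (simp add: power_add sum_distrib_left mult.assoc)
 also have "\<dots> <= (5/3) ^ n * (\<Sum>w\<in>words n. 2 * (27/35) ^ k * E0 (cv f w) (cv f w) + 2 * (\<Sum>v\<in>words k. (5/3) ^ k * E0 (?r w v) (?r w v)))"
  by (intro mult_left_mono sum_mono s) auto
 also have "\<dots> = 2 * (27/35) ^ k * En n f f + 2 * ((5/3) ^ n * (\<Sum>w\<in>words n. \<Sum>v\<in>words k. (5/3) ^ k * E0 (?r w v) (?r w v)))"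
  unfolding En_def by (simp add: sum.distrib sum_distrib_left distrib_left mult_ac)
 finally show ?thesis unfolding En_pyth .
qed

text \<open>Two stages: n is chosen so that En n is close to the full energy, which makes the second
  term of \<open>defect_le\<close> small uniformly in k, and then k makes the first term
  small.\<close>

lemma Xn_norm_lim:
 assumes f: "f \<in> fdom SG" shows "(%n. (L2_norm Mh (Xn n f))^2) \<longlonglongrightarrow> Elim f"
proof (rule LIMSEQ_I)
 fix e :: real assume e: "e > 0"
 have E: "0 <= Elim f" by (rule Elim_nonneg[OF f])
 obtain n where n: "Elim f - En n f f < e / 8"
 proof -
  have "eventually (%n. Elim f - e / 8 < En n f f) sequentially"
   using order_tendstoD(1)[OF Elim[OF f], of "Elim f - e / 8"] e by simp
  then obtain N where "ALL n>=N. Elim f - e / 8 < En n f f" unfolding eventually_sequentially by blast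
  hence "Elim f - e / 8 < En N f f" by blast
  hence "Elim f - En N f f < e / 8" by linarith
  thus ?thesis by (rule that)
 qed
 have "(%k. 2 * (27/35) ^ k * Elim f) \<longlonglongrightarrow> 2 * 0 * Elim f" by (intro tendsto_intros LIMSEQ_power_zero) simp
 hence "eventually (%k. 2 * (27/35) ^ k * Elim f < e / 2) sequentially"
  using e by (intro order_tendstoD(2)[of _ 0]) auto
 then obtain k0 where k0: "!!k. k >= k0 ==> 2 * (27/35) ^ k * Elim f < e / 2" by (auto simp: eventually_sequentially)
 show "\<exists>N. ALL m>=N. norm ((L2_norm Mh (Xn m f))^2 - Elim f) < e"
 proof (intro exI[of _ "n + k0"] allI impI)
  fix m assume "m >= n + k0"
  then obtain k where m: "m = n + k" "k >= k0" by (metis add.assoc le_add1 le_iff_add)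
  have "En n f f <= En m f f" using En_mono[of n m] m by simp
  have "2 * (27/35) ^ k * En n f f <= 2 * (27/35) ^ k * Elim f" by (intro mult_left_mono En_le_Elim f) auto
  moreover have "A - N < e / 2 + 2 * (e / 8)"
   if "A - N <= X + 2 * (A - B)" "Y < e / 2" "L - B < e / 8" "A <= L" "X <= Y" for A B L N X Y :: real
   using that by simp
  ultimately have "En m f f - (L2_norm Mh (Xn m f))^2 < e / 2 + 2 * (e / 8)"
   using defect_le[of n k f] k0[OF m(2)] n En_le_Elim[OF f, of "n + k"] unfolding m(1) by blast
  moreover have "Elim f - En m f f < e / 8" using n \<open>En n f f <= En m f f\<close> by simp
  moreover have "(L2_norm Mh (Xn m f))^2 <= Elim f" using Xn_norm_le[of m f] En_le_Elim[OF f, of m] by simp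
  ultimately show "norm ((L2_norm Mh (Xn m f))^2 - Elim f) < e" using e by simp
 qed
qed

text \<open>For a martingale the squared norm of a difference is the difference of the squared norms
  (\<open>Xn_diff_norm\<close>), so the convergence of the norms suffices.\<close>

lemma Xn_Cauchy:
 assumes f: "f \<in> fdom SG" shows "L2_Cauchy Mh (%n. Xn n f)" unfolding L2_Cauchy_def
proof (intro conjI allI impI Xn_L2)
 fix e :: real assume e: "e > 0"
 have "Cauchy (%n. (L2_norm Mh (Xn n f))^2)" using Xn_norm_lim[OF f] LIMSEQ_imp_Cauchy by blast
 then obtain N where N: "!!m n. m >= N ==> n >= N ==> \<bar>(L2_norm Mh (Xn m f))^2 - (L2_norm Mh (Xn n f))^2\<bar> < e^2"
  using e unfolding Cauchy_def dist_real_def by (meson zero_less_power)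
 have le: "L2_norm Mh (%x. Xn m f x - Xn n f x) < e" if "n >= N" "m >= n" for m n
 proof -
  obtain k where "m = n + k" using \<open>m >= n\<close> le_Suc_ex by blast
  hence "(L2_norm Mh (%x. Xn m f x - Xn n f x))^2 < e^2" using Xn_diff_norm[of n k f] N[of m n] that by simp
  thus ?thesis using e by (simp add: power2_less_imp_less)
 qed
 have "L2_norm Mh (%x. Xn m f x - Xn n f x) < e" if "m >= N" "n >= N" for m n
  using le[of n m] le[of m n] that L2_norm_minus_commute[of Mh "Xn m f" "Xn n f"] by (cases "n <= m") auto
 thus "\<exists>N. ALL m>=N. ALL n>=N. L2_norm Mh (%x. Xn m f x - Xn n f x) < e" by blast
qed

definition DS :: "(real^2 => real) => real^2 => real" where
 "DS f = (SOME g. L2_lim Mh (%n. Xn n f) g)"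

lemma DS: "f \<in> fdom SG ==> L2_lim Mh (%n. Xn n f) (DS f)"
proof -
 assume "f \<in> fdom SG"
 then obtain g where "L2_lim Mh (%n. Xn n f) g" using Mh.L2_complete[OF Xn_Cauchy] by blast
 thus ?thesis unfolding DS_def by (rule someI[of "L2_lim Mh (%n. Xn n f)"])
qed

lemma DS_norm: "f \<in> fdom SG ==> (L2_norm Mh (DS f))^2 = Elim f"
 using LIMSEQ_unique[OF tendsto_power[OF L2_lim_norm[OF DS]] Xn_norm_lim] by blast

lemma SG_cont_bdd:
 assumes "continuous_on K (f :: real^2 => real)"
 obtains B where "B >= 0" "!!x. x \<in> K ==> \<bar>f x\<bar> <= B"
proof -
 have "bounded (f ` K)" by (intro compact_imp_bounded compact_continuous_image assms K_compact)
 then obtain B where B: "!!x. x \<in> K ==> \<bar>f x\<bar> <= B" by (auto simp: bounded_iff)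
 thus ?thesis using that[of "\<bar>B\<bar>"] by (meson abs_ge_self abs_ge_zero order_trans)
qed

lemma SG_unif_cont:
 assumes "continuous_on K (f :: real^2 => real)" "e > 0"
 obtains d where "d > 0" "!!x y. x \<in> K ==> y \<in> K ==> dist x y < d ==> \<bar>f x - f y\<bar> < e"
 using compact_uniformly_continuous[OF assms(1) K_compact] assms(2)
 unfolding uniformly_continuous_on_def by (metis dist_real_def dist_commute)

text \<open>Freezing c at a corner of the cell changes it by at most e1 on small cells, so the
  product changes by at most e1 |Xn|, whose norm is controlled by the energy of f.\<close>

lemma stp_mult_lim:
 assumes f: "f \<in> fdom SG" and c: "continuous_on K c"
 shows "L2_lim Mh (%n. stp n (%w. c (Fw w (q 0)) * xi f w)) (%x. c x * DS f x)"
proof -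
 obtain B where B: "B >= 0" "!!x. x \<in> K ==> \<bar>c x\<bar> <= B" using SG_cont_bdd[OF c] by blast
 have cm: "c \<in> borel_measurable Mh" using radon_on_measurable[OF Mh_radon] c by (simp add: SG_simps)
 have cB: "AE x in Mh. \<bar>c x\<bar> <= B" using B(2) by (intro AE_I2) (simp add: space_Mh)
 have DL: "DS f \<in> L2 Mh" using DS[OF f] by (rule L2_lim_L2)
 have L: "(%x. c x * g x) \<in> L2 Mh" if "g \<in> L2 Mh" for g by (rule L2_mult_bounded[OF cm cB that])
 show ?thesis
 proof (unfold L2_lim_def, intro conjI allI stp_L2 L DL)
  show "(%n. L2_norm Mh (%x. stp n (%w. c (Fw w (q 0)) * xi f w) x - c x * DS f x)) \<longlonglongrightarrow> 0"
  proof (rule LIMSEQ_I)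
   fix e :: real assume e: "e > 0"
   define s where "s = sqrt (Elim f)"
   have s: "s >= 0" using Elim_nonneg[OF f] by (simp add: s_def)
   define e1 where "e1 = e / 2 / (s + 1)"
   have e1: "e1 > 0" using e s by (simp add: e1_def)
   obtain d where d: "d > 0" "!!x y. x \<in> K ==> y \<in> K ==> dist x y < d ==> \<bar>c x - c y\<bar> < e1"
    using SG_unif_cont[OF c e1] by blast
   obtain N1 where N1: "!!n. n >= N1 ==> diam / 2 ^ n < d" using cells_small[OF d(1)] by blast
   have "(%n. B * L2_norm Mh (%x. Xn n f x - DS f x)) \<longlonglongrightarrow> B * 0"
    using DS[OF f] by (intro tendsto_mult tendsto_const) (simp add: L2_lim_def)
   hence "eventually (%n. B * L2_norm Mh (%x. Xn n f x - DS f x) < e / 2) sequentially"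
    using e by (intro order_tendstoD(2)[of _ 0]) auto
   then obtain N2 where N2: "!!n. n >= N2 ==> B * L2_norm Mh (%x. Xn n f x - DS f x) < e / 2"
    by (auto simp: eventually_sequentially)
   have le: "L2_norm Mh u <= b * L2_norm Mh v" if "u \<in> L2 Mh" "v \<in> L2 Mh" "b >= 0" "AE x in Mh. \<bar>u x\<bar> <= b * \<bar>v x\<bar>" for u v b
   proof (rule power2_le_imp_le)
    have "(LINT x|Mh. (u x)^2) <= (LINT x|Mh. b^2 * (v x)^2)"
    proof (rule integral_mono_AE)
     show "AE x in Mh. (u x)^2 <= b^2 * (v x)^2" using that(4)
     proof eventually_elim
      case (elim x)
      have "\<bar>u x\<bar>^2 <= (b * \<bar>v x\<bar>)^2" by (rule power_mono[OF elim]) simp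
      thus ?case by (simp add: power_mult_distrib)
     qed
    qed (use that(1,2) in "auto simp: L2_def")
    thus "(L2_norm Mh u)^2 <= (b * L2_norm Mh v)^2" by (simp add: L2_norm_sq power_mult_distrib)
   qed (simp add: that(3))
   show "\<exists>N. ALL n>=N. norm (L2_norm Mh (%x. stp n (%w. c (Fw w (q 0)) * xi f w) x - c x * DS f x) - 0) < e"
   proof (intro exI[of _ "max N1 N2"] allI impI)
    fix n assume n: "n >= max N1 N2"
    let ?Y = "stp n (%w. c (Fw w (q 0)) * xi f w)"
    have "L2_norm Mh (%x. ?Y x - c x * DS f x)
     <= L2_norm Mh (%x. ?Y x - c x * Xn n f x) + L2_norm Mh (%x. c x * Xn n f x - c x * DS f x)"
     by (intro L2_norm_triangle stp_L2 L Xn_L2 DL)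
    moreover have "L2_norm Mh (%x. ?Y x - c x * Xn n f x) <= e1 * L2_norm Mh (Xn n f)"
    proof (rule le)
     show "AE x in Mh. \<bar>?Y x - c x * Xn n f x\<bar> <= e1 * \<bar>Xn n f x\<bar>"
     proof (rule stp_AE[of n])
      fix w x assume w: "w \<in> words n" "x \<in> Kc w"
      then obtain y where y: "y \<in> K" "x = Fw w y" by (auto simp: Kc_def)
      have "dist (Fw w (q 0)) x <= diam / 2 ^ n" unfolding y(2) by (intro cell_diam w K_T q_K y) simp
      hence "\<bar>c (Fw w (q 0)) - c x\<bar> < e1"
       using N1[of n] n y Fw_K[OF q_K w(1)] Fw_K[OF y(1) w(1)] by (intro d(2)) auto
      hence "\<bar>c (Fw w (q 0)) - c x\<bar> * \<bar>xi f w\<bar> <= e1 * \<bar>xi f w\<bar>" by (intro mult_right_mono) auto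
      thus "\<bar>?Y x - c x * Xn n f x\<bar> <= e1 * \<bar>Xn n f x\<bar>"
       by (simp add: Xn_def stp_at[OF w] abs_mult left_diff_distrib[symmetric])
     qed
    qed (use e1 in "auto intro!: L2_diff stp_L2 L Xn_L2")
    moreover have "L2_norm Mh (%x. c x * Xn n f x - c x * DS f x) <= B * L2_norm Mh (%x. Xn n f x - DS f x)"
    proof (rule le)
     show "AE x in Mh. \<bar>c x * Xn n f x - c x * DS f x\<bar> <= B * \<bar>Xn n f x - DS f x\<bar>"
      using cB by eventually_elim (simp add: right_diff_distrib[symmetric] abs_mult mult_right_mono)
    qed (use B in "auto intro!: L2_diff L Xn_L2 DL")
    moreover have "L2_norm Mh (Xn n f) <= s" unfolding s_def using Xn_norm_le[of n f] En_le_Elim[OF f, of n]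
     by (intro real_le_rsqrt) linarith
    hence "e1 * L2_norm Mh (Xn n f) <= e1 * s" using e1 by (intro mult_left_mono) auto
    moreover have "e1 * s <= e1 * (s + 1)" using e1 by simp
    moreover have "s + 1 ~= 0" using s by simp
    hence "e1 * (s + 1) = e / 2" unfolding e1_def by (rule nonzero_eq_divide_eq[THEN iffD1, OF _ refl])
    ultimately show "norm (L2_norm Mh (%x. ?Y x - c x * DS f x) - 0) < e" using N2[of n] n by simp
   qed
  qed
 qed
qed

lemma stp_list_lim:
 assumes "ps \<in> form_terms SG"
 shows "L2_lim Mh (%n. stp n (%w. \<Sum>(c, f)\<leftarrow>ps. c (Fw w (q 0)) * xi f w)) (%x. \<Sum>(c, f)\<leftarrow>ps. c x * DS f x)"
 using assms
proof (induction ps)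
 case Nil
 have "stp n (%w. 0) = (%x. 0)" for n by (rule ext) (simp add: stp_def)
 thus ?case using L2_lim_const[OF L2_zero, of Mh] by simp
next
 case (Cons p ps)
 obtain c f where p: "p = (c, f)" by (cases p)
 have c: "continuous_on K c" "f \<in> fdom SG" and ps: "ps \<in> form_terms SG"
  using Cons.prems p by (auto simp: form_terms_def cont_funs_def SG_simps(1))
 show ?case using L2_lim_add[OF stp_mult_lim[OF c(2,1)] Cons.IH[OF ps]] by (simp add: p stp_add)
qed

text \<open>On small cells the hypothesis bounds the increments of u minus the combination of the f
  with frozen coefficients. The total energy of this remainder is therefore small, and projecting
  onto the increments of h does not enlarge it, by Cauchy-Schwarz in each cell.\<close>

lemma DS_calc:
 assumes ps: "ps \<in> form_terms SG"
  and u: "!!e. e > 0 ==> \<exists>d>0. \<forall>x\<in>K. \<forall>y\<in>K. dist x y < d -->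
   \<bar>u x - u y - (\<Sum>(c, f)\<leftarrow>ps. c x * (f x - f y))\<bar> <= e * (\<Sum>(c, f)\<leftarrow>ps. \<bar>f x - f y\<bar>)"
 shows "u \<in> fdom SG & (AE x in Mh. DS u x = (\<Sum>(c, f)\<leftarrow>ps. c x * DS f x))"
proof -
 have pc: "continuous_on K c" "f \<in> fdom SG" "continuous_on K f" if "(c, f) \<in> set ps" for c f
  using ps that by (auto simp: form_terms_def cont_funs_def SG_simps in_lists_conv_set)
 define fs where "fs = map snd ps"
 have fs: "f \<in> fdom SG" if "f \<in> set fs" for f using that pc by (auto simp: fs_def)
 have sfs: "(\<Sum>(c, f)\<leftarrow>ps. G f) = (\<Sum>f\<leftarrow>fs. G f)" for G :: "(real^2 => real) => real"
  by (simp add: fs_def case_prod_unfold comp_def)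
 obtain B where B: "B >= 0" "!!c f x. (c, f) \<in> set ps ==> x \<in> K ==> \<bar>c x\<bar> <= B"
 proof -
  have "\<forall>r\<in>set ps. eventually (%B. \<forall>x\<in>K. \<bar>fst r x\<bar> <= B) at_top"
  proof
   fix r assume "r \<in> set ps"
   hence "continuous_on K (fst r)" using pc(1)[of "fst r" "snd r"] by simp
   then obtain B0 where "!!x. x \<in> K ==> \<bar>fst r x\<bar> <= B0" using SG_cont_bdd by blast
   hence "\<forall>x\<in>K. \<bar>fst r x\<bar> <= B" if "B >= B0" for B using that order_trans by blast
   thus "eventually (%B. \<forall>x\<in>K. \<bar>fst r x\<bar> <= B) at_top" unfolding eventually_at_top_linorder by blast
  qed
  hence "eventually (%B. \<forall>r\<in>set ps. \<forall>x\<in>K. \<bar>fst r x\<bar> <= B) at_top"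
   by (rule eventually_ball_finite[OF finite_set])
  then obtain B where "!!B'. B' >= B ==> \<forall>r\<in>set ps. \<forall>x\<in>K. \<bar>fst r x\<bar> <= B'"
   unfolding eventually_at_top_linorder by blast
  hence "\<forall>r\<in>set ps. \<forall>x\<in>K. \<bar>fst r x\<bar> <= max B 0" by simp
  thus ?thesis by (intro that[of "max B 0"]) auto
 qed
 have incr: "\<bar>\<Sum>(c, f)\<leftarrow>ps. c x * (f x - f y)\<bar> <= B * (\<Sum>f\<leftarrow>fs. \<bar>f x - f y\<bar>)" if "x \<in> K" for x y
 proof -
  have "\<bar>\<Sum>(c, f)\<leftarrow>qs. c x * (f x - f y)\<bar> <= B * (\<Sum>(c, f)\<leftarrow>qs. \<bar>f x - f y\<bar>)" if "set qs \<subseteq> set ps" for qs using that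
  proof (induction qs)
   case (Cons r qs)
   obtain c f where r: "r = (c, f)" by (cases r)
   have "\<bar>c x * (f x - f y)\<bar> <= B * \<bar>f x - f y\<bar>"
    unfolding abs_mult using B(2)[of c f x] Cons.prems r \<open>x \<in> K\<close> by (intro mult_right_mono) auto
   thus ?case using Cons.IH Cons.prems by (simp add: r distrib_left)
  qed (simp add: B)
  thus ?thesis unfolding sfs[symmetric] by blast
 qed
 \<comment> \<open>The single scale e = 1 bounds the increments of u by those of the f; this gives
   continuity and finite energy of u.\<close>
 obtain d1 where d1: "d1 > 0" "!!x y. x \<in> K ==> y \<in> K ==> dist x y < d1 ==>
   \<bar>u x - u y - (\<Sum>(c, f)\<leftarrow>ps. c x * (f x - f y))\<bar> <= 1 * (\<Sum>f\<leftarrow>fs. \<bar>f x - f y\<bar>)"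
  using u[of 1] unfolding sfs by auto
 have lip: "\<bar>u x - u y\<bar> <= (B + 1) * (\<Sum>f\<leftarrow>fs. \<bar>f x - f y\<bar>)" if "x \<in> K" "y \<in> K" "dist x y < d1" for x y
  using d1(2)[OF that] incr[OF that(1), of y] unfolding distrib_right by linarith
 have uc: "continuous_on K u" unfolding continuous_on_iff
 proof (intro ballI allI impI)
  fix x and e :: real assume x: "x \<in> K" and e: "e > 0"
  have "continuous_on K (%y. (B + 1) * (\<Sum>f\<leftarrow>gs. \<bar>f x - f y\<bar>))" if "set gs \<subseteq> set fs" for gs using that
  proof (induction gs)
   case (Cons g gs)
   have gc: "continuous_on K g" using fs[of g] Cons.prems by (simp add: SG_simps)
   have "continuous_on K (%y. (B + 1) * \<bar>g x - g y\<bar> + (B + 1) * (\<Sum>f\<leftarrow>gs. \<bar>f x - f y\<bar>))"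
    by (intro continuous_on_add Cons.IH continuous_intros gc) (use Cons.prems in auto)
   thus ?case by (simp add: distrib_left)
  qed simp
  hence "continuous_on K (%y. (B + 1) * (\<Sum>f\<leftarrow>fs. \<bar>f x - f y\<bar>))" by blast
  then obtain d2 where d2: "d2 > 0" "!!y. y \<in> K ==> dist y x < d2 ==>
    dist ((B + 1) * (\<Sum>f\<leftarrow>fs. \<bar>f x - f y\<bar>)) ((B + 1) * (\<Sum>f\<leftarrow>fs. \<bar>f x - f x\<bar>)) < e"
   using x e unfolding continuous_on_iff by blast
  have z: "(\<Sum>f\<leftarrow>fs. \<bar>f x - f x\<bar>) = 0" by (induction fs) auto
  show "\<exists>d>0. \<forall>y\<in>K. dist y x < d --> dist (u y) (u x) < e"
  proof (intro exI[of _ "min d1 d2"] conjI ballI impI)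
   fix y assume y: "y \<in> K" "dist y x < min d1 d2"
   have "\<bar>u x - u y\<bar> <= (B + 1) * (\<Sum>f\<leftarrow>fs. \<bar>f x - f y\<bar>)" using lip[OF x y(1)] y(2) by (simp add: dist_commute)
   also have "\<dots> < e" using d2(2)[OF y(1)] y(2) unfolding z by (simp add: dist_real_def)
   finally show "dist (u y) (u x) < e" by (simp add: dist_real_def abs_minus_commute)
  qed (use d1 d2 in simp)
 qed
 define C where "C = real (length fs) * (\<Sum>f\<leftarrow>fs. Elim f)"
 have sumE: "(5/3) ^ n * (\<Sum>w\<in>words n. \<Sum>f\<leftarrow>fs. E0 (cv f w) (cv f w)) <= (\<Sum>f\<leftarrow>fs. Elim f)" for n
 proof -
  have "(5/3) ^ n * (\<Sum>w\<in>words n. \<Sum>f\<leftarrow>gs. E0 (cv f w) (cv f w)) <= (\<Sum>f\<leftarrow>gs. Elim f)" if "set gs \<subseteq> set fs" for gs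
   using that
  proof (induction gs)
   case (Cons g gs)
   thus ?case using En_le_Elim[OF fs, of g n] by (simp add: sum.distrib distrib_left En_def add_mono)
  qed simp
  thus ?thesis by blast
 qed
 have bound: "(5/3) ^ n * (\<Sum>w\<in>words n. E0 (c w) (c w)) <= \<beta>^2 * C"
  if "\<beta> >= 0" "!!w i j. w \<in> words n ==> i \<in> {0,1,2} ==> j \<in> {0,1,2} ==>
    \<bar>c w i - c w j\<bar> <= \<beta> * (\<Sum>f\<leftarrow>fs. \<bar>cv f w i - cv f w j\<bar>)" for n c \<beta>
 proof -
  have "(5/3) ^ n * (\<Sum>w\<in>words n. E0 (c w) (c w))
   <= (5/3) ^ n * (\<Sum>w\<in>words n. \<beta>^2 * (real (length fs) * (\<Sum>f\<leftarrow>fs. E0 (cv f w) (cv f w))))"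
  proof (intro mult_left_mono sum_mono)
   fix w assume w: "w \<in> words n"
   have "E0 (c w) (c w) <= \<beta>^2 * (real (length (map (%f. cv f w) fs)) * (\<Sum>b\<leftarrow>map (%f. cv f w) fs. E0 b b))"
    by (rule E0_list_bound[OF that(1)]) (use that(2)[OF w] in "simp add: comp_def")
   thus "E0 (c w) (c w) <= \<beta>^2 * (real (length fs) * (\<Sum>f\<leftarrow>fs. E0 (cv f w) (cv f w)))" by (simp add: comp_def)
  qed simp
  also have "\<dots> = \<beta>^2 * (real (length fs) * ((5/3) ^ n * (\<Sum>w\<in>words n. \<Sum>f\<leftarrow>fs. E0 (cv f w) (cv f w))))"
   by (simp add: sum_distrib_left mult_ac)
  also have "\<dots> <= \<beta>^2 * C" unfolding C_def by (intro mult_left_mono sumE) auto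
  finally show ?thesis .
 qed
 have small: "dist (Fw w (q i)) (Fw w (q j)) < d" if "w \<in> words n" "i \<in> {0,1,2}" "j \<in> {0,1,2}" "diam / 2 ^ n < d" for w n i j d
  using cell_diam[OF that(1) q_T[OF that(2)] q_T[OF that(3)]] that(4) by simp
 have ud: "u \<in> fdom SG"
 proof -
  obtain N where N: "!!n. n >= N ==> diam / 2 ^ n < d1" using cells_small[OF d1(1)] by blast
  have big: "En n u u <= (B + 1)^2 * C" if n: "n >= N" for n unfolding En_def
  proof (rule bound)
   fix w and i j :: nat assume w: "w \<in> words n" "i \<in> {0,1,2}" "j \<in> {0,1,2}"
   show "\<bar>cv u w i - cv u w j\<bar> <= (B + 1) * (\<Sum>f\<leftarrow>fs. \<bar>cv f w i - cv f w j\<bar>)"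
    unfolding cv_def by (intro lip Fw_K[OF _ w(1)] q_K w small[OF w] N[OF n])
  qed (use B in simp)
  have "En n u u <= (B + 1)^2 * C" for n using En_mono[of n "max n N" u] big[of "max n N"] by simp
  thus ?thesis by (rule SG_domI[OF uc])
 qed
 let ?Y = "%n. stp n (%w. \<Sum>(c, f)\<leftarrow>ps. c (Fw w (q 0)) * xi f w)"
 have C0: "C >= 0" unfolding C_def by (intro mult_nonneg_nonneg sum_list_nonneg) (auto intro: Elim_nonneg fs)
 have diff: "(%n. L2_norm Mh (%x. Xn n u x - ?Y n x)) \<longlonglongrightarrow> 0"
 proof (rule LIMSEQ_I)
  fix e :: real assume e: "e > 0"
  define e1 where "e1 = e / (4 * (sqrt C + 1))"
  have e1: "e1 > 0" using e C0 by (simp add: e1_def add_nonneg_pos)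
  obtain d where d: "d > 0" "!!x y. x \<in> K ==> y \<in> K ==> dist x y < d ==>
   \<bar>u x - u y - (\<Sum>(c, f)\<leftarrow>ps. c x * (f x - f y))\<bar> <= e1 * (\<Sum>f\<leftarrow>fs. \<bar>f x - f y\<bar>)"
   using u[OF e1] unfolding sfs by blast
  obtain d' where d': "d' > 0" "!!c f x y. (c, f) \<in> set ps ==> x \<in> K ==> y \<in> K ==> dist x y < d' ==> \<bar>c x - c y\<bar> <= e1"
  proof -
   have "\<forall>r\<in>set ps. eventually (%d. \<forall>x\<in>K. \<forall>y\<in>K. dist x y < d --> \<bar>fst r x - fst r y\<bar> <= e1) (at_right 0)"
   proof
    fix r assume "r \<in> set ps"
    hence "continuous_on K (fst r)" using pc(1)[of "fst r" "snd r"] by simp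
    from SG_unif_cont[OF this e1] obtain d0 where d0: "d0 > 0"
     "!!x y. x \<in> K ==> y \<in> K ==> dist x y < d0 ==> \<bar>fst r x - fst r y\<bar> < e1" by blast
    have "\<bar>fst r x - fst r y\<bar> <= e1" if "d < d0" "x \<in> K" "y \<in> K" "dist x y < d" for d x y
     using d0(2)[of x y] that by simp
    thus "eventually (%d. \<forall>x\<in>K. \<forall>y\<in>K. dist x y < d --> \<bar>fst r x - fst r y\<bar> <= e1) (at_right 0)"
     unfolding eventually_at_right_field using d0(1) by blast
   qed
   hence "eventually (%d. \<forall>r\<in>set ps. \<forall>x\<in>K. \<forall>y\<in>K. dist x y < d --> \<bar>fst r x - fst r y\<bar> <= e1) (at_right 0)"
    by (rule eventually_ball_finite[OF finite_set])
   then obtain b where b: "b > 0" "!!d. 0 < d ==> d < b ==>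
     \<forall>r\<in>set ps. \<forall>x\<in>K. \<forall>y\<in>K. dist x y < d --> \<bar>fst r x - fst r y\<bar> <= e1"
    unfolding eventually_at_right_field by blast
   from that[of "b / 2"] b(2)[of "b / 2"] b(1) show ?thesis by force
  qed
  obtain N where N: "!!n. n >= N ==> diam / 2 ^ n < min d d'" using cells_small[of "min d d'"] d(1) d'(1) by auto
  show "\<exists>N. ALL n>=N. norm (L2_norm Mh (%x. Xn n u x - ?Y n x) - 0) < e"
  proof (intro exI[of _ N] allI impI)
   fix n assume n: "n >= N"
   \<comment> \<open>Coefficients are frozen at the corner q 0 of the cell. The bound 2 * e1 below
     has one e1 from the hypothesis on u and one from the freezing.\<close>
   define r where "r w j = cv u w j - (\<Sum>(c, f)\<leftarrow>ps. c (Fw w (q 0)) * cv f w j)" for w j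
   have Er: "(5/3) ^ n * (\<Sum>w\<in>words n. E0 (r w) (r w)) <= (2 * e1)^2 * C"
   proof (rule bound)
    fix w and i j :: nat assume w: "w \<in> words n" "i \<in> {0,1,2}" "j \<in> {0,1,2}"
    let ?x = "Fw w (q i)" and ?y = "Fw w (q j)" and ?o = "Fw w (q 0)"
    have K3: "?x \<in> K" "?y \<in> K" "?o \<in> K" using Fw_K[OF q_K w(1)] w(2,3) by auto
    have 1: "\<bar>u ?x - u ?y - (\<Sum>(c, f)\<leftarrow>ps. c ?x * (f ?x - f ?y))\<bar> <= e1 * (\<Sum>f\<leftarrow>fs. \<bar>f ?x - f ?y\<bar>)"
     using small[OF w, of d] N[OF n] by (intro d(2) K3) auto
    have dx: "dist ?x ?o < d'" using small[OF w(1,2), of 0 d'] N[OF n] by simp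
    have "\<bar>(\<Sum>(c, f)\<leftarrow>qs. c ?x * (f ?x - f ?y)) - (\<Sum>(c, f)\<leftarrow>qs. c ?o * (f ?x - f ?y))\<bar>
     <= e1 * (\<Sum>(c, f)\<leftarrow>qs. \<bar>f ?x - f ?y\<bar>)" if "set qs \<subseteq> set ps" for qs using that
    proof (induction qs)
     case (Cons s qs)
     obtain c f where s: "s = (c, f)" by (cases s)
     have "\<bar>c ?x * (f ?x - f ?y) - c ?o * (f ?x - f ?y)\<bar> = \<bar>c ?x - c ?o\<bar> * \<bar>f ?x - f ?y\<bar>"
      by (simp only: left_diff_distrib[symmetric] abs_mult)
     also have "\<dots> <= e1 * \<bar>f ?x - f ?y\<bar>" using Cons.prems s by (intro mult_right_mono d'(2)[of c f] K3 dx) auto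
     finally have "\<bar>c ?x * (f ?x - f ?y) - c ?o * (f ?x - f ?y)\<bar> <= e1 * \<bar>f ?x - f ?y\<bar>" .
     thus ?case using Cons.IH Cons.prems by (simp add: s distrib_left)
    qed simp
    hence 2: "\<bar>(\<Sum>(c, f)\<leftarrow>ps. c ?x * (f ?x - f ?y)) - (\<Sum>(c, f)\<leftarrow>ps. c ?o * (f ?x - f ?y))\<bar>
     <= e1 * (\<Sum>f\<leftarrow>fs. \<bar>f ?x - f ?y\<bar>)" unfolding sfs[symmetric] by blast
    have 3: "r w i - r w j = u ?x - u ?y - (\<Sum>(c, f)\<leftarrow>ps. c ?o * (f ?x - f ?y))"
    proof -
     have "(\<Sum>(c, f)\<leftarrow>ps. c ?o * (f ?x - f ?y)) = (\<Sum>(c, f)\<leftarrow>ps. c ?o * f ?x) - (\<Sum>(c, f)\<leftarrow>ps. c ?o * f ?y)"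
      by (induction ps) (auto simp: algebra_simps)
     thus ?thesis by (simp add: r_def cv_def)
    qed
    show "\<bar>r w i - r w j\<bar> <= 2 * e1 * (\<Sum>f\<leftarrow>fs. \<bar>cv f w i - cv f w j\<bar>)" unfolding 3 cv_def using 1 2 by linarith
   qed (use e1 in simp)
   have "(L2_norm Mh (%x. Xn n u x - ?Y n x))^2
     = (\<Sum>w\<in>words n. (xi u w - (\<Sum>(c, f)\<leftarrow>ps. c (Fw w (q 0)) * xi f w))^2 * pm w)"
    unfolding Xn_def stp_diff[symmetric] stp_norm ..
   also have "\<dots> <= (\<Sum>w\<in>words n. (5/3) ^ n * E0 (r w) (r w))"
   proof (rule sum_mono)
    fix w assume w: "w \<in> words n"
    have "E0 (r w) (ha w) = E0 (cv u w) (ha w) - (\<Sum>(c, f)\<leftarrow>ps. c (Fw w (q 0)) * E0 (cv f w) (ha w))"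
    proof -
     have "E0 (%j. \<Sum>(c, f)\<leftarrow>ps. c (Fw w (q 0)) * cv f w j) (ha w) = (\<Sum>(c, f)\<leftarrow>ps. c (Fw w (q 0)) * E0 (cv f w) (ha w))"
     proof (induction ps)
      case (Cons p ps)
      thus ?case by (cases p) (simp add: E0_add E0_cmult)
     qed (simp add: E0_def)
     thus ?thesis unfolding r_def by (simp add: E0_diff)
    qed
    moreover have "(\<Sum>(c, f)\<leftarrow>ps. c (Fw w (q 0)) * xi f w) = (\<Sum>(c, f)\<leftarrow>ps. c (Fw w (q 0)) * E0 (cv f w) (ha w)) / E0 (ha w) (ha w)"
     by (induction ps) (auto simp: xi_def add_divide_distrib)
    ultimately have x: "xi u w - (\<Sum>(c, f)\<leftarrow>ps. c (Fw w (q 0)) * xi f w) = E0 (r w) (ha w) / E0 (ha w) (ha w)"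
     by (simp add: xi_def diff_divide_distrib)
    have p: "E0 (ha w) (ha w) > 0" by (rule ha_pos[OF w])
    have "(E0 (r w) (ha w) / E0 (ha w) (ha w))^2 * pm w = (5/3) ^ n * ((E0 (r w) (ha w))^2 / E0 (ha w) (ha w))"
     using p by (simp add: pm_def words_length[OF w] power2_eq_square)
    also have "\<dots> <= (5/3) ^ n * E0 (r w) (r w)"
     using E0_CS[of "r w" "ha w"] p by (intro mult_left_mono) (auto simp: divide_le_eq)
    finally show "(xi u w - (\<Sum>(c, f)\<leftarrow>ps. c (Fw w (q 0)) * xi f w))^2 * pm w <= (5/3) ^ n * E0 (r w) (r w)"
     unfolding x .
   qed
   also have "\<dots> <= (2 * e1)^2 * C" using Er by (simp add: sum_distrib_left)
   also have "\<dots> <= (2 * e1 * (sqrt C + 1))^2"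
   proof -
    have "C <= (sqrt C + 1)^2" using C0 by (simp add: power2_sum)
    hence "(2 * e1)^2 * C <= (2 * e1)^2 * (sqrt C + 1)^2" by (intro mult_left_mono) auto
    thus ?thesis by (simp add: power_mult_distrib)
   qed
   finally have "L2_norm Mh (%x. Xn n u x - ?Y n x) <= 2 * e1 * (sqrt C + 1)"
    by (rule power2_le_imp_le) (use e1 C0 in simp)
   also have "\<dots> = e / 2"
   proof -
    have "sqrt C + 1 > 0" using C0 by (simp add: add_nonneg_pos)
    thus ?thesis by (simp add: e1_def field_simps)
   qed
   finally show "norm (L2_norm Mh (%x. Xn n u x - ?Y n x) - 0) < e" using e by simp
  qed
 qed
 have Y: "L2_lim Mh ?Y (%x. \<Sum>(c, f)\<leftarrow>ps. c x * DS f x)" by (rule stp_list_lim[OF ps])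
 have "L2_lim Mh (%n x. Xn n u x - ?Y n x) (%_. 0)"
  unfolding L2_lim_def using diff by (auto intro!: L2_diff Xn_L2 stp_L2 L2_zero)
 from L2_lim_add[OF this Y] have "L2_lim Mh (%n. Xn n u) (%x. \<Sum>(c, f)\<leftarrow>ps. c x * DS f x)" by simp
 from L2_lim_unique[OF DS[OF ud] this] ud show ?thesis by blast
qed

end

section \<open>The gasket as an instance of the abstract setting\<close>

context gasket_harmonic begin

lemma h_cont: "continuous_on K h" by (rule continuous_on_eq[OF hf_cont]) (simp add: h_hf)

lemma cv_h: "w \<in> words n ==> j \<in> {0,1,2} ==> cv h w j = ha w j"
 using cv_hf[of w n j a] h_hf[OF Fw_K[OF q_K]] by (simp add: cv_def)

lemma En_h: "En n h f = E0 a (cv f [])"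
proof -
 have "E0 (cv h w) (cv f w) = E0 (cv (hf a) w) (cv f w)" if "w \<in> words n" for w
  by (intro E0_cong) (simp_all add: cv_h[OF that] cv_hf[OF that])
 hence "En n h f = En n (hf a) f" unfolding En_def by simp
 thus ?thesis by (simp add: En_hf)
qed

lemma h_SG: "h \<in> fdom SG" by (rule SG_domI[OF h_cont, of "E0 a (cv h [])"]) (simp add: En_h)

lemma energy_SG_h: "f \<in> fdom SG ==> energy SG h f = E0 a (cv f [])"
proof -
 assume f: "f \<in> fdom SG"
 have "(%n. En n h f) \<longlonglongrightarrow> energy SG h f" by (rule SG_energy_lim[OF h_SG f])
 from LIMSEQ_unique[OF this[unfolded En_h] tendsto_const] show ?thesis .
qed

lemma DS_h: "AE x in Mh. DS h x = 1"
proof (rule L2_lim_unique[OF DS[OF h_SG]])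
 have one: "(%_. 1) \<in> L2 Mh" by (rule Mh.L2_bounded[of _ 1]) auto
 have "AE x in Mh. 1 = Xn n h x" for n
 proof (rule stp_AE[of n])
  fix w x assume w: "w \<in> words n" "x \<in> Kc w"
  have "E0 (cv h w) (ha w) = E0 (ha w) (ha w)" by (intro E0_cong) (simp_all add: cv_h[OF w(1)])
  thus "1 = Xn n h x" using ha_pos[OF w(1)] by (simp add: Xn_def stp_at[OF w] xi_def)
 qed
 thus "L2_lim Mh (%n. Xn n h) (%_. 1)" by (intro L2_lim_cong_AE[OF L2_lim_const[OF one]] Xn_L2 one) auto
qed

lemma DS_L2: "f \<in> fdom SG ==> DS f \<in> L2 Mh" using DS L2_lim_L2(1) by blast

lemma DS_add_cmult:
 assumes f: "f \<in> fdom SG" and g: "g \<in> fdom SG"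
 shows "AE x in Mh. DS (%x. f x + r * g x) x = DS f x + r * DS g x"
proof -
 have "[(%_. 1, f), (%_. r, g)] \<in> form_terms SG" using f g by (simp add: form_terms_def cont_funs_def)
 from DS_calc[OF this, of "%x. f x + r * g x", OF exI[of _ 1]]
 show ?thesis by (simp add: right_diff_distrib)
qed

lemma DS_diff_norm:
 assumes f: "f \<in> fdom SG" and g: "g \<in> fdom SG"
 shows "(L2_norm Mh (%x. DS f x - DS g x))^2 = Elim (%x. f x - g x)"
proof -
 have "AE x in Mh. DS (%x. f x - g x) x = DS f x - DS g x" using DS_add_cmult[OF f g, of "-1"] by simp
 hence "L2_norm Mh (DS (%x. f x - g x)) = L2_norm Mh (%x. DS f x - DS g x)"
  by (intro L2_norm_cong_AE L2_measurable L2_diff DS_L2 f g SG_add)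
 thus ?thesis using DS_norm[OF SG_add(2)[OF f g]] by simp
qed

lemma DS_energy:
 assumes f: "f \<in> fdom SG" and g: "g \<in> fdom SG"
 shows "energy SG f g = (LINT x|Mh. DS f x * DS g x)"
proof -
 have "AE x in Mh. DS (%x. f x + g x) x = DS f x + DS g x" using DS_add_cmult[OF f g, of 1] by simp
 hence "L2_norm Mh (DS (%x. f x + g x)) = L2_norm Mh (%x. DS f x + DS g x)"
  by (intro L2_norm_cong_AE L2_measurable L2_add DS_L2 f g SG_add)
 hence "Elim (%x. f x + g x) = (L2_norm Mh (%x. DS f x + DS g x))^2" using DS_norm[OF SG_add(1)[OF f g]] by simp
 thus ?thesis unfolding SG_energy DS_diff_norm[OF f g, symmetric] L2_norm_diff_sq[OF DS_L2[OF f] DS_L2[OF g]]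
  by (simp add: L2_norm_add_sq[OF DS_L2[OF f] DS_L2[OF g]])
qed

text \<open>Discrete energies of a fixed level are continuous under pointwise convergence. The
  Cauchy estimate for the energy of u n - u m therefore passes to u n - v, level by level and then
  in the limit.\<close>

lemma DS_closed:
 assumes u: "!!n. u n \<in> fdom SG" and lim: "uniform_limit K u v sequentially"
  and D: "L2_lim Mh (%n. DS (u n)) \<xi>"
 shows "v \<in> fdom SG & (AE x in Mh. DS v x = \<xi> x)"
proof -
 have vc: "continuous_on K v" by (rule uniform_limit_theorem[OF _ lim]) (use u in "auto simp: SG_simps")
 have pt: "(%n. u n x) \<longlonglongrightarrow> v x" if "x \<in> K" for x by (rule tendsto_uniform_limitI[OF lim that])
 have small: "\<exists>N. ALL n>=N. (%x. u n x - v x) \<in> fdom SG & Elim (%x. u n x - v x) <= e^2" if e: "e > 0" for e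
 proof -
  have "(%n. L2_norm Mh (%x. DS (u n) x - \<xi> x)) \<longlonglongrightarrow> 0" using D by (simp add: L2_lim_def)
  hence "eventually (%n. L2_norm Mh (%x. DS (u n) x - \<xi> x) < e / 2) sequentially"
   using e by (intro order_tendstoD(2)[of _ 0]) auto
  then obtain N where N: "!!n. n >= N ==> L2_norm Mh (%x. DS (u n) x - \<xi> x) < e / 2"
   unfolding eventually_sequentially by blast
  have le: "En k (%x. u n x - v x) (%x. u n x - v x) <= e^2" if n: "n >= N" for n k
  proof (rule LIMSEQ_le_const2)
   show "(%m. En k (%x. u n x - u m x) (%x. u n x - u m x)) \<longlonglongrightarrow> En k (%x. u n x - v x) (%x. u n x - v x)"
    unfolding En_def E0_def cv_def by (intro tendsto_intros pt Fw_K[OF q_K]) auto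
   have "En k (%x. u n x - u m x) (%x. u n x - u m x) <= e^2" if m: "m >= N" for m
   proof -
    have "L2_norm Mh (%x. DS (u n) x - DS (u m) x) <= e"
     using L2_norm_triangle[OF DS_L2[OF u[of n]] L2_lim_L2(1)[OF D] DS_L2[OF u[of m]]]
      L2_norm_minus_commute[of Mh \<xi> "DS (u m)"] N[OF n] N[OF m] by linarith
    hence "Elim (%x. u n x - u m x) <= e^2" unfolding DS_diff_norm[OF u u, symmetric] by (intro power_mono) auto
    thus ?thesis using En_le_Elim[OF SG_add(2)[OF u u]] order_trans by blast
   qed
   thus "\<exists>N. ALL m>=N. En k (%x. u n x - u m x) (%x. u n x - u m x) <= e^2" by blast
  qed
  have "(%x. u n x - v x) \<in> fdom SG" if "n >= N" for n
  proof (rule SG_domI[OF _ le[OF that]])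
   show "continuous_on K (%x. u n x - v x)" using u vc by (intro continuous_on_diff) (auto simp: SG_simps)
  qed
  moreover from this have "Elim (%x. u n x - v x) <= e^2" if "n >= N" for n
   using LIMSEQ_le_const2[OF Elim] le[OF that] that by blast
  ultimately show ?thesis by blast
 qed
 have vd: "v \<in> fdom SG"
 proof -
  obtain N where "(%x. u N x - v x) \<in> fdom SG" using small[of 1] by auto
  from SG_add(2)[OF u[of N] this] show ?thesis by simp
 qed
 have "L2_lim Mh (%n. DS (u n)) (DS v)" unfolding L2_lim_def
 proof (intro conjI allI DS_L2 u vd LIMSEQ_I)
  fix e :: real assume e: "e > 0"
  obtain N where N: "!!n. n >= N ==> Elim (%x. u n x - v x) <= (e / 2)^2" using small[of "e / 2"] e by auto
  have "L2_norm Mh (%x. DS (u n) x - DS v x) <= e / 2" if "n >= N" for n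
   by (rule power2_le_imp_le) (use N[OF that] e in "simp_all add: DS_diff_norm[OF u vd]")
  thus "\<exists>N. ALL n>=N. norm (L2_norm Mh (%x. DS (u n) x - DS v x) - 0) < e" using e by (intro exI[of _ N]) force
 qed
 from L2_lim_unique[OF this D] vd show ?thesis by blast
qed

lemma Mh_supp:
 assumes U: "open U" and ne: "U \<inter> K ~= {}" shows "emeasure Mh (U \<inter> K) ~= 0"
proof -
 obtain x where x: "x \<in> U" "x \<in> K" using ne by blast
 obtain e where e: "e > 0" "ball x e \<subseteq> U" using U x(1) open_contains_ball by blast
 obtain n where n: "diam / 2 ^ n < e" using cells_small[OF e(1)] by blast
 obtain w y where w: "w \<in> words n" "y \<in> K" "x = Fw w y" using K_cell[OF x(2)] by blast
 have "Kc w \<subseteq> U \<inter> K"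
 proof
  fix p assume "p \<in> Kc w"
  then obtain z where z: "z \<in> K" "p = Fw w z" by (auto simp: Kc_def)
  have "dist x p < e" using cell_diam[OF w(1) K_T[OF w(2)] K_T[OF z(1)]] n w(3) z(2) by simp
  thus "p \<in> U \<inter> K" using e(2) Fw_K[OF z(1) w(1)] z(2) by auto
 qed
 moreover have "U \<inter> K \<in> sets Mh" unfolding sets_Mh sets_restrict_space using U by auto
 ultimately have "emeasure Mh (Kc w) <= emeasure Mh (U \<inter> K)" by (rule emeasure_mono)
 moreover have "emeasure Mh (Kc w) > 0"
  using Kc_measure[OF w(1)] pm_pos[OF w(1)] by (simp add: Mh.emeasure_eq_measure)
 ultimately show ?thesis by auto
qed

lemma SG_one_dim: "one_dim_energy SG h Mh DS"
proof
 show "compact (carr SG)" "finite (bdry SG)" "bdry SG \<subseteq> carr SG" "bdry SG ~= {}"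
  using K_compact q_K by (auto simp: SG_simps(1,2))
 show "AE x in Mh. x \<notin> bdry SG" using sgV_null[of 0] by (simp add: SG_simps(2))
 show "EX c>=0. \<forall>f\<in>fdom SG. \<forall>x\<in>carr SG. \<forall>y\<in>carr SG. \<bar>f x - f y\<bar> <= c * L2_norm Mh (DS f)"
 proof (intro exI[of _ 10] conjI ballI)
  fix f x y assume f: "f \<in> fdom SG" and xy: "x \<in> carr SG" "y \<in> carr SG"
  have "sqrt (Elim f) = L2_norm Mh (DS f)" by (simp add: DS_norm[OF f, symmetric])
  thus "\<bar>f x - f y\<bar> <= 10 * L2_norm Mh (DS f)" using SG_poincare[OF f] xy by (simp add: SG_simps(1))
 qed simp
 show "continuous_on (carr SG) f" if "f \<in> fdom SG" for f using that by (simp add: SG_simps)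
 show "v \<in> fdom SG & (AE x in Mh. DS v x = \<xi> x)"
  if "!!n. u n \<in> fdom SG" "uniform_limit (carr SG) u v sequentially" "L2_lim Mh (%n. DS (u n)) \<xi>" for u v \<xi>
  using DS_closed[OF that(1) that(2)[unfolded SG_simps(1)] that(3)] .
qed (unfold SG_simps(1), (rule Mh_radon Mh_supp h_SG DS_h DS_L2 DS_energy SG_separate DS_calc; blast)+)

text \<open>The normal derivative of the harmonic function at q i is the sum of the differences a i
  - a j.\<close>

definition flux :: "real^2 => real" where
 "flux p = (\<Sum>i\<in>{0,1,2}. if p = q i then 3 * a i - (a 0 + a 1 + a 2) else 0)"

lemma flux_q: "i \<in> {0,1,2} ==> flux (q i) = 3 * a i - (a 0 + a 1 + a 2)"
 using q_distinct by (auto simp: flux_def)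

text \<open>The factor r is 1 on the gasket and (3/5)^m on the graphs.\<close>

lemma sum_flux: "(\<Sum>p\<in>{q 0, q 1, q 2}. r * flux p * f p) = r * E0 a (cv f [])"
 using q_distinct by (simp add: flux_q E0_def cv_def) (simp add: algebra_simps)

lemma SG_bdry3:
 assumes "c > 0"
 shows "one_dim_bdry3 SG h Mh DS flux q c"
proof -
 interpret one_dim_energy SG h Mh DS by (rule SG_one_dim)
 show ?thesis
 proof
  fix f assume f: "f \<in> fdom SG"
  show "energy SG h f = (\<Sum>p\<in>bdry SG. flux p * f p)"
   unfolding energy_SG_h[OF f] SG_simps(2) using sum_flux[of 1 f] by simp
 qed (use assms q_distinct in "simp_all add: SG_simps(2)")
qed

end

section \<open>Absolutely continuous functions on the unit interval\<close>

abbreviation UI :: "real measure" where "UI \<equiv> restrict_space lborel {0..1}"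

lemma space_UI: "space UI = {0..1}" by (simp add: space_restrict_space)

interpretation UI: finite_measure UI by (rule finite_measureI) (simp add: space_UI emeasure_restrict_space)

lemma UI_measurable: "f \<in> borel_measurable borel ==> f \<in> borel_measurable UI"
 by (intro measurable_restrict_space1) simp

lemma UI_integral: "(LINT s|UI. g s) = (LINT s|lborel. indicator {0..1} s * (g s :: real))"
 by (subst integral_restrict_space) auto

lemma UI_integrable: "integrable UI g \<longleftrightarrow> integrable lborel (%s. indicator {0..1} s * (g s :: real))"
 by (subst integrable_restrict_space) auto

lemma UI_reflect: "(LINT s|UI. g (1 - s)) = (LINT s|UI. (g s :: real))"
 "integrable UI (%s. g (1 - s)) \<longleftrightarrow> integrable UI g"
proof -
 have e: "(%s. indicator {0..1} s * g (1 - s)) = (%s. indicator {0..1} (1 + (-1) * s) * g (1 + (-1) * s))"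
  by (auto simp: fun_eq_iff indicator_def)
 show "(LINT s|UI. g (1 - s)) = (LINT s|UI. g s)" unfolding UI_integral e
  using lborel_integral_real_affine[of "-1" "%s. indicator {0..1} s * g s" 1] by simp
 show "integrable UI (%s. g (1 - s)) \<longleftrightarrow> integrable UI g" unfolding UI_integrable e
  using lborel_integrable_real_affine_iff[of "-1" "%s. indicator {0..1} s * g s" 1] by simp
qed

definition J :: "(real => real) => real => real" where "J g t = (LINT s:{0..t}|lborel. g s)"

lemma J_eq: "t \<in> {0..1} ==> J g t = (LINT s|UI. indicator {0..t} s * g s)"
 unfolding J_def UI_integral set_lebesgue_integral_def
 by (intro Bochner_Integration.integral_cong) (auto simp: indicator_def)

lemma J_1: "J g 1 = (LINT s|UI. g s)" by (simp add: J_def UI_integral set_lebesgue_integral_def)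

lemma ind_L2: "g \<in> L2 UI ==> (%s. indicator {0..t} s * g s) \<in> L2 UI"
 by (rule L2_mult_bounded[where B=1]) (auto intro: UI_measurable simp: indicator_def)

lemma J_integrable: "g \<in> L2 UI ==> integrable UI (%s. indicator {0..t} s * g s)"
 by (intro UI.L2_integrable ind_L2)

lemma J_add: "g \<in> L2 UI ==> k \<in> L2 UI ==> t \<in> {0..1} ==> J (%s. g s + k s) t = J g t + J k t"
 by (simp add: J_eq distrib_left J_integrable)

lemma J_cmult: "t \<in> {0..1} ==> J (%s. c * g s) t = c * J g t" by (simp add: J_eq mult.left_commute[of _ c])

lemma J_diff: "g \<in> L2 UI ==> k \<in> L2 UI ==> t \<in> {0..1} ==> J (%s. g s - k s) t = J g t - J k t"
 by (simp add: J_eq right_diff_distrib J_integrable)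

lemma J_sum_list: "(!!x. x \<in> set xs ==> G x \<in> L2 UI) ==> t \<in> {0..1} ==>
  (%s. \<Sum>x\<leftarrow>xs. G x s) \<in> L2 UI & J (%s. \<Sum>x\<leftarrow>xs. G x s) t = (\<Sum>x\<leftarrow>xs. J (G x) t)"
proof (induction xs)
 case (Cons x xs)
 thus ?case using J_add[of "G x" "%s. \<Sum>x\<leftarrow>xs. G x s" t] by (auto intro: L2_add)
qed (simp add: J_eq L2_zero)

lemma J_0: "J g 0 = 0"
proof -
 have "AE s in lborel. indicator {0..0} s *\<^sub>R g s = 0"
  using AE_lborel_singleton[of "0::real"] by eventually_elim (auto simp: indicator_def)
 thus ?thesis unfolding J_def set_lebesgue_integral_def by (rule integral_eq_zero_AE)
qed

lemma J_increment:
 assumes "g \<in> L2 UI" "0 <= s" "s <= t" "t <= 1"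
 shows "J g t - J g s = (LINT r|UI. indicator {s<..t} r * g r)"
proof -
 have "J g t - J g s = (LINT r|UI. indicator {0..t} r * g r - indicator {0..s} r * g r)"
  using assms by (simp add: J_eq J_integrable)
 also have "\<dots> = (LINT r|UI. indicator {s<..t} r * g r)"
  using assms by (intro Bochner_Integration.integral_cong) (auto simp: indicator_def)
 finally show ?thesis .
qed

lemma ioc_L2: "g \<in> L2 UI ==> (%r. indicator {s<..t} r * g r) \<in> L2 UI"
 by (rule L2_mult_bounded[where B=1]) (auto intro: UI_measurable simp: indicator_def)

lemma J_increment_mono:
 assumes k: "k \<in> L2 UI" and m: "m \<in> L2 UI" and st: "0 <= s" "s <= t" "t <= 1"
  and le: "!!r. s <= r ==> r <= t ==> \<bar>k r\<bar> <= m r"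
 shows "\<bar>J k t - J k s\<bar> <= J m t - J m s" unfolding J_increment[OF k st] J_increment[OF m st]
proof (rule integral_abs_bound[THEN order_trans], rule integral_mono)
 show "integrable UI (%r. \<bar>indicator {s<..t} r * k r\<bar>)" "integrable UI (%r. indicator {s<..t} r * m r)"
  by (intro integrable_abs UI.L2_integrable ioc_L2 k m)+
qed (use le in "auto simp: indicator_def")

lemma J_holder:
 assumes g: "g \<in> L2 UI" and st: "0 <= s" "s <= t" "t <= 1"
 shows "\<bar>J g t - J g s\<bar> <= sqrt (t - s) * L2_norm UI g"
proof -
 have i: "indicator {s<..t} \<in> L2 UI" by (rule UI.L2_bounded[of _ 1]) (auto intro: UI_measurable simp: indicator_def)
 have "(LINT r|UI. (indicator {s<..t} r :: real)^2) = (LINT r|lborel. indicator {s<..t} r)"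
  unfolding UI_integral using st by (intro Bochner_Integration.integral_cong) (auto simp: indicator_def)
 hence "L2_norm UI (indicator {s<..t}) = sqrt (t - s)" using st by (simp add: L2_norm_def)
 thus ?thesis using L2_norm_CS[OF i g] unfolding J_increment[OF g st] by simp
qed

lemma J_cont:
 assumes g: "g \<in> L2 UI" shows "continuous_on {0..1} (J g)"
proof (rule continuous_onI)
 fix t e :: real assume t: "t \<in> {0..1}" and e: "e > 0"
 let ?N = "L2_norm UI g + 1"
 have N: "?N > 0" by (simp add: add_nonneg_pos)
 have "dist (J g s) (J g t) <= e" if s: "s \<in> {0..1}" "dist s t < (e / ?N)^2" for s
 proof -
  have "\<bar>J g s - J g t\<bar> <= sqrt \<bar>s - t\<bar> * L2_norm UI g"
   using J_holder[OF g, of s t] J_holder[OF g, of t s] s t by (cases "s <= t") (auto simp: abs_minus_commute)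
  also have "\<dots> <= (e / ?N) * ?N" using s(2) e N by (intro mult_mono real_le_lsqrt) (auto simp: dist_real_def)
  finally show ?thesis using N by (simp add: dist_real_def)
 qed
 thus "\<exists>d>0. \<forall>s\<in>{0..1}. dist s t < d --> dist (J g s) (J g t) <= e"
  using e N by (intro exI[of _ "(e / ?N)^2"]) auto
qed

text \<open>The positive and the negative part of g define finite measures on the line with the same
  distribution function. They are equal, and so are their densities.\<close>

lemma J_zero_AE:
 assumes g: "g \<in> L2 UI" and z: "!!t. t \<in> {0..1} ==> J g t = 0"
 shows "AE s in UI. g s = 0"
proof -
 define \<psi> where "\<psi> s = indicator {0..1} s * g s" for s
 have \<psi>: "integrable lborel \<psi>" using UI.L2_integrable[OF g] unfolding UI_integrable \<psi>_def .
 have all: "(LINT s|lborel. indicator {..t} s * \<psi> s) = 0" for t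
 proof -
  consider "t < 0" | "t \<in> {0..1}" | "t > 1" by force
  thus ?thesis
  proof cases
   case 1
   hence "(%s. indicator {..t} s * \<psi> s) = (%_. 0)" by (auto simp: \<psi>_def indicator_def)
   thus ?thesis by simp
  next
   case 2
   have "(LINT s|lborel. indicator {..t} s * \<psi> s) = J g t" unfolding J_def set_lebesgue_integral_def using 2
    by (intro Bochner_Integration.integral_cong) (auto simp: \<psi>_def indicator_def)
   thus ?thesis using z[OF 2] by simp
  next
   case 3
   have "(LINT s|lborel. indicator {..t} s * \<psi> s) = J g 1" unfolding J_def set_lebesgue_integral_def using 3
    by (intro Bochner_Integration.integral_cong) (auto simp: \<psi>_def indicator_def)
   thus ?thesis using z[of 1] by simp
  qed
 qed
 define M where "M k = density lborel (%s. ennreal (k s))" for k :: "real => real"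
 let ?p = "%s. max 0 (\<psi> s)" and ?n = "%s. max 0 (- \<psi> s)"
 have i: "integrable lborel ?p" "integrable lborel ?n" using \<psi> by auto
 have em: "emeasure (M k) A = ennreal (LINT s|lborel. indicator A s * k s)"
  if "integrable lborel k" "!!s. k s >= 0" "A \<in> sets borel" for k A
 proof -
  have "integrable lborel (%s. indicator A s * k s)"
   using integrable_mult_indicator[of A lborel k] that(1,3) by simp
  hence "(\<integral>\<^sup>+s. ennreal (indicator A s * k s) \<partial>lborel) = ennreal (LINT s|lborel. indicator A s * k s)"
   by (rule nn_integral_eq_integral) (simp add: that(2))
  moreover have "emeasure (M k) A = (\<integral>\<^sup>+s. ennreal (indicator A s * k s) \<partial>lborel)"
   unfolding M_def using that by (subst emeasure_density) (auto intro!: nn_integral_cong simp: indicator_def)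
  ultimately show ?thesis by simp
 qed
 have fin: "finite_borel_measure (M k)" if "integrable lborel k" "!!s. k s >= 0" for k
 proof -
  have "finite_measure (M k)" using em[OF that, of UNIV] by (intro finite_measureI) (simp add: M_def)
  thus ?thesis by (simp add: finite_borel_measure_def finite_borel_measure_axioms_def M_def)
 qed
 have "M ?p = M ?n"
 proof (rule cdf_unique'[OF fin fin])
  show "cdf (M ?p) = cdf (M ?n)"
  proof
   fix t
   have "(LINT s|lborel. indicator {..t} s * ?p s) - (LINT s|lborel. indicator {..t} s * ?n s)
    = (LINT s|lborel. indicator {..t} s * ?p s - indicator {..t} s * ?n s)"
    using integrable_mult_indicator[OF _ i(1), of "{..t}"] integrable_mult_indicator[OF _ i(2), of "{..t}"] by simp
   also have "\<dots> = (LINT s|lborel. indicator {..t} s * \<psi> s)"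
    by (intro Bochner_Integration.integral_cong) (auto simp: indicator_def)
   finally show "cdf (M ?p) t = cdf (M ?n) t"
    using all[of t] em[OF i(1), of "{..t}"] em[OF i(2), of "{..t}"] by (simp add: cdf_def measure_def)
  qed
 qed (use i in auto)
 hence "AE s in lborel. ennreal (?p s) = ennreal (?n s)"
  unfolding M_def using \<psi> by (subst (asm) lborel.sigma_finite_measure_axioms[THEN sigma_finite_measure.density_unique_iff]) auto
 hence "AE s in lborel. s \<in> {0..1} --> g s = 0"
  by eventually_elim (auto simp: \<psi>_def indicator_def max_def split: if_splits)
 thus ?thesis by (subst AE_restrict_space_iff) auto
qed

lemma h1_iff: "h1_deriv f f' \<longleftrightarrow> f' \<in> borel_measurable borel & f' \<in> L2 UI & (\<forall>t\<in>{0..1}. f t = f 0 + J f' t)"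
 using UI_measurable[of f']
 unfolding h1_deriv_def L2_def mem_Collect_eq set_integrable_def UI_integrable J_def real_scaleR_def by blast

lemma h1_weak: "h1_deriv f f' ==> h1_deriv f (weak_deriv f)"
 unfolding weak_deriv_def by (rule someI[of "h1_deriv f"])

lemma h1_unique: assumes "h1_deriv f f'" "h1_deriv f g'" shows "AE t in UI. f' t = g' t"
proof -
 have L: "f' \<in> L2 UI" "g' \<in> L2 UI" using assms unfolding h1_iff by blast+
 have "AE t in UI. f' t - g' t = 0"
 proof (rule J_zero_AE[OF L2_diff[OF L]])
  fix t :: real assume t: "t \<in> {0..1}"
  have "f t = f 0 + J f' t" "f t = f 0 + J g' t" using assms t unfolding h1_iff by blast+
  thus "J (%t. f' t - g' t) t = 0" unfolding J_diff[OF L t] by linarith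
 qed
 thus ?thesis by simp
qed

lemma h1_cont: assumes "h1_deriv f f'" shows "continuous_on {0..1} f"
proof (rule continuous_on_eq)
 show "continuous_on {0..1} (%t. f 0 + J f' t)"
  using assms unfolding h1_iff by (intro continuous_intros J_cont) blast
 show "f 0 + J f' t = f t" if "t \<in> {0..1}" for t using assms that unfolding h1_iff by metis
qed

lemma h1_reflect: assumes "h1_deriv f f'" shows "h1_deriv (%t. f (1 - t)) (%t. - f' (1 - t))"
proof -
 have f: "f' \<in> borel_measurable borel" "f' \<in> L2 UI" "!!t. t \<in> {0..1} ==> f t = f 0 + J f' t"
  using assms unfolding h1_iff by blast+
 have m: "(%t. - f' (1 - t)) \<in> borel_measurable borel" using f(1) by measurable
 have J: "J (%t. - f' (1 - t)) t = J f' (1 - t) - J f' 1" if t: "t \<in> {0..1}" for t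
 proof -
  have "J (%t. - f' (1 - t)) t = - (LINT s|UI. indicator {0..t} (1 - (1 - s)) * f' (1 - s))"
   using t by (simp add: J_eq)
  also have "\<dots> = - (LINT s|UI. indicator {0..t} (1 - s) * f' s)"
   using UI_reflect(1)[of "%s. indicator {0..t} (1 - s) * f' s"] by simp
  also have "(LINT s|UI. indicator {0..t} (1 - s) * f' s) = (LINT s|UI. indicator {1 - t<..1} s * f' s)"
  proof (rule integral_cong_AE)
   show "AE s in UI. indicator {0..t} (1 - s) * f' s = indicator {1 - t<..1} s * f' s"
    using AE_lborel_singleton[of "1 - t"] by (subst AE_restrict_space_iff) (auto simp: indicator_def)
   show "(%s. indicator {0..t} (1 - s) * f' s) \<in> borel_measurable UI"
    "(%s. indicator {1 - t<..1} s * f' s) \<in> borel_measurable UI"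
    using f(1) by (auto intro!: UI_measurable borel_measurable_times borel_measurable_indicator' simp: vimage_def)
  qed
  finally show ?thesis using J_increment[OF f(2), of "1 - t" 1] t by simp
 qed
 show ?thesis unfolding h1_iff
 proof (intro conjI ballI m)
  show "(%t. - f' (1 - t)) \<in> L2 UI"
   using f(2) UI_measurable[OF m] UI_reflect(2)[of "%t. (f' t)^2"] by (simp add: L2_def)
  fix t :: real assume t: "t \<in> {0..1}"
  show "f (1 - t) = f (1 - 0) + J (%t. - f' (1 - t)) t"
   using f(3)[of "1 - t"] f(3)[of 1] t by (simp add: J[OF t])
 qed
qed

text \<open>Cut [0, t] into N equal pieces shorter than d and add up the increments.\<close>

lemma fine_increments:
 fixes w G :: "real => real"
 assumes inc: "!!s t. 0 <= s ==> s <= t ==> t <= 1 ==> t - s < d ==> \<bar>w t - w s\<bar> <= G t - G s"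
  and d: "d > 0" and t: "0 <= t" "t <= 1"
 shows "\<bar>w t - w 0\<bar> <= G t - G 0"
proof -
 obtain N :: nat where N: "1 / d < N" using reals_Archimedean2 by blast
 have N0: "real N > 0" using N d by (meson divide_pos_pos less_trans zero_less_one)
 have tN: "t / N < d"
 proof -
  have "1 < d * N" using N d by (simp add: divide_less_eq mult.commute)
  thus ?thesis using t N0 by (simp add: divide_less_eq)
 qed
 define r where "r = t / N"
 have r: "0 <= r" "r < d" "N * r = t" using t tN N0 by (simp_all add: r_def)
 have "k <= N ==> \<bar>w (k * r) - w 0\<bar> <= G (k * r) - G 0" for k
 proof (induction k)
  case (Suc k)
  have s: "Suc k * r = k * r + r" unfolding of_nat_Suc distrib_right by simp
  have "Suc k * r <= N * r" using Suc.prems r(1) by (intro mult_right_mono) auto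
  hence "\<bar>w (Suc k * r) - w (k * r)\<bar> <= G (Suc k * r) - G (k * r)" using r t unfolding s by (intro inc) auto
  thus ?case using Suc by simp
 qed simp
 from this[of N] show ?thesis unfolding r(3) by simp
qed

text \<open>On short intervals the increments of u and of the integral of the candidate derivative
  differ by at most 2 e times the total variation of the f, which \<open>m\<close> integrates to.
  \<open>fine_increments\<close> adds this up to [0, t], and e is arbitrary.\<close>

lemma h1_calc:
 assumes ps: "!!c f. (c, f) \<in> set ps ==> continuous_on {0..1} c & h1_deriv f (weak_deriv f)"
  and u: "!!e. e > 0 ==> \<exists>d>0. \<forall>s\<in>{0..1}. \<forall>t\<in>{0..1}. \<bar>s - t\<bar> < d -->
   \<bar>u s - u t - (\<Sum>(c, f)\<leftarrow>ps. c s * (f s - f t))\<bar> <= e * (\<Sum>(c, f)\<leftarrow>ps. \<bar>f s - f t\<bar>)"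
 shows "h1_deriv u (%t. \<Sum>(c, f)\<leftarrow>ps. (indicator {0..1} t * c t) * weak_deriv f t)"
proof -
 \<comment> \<open>The indicator makes the candidate Borel measurable on the whole line, as
   \<open>h1_deriv\<close> demands, while the coefficient is continuous on [0, 1] only.\<close>
 define P where "P p t = (indicator {0..1} t * fst p t) * weak_deriv (snd p) t" for p :: "(real => real) \<times> (real => real)" and t
 define m where "m p t = \<bar>weak_deriv (snd p) t\<bar>" for p :: "(real => real) \<times> (real => real)" and t
 have c: "continuous_on {0..1} (fst p)" and f: "h1_deriv (snd p) (weak_deriv (snd p))" if "p \<in> set ps" for p
  using ps[of "fst p" "snd p"] that by auto
 have cm: "(%t. indicator {0..1} t * fst p t) \<in> borel_measurable borel" if "p \<in> set ps" for p
  using borel_measurable_continuous_on_indicator[OF _ c[OF that]] by simp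
 have Pm: "P p \<in> borel_measurable borel" if "p \<in> set ps" for p
  using borel_measurable_times[OF cm[OF that]] f[OF that] unfolding P_def h1_iff by blast
 have fL: "weak_deriv (snd p) \<in> L2 UI" if "p \<in> set ps" for p using f[OF that] by (simp add: h1_iff)
 have fJ: "snd p t = snd p 0 + J (weak_deriv (snd p)) t" if "p \<in> set ps" "t \<in> {0..1}" for p t
  using f[OF that(1)] that(2) unfolding h1_iff by blast
 have PL: "P p \<in> L2 UI" if p: "p \<in> set ps" for p
 proof -
  have "bounded (fst p ` {0..1})" by (intro compact_imp_bounded compact_continuous_image c p) simp
  then obtain B where "\<forall>x\<in>fst p ` {0..1}. norm x <= B" unfolding bounded_iff by blast
  hence "AE t in UI. \<bar>indicator {0..1} t * fst p t\<bar> <= B" by (intro AE_I2) (auto simp: space_UI)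
  thus ?thesis unfolding P_def by (intro L2_mult_bounded[where B=B] UI_measurable cm p fL)
 qed
 have mL: "m p \<in> L2 UI" if "p \<in> set ps" for p
  using fL[OF that] unfolding m_def L2_def by (auto intro!: borel_measurable_abs)
 let ?P = "%t. \<Sum>p\<leftarrow>ps. P p t" and ?m = "%t. \<Sum>p\<leftarrow>ps. m p t"
 have JP: "?P \<in> L2 UI" "J ?P t = (\<Sum>p\<leftarrow>ps. J (P p) t)" and Jm: "J ?m t = (\<Sum>p\<leftarrow>ps. J (m p) t)" if "t \<in> {0..1}" for t
  using J_sum_list[of ps P t, OF PL that] J_sum_list[of ps m t, OF mL that] by auto
 have finc: "\<bar>snd p t - snd p s\<bar> <= J (m p) t - J (m p) s" if p: "p \<in> set ps" and st: "0 <= s" "s <= t" "t <= 1" for p s t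
 proof -
  have "snd p t - snd p s = J (weak_deriv (snd p)) t - J (weak_deriv (snd p)) s"
   using fJ[OF p, of t] fJ[OF p, of s] st by simp
  thus ?thesis using J_increment_mono[OF fL[OF p] mL[OF p] st] by (simp add: m_def)
 qed
 have key: "\<bar>(u t - J ?P t) - (u 0 - J ?P 0)\<bar> <= e * (2 * J ?m t)" if e: "e > 0" and t: "t \<in> {0..1}" for e t
 proof -
  obtain d where d: "d > 0" "!!s t. s \<in> {0..1} ==> t \<in> {0..1} ==> \<bar>s - t\<bar> < d ==>
   \<bar>u s - u t - (\<Sum>p\<leftarrow>ps. fst p s * (snd p s - snd p t))\<bar> <= e * (\<Sum>p\<leftarrow>ps. \<bar>snd p s - snd p t\<bar>)"
   using u[OF e] unfolding case_prod_unfold by blast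
  have "\<forall>p\<in>set ps. eventually (%d. \<forall>s\<in>{0..1}. \<forall>t\<in>{0..1}. \<bar>s - t\<bar> < d --> \<bar>fst p s - fst p t\<bar> <= e) (at_right 0)"
  proof
   fix p assume "p \<in> set ps"
   from compact_uniformly_continuous[OF c[OF this] compact_Icc] e obtain d0 where d0: "d0 > 0"
    "!!s t. s \<in> {0..1} ==> t \<in> {0..1} ==> dist t s < d0 ==> dist (fst p t) (fst p s) < e"
    unfolding uniformly_continuous_on_def by blast
   have "\<bar>fst p s - fst p t\<bar> <= e" if "d < d0" "s \<in> {0..1}" "t \<in> {0..1}" "\<bar>s - t\<bar> < d" for d s t
    using d0(2)[of t s] that by (simp add: dist_real_def)
   thus "eventually (%d. \<forall>s\<in>{0..1}. \<forall>t\<in>{0..1}. \<bar>s - t\<bar> < d --> \<bar>fst p s - fst p t\<bar> <= e) (at_right 0)"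
    unfolding eventually_at_right_field using d0(1) by blast
  qed
  hence "eventually (%d. \<forall>p\<in>set ps. \<forall>s\<in>{0..1}. \<forall>t\<in>{0..1}. \<bar>s - t\<bar> < d --> \<bar>fst p s - fst p t\<bar> <= e) (at_right 0)"
   by (rule eventually_ball_finite[OF finite_set])
  then obtain b where b: "b > 0" "!!d. 0 < d ==> d < b ==>
    \<forall>p\<in>set ps. \<forall>s\<in>{0..1}. \<forall>t\<in>{0..1}. \<bar>s - t\<bar> < d --> \<bar>fst p s - fst p t\<bar> <= e"
   unfolding eventually_at_right_field by blast
  \<comment> \<open>The factor 2 combines the error allowed by the hypothesis on u with that of
    freezing the coefficients at the endpoint t.\<close>
  have inc: "\<bar>(u t - J ?P t) - (u s - J ?P s)\<bar> <= e * (2 * J ?m t) - e * (2 * J ?m s)"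
   if st: "0 <= s" "s <= t" "t <= 1" "t - s < min d (b / 2)" for s t
  proof -
   have I: "s \<in> {0..1}" "t \<in> {0..1}" using st by auto
   have "\<bar>u t - u s - (\<Sum>p\<leftarrow>ps. fst p t * (snd p t - snd p s))\<bar> <= e * (\<Sum>p\<leftarrow>ps. \<bar>snd p t - snd p s\<bar>)"
    using st by (intro d(2) I) auto
   also have "(\<Sum>p\<leftarrow>ps. \<bar>snd p t - snd p s\<bar>) <= (\<Sum>p\<leftarrow>ps. J (m p) t - J (m p) s)" by (intro sum_list_mono finc st)
   finally have 1: "\<bar>u t - u s - (\<Sum>p\<leftarrow>ps. fst p t * (snd p t - snd p s))\<bar> <= e * (J ?m t - J ?m s)"
    using e by (simp add: Jm[OF I(1)] Jm[OF I(2)] sum_list_subtractf)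
   have trm: "\<bar>fst p t * (snd p t - snd p s) - (J (P p) t - J (P p) s)\<bar> <= e * (J (m p) t - J (m p) s)"
    if p: "p \<in> set ps" for p
   proof -
    let ?k = "%r. fst p t * weak_deriv (snd p) r - P p r" and ?f = "weak_deriv (snd p)"
    have sd: "snd p t - snd p s = J ?f t - J ?f s" using fJ[OF p I(2)] fJ[OF p I(1)] by simp
    have kJ: "J ?k r = fst p t * J ?f r - J (P p) r" if "r \<in> {0..1}" for r
     using that by (simp add: J_diff[OF L2_cmult[OF fL[OF p]] PL[OF p]] J_cmult)
    have eq: "fst p t * (snd p t - snd p s) - (J (P p) t - J (P p) s) = J ?k t - J ?k s"
     unfolding sd kJ[OF I(1)] kJ[OF I(2)] by (simp add: right_diff_distrib)
    have "\<bar>J ?k t - J ?k s\<bar> <= J (%r. e * m p r) t - J (%r. e * m p r) s"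
    proof (rule J_increment_mono)
     fix r assume r: "s <= r" "r <= t"
     have "\<bar>fst p t - fst p r\<bar> <= e" using b(2)[of "b / 2"] b(1) p I st r by auto
     hence "\<bar>fst p t - fst p r\<bar> * \<bar>?f r\<bar> <= e * \<bar>?f r\<bar>" by (intro mult_right_mono) auto
     moreover have "?k r = (fst p t - fst p r) * ?f r" using r st by (simp add: P_def left_diff_distrib)
     ultimately show "\<bar>?k r\<bar> <= e * m p r" by (simp add: m_def abs_mult)
    qed (use p st in "auto intro!: L2_diff L2_cmult fL PL mL")
    thus ?thesis unfolding eq using I by (simp add: J_cmult right_diff_distrib)
   qed
   have "\<bar>\<Sum>p\<leftarrow>ps. fst p t * (snd p t - snd p s) - (J (P p) t - J (P p) s)\<bar>
     <= (\<Sum>p\<leftarrow>ps. \<bar>fst p t * (snd p t - snd p s) - (J (P p) t - J (P p) s)\<bar>)"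
    using sum_list_abs[of "map (%p. fst p t * (snd p t - snd p s) - (J (P p) t - J (P p) s)) ps"] by (simp add: comp_def)
   also have "\<dots> <= (\<Sum>p\<leftarrow>ps. e * (J (m p) t - J (m p) s))" by (intro sum_list_mono trm)
   finally have 2: "\<bar>(\<Sum>p\<leftarrow>ps. fst p t * (snd p t - snd p s)) - (J ?P t - J ?P s)\<bar> <= e * (J ?m t - J ?m s)"
    by (simp add: sum_list_subtractf sum_list_const_mult Jm[OF I(1)] Jm[OF I(2)] JP(2)[OF I(1)] JP(2)[OF I(2)])
   show ?thesis using 1 2 by (simp add: right_diff_distrib)
  qed
  have "\<bar>(u t - J ?P t) - (u 0 - J ?P 0)\<bar> <= e * (2 * J ?m t) - e * (2 * J ?m 0)"
   by (rule fine_increments[where d="min d (b / 2)" and w="%t. u t - J ?P t" and G="%t. e * (2 * J ?m t)", OF inc]) (use d(1) b(1) t in auto)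
  thus ?thesis by (simp add: J_0)
 qed
 have uJ: "u t = u 0 + J ?P t" if t: "t \<in> {0..1}" for t
 proof (rule ccontr)
  assume ne: "u t ~= u 0 + J ?P t"
  define x where "x = \<bar>u t - J ?P t - u 0\<bar>"
  have x: "x > 0" using ne by (simp add: x_def)
  define y where "y = 2 * J ?m t"
  have le: "x <= e * y" if "e > 0" for e using key[OF that t] by (simp add: x_def y_def J_0)
  hence y: "y > 0" using x le[of 1] by simp
  \<comment> \<open>With this e the inequality x <= e y becomes x <= x / 2.\<close>
  have "x / (2 * y) > 0" using x y by simp
  from le[OF this] show False using x y by simp
 qed
 have "?P \<in> borel_measurable borel" using Pm by (induction ps) (auto intro!: borel_measurable_add)
 moreover have "?P \<in> L2 UI" by (rule JP(1)[of 0]) simp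
 ultimately have "h1_deriv u ?P" unfolding h1_iff using uJ by blast
 thus ?thesis by (simp add: P_def case_prod_unfold)
qed

section \<open>Metric graphs in the plane\<close>

lemma h1_affine: "h1_deriv (%s. (1 - s) * c + s * d) (%_. d - c)"
proof -
 have 1: "J (%_. 1) t = t" if "t \<in> {0..1}" for t using that by (simp add: J_def set_lebesgue_integral_def)
 have "J (%_. d - c) t = (d - c) * t" if "t \<in> {0..1}" for t
  using J_cmult[OF that, of "d - c" "%_. 1"] 1[OF that] by simp
 thus ?thesis unfolding h1_iff using UI.L2_const[of "d - c"] by (auto simp: algebra_simps)
qed

lemma edge_pt_reverse: "edge_pt y x t = edge_pt x y (1 - t)" by (simp add: edge_pt_def add.commute)

text \<open>\<open>meet\<close> says that an interior point of an edge lies on no other edge, and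
  \<open>hne\<close> that the edge-linear extension of h is strictly monotone on every edge, so that
  its gradient dominates. The root v0 only serves to express connectedness.\<close>

locale plane_graph =
 fixes Ed :: "((real^2) \<times> (real^2)) set" and B :: "(real^2) set" and h :: "real^2 => real" and v0 :: "real^2"
 assumes fin: "finite Ed" and sym: "!!x y. (x, y) \<in> Ed ==> (y, x) \<in> Ed"
  and meet: "!!x y x' y' t t'. (x, y) \<in> Ed ==> (x', y') \<in> Ed ==> 0 < t ==> t < 1 ==> 0 <= t' ==> t' <= 1 ==>
   edge_pt x y t = edge_pt x' y' t' ==> (x', y') = (x, y) | (x', y') = (y, x)"
  and hne: "!!x y. (x, y) \<in> Ed ==> h x ~= h y"
  and conn: "!!x y. (x, y) \<in> Ed ==> (v0, x) \<in> Ed\<^sup>*"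
  and B: "finite B" "B ~= {}" "B \<subseteq> fst ` Ed"
begin

abbreviation "X \<equiv> graph_pts Ed"
abbreviation "GS \<equiv> graph_space Ed B"
abbreviation "hl \<equiv> edge_linear Ed h"

text \<open>One of the two orientations of every edge, namely the one along which h increases, so
  that \<open>dh\<close> is positive.\<close>

definition E where "E = {e \<in> Ed. h (fst e) < h (snd e)}"
definition dh where "dh e = h (snd e) - h (fst e)"
definition ept where "ept e t = edge_pt (fst e) (snd e) t"
definition tc :: "(real^2) \<times> (real^2) => real^2 => real" where
 "tc e p = ((p - fst e) \<bullet> (snd e - fst e)) / ((snd e - fst e) \<bullet> (snd e - fst e))"
definition dv where "dv f e = weak_deriv (%s. f (ept e s))"

lemma E_Ed: "e \<in> E ==> e \<in> Ed" and finE: "finite E" and dh_pos: "e \<in> E ==> dh e > 0"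
 using fin by (auto simp: E_def dh_def)

lemma Ed_ne: "e \<in> Ed ==> fst e ~= snd e" using hne[of "fst e" "snd e"] by auto

lemma ept_swap: "ept (prod.swap e) t = ept e (1 - t)" by (simp add: ept_def edge_pt_reverse[of "snd e" "fst e"])

lemma Ed_cases: assumes "e \<in> Ed" shows "e \<in> E | prod.swap e \<in> E"
proof (cases e)
 case (Pair x y)
 thus ?thesis using assms hne[of x y] sym[of x y] by (auto simp: E_def)
qed

lemma Ed_split: "Ed = E \<union> prod.swap ` E" "E \<inter> prod.swap ` E = {}"
proof -
 show "Ed = E \<union> prod.swap ` E"
 proof (intro set_eqI iffI)
  fix e assume "e \<in> Ed"
  hence "e \<in> E | prod.swap e \<in> E" by (rule Ed_cases)
  thus "e \<in> E \<union> prod.swap ` E" using image_eqI[of e prod.swap "prod.swap e" E] by auto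
 next
  fix e assume "e \<in> E \<union> prod.swap ` E"
  then obtain e' where "e' \<in> E" "e = e' | e = prod.swap e'" by blast
  thus "e \<in> Ed" using E_Ed[of e'] sym[of "fst e'" "snd e'"] by (auto simp: prod.swap_def)
 qed
qed (auto simp: E_def)

lemma sum_Ed: assumes "!!e. e \<in> E ==> G (prod.swap e) = G e"
 shows "(\<Sum>e\<in>Ed. G e) = 2 * (\<Sum>e\<in>E. G e :: real)"
proof -
 have "(\<Sum>e\<in>Ed. G e) = (\<Sum>e\<in>E \<union> prod.swap ` E. G e)" by (rule sum.cong[OF Ed_split(1) refl])
 also have "\<dots> = (\<Sum>e\<in>E. G e) + (\<Sum>e\<in>prod.swap ` E. G e)"
  by (rule sum.union_disjoint) (use finE Ed_split(2) in auto)
 also have "(\<Sum>e\<in>prod.swap ` E. G e) = (\<Sum>e\<in>E. G e)"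
  by (subst sum.reindex) (auto simp: assms comp_def intro!: sum.cong)
 finally show ?thesis by simp
qed

lemma ept_eq: "ept e t = fst e + t *\<^sub>R (snd e - fst e)" by (simp add: ept_def edge_pt_def algebra_simps)

lemma ept_ends: "ept e 0 = fst e" "ept e 1 = snd e" by (simp_all add: ept_eq)

lemma tc_ept: "e \<in> Ed ==> tc e (ept e t) = t" using Ed_ne[of e] by (simp add: tc_def ept_eq)

lemma ept_cont: "continuous_on A (ept e)" and tc_cont: "continuous_on C (tc e)"
 unfolding ept_eq tc_def divide_inverse by (intro continuous_intros)+

lemma ept_X: "e \<in> Ed ==> t \<in> {0..1} ==> ept e t \<in> X"
 unfolding graph_pts_def ept_def by (rule UN_I[of e]) (auto simp: case_prod_unfold)

lemma X_E: "p \<in> X ==> \<exists>e\<in>E. \<exists>t\<in>{0..1}. p = ept e t"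
proof -
 assume "p \<in> X"
 then obtain e t where e: "e \<in> Ed" "t \<in> {0..1}" "p = ept e t" by (auto simp: graph_pts_def ept_def)
 have "p = ept (prod.swap e) (1 - t)" "1 - t \<in> {0..1}" using e by (auto simp: ept_swap)
 thus ?thesis using Ed_cases[OF e(1)] e(2,3) by blast
qed

lemma X_eq: "X = (\<Union>e\<in>E. ept e ` {0..1})" using X_E ept_X E_Ed by blast

lemma edge_closed: "closed (ept e ` {0..1})"
 by (intro compact_imp_closed compact_continuous_image ept_cont compact_Icc)

lemma X_compact: "compact X"
 unfolding X_eq by (intro compact_UN finE compact_continuous_image ept_cont compact_Icc)

lemma meet_E:
 assumes e: "e \<in> E" "e' \<in> E" and t: "0 < t" "t < 1" "t' \<in> {0..1}" and eq: "ept e t = ept e' t'"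
 shows "e' = e" using meet[of "fst e" "snd e" "fst e'" "snd e'" t t'] e t eq
 by (auto simp: E_def ept_def prod_eq_iff)

lemma UI_interior: assumes "!!t. 0 < t ==> t < 1 ==> P t" shows "AE t in UI. P t"
proof -
 have "AE t in lborel. t \<in> {0..1} --> P t"
  using AE_lborel_singleton[of "0::real"] AE_lborel_singleton[of "1::real"]
  by eventually_elim (use assms in force)
 thus ?thesis by (subst AE_restrict_space_iff) auto
qed

text \<open>On an edge with slope \<open>dh e\<close> the energy measure of the edge-linear function
  is (dh e)^2 times Lebesgue measure. \<open>MG\<close> is its image on the plane; vertices shared
  by several edges are null sets, so the images do not interfere.\<close>

definition PM where "PM = point_measure E (%e. ennreal ((dh e)^2)) \<Otimes>\<^sub>M UI"
definition MG where "MG = distr PM (restrict_space borel X) (%(e, t). ept e t)"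

lemma ept_meas: "e \<in> E ==> ept e \<in> measurable UI (restrict_space borel X)"
 using ept_X E_Ed borel_measurable_continuous_onI[OF ept_cont]
 by (intro measurable_restrict_space2 measurable_restrict_space1) (auto simp: space_UI)

lemma PM_meas:
 assumes "!!e. e \<in> E ==> G e \<in> measurable UI N"
 shows "(%(e, t). G e t) \<in> measurable PM N"
proof -
 have "(%(e, t). G e t) \<in> measurable (count_space E \<Otimes>\<^sub>M UI) N"
  by (rule measurable_pair_measure_countable1) (use assms finE in "auto intro: countable_finite")
 moreover have "sets PM = sets (count_space E \<Otimes>\<^sub>M UI)"
  unfolding PM_def by (intro sets_pair_measure_cong sets_point_measure_count_space refl)
 ultimately show ?thesis by (simp cong: measurable_cong_sets)
qed

lemma point_finite: "finite_measure (point_measure E (%e. ennreal ((dh e)^2)))"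
 by (rule finite_measureI) (simp add: space_point_measure emeasure_point_measure_finite finE sum_ennreal)

lemma MG_finite: "finite_measure MG"
 unfolding MG_def using finite_measure_pair_measure[OF UI.finite_measure_axioms point_finite] PM_meas[OF ept_meas]
 by (intro finite_measure.finite_measure_distr) (simp_all add: PM_def)

lemma sets_MG: "sets MG = sets (restrict_space borel X)" and space_MG: "space MG = X"
 by (simp_all add: MG_def space_restrict_space)

lemma MG_radon: "radon_on GS MG" using MG_finite by (simp add: radon_on_def sets_MG graph_space_def)

sublocale MG: finite_measure MG by (rule MG_finite)

lemma comp_ept_meas: "g \<in> borel_measurable MG ==> e \<in> E ==> (%t. g (ept e t)) \<in> borel_measurable UI"
 using measurable_compose[OF ept_meas, of e g borel] by (simp add: sets_MG cong: measurable_cong_sets)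

lemma MG_integral:
 fixes g :: "real^2 => real"
 assumes g: "g \<in> borel_measurable MG"
 shows "integrable MG g \<longleftrightarrow> (\<forall>e\<in>E. integrable UI (%t. g (ept e t)))"
  and "integrable MG g ==> (LINT p|MG. g p) = (\<Sum>e\<in>E. (dh e)^2 * (LINT t|UI. g (ept e t)))"
proof -
 let ?Q = "point_measure E (%e. ennreal ((dh e)^2))"
 interpret Q: finite_measure ?Q by (rule point_finite)
 interpret QU: pair_sigma_finite ?Q UI ..
 have gX: "g \<in> borel_measurable (restrict_space borel X)" using g by (simp add: sets_MG cong: measurable_cong_sets)
 have gm: "(%(e, t). ept e t) \<in> measurable PM (restrict_space borel X)" by (rule PM_meas[OF ept_meas])
 have G: "(%(e, t). g (ept e t)) \<in> borel_measurable (?Q \<Otimes>\<^sub>M UI)"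
  using PM_meas[OF comp_ept_meas[OF g]] by (simp add: PM_def)
 have i: "integrable MG g \<longleftrightarrow> integrable (?Q \<Otimes>\<^sub>M UI) (%(e, t). g (ept e t))"
  unfolding MG_def by (subst integrable_distr_eq[OF gm gX]) (simp add: PM_def case_prod_unfold)
 show iff: "integrable MG g \<longleftrightarrow> (\<forall>e\<in>E. integrable UI (%t. g (ept e t)))"
 proof
  assume "integrable MG g"
  from QU.AE_integrable_fst'[OF this[unfolded i]]
  have "\<forall>e\<in>E. 0 < ennreal ((dh e)^2) --> integrable UI (%t. g (ept e t))"
   by (simp only: AE_point_measure prod.case)
  moreover have "0 < ennreal ((dh e)^2)" if "e \<in> E" for e using dh_pos[OF that] by simp
  ultimately show "\<forall>e\<in>E. integrable UI (%t. g (ept e t))" by blast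
 next
  assume "\<forall>e\<in>E. integrable UI (%t. g (ept e t))"
  thus "integrable MG g" unfolding i
   by (intro QU.Fubini_integrable G integrable_point_measure_finite finE) (simp add: AE_point_measure)
 qed
 assume I: "integrable MG g"
 have "(LINT p|MG. g p) = (\<integral>x. (case x of (e, t) => g (ept e t)) \<partial>(?Q \<Otimes>\<^sub>M UI))"
  unfolding MG_def by (subst integral_distr[OF gm gX]) (simp add: PM_def case_prod_unfold)
 also have "\<dots> = (\<integral>e. (LINT t|UI. g (ept e t)) \<partial>?Q)" using QU.integral_fst'[OF I[unfolded i]] by simp
 also have "\<dots> = (\<Sum>e\<in>E. (dh e)^2 * (LINT t|UI. g (ept e t)))"
  by (subst lebesgue_integral_point_measure_finite[OF finE]) simp_all
 finally show "(LINT p|MG. g p) = (\<Sum>e\<in>E. (dh e)^2 * (LINT t|UI. g (ept e t)))" .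
qed

lemma MG_L2:
 assumes g: "g \<in> borel_measurable MG"
 shows "g \<in> L2 MG \<longleftrightarrow> (\<forall>e\<in>E. (%t. g (ept e t)) \<in> L2 UI)"
proof -
 have "(%p. (g p)^2) \<in> borel_measurable MG" using g by simp
 from MG_integral(1)[OF this] show ?thesis using comp_ept_meas[OF g] g by (simp add: L2_def)
qed

lemma MG_inner:
 assumes "g \<in> L2 MG" "k \<in> L2 MG"
 shows "(LINT p|MG. g p * k p) = (\<Sum>e\<in>E. (dh e)^2 * (LINT t|UI. g (ept e t) * k (ept e t)))"
 by (rule MG_integral(2)) (use assms L2_mult_integrable[OF assms] in auto)

lemma MG_norm:
 assumes "g \<in> L2 MG"
 shows "(L2_norm MG g)^2 = (\<Sum>e\<in>E. (dh e * L2_norm UI (%t. g (ept e t)))^2)"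
 using MG_inner[OF assms assms] by (simp only: L2_norm_sq power_mult_distrib power2_eq_square[symmetric])

lemma MG_norm_edge:
 assumes g: "g \<in> L2 MG" and e: "e \<in> E"
 shows "dh e * L2_norm UI (%t. g (ept e t)) <= L2_norm MG g"
proof (rule power2_le_imp_le)
 show "(dh e * L2_norm UI (%t. g (ept e t)))^2 <= (L2_norm MG g)^2"
  unfolding MG_norm[OF g] by (rule member_le_sum[OF e]) (auto simp: finE)
qed simp

lemma MG_AE_eq:
 assumes L: "f \<in> L2 MG" "g \<in> L2 MG" and ae: "!!e. e \<in> E ==> AE t in UI. f (ept e t) = g (ept e t)"
 shows "AE p in MG. f p = g p"
proof (rule L2_AE_eqI[OF L])
 have "(L2_norm MG (%p. f p - g p))^2 = 0" unfolding MG_norm[OF L2_diff[OF L]]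
 proof (intro sum.neutral ballI)
  fix e assume e: "e \<in> E"
  have "L2_norm UI (%t. f (ept e t) - g (ept e t)) = L2_norm UI (%_. 0)"
  proof (rule L2_norm_cong_AE)
   show "AE t in UI. f (ept e t) - g (ept e t) = 0" using ae[OF e] by eventually_elim simp
   show "(%t. f (ept e t) - g (ept e t)) \<in> borel_measurable UI"
    using comp_ept_meas[OF L2_measurable[OF L(1)] e] comp_ept_meas[OF L2_measurable[OF L(2)] e] by (rule borel_measurable_diff)
  qed simp
  thus "(dh e * L2_norm UI (%t. f (ept e t) - g (ept e t)))^2 = 0" by (simp add: L2_norm_def)
 qed
 thus "L2_norm MG (%p. f p - g p) = 0" by simp
qed

lemma GS_dom: "f \<in> fdom GS \<longleftrightarrow> continuous_on X f & (\<forall>e\<in>Ed. \<exists>f'. h1_deriv (%s. f (ept e s)) f')"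
 by (auto simp: graph_space_def ept_def case_prod_unfold)

lemma dv: "f \<in> fdom GS ==> e \<in> E ==> h1_deriv (%s. f (ept e s)) (dv f e)"
 unfolding dv_def GS_dom using h1_weak E_Ed by blast

lemma dv_L2: "f \<in> fdom GS ==> e \<in> E ==> dv f e \<in> L2 UI" using dv unfolding h1_iff by blast

lemma edges_cont:
 assumes "!!e. e \<in> E ==> continuous_on {0..1} (%t. f (ept e t))" shows "continuous_on X (f :: real^2 => real)"
 unfolding X_eq
proof (rule continuous_on_closed_Union[OF finE])
 fix e assume e: "e \<in> E"
 have "tc e ` ept e ` {0..1} \<subseteq> {0..1}" using tc_ept[OF E_Ed[OF e]] by auto
 hence "continuous_on (ept e ` {0..1}) (%p. f (ept e (tc e p)))"
  by (intro continuous_on_compose2[OF assms[OF e] tc_cont])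
 thus "continuous_on (ept e ` {0..1}) f" by (rule continuous_on_eq) (use tc_ept[OF E_Ed[OF e]] in auto)
qed (rule edge_closed)

lemma GS_domI:
 assumes "!!e. e \<in> E ==> h1_deriv (%s. f (ept e s)) (k e)" shows "f \<in> fdom GS" unfolding GS_dom
proof (intro conjI edges_cont ballI)
 show "continuous_on {0..1} (%t. f (ept e t))" if "e \<in> E" for e by (rule h1_cont[OF assms[OF that]])
 fix e assume "e \<in> Ed"
 then consider "e \<in> E" | "prod.swap e \<in> E" using Ed_cases by blast
 thus "\<exists>f'. h1_deriv (%s. f (ept e s)) f'"
 proof cases
  case 2
  from h1_reflect[OF assms[OF 2]] show ?thesis unfolding ept_swap by auto
 qed (use assms in blast)
qed

text \<open>The derivative with respect to h, that is f' / h' on the interior of every edge. Written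
  as a sum of Borel functions it is visibly measurable; at the vertices it is 0.\<close>

definition DG :: "(real^2 => real) => real^2 => real" where
 "DG f p = (\<Sum>e\<in>E. indicator {0<..<1} (tc e p) * indicator (ept e ` {0..1}) p * (dv f e (tc e p) / dh e))"

lemma DG_edge: assumes e: "e \<in> E" and t: "0 < t" "t < 1" shows "DG f (ept e t) = dv f e t / dh e"
proof -
 have "DG f (ept e t) = (\<Sum>e'\<in>E. if e' = e then dv f e t / dh e else 0)" unfolding DG_def
 proof (intro sum.cong refl)
  fix e' assume e': "e' \<in> E"
  show "indicator {0<..<1} (tc e' (ept e t)) * indicator (ept e' ` {0..1}) (ept e t) * (dv f e' (tc e' (ept e t)) / dh e')
   = (if e' = e then dv f e t / dh e else 0)"
  proof (cases "e' = e")
   case True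
   have "ept e t \<in> ept e ` {0..1}" using t by auto
   thus ?thesis using True t tc_ept[OF E_Ed[OF e]] by simp
  next
   case False
   hence "ept e t \<notin> ept e' ` {0..1}" using meet_E[OF e e' t] by blast
   thus ?thesis using False by simp
  qed
 qed
 thus ?thesis using e finE by simp
qed

lemma DG_meas: assumes f: "f \<in> fdom GS" shows "DG f \<in> borel_measurable MG"
proof -
 have "DG f \<in> borel_measurable borel" unfolding DG_def
 proof (intro borel_measurable_sum)
  fix e assume e: "e \<in> E"
  have t: "tc e \<in> borel_measurable borel" by (rule borel_measurable_continuous_onI[OF tc_cont])
  have d: "dv f e \<in> borel_measurable borel" using dv[OF f e] unfolding h1_iff by blast
  have c: "ept e ` {0..1} \<in> sets borel" by (rule borel_closed[OF edge_closed])
  have i: "(%p. indicator {0<..<1} (tc e p) :: real) \<in> borel_measurable borel"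
   by (rule measurable_compose[OF t]) simp
  show "(%p. indicator {0<..<1} (tc e p) * indicator (ept e ` {0..1}) p * (dv f e (tc e p) / dh e)) \<in> borel_measurable borel"
   by (intro borel_measurable_times borel_measurable_divide i measurable_compose[OF t d]
     borel_measurable_indicator c borel_measurable_const)
 qed
 hence "DG f \<in> borel_measurable (restrict_space borel X)" by (rule measurable_restrict_space1)
 thus ?thesis by (simp add: sets_MG cong: measurable_cong_sets)
qed

lemma DG_AE: "e \<in> E ==> AE t in UI. DG f (ept e t) = dv f e t / dh e" by (intro UI_interior DG_edge)

lemma DG_L2: assumes f: "f \<in> fdom GS" shows "DG f \<in> L2 MG" unfolding MG_L2[OF DG_meas[OF f]]
proof
 fix e assume e: "e \<in> E"
 show "(%t. DG f (ept e t)) \<in> L2 UI"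
 proof (rule L2_cong_AE)
  show "(%t. 1 / dh e * dv f e t) \<in> L2 UI" by (rule L2_cmult[OF dv_L2[OF f e]])
  show "AE t in UI. 1 / dh e * dv f e t = DG f (ept e t)" using DG_AE[OF e, of f] by eventually_elim simp
 qed (rule comp_ept_meas[OF DG_meas[OF f] e])
qed

lemma DG_eqI:
 assumes g: "g \<in> borel_measurable MG" and k: "!!e. e \<in> E ==> h1_deriv (%s. f (ept e s)) (k e)"
  and eq: "!!e t. e \<in> E ==> 0 < t ==> t < 1 ==> g (ept e t) = k e t / dh e"
 shows "f \<in> fdom GS & (AE p in MG. DG f p = g p)"
proof
 show f: "f \<in> fdom GS" by (rule GS_domI[OF k])
 have ae: "AE t in UI. DG f (ept e t) = g (ept e t)" if e: "e \<in> E" for e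
 proof -
  have "AE t in UI. g (ept e t) = k e t / dh e" by (intro UI_interior eq e)
  with DG_AE[OF e, of f] h1_unique[OF dv[OF f e] k[OF e]] show ?thesis by eventually_elim simp
 qed
 have "g \<in> L2 MG" unfolding MG_L2[OF g]
 proof
  fix e assume e: "e \<in> E"
  have "(%t. DG f (ept e t)) \<in> L2 UI" using DG_L2[OF f] e MG_L2[OF DG_meas[OF f]] by blast
  thus "(%t. g (ept e t)) \<in> L2 UI" by (rule L2_cong_AE[OF _ comp_ept_meas[OF g e] ae[OF e]])
 qed
 thus "AE p in MG. DG f p = g p" by (rule MG_AE_eq[OF DG_L2[OF f] _ ae])
qed

lemma GS_energy:
 assumes f: "f \<in> fdom GS" and g: "g \<in> fdom GS"
 shows "energy GS f g = (\<Sum>e\<in>E. LINT t|UI. dv f e t * dv g e t)"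
proof -
 have LI: "(LINT t:{0..1}|lborel. k t) = (LINT t|UI. k t)" for k :: "real => real"
  by (simp add: set_lebesgue_integral_def UI_integral)
 have "energy GS f g = 1/2 * (\<Sum>e\<in>Ed. LINT t|UI. dv f e t * dv g e t)"
  by (simp add: graph_space_def graph_energy_def LI dv_def ept_def case_prod_unfold)
 also have "(\<Sum>e\<in>Ed. LINT t|UI. dv f e t * dv g e t) = 2 * (\<Sum>e\<in>E. LINT t|UI. dv f e t * dv g e t)"
 proof (rule sum_Ed)
  fix e assume e: "e \<in> E"
  have r: "h1_deriv (%s. u (ept (prod.swap e) s)) (%t. - dv u e (1 - t))" if "u \<in> fdom GS" for u
   using h1_reflect[OF dv[OF that e]] by (simp add: ept_swap)
  have w: "AE t in UI. dv u (prod.swap e) t = - dv u e (1 - t)" if "u \<in> fdom GS" for u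
   unfolding dv_def[of u "prod.swap e"] by (rule h1_unique[OF h1_weak[OF r[OF that]] r[OF that]])
  have m: "dv u (prod.swap e) \<in> borel_measurable UI" "(%t. - dv u e (1 - t)) \<in> borel_measurable UI" if "u \<in> fdom GS" for u
   using r[OF that] h1_weak[OF r[OF that]] unfolding dv_def[of u "prod.swap e"] h1_iff by (blast intro: UI_measurable)+
  have "(LINT t|UI. dv f (prod.swap e) t * dv g (prod.swap e) t) = (LINT t|UI. - dv f e (1 - t) * - dv g e (1 - t))"
  proof (rule integral_cong_AE)
   show "AE t in UI. dv f (prod.swap e) t * dv g (prod.swap e) t = - dv f e (1 - t) * - dv g e (1 - t)"
    using w[OF f] w[OF g] by eventually_elim simp
  qed (intro borel_measurable_times m f g)+
  also have "\<dots> = (LINT t|UI. dv f e t * dv g e t)" using UI_reflect(1)[of "%t. dv f e t * dv g e t"] by simp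
  finally show "(LINT t|UI. dv f (prod.swap e) t * dv g (prod.swap e) t) = (LINT t|UI. dv f e t * dv g e t)" .
 qed
 finally show ?thesis by simp
qed

end

section \<open>The metric graph as an instance of the abstract setting\<close>

context plane_graph begin

lemma DG_energy:
 assumes f: "f \<in> fdom GS" and g: "g \<in> fdom GS"
 shows "energy GS f g = (LINT p|MG. DG f p * DG g p)"
 unfolding GS_energy[OF f g] MG_inner[OF DG_L2[OF f] DG_L2[OF g]]
proof (intro sum.cong refl)
 fix e assume e: "e \<in> E"
 have "(LINT t|UI. DG f (ept e t) * DG g (ept e t)) = (LINT t|UI. (1 / (dh e)^2) * (dv f e t * dv g e t))"
 proof (rule integral_cong_AE)
  show "AE t in UI. DG f (ept e t) * DG g (ept e t) = (1 / (dh e)^2) * (dv f e t * dv g e t)"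
   using DG_AE[OF e, of f] DG_AE[OF e, of g] by eventually_elim (simp add: power2_eq_square)
 qed (intro borel_measurable_times borel_measurable_const L2_measurable[OF dv_L2[OF _ e]] comp_ept_meas[OF DG_meas e] f g)+
 thus "(LINT t|UI. dv f e t * dv g e t) = (dh e)^2 * (LINT t|UI. DG f (ept e t) * DG g (ept e t))"
  using dh_pos[OF e] by simp
qed

lemma dv_norm_le: assumes f: "f \<in> fdom GS" and e: "e \<in> E" shows "L2_norm UI (dv f e) <= L2_norm MG (DG f)"
proof -
 have "L2_norm UI (%t. DG f (ept e t)) = L2_norm UI (%t. 1 / dh e * dv f e t)"
 proof (rule L2_norm_cong_AE)
  show "AE t in UI. DG f (ept e t) = 1 / dh e * dv f e t" using DG_AE[OF e, of f] by eventually_elim simp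
 qed (intro borel_measurable_times borel_measurable_const L2_measurable[OF dv_L2[OF f e]] comp_ept_meas[OF DG_meas[OF f] e])+
 thus ?thesis using MG_norm_edge[OF DG_L2[OF f] e] dh_pos[OF e] unfolding L2_norm_cmult by simp
qed

lemma edge_increment:
 assumes f: "f \<in> fdom GS" and e: "e \<in> E" and t: "t \<in> {0..1}"
 shows "\<bar>f (ept e t) - f (fst e)\<bar> <= L2_norm MG (DG f)"
proof -
 have "f (ept e t) = f (ept e 0) + J (dv f e) t" using dv[OF f e] t unfolding h1_iff by blast
 hence "\<bar>f (ept e t) - f (fst e)\<bar> <= sqrt t * L2_norm UI (dv f e)"
  using J_holder[OF dv_L2[OF f e], of 0 t] t by (simp add: J_0 ept_ends)
 also have "\<dots> <= 1 * L2_norm MG (DG f)" using t by (intro mult_mono dv_norm_le f e) auto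
 finally show ?thesis by simp
qed

text \<open>Every edge has length 1, so increments along it are bounded by the norm of the
  derivative. Following a path from v0 multiplies the constant by its length, and finitely many
  edges allow a common constant.\<close>

lemma GS_poincare: "EX c>=0. \<forall>f\<in>fdom GS. \<forall>x\<in>X. \<forall>y\<in>X. \<bar>f x - f y\<bar> <= c * L2_norm MG (DG f)"
proof -
 have step: "\<bar>f x - f y\<bar> <= L2_norm MG (DG f)" if "f \<in> fdom GS" "(x, y) \<in> Ed" for f x y
  using Ed_cases[OF that(2)] edge_increment[OF that(1), of "(x, y)" 1] edge_increment[OF that(1), of "(y, x)" 1]
  by (auto simp: ept_ends abs_minus_commute)
 have path: "\<exists>c. \<forall>f\<in>fdom GS. \<bar>f v0 - f x\<bar> <= c * L2_norm MG (DG f)" if "(v0, x) \<in> Ed\<^sup>*" for x using that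
 proof induction
  case (step y z)
  then obtain c where c: "!!f. f \<in> fdom GS ==> \<bar>f v0 - f y\<bar> <= c * L2_norm MG (DG f)" by blast
  have "\<bar>f v0 - f z\<bar> <= (c + 1) * L2_norm MG (DG f)" if f: "f \<in> fdom GS" for f
   using c[OF f] \<open>!!f x y. f \<in> fdom GS ==> (x, y) \<in> Ed ==> \<bar>f x - f y\<bar> <= L2_norm MG (DG f)\<close>[OF f step(2)]
   by (simp add: distrib_right)
  thus ?case by blast
 qed (auto intro: exI[of _ 0])
 have "\<forall>e\<in>E. eventually (%c. \<forall>f\<in>fdom GS. \<bar>f v0 - f (fst e)\<bar> <= c * L2_norm MG (DG f)) at_top"
 proof
  fix e assume e: "e \<in> E"
  have "(v0, fst e) \<in> Ed\<^sup>*" using conn[of "fst e" "snd e"] E_Ed[OF e] by simp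
  then obtain c where c: "!!f. f \<in> fdom GS ==> \<bar>f v0 - f (fst e)\<bar> <= c * L2_norm MG (DG f)" using path by blast
  have "\<forall>f\<in>fdom GS. \<bar>f v0 - f (fst e)\<bar> <= c' * L2_norm MG (DG f)" if "c' >= c" for c'
   using c mult_right_mono[OF that L2_norm_nonneg] order_trans by blast
  thus "eventually (%c. \<forall>f\<in>fdom GS. \<bar>f v0 - f (fst e)\<bar> <= c * L2_norm MG (DG f)) at_top"
   unfolding eventually_at_top_linorder by blast
 qed
 hence "eventually (%c. \<forall>e\<in>E. \<forall>f\<in>fdom GS. \<bar>f v0 - f (fst e)\<bar> <= c * L2_norm MG (DG f)) at_top"
  by (rule eventually_ball_finite[OF finE])
 then obtain c0 where "!!c. c >= c0 ==> \<forall>e\<in>E. \<forall>f\<in>fdom GS. \<bar>f v0 - f (fst e)\<bar> <= c * L2_norm MG (DG f)"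
  unfolding eventually_at_top_linorder by blast
 from this[of "max c0 0"] have c: "\<forall>e\<in>E. \<forall>f\<in>fdom GS. \<bar>f v0 - f (fst e)\<bar> <= max c0 0 * L2_norm MG (DG f)" by simp
 have pt: "\<bar>f x - f v0\<bar> <= (max c0 0 + 1) * L2_norm MG (DG f)" if f: "f \<in> fdom GS" and x: "x \<in> X" for f x
 proof -
  obtain e t where e: "e \<in> E" "t \<in> {0..1}" "x = ept e t" using X_E[OF x] by blast
  have "\<bar>f v0 - f (fst e)\<bar> <= max c0 0 * L2_norm MG (DG f)" using c e(1) f by blast
  thus ?thesis using edge_increment[OF f e(1,2)] unfolding e(3) distrib_right by linarith
 qed
 show ?thesis
 proof (intro exI[of _ "2 * (max c0 0 + 1)"] conjI ballI)
  fix f x y assume "f \<in> fdom GS" "x \<in> X" "y \<in> X"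
  thus "\<bar>f x - f y\<bar> <= 2 * (max c0 0 + 1) * L2_norm MG (DG f)"
   using pt[of f x] pt[of f y] unfolding mult.assoc[of 2] by linarith
 qed simp
qed

text \<open>The coordinates of the plane are affine on every edge.\<close>

lemma GS_separate: assumes "x ~= y" shows "\<exists>f\<in>fdom GS. f x ~= f y"
proof -
 obtain i where i: "x $ i ~= y $ i" using assms by (auto simp: vec_eq_iff)
 have "(%p. p $ i) \<in> fdom GS"
 proof (rule GS_domI)
  show "h1_deriv (%s. ept e s $ i) (%_. snd e $ i - fst e $ i)" for e
   using h1_affine[of "fst e $ i" "snd e $ i"] by (simp add: ept_def edge_pt_def)
 qed
 from bexI[of "%f. f x ~= f y", OF i this] show ?thesis .
qed

text \<open>The description in \<open>edge_linear\<close> is unique: an interior point determines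
  its edge up to orientation and hence its parameter, and at an endpoint every edge gives the value
  of h at the vertex.\<close>

lemma hl_edge: assumes e: "e \<in> Ed" and t: "t \<in> {0..1}" shows "hl (ept e t) = (1 - t) * h (fst e) + t * h (snd e)"
proof -
 define val where "val e t = (1 - t) * h (fst e) + t * h (snd e)" for e :: "(real^2) \<times> (real^2)" and t
 have half: "val e t = val e' t'"
  if e: "e \<in> Ed" "e' \<in> Ed" and t: "0 < t" "t < 1" "t' \<in> {0..1}" and eq: "ept e t = ept e' t'" for e e' t t'
 proof -
  have "e' = e | e' = prod.swap e"
  proof -
   have "(fst e', snd e') = (fst e, snd e) | (fst e', snd e') = (snd e, fst e)"
    by (rule meet[of _ _ _ _ t t']) (use e t eq in "simp_all add: ept_def")
   thus ?thesis by (auto simp: prod_eq_iff)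
  qed
  thus ?thesis
  proof
   assume e': "e' = e"
   have "tc e (ept e t) = tc e (ept e t')" unfolding eq e' ..
   hence "t = t'" unfolding tc_ept[OF e(1)] .
   thus ?thesis by (simp add: e')
  next
   assume e': "e' = prod.swap e"
   have "tc e (ept e t) = tc e (ept e (1 - t'))" unfolding eq e' ept_swap ..
   hence "t = 1 - t'" unfolding tc_ept[OF e(1)] .
   thus ?thesis by (auto simp: e' val_def)
  qed
 qed
 have uniq: "val e t = val e' t'"
  if e: "e \<in> Ed" "e' \<in> Ed" and t: "t \<in> {0..1}" "t' \<in> {0..1}" and eq: "ept e t = ept e' t'" for e e' t t'
 proof -
  have "t = 0 | t = 1 | 0 < t & t < 1" "t' = 0 | t' = 1 | 0 < t' & t' < 1" using t by auto
  then consider "0 < t" "t < 1" | "0 < t'" "t' < 1" | "t = 0 | t = 1" "t' = 0 | t' = 1" by blast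
  thus ?thesis
  proof cases
   case 1
   thus ?thesis by (rule half[OF e _ _ t(2) eq])
  next
   case 2
   thus ?thesis using half[OF e(2,1) _ _ t(1) eq[symmetric]] by simp
  next
   case 3
   have "val d s = h (ept d s)" if "s = 0 | s = 1" for d s using that by (auto simp: val_def ept_ends)
   thus ?thesis using 3 eq by simp
  qed
 qed
 have "hl (ept e t) = (THE c. \<exists>d\<in>Ed. \<exists>s\<in>{0..1}. ept e t = ept d s & c = val d s)"
  by (simp add: edge_linear_def val_def ept_def case_prod_unfold)
 also have "\<dots> = val e t"
 proof (rule the_equality)
  show "\<exists>d\<in>Ed. \<exists>s\<in>{0..1}. ept e t = ept d s & val e t = val d s" using e t by blast
  fix c assume "\<exists>d\<in>Ed. \<exists>s\<in>{0..1}. ept e t = ept d s & c = val d s"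
  then obtain d s where d: "d \<in> Ed" "s \<in> {0..1}" "ept e t = ept d s" "c = val d s" by blast
  show "c = val e t" unfolding d(4) by (rule uniq[OF e d(1) t d(2,3), symmetric])
 qed
 finally show ?thesis by (simp add: val_def)
qed

lemma h1_hl: "e \<in> E ==> h1_deriv (%s. hl (ept e s)) (%_. dh e)"
proof -
 assume e: "e \<in> E"
 have "hl (ept e t) = (1 - t) * h (fst e) + t * h (snd e)" if "t \<in> {0..1}" for t
  by (rule hl_edge[OF E_Ed[OF e] that])
 moreover note h1_affine[of "h (fst e)" "h (snd e)"]
 ultimately show ?thesis unfolding h1_iff dh_def by (simp add: J_0)
qed

lemma hl_dom: "hl \<in> fdom GS" and DG_hl: "AE p in MG. DG hl p = 1"
proof -
 have "hl \<in> fdom GS & (AE p in MG. DG hl p = 1)" by (rule DG_eqI[OF _ h1_hl]) (use dh_pos in force)+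
 thus "hl \<in> fdom GS" "AE p in MG. DG hl p = 1" by blast+
qed

lemma hl_energy: assumes f: "f \<in> fdom GS"
 shows "energy GS hl f = 1/2 * (\<Sum>(x, y)\<in>Ed. (h x - h y) * (f x - f y))"
proof -
 have "(LINT t|UI. dv hl e t * dv f e t) = (h (fst e) - h (snd e)) * (f (fst e) - f (snd e))" if e: "e \<in> E" for e
 proof -
  have "(LINT t|UI. dv hl e t * dv f e t) = (LINT t|UI. dh e * dv f e t)"
  proof (rule integral_cong_AE)
   show "AE t in UI. dv hl e t * dv f e t = dh e * dv f e t"
    using h1_unique[OF dv[OF hl_dom e] h1_hl[OF e]] by eventually_elim simp
  qed (intro borel_measurable_times borel_measurable_const L2_measurable[OF dv_L2[OF _ e]] hl_dom f)+
  also have "\<dots> = dh e * J (dv f e) 1" by (simp add: J_1)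
  also have "f (ept e 1) = f (ept e 0) + J (dv f e) 1" using dv[OF f e] unfolding h1_iff by (blast intro: atLeastAtMost_iff[THEN iffD2] zero_le_one order_refl)
  hence "J (dv f e) 1 = f (snd e) - f (fst e)" by (simp add: ept_ends)
  finally show ?thesis by (simp add: dh_def algebra_simps)
 qed
 hence "energy GS hl f = (\<Sum>e\<in>E. (h (fst e) - h (snd e)) * (f (fst e) - f (snd e)))"
  unfolding GS_energy[OF hl_dom f] by simp
 also have "\<dots> = 1/2 * (\<Sum>e\<in>Ed. (h (fst e) - h (snd e)) * (f (fst e) - f (snd e)))"
  by (subst sum_Ed) (auto simp: algebra_simps)
 finally show ?thesis by (simp add: case_prod_unfold)
qed

lemma DG_calc:
 assumes ps: "ps \<in> form_terms GS"
  and u: "!!e. e > 0 ==> \<exists>d>0. \<forall>x\<in>X. \<forall>y\<in>X. dist x y < d -->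
   \<bar>u x - u y - (\<Sum>(c, f)\<leftarrow>ps. c x * (f x - f y))\<bar> <= e * (\<Sum>(c, f)\<leftarrow>ps. \<bar>f x - f y\<bar>)"
 shows "u \<in> fdom GS & (AE p in MG. DG u p = (\<Sum>(c, f)\<leftarrow>ps. c p * DG f p))"
proof (rule DG_eqI)
 have pc: "continuous_on X (fst r)" "snd r \<in> fdom GS" if "r \<in> set ps" for r
 proof -
  have "r \<in> cont_funs GS \<times> fdom GS" using ps that unfolding form_terms_def in_lists_conv_set by blast
  thus "continuous_on X (fst r)" "snd r \<in> fdom GS"
   by (simp_all add: mem_Times_iff) (simp add: cont_funs_def graph_space_def)
 qed
 have cm: "fst r \<in> borel_measurable MG" if "r \<in> set ps" for r
  using radon_on_measurable[OF MG_radon] pc(1)[OF that] by (simp add: graph_space_def)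
 have "(%p. \<Sum>r\<leftarrow>qs. fst r p * DG (snd r) p) \<in> borel_measurable MG" if "set qs \<subseteq> set ps" for qs using that
 proof (induction qs)
  case (Cons r qs)
  thus ?case using borel_measurable_add[OF borel_measurable_times[OF cm DG_meas[OF pc(2)]], of r r] by simp
 qed simp
 thus "(%p. \<Sum>(c, f)\<leftarrow>ps. c p * DG f p) \<in> borel_measurable MG" by (simp add: case_prod_unfold)
 fix e assume e: "e \<in> E"
 define L where "L = dist (fst e) (snd e)"
 have L: "L > 0" using Ed_ne[OF E_Ed[OF e]] by (simp add: L_def)
 have dist: "dist (ept e s) (ept e t) = \<bar>s - t\<bar> * L" for s t
 proof -
  have "ept e s - ept e t = (s - t) *\<^sub>R (snd e - fst e)" by (simp add: ept_eq algebra_simps)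
  thus ?thesis by (simp add: dist_norm L_def norm_minus_commute)
 qed
 let ?ps = "map (%(c, f). (%s. c (ept e s), %s. f (ept e s))) ps"
 have "h1_deriv (%s. u (ept e s)) (%t. \<Sum>(c, f)\<leftarrow>?ps. (indicator {0..1} t * c t) * weak_deriv f t)"
 proof (rule h1_calc)
  fix c f assume "(c, f) \<in> set ?ps"
  then obtain r where r: "r \<in> set ps" "c = (%s. fst r (ept e s))" "f = (%s. snd r (ept e s))" by auto
  show "continuous_on {0..1} c & h1_deriv f (weak_deriv f)"
   unfolding r(2,3) using dv[OF pc(2)[OF r(1)] e] ept_X[OF E_Ed[OF e]]
   by (auto simp: dv_def intro!: continuous_on_compose2[OF pc(1)[OF r(1)] ept_cont])
 next
  fix \<epsilon> :: real assume "\<epsilon> > 0"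
  from u[OF this] obtain d where d: "d > 0" "!!x y. x \<in> X ==> y \<in> X ==> dist x y < d ==>
   \<bar>u x - u y - (\<Sum>(c, f)\<leftarrow>ps. c x * (f x - f y))\<bar> <= \<epsilon> * (\<Sum>(c, f)\<leftarrow>ps. \<bar>f x - f y\<bar>)" by blast
  show "\<exists>d>0. \<forall>s\<in>{0..1}. \<forall>t\<in>{0..1}. \<bar>s - t\<bar> < d -->
   \<bar>u (ept e s) - u (ept e t) - (\<Sum>(c, f)\<leftarrow>?ps. c s * (f s - f t))\<bar> <= \<epsilon> * (\<Sum>(c, f)\<leftarrow>?ps. \<bar>f s - f t\<bar>)"
  proof (intro exI[of _ "d / L"] conjI ballI impI)
   fix s t :: real assume st: "s \<in> {0..1}" "t \<in> {0..1}" "\<bar>s - t\<bar> < d / L"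
   have "dist (ept e s) (ept e t) < d" unfolding dist using st(3) L by (simp add: less_divide_eq)
   from d(2)[OF ept_X[OF E_Ed[OF e] st(1)] ept_X[OF E_Ed[OF e] st(2)] this]
   show "\<bar>u (ept e s) - u (ept e t) - (\<Sum>(c, f)\<leftarrow>?ps. c s * (f s - f t))\<bar> <= \<epsilon> * (\<Sum>(c, f)\<leftarrow>?ps. \<bar>f s - f t\<bar>)"
    by (simp add: comp_def case_prod_unfold)
  qed (use d(1) L in simp)
 qed
 thus "h1_deriv (%s. u (ept e s)) (%t. \<Sum>(c, f)\<leftarrow>ps. (indicator {0..1} t * c (ept e t)) * dv f e t)"
  by (simp add: comp_def case_prod_unfold dv_def)
 fix t :: real assume t: "0 < t" "t < 1"
 show "(\<Sum>(c, f)\<leftarrow>ps. c (ept e t) * DG f (ept e t)) = (\<Sum>(c, f)\<leftarrow>ps. (indicator {0..1} t * c (ept e t)) * dv f e t) / dh e"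
  using t by (induction ps) (auto simp: DG_edge[OF e t] add_divide_distrib)
qed

lemma DG_closed:
 assumes u: "!!n. u n \<in> fdom GS" and lim: "uniform_limit X u v sequentially"
  and D: "L2_lim MG (%n. DG (u n)) \<xi>"
 shows "v \<in> fdom GS & (AE p in MG. DG v p = \<xi> p)"
proof (rule DG_eqI)
 have \<xi>L: "\<xi> \<in> L2 MG" using D by (rule L2_lim_L2)
 thus \<xi>m: "\<xi> \<in> borel_measurable MG" by (rule L2_measurable)
 fix e assume e: "e \<in> E"
 define k where "k t = indicator {0..1} t * (dh e * \<xi> (ept e t))" for t
 have \<xi>e: "(%t. dh e * \<xi> (ept e t)) \<in> L2 UI" using MG_L2[OF \<xi>m] \<xi>L e by (intro L2_cmult) blast
 have "(%t. indicator {0..1} t *\<^sub>R (dh e * \<xi> (ept e t))) \<in> borel_measurable lborel"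
  using L2_measurable[OF \<xi>e] by (subst (asm) borel_measurable_restrict_space_iff) auto
 moreover have "k = (%t. indicator {0..1} t *\<^sub>R (dh e * \<xi> (ept e t)))" by (simp add: k_def fun_eq_iff)
 ultimately have km: "k \<in> borel_measurable borel" by simp
 have kL: "k \<in> L2 UI" by (rule L2_cong_AE[OF \<xi>e UI_measurable[OF km]]) (auto intro!: AE_I2 simp: k_def space_UI)
 have "v (ept e t) = v (ept e 0) + J k t" if t: "t \<in> {0..1}" for t
 proof -
  have pt: "(%n. u n (ept e s)) \<longlonglongrightarrow> v (ept e s)" if "s \<in> {0..1}" for s
   by (rule tendsto_uniform_limitI[OF lim ept_X[OF E_Ed[OF e] that]])
  have "(%n. J (dv (u n) e) t - J k t) \<longlonglongrightarrow> 0"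
  proof (rule Lim_null_comparison)
   show "(%n. L2_norm MG (%p. DG (u n) p - \<xi> p)) \<longlonglongrightarrow> 0" using D by (simp add: L2_lim_def)
   have "\<bar>J (dv (u n) e) t - J k t\<bar> <= L2_norm MG (%p. DG (u n) p - \<xi> p)" for n
   proof -
    have dL: "(%s. dv (u n) e s - k s) \<in> L2 UI" by (intro L2_diff dv_L2 u e kL)
    have "L2_norm UI (%s. dv (u n) e s - k s) = L2_norm UI (%s. dh e * (DG (u n) (ept e s) - \<xi> (ept e s)))"
    proof (rule L2_norm_cong_AE)
     show "AE s in UI. dv (u n) e s - k s = dh e * (DG (u n) (ept e s) - \<xi> (ept e s))"
      using dh_pos[OF e] by (intro UI_interior) (simp add: DG_edge[OF e] k_def right_diff_distrib)
    qed (intro L2_measurable[OF dL] borel_measurable_times borel_measurable_const borel_measurable_diff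
       comp_ept_meas[OF DG_meas[OF u] e] comp_ept_meas[OF \<xi>m e])+
    also have "\<dots> <= L2_norm MG (%p. DG (u n) p - \<xi> p)"
     using MG_norm_edge[OF L2_diff[OF DG_L2[OF u[of n]] \<xi>L] e] dh_pos[OF e] unfolding L2_norm_cmult by simp
    finally have n: "L2_norm UI (%s. dv (u n) e s - k s) <= L2_norm MG (%p. DG (u n) p - \<xi> p)" .
    have "\<bar>J (%s. dv (u n) e s - k s) t\<bar> <= sqrt t * L2_norm UI (%s. dv (u n) e s - k s)"
     using J_holder[OF dL, of 0 t] t by (simp add: J_0)
    also have "\<dots> <= 1 * L2_norm MG (%p. DG (u n) p - \<xi> p)" using t by (intro mult_mono n) auto
    finally show ?thesis using J_diff[OF dv_L2[OF u[of n] e] kL t] by simp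
   qed
   thus "\<forall>\<^sub>F n in sequentially. norm (J (dv (u n) e) t - J k t) <= L2_norm MG (%p. DG (u n) p - \<xi> p)" by simp
  qed
  hence "(%n. J (dv (u n) e) t) \<longlonglongrightarrow> J k t" by (rule LIM_zero_cancel)
  hence "(%n. u n (ept e 0) + J (dv (u n) e) t) \<longlonglongrightarrow> v (ept e 0) + J k t" by (intro tendsto_add pt) auto
  moreover have "u n (ept e 0) + J (dv (u n) e) t = u n (ept e t)" for n using dv[OF u e, of n] t unfolding h1_iff by metis
  ultimately have "(%n. u n (ept e t)) \<longlonglongrightarrow> v (ept e 0) + J k t" by simp
  thus ?thesis by (rule LIMSEQ_unique[OF pt[OF t]])
 qed
 thus "h1_deriv (%s. v (ept e s)) (%t. indicator {0..1} t * (dh e * \<xi> (ept e t)))"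
  using km kL unfolding h1_iff k_def by blast
 show "\<xi> (ept e t) = indicator {0..1} t * (dh e * \<xi> (ept e t)) / dh e" if "0 < t" "t < 1" for t
  using that dh_pos[OF e] by simp
qed

lemma MG_measure:
 assumes A: "A \<in> sets borel" shows "measure MG (A \<inter> X) = (\<Sum>e\<in>E. (dh e)^2 * measure UI {t \<in> {0..1}. ept e t \<in> A})"
proof -
 have AX: "A \<inter> X \<in> sets MG" unfolding sets_MG sets_restrict_space using A by auto
 have "measure MG (A \<inter> X) = (LINT p|MG. indicator (A \<inter> X) p)" using AX by simp
 also have "\<dots> = (\<Sum>e\<in>E. (dh e)^2 * (LINT t|UI. indicator (A \<inter> X) (ept e t)))"
  by (rule MG_integral(2)) (use AX in "auto simp: MG.emeasure_eq_measure")
 also have "\<dots> = (\<Sum>e\<in>E. (dh e)^2 * measure UI {t \<in> {0..1}. ept e t \<in> A})"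
 proof (intro sum.cong refl)
  fix e assume e: "e \<in> E"
  have "ept e -` A \<in> sets borel"
   using measurable_sets[OF borel_measurable_continuous_onI[OF ept_cont] A, of e] by simp
  hence s: "{t \<in> {0..1}. ept e t \<in> A} \<in> sets UI"
   unfolding sets_restrict_space by (intro image_eqI[of _ _ "ept e -` A"]) auto
  have "(LINT t|UI. indicator (A \<inter> X) (ept e t)) = (LINT t|UI. indicator {t \<in> {0..1}. ept e t \<in> A} t)"
   by (intro Bochner_Integration.integral_cong refl)
    (use ept_X[OF E_Ed[OF e]] in "auto simp: indicator_def space_UI")
  also have "\<dots> = measure UI ({t \<in> {0..1}. ept e t \<in> A} \<inter> space UI)" by (rule Bochner_Integration.integral_indicator)
  also have "{t \<in> {0..1}. ept e t \<in> A} \<inter> space UI = {t \<in> {0..1}. ept e t \<in> A}" by (auto simp: space_UI)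
  finally show "(dh e)^2 * (LINT t|UI. indicator (A \<inter> X) (ept e t)) = (dh e)^2 * measure UI {t \<in> {0..1}. ept e t \<in> A}" by simp
 qed
 finally show ?thesis .
qed

lemma MG_supp:
 assumes U: "open U" and ne: "U \<inter> X ~= {}" shows "emeasure MG (U \<inter> X) ~= 0"
proof
 assume 0: "emeasure MG (U \<inter> X) = 0"
 obtain e t where e: "e \<in> E" "t \<in> {0..1}" "ept e t \<in> U" using ne X_E by blast
 have "(\<Sum>e\<in>E. (dh e)^2 * measure UI {t \<in> {0..1}. ept e t \<in> U}) = 0"
  using 0 MG_measure[of U] U by (simp add: measure_def)
 hence "(dh e)^2 * measure UI {t \<in> {0..1}. ept e t \<in> U} = 0"
  using e(1) finE by (subst (asm) sum_nonneg_eq_0_iff) auto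
 hence z: "measure UI {t \<in> {0..1}. ept e t \<in> U} = 0" using dh_pos[OF e(1)] by simp
 have "open (ept e -` U)" by (rule open_vimage[OF U ept_cont])
 then obtain r where r: "r > 0" "ball t r \<subseteq> ept e -` U" using e(3) open_contains_ball by (metis vimageI2)
 define a b where "a = max 0 (t - r / 2)" and "b = min 1 (t + r / 2)"
 have ab: "a < b" "{a..b} \<subseteq> {t \<in> {0..1}. ept e t \<in> U}"
 proof -
  show "a < b" using r(1) e(2) by (auto simp: a_def b_def)
  have "s \<in> ball t r" if "s \<in> {a..b}" for s using that r(1) by (auto simp: a_def b_def dist_real_def)
  hence "ept e s \<in> U" if "s \<in> {a..b}" for s using r(2) that by blast
  moreover have "{a..b} \<subseteq> {0..1}" by (auto simp: a_def b_def)
  ultimately show "{a..b} \<subseteq> {t \<in> {0..1}. ept e t \<in> U}" by blast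
 qed
 have "ept e -` U \<in> sets borel" using \<open>open (ept e -` U)\<close> by simp
 hence "{t \<in> {0..1}. ept e t \<in> U} \<in> sets UI"
  unfolding sets_restrict_space by (intro image_eqI[of _ _ "ept e -` U"]) auto
 hence "measure UI {a..b} <= measure UI {t \<in> {0..1}. ept e t \<in> U}" by (rule UI.finite_measure_mono[OF ab(2)])
 moreover have "measure UI {a..b} = b - a"
  using ab(1) by (subst measure_restrict_space) (auto simp: a_def b_def)
 ultimately show False using z ab(1) by simp
qed

lemma MG_bdry: "AE p in MG. p \<notin> B"
proof -
 have BX: "B \<subseteq> X" using B(3) ept_X[of _ 0] by (force simp: ept_ends)
 have cB: "B \<in> sets borel" using B(1) by (intro borel_closed finite_imp_closed)
 have "measure MG (B \<inter> X) = 0" unfolding MG_measure[OF cB]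
 proof (intro sum.neutral ballI)
  fix e assume e: "e \<in> E"
  have "{t \<in> {0..1}. ept e t \<in> B} \<subseteq> tc e ` B"
  proof
   fix t assume "t \<in> {t \<in> {0..1}. ept e t \<in> B}"
   thus "t \<in> tc e ` B" using tc_ept[OF E_Ed[OF e], of t] image_eqI[of t "tc e" "ept e t" B] by simp
  qed
  hence fB: "finite {t \<in> {0..1}. ept e t \<in> B}" using B(1) finite_subset by blast
  have "measure lborel {t \<in> {0..1}. ept e t \<in> B} = 0"
   using null_setsD1[OF finite_imp_null_set_lborel[OF fB]] by (simp only: measure_def enn2real_0)
  thus "(dh e)^2 * measure UI {t \<in> {0..1}. ept e t \<in> B} = 0" by (subst measure_restrict_space) auto
 qed
 moreover have "B \<in> sets MG" unfolding sets_MG sets_restrict_space using cB BX by (intro image_eqI[of _ _ B]) auto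
 ultimately have "B \<in> null_sets MG" using BX by (simp add: null_sets_def MG.emeasure_eq_measure Int_absorb2)
 thus ?thesis by (rule AE_not_in)
qed

lemma GS_one_dim: "one_dim_energy GS hl MG DG"
proof
 have simps: "carr GS = X" "bdry GS = B" by (simp_all add: graph_space_def)
 show "compact (carr GS)" "finite (bdry GS)" "bdry GS ~= {}" "bdry GS \<subseteq> carr GS"
  using X_compact B ept_X[of _ 0] unfolding simps by (force simp: ept_ends)+
 show "AE p in MG. p \<notin> bdry GS" unfolding simps by (rule MG_bdry)
 show "continuous_on (carr GS) f" if "f \<in> fdom GS" for f using that unfolding simps GS_dom by blast
 show "emeasure MG (U \<inter> carr GS) ~= 0" if "open U" "U \<inter> carr GS ~= {}" for U
  using MG_supp that unfolding simps by blast
 show "EX c>=0. \<forall>f\<in>fdom GS. \<forall>x\<in>carr GS. \<forall>y\<in>carr GS. \<bar>f x - f y\<bar> <= c * L2_norm MG (DG f)"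
  unfolding simps by (rule GS_poincare)
 show "v \<in> fdom GS & (AE x in MG. DG v x = \<xi> x)"
  if "!!n. u n \<in> fdom GS" "uniform_limit (carr GS) u v sequentially" "L2_lim MG (%n. DG (u n)) \<xi>" for u v \<xi>
  using DG_closed[OF that(1) that(2)[unfolded simps] that(3)] .
 show "u \<in> fdom GS & (AE x in MG. DG u x = (\<Sum>(a, f)\<leftarrow>ps. a x * DG f x))"
  if "ps \<in> form_terms GS" "!!e. e > 0 ==> \<exists>d>0. \<forall>x\<in>carr GS. \<forall>y\<in>carr GS. dist x y < d -->
   \<bar>u x - u y - (\<Sum>(a, f)\<leftarrow>ps. a x * (f x - f y))\<bar> <= e * (\<Sum>(a, f)\<leftarrow>ps. \<bar>f x - f y\<bar>)" for ps u
  using DG_calc[OF that(1) that(2)[unfolded simps]] .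
 show "DG f \<in> L2 MG" if "f \<in> fdom GS" for f by (rule DG_L2[OF that])
 show "energy GS f g = (LINT x|MG. DG f x * DG g x)" if "f \<in> fdom GS" "g \<in> fdom GS" for f g by (rule DG_energy[OF that])
 show "\<exists>f\<in>fdom GS. f x ~= f y" if "x ~= y" for x y by (rule GS_separate[OF that])
qed (rule MG_radon hl_dom DG_hl)+

end

lemma (in plane_graph) hl_vertex: "(x, y) \<in> Ed ==> hl x = h x"
 using hl_edge[of "(x, y)" 0] by (simp add: ept_ends)

section \<open>The graph approximations of the gasket\<close>

text \<open>
 The differences of the boundary values on a cell are, up to a common factor, integers whose
 residues modulo 3 are inherited up to sign by the subcells; hence they never vanish.
\<close>

definition mod3_edges :: "(nat => real) => bool" where
 "mod3_edges a \<longleftrightarrow> (\<exists>s x y. s ~= 0 & a 0 - a 1 = s * of_int x & a 1 - a 2 = s * of_int y &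
  x mod 3 = y mod 3 & x mod 3 ~= 0)"

lemma mod3_edgesI: "s ~= 0 ==> a 0 - a 1 = s * of_int x ==> a 1 - a 2 = s * of_int y ==>
  x mod 3 = y mod 3 ==> x mod 3 ~= 0 ==> mod3_edges a" unfolding mod3_edges_def by blast

lemma mod3_edges_ne:
 assumes "mod3_edges a" "i \<in> {0,1,2}" "j \<in> {0,1,2}" "i ~= j" shows "a i ~= a j"
proof -
 obtain s x y where s: "s ~= 0" "a 0 - a 1 = s * of_int x" "a 1 - a 2 = s * of_int y"
  and m: "x mod 3 = y mod 3" "x mod 3 ~= 0" using assms(1) unfolding mod3_edges_def by blast
 have "x ~= 0" "y ~= 0" "x + y ~= 0" using m by presburger+
 moreover have "a 0 - a 2 = s * of_int (x + y)" using s by (simp add: distrib_left)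
 ultimately have "a 0 ~= a 1" "a 1 ~= a 2" "a 0 ~= a 2" using s by (metis diff_self mult_eq_0_iff of_int_eq_0_iff)+
 thus ?thesis using assms(2-4) by auto
qed

lemma mod3_edges_hext: assumes "mod3_edges a" "i \<in> {0,1,2}" shows "mod3_edges (hext i a)"
proof -
 obtain s x y where s: "s ~= 0" "a 0 - a 1 = s * of_int x" "a 1 - a 2 = s * of_int y"
  and m: "x mod 3 = y mod 3" "x mod 3 ~= 0" using assms(1) unfolding mod3_edges_def by blast
 have a: "a 1 = a 0 - s * of_int x" "a 2 = a 0 - s * of_int x - s * of_int y" using s by simp_all
 obtain k where k: "y = x + 3 * k" using m(1) by (rule mod_eqE)
 \<comment> \<open>In units of s / 5 the new pairs of differences are (3 x + y, y), (2 x - y, 2 y -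
   x) and (x, x + 3 y) for i = 0, 1, 2. As y is congruent to x, each pair is again congruent and
   nonzero modulo 3.\<close>
 have m: "(3 * x + y) mod 3 = y mod 3" "(3 * x + y) mod 3 ~= 0"
  "(2 * x - y) mod 3 = (2 * y - x) mod 3" "(2 * x - y) mod 3 ~= 0"
  "x mod 3 = (x + 3 * y) mod 3" "x mod 3 ~= 0" using m(2) unfolding k by presburger+
 consider "i = 0" | "i = 1" | "i = 2" using assms(2) by auto
 thus ?thesis
 proof cases
  case 1
  show ?thesis unfolding 1
   by (rule mod3_edgesI[of "s / 5", OF _ _ _ m(1,2)]) (simp_all add: s(1) hext_def a field_simps)
 next
  case 2
  show ?thesis unfolding 2
   by (rule mod3_edgesI[of "s / 5", OF _ _ _ m(3,4)]) (simp_all add: s(1) hext_def a field_simps)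
 next
  case 3
  show ?thesis unfolding 3
   by (rule mod3_edgesI[of "s / 5", OF _ _ _ m(5,6)]) (simp_all add: s(1) hext_def a field_simps)
 qed
qed

lemma mod3_edges_hexts: "set w \<subseteq> {0,1,2} ==> mod3_edges a ==> mod3_edges (hexts w a)"
 by (induction w arbitrary: a) (auto simp: hexts_def intro!: mod3_edges_hext)

text \<open>The cell at q 0 inherits the symmetry of the values. The first letter 1 or 2 leaves it
  and starts the invariant modulo 3, with the differences (2, -1) or (1, 1) in units of (a 0 - a 1)
  / 5.\<close>

lemma hexts_two_equal:
 "set w \<subseteq> {0,1,2} ==> a 0 ~= a 1 ==> a 1 = a 2 ==>
  mod3_edges (hexts w a) | w = replicate (length w) 0 & hexts w a 0 ~= hexts w a 1 & hexts w a 1 = hexts w a 2"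
proof (induction w arbitrary: a)
 case (Cons i w)
 have w: "set w \<subseteq> {0,1,2}" and hw: "hexts (k # w) a = hexts w (hext k a)" for k
  using Cons.prems(1) by (simp_all add: hexts_def)
 consider "i = 0" | "i = 1" | "i = 2" using Cons.prems(1) by auto
 thus ?case
 proof cases
  case 1
  have "hext 0 a 0 ~= hext 0 a 1" "hext 0 a 1 = hext 0 a 2" using Cons.prems by (auto simp: hext_def)
  from Cons.IH[OF w this] show ?thesis unfolding hw 1 length_Cons replicate_Suc list.inject by blast
 next
  case 2
  have "mod3_edges (hext 1 a)" by (rule mod3_edgesI[of "(a 0 - a 1) / 5" _ 2 "-1"])
    (use Cons.prems(2) in "simp_all add: hext_def Cons.prems(3)[symmetric] field_simps")
  thus ?thesis unfolding hw 2 by (intro disjI1 mod3_edges_hexts[OF w])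
 next
  case 3
  have "mod3_edges (hext 2 a)" by (rule mod3_edgesI[of "(a 0 - a 1) / 5" _ 1 1])
    (use Cons.prems(2) in "simp_all add: hext_def Cons.prems(3)[symmetric] field_simps")
  thus ?thesis unfolding hw 3 by (intro disjI1 mod3_edges_hexts[OF w])
 qed
qed (simp add: hexts_def)

context gasket_geom begin

lemma edge_pt_Fw: "edge_pt (Fw w x) (Fw w y) t = Fw w (edge_pt x y t)"
proof (induction w)
 case (Cons i w)
 have "edge_pt (F i u) (F i v) t = F i (edge_pt u v t)" for u v
  by (simp add: vec_eq_iff edge_pt_def sgF_def field_simps)
 thus ?case using Cons by simp
qed simp

lemma bc_edge_pt:
 assumes "i \<in> {0,1,2}" "j \<in> {0,1,2}" "k \<in> {0,1,2}"
 shows "bc k (edge_pt (q i) (q j) t) = (1 - t) * (if k = i then 1 else 0) + t * (if k = j then 1 else 0)"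
 unfolding edge_pt_def using bc_affine[of "1 - t" t k "q i" "q j"] assms by (simp add: bc_vertex)

lemma sg_edgeE:
 assumes "(x, y) \<in> sg_edges q m"
 obtains w i j where "w \<in> words m" "(i, j) \<in> P3" "x = Fw w (q i)" "y = Fw w (q j)"
 using assms unfolding sg_edges_eq by auto

text \<open>At an interior point of an edge two barycentric coordinates of its cell are positive and
  none is 1. The point is thus no corner, so \<open>cells_meet\<close> puts both edges into the same
  cell, and the positive coordinates identify the endpoints.\<close>

lemma sg_edges_meet:
 assumes e: "(x, y) \<in> sg_edges q m" "(x', y') \<in> sg_edges q m" and t: "0 < t" "t < 1" "0 <= t'" "t' <= 1"
  and eq: "edge_pt x y t = edge_pt x' y' t'"
 shows "(x', y') = (x, y) | (x', y') = (y, x)"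
proof -
 obtain w i j where w: "w \<in> words m" "(i, j) \<in> P3" "x = Fw w (q i)" "y = Fw w (q j)" using sg_edgeE[OF e(1)] .
 obtain w' i' j' where w': "w' \<in> words m" "(i', j') \<in> P3" "x' = Fw w' (q i')" "y' = Fw w' (q j')" using sg_edgeE[OF e(2)] .
 have i: "i \<in> {0,1,2}" "j \<in> {0,1,2}" "i ~= j" and i': "i' \<in> {0,1,2}" "j' \<in> {0,1,2}" "i' ~= j'"
  using w(2) w'(2) by (simp_all add: P3_iff)
 let ?p = "edge_pt (q i) (q j) t" and ?p' = "edge_pt (q i') (q j') t'"
 have F: "Fw w ?p = Fw w' ?p'" using eq unfolding w(3,4) w'(3,4) edge_pt_Fw .
 have pT: "?p \<in> T" "?p' \<in> T" using segment_K[OF i(1,2), of t] segment_K[OF i'(1,2), of t'] t K_T by auto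
 have b: "bc i ?p > 0" "bc j ?p > 0" "bc i ?p < 1" "bc j ?p < 1" "bc k ?p ~= 1" if "k \<in> {0,1,2}" for k
  using t i that by (auto simp: bc_edge_pt)
 show ?thesis
 proof (cases "w = w'")
  case True
  hence "?p = ?p'" using F by (simp add: sgFw_inj)
  hence "bc i ?p' > 0" "bc j ?p' > 0" using b(1,2)[of i] i by auto
  hence "i \<in> {i', j'}" "j \<in> {i', j'}" using i i' by (auto simp: bc_edge_pt split: if_splits)
  thus ?thesis using True i(3) w(3,4) w'(3,4) by auto
 next
  case False
  then obtain k where k: "k \<in> {0,1,2}" "?p = q k" using cells_meet[OF w(1) w'(1) False pT F] by blast
  thus ?thesis using b(5)[OF k(1)] by (simp add: bc_vertex)
 qed
qed

lemma sg_edges_sym: "(x, y) \<in> sg_edges q m ==> (y, x) \<in> sg_edges q m" by (auto simp: sg_edges_def sg_nbr_def)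

lemma sg_edges_cell: "w \<in> words m ==> (i, j) \<in> P3 ==> (Fw w (q i), Fw w (q j)) \<in> sg_edges q m"
 unfolding sg_edges_eq by (rule image_eqI[of _ _ "(w, i, j)"]) auto

lemma sg_edges_red_iff:
 assumes w: "w \<in> words m" "(i, j) \<in> P3"
 shows "(Fw w (q i), Fw w (q j)) \<in> sg_edges_red q m \<longleftrightarrow> ~ (w = replicate m 0 & {i, j} = {1, 2})"
proof -
 let ?r = "replicate m (0 :: nat)"
 have r: "?r \<in> words m" by (auto simp: words_def)
 have inj: "(Fw w (q i), Fw w (q j)) = (Fw ?r (q k), Fw ?r (q l)) \<longleftrightarrow> w = ?r & i = k & j = l" if "(k, l) \<in> P3" for k l
  using inj_onD[OF sg_edges_inj, of "(w, i, j)" "(?r, k, l)" m] w r that by auto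
 have "(1, 2) \<in> P3" "(2, 1) \<in> P3" by (simp_all add: P3_def)
 thus ?thesis
  unfolding sg_edges_red_def sgFw_replicate[symmetric] Diff_iff insert_iff empty_iff inj[OF \<open>(1, 2) \<in> P3\<close>] inj[OF \<open>(2, 1) \<in> P3\<close>]
  using sg_edges_cell[OF w] w(2) by (auto simp: P3_iff doubleton_eq_iff)
qed

lemma sg_edges_red_sym: "(x, y) \<in> sg_edges_red q m ==> (y, x) \<in> sg_edges_red q m"
 unfolding sg_edges_red_def using sg_edges_sym by blast

text \<open>If the corners of the smallest cells are connected, then so are those of all coarser
  cells, because the two subcells at corners i and j share a corner. From q 0 every cell is then
  reached letter by letter.\<close>

lemma cells_connected:
 assumes R: "!!w i j. w \<in> words m ==> i \<in> {0,1,2} ==> j \<in> {0,1,2} ==> (Fw w (q i), Fw w (q j)) \<in> R\<^sup>*"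
  and w: "w \<in> words m" and j: "j \<in> {0,1,2}"
 shows "(q 0, Fw w (q j)) \<in> R\<^sup>*"
proof -
 have corner: "Fw (u @ [i]) (q i) = Fw u (q i)" "Fw (u @ [i]) (q k) = Fw (u @ [k]) (q i)" for u i k
  by (simp_all add: sgFw_append sgF_commute)
 have cell: "(Fw u (q i), Fw u (q j)) \<in> R\<^sup>*"
  if "u \<in> words k" "k + n = m" "i \<in> {0,1,2}" "j \<in> {0,1,2}" for u k n i j using that
 proof (induction n arbitrary: u k i j)
  case (Suc n)
  have "(Fw (u @ [l]) (q i), Fw (u @ [l]) (q j)) \<in> R\<^sup>*" if "l \<in> {0,1,2}" "i \<in> {0,1,2}" "j \<in> {0,1,2}" for l i j
   using Suc.IH[OF words_snoc[OF Suc.prems(1) that(1)] _ that(2,3)] Suc.prems(2) by simp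
  from this[of i i j] this[of j i j] show ?case
   using Suc.prems(3,4) corner(1)[of u i] corner(1)[of u j] corner(2)[of u i j] by (auto intro: rtrancl_trans)
 qed (use R in auto)
 have "(q 0, Fw u (q j)) \<in> R\<^sup>*" if "u \<in> words k" "k <= m" "j \<in> {0,1,2}" for u k j using that
 proof (induction k arbitrary: u j)
  case 0
  thus ?case using cell[of "[]" 0 m 0 j] by (simp add: words_0)
 next
  case (Suc k)
  obtain v i where v: "u = v @ [i]" "v \<in> words k" "i \<in> {0,1,2}"
   using Suc.prems(1) by (cases u rule: rev_cases) (auto simp: words_def)
  have "(q 0, Fw u (q i)) \<in> R\<^sup>*" using Suc.IH[OF v(2) _ v(3)] Suc.prems(2) corner(1)[of v i] v(1) by simp
  moreover have "(Fw u (q i), Fw u (q j)) \<in> R\<^sup>*"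
   using cell[OF Suc.prems(1) _ v(3) Suc.prems(3), of "m - Suc k"] Suc.prems(2) by simp
  ultimately show ?case by (rule rtrancl_trans)
 qed
 thus ?thesis using w j by blast
qed

text \<open>The route through corner 0 of the cell avoids the removed edge, which joins corners 1
  and 2.\<close>

lemma sg_edges_red_connected:
 assumes w: "w \<in> words m" and ij: "i \<in> {0,1,2}" "j \<in> {0,1,2}"
 shows "(Fw w (q i), Fw w (q j)) \<in> (sg_edges_red q m)\<^sup>*"
proof -
 have z: "(Fw w (q k), Fw w (q 0)) \<in> (sg_edges_red q m)\<^sup>*" "(Fw w (q 0), Fw w (q k)) \<in> (sg_edges_red q m)\<^sup>*" if "k \<in> {0,1,2}" for k
 proof -
  have k: "(k, 0) \<in> P3 & (0, k) \<in> P3 & {k, 0} ~= {1, 2} & {0, k} ~= {1, 2 :: nat}" if "k ~= 0"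
   using that \<open>k \<in> {0,1,2}\<close> by (auto simp: P3_iff doubleton_eq_iff)
  show "(Fw w (q k), Fw w (q 0)) \<in> (sg_edges_red q m)\<^sup>*" "(Fw w (q 0), Fw w (q k)) \<in> (sg_edges_red q m)\<^sup>*"
   using k sg_edges_red_iff[OF w, of k 0] sg_edges_red_iff[OF w, of 0 k] by (cases "k = 0"; simp add: r_into_rtrancl)+
 qed
 show ?thesis by (rule rtrancl_trans[OF z(1)[OF ij(1)] z(2)[OF ij(2)]])
qed

lemma sg_edges_red_sub: "sg_edges_red q m \<subseteq> sg_edges q m" by (auto simp: sg_edges_red_def)

lemma sgV_sub_edges: "sgV q 0 \<subseteq> fst ` sg_edges_red q m"
proof -
 have "q i \<in> fst ` sg_edges_red q m" if "(i, j) \<in> {(0, 1), (1, 0), (2, 0)}" for i j :: nat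
 proof -
  have r: "replicate m i \<in> words m" "(i, j) \<in> P3" "{i, j} ~= {1, 2}"
   using that by (auto simp: words_def P3_iff doubleton_eq_iff)
  have "(F i ^^ k) (q i) = q i" for k by (induction k) auto
  hence "Fw (replicate m i) (q i) = q i" by (simp add: sgFw_replicate)
  thus ?thesis using sg_edges_red_iff[OF r(1,2)] r(3)
   by (intro image_eqI[of _ fst "(q i, Fw (replicate m i) (q j))"]) simp_all
 qed
 from this[of 0 1] this[of 1 0] this[of 2 0] show ?thesis by simp
qed

lemma graph_cell:
 assumes p: "p \<in> graph_pts Ed" and Ed: "Ed \<subseteq> sg_edges q m"
 obtains x y s where "(x, y) \<in> Ed" "s \<in> {0..1}" "p = edge_pt x y s" "p \<in> K" "x \<in> K" "y \<in> K"
  "dist p x <= diam / 2 ^ m" "dist p y <= diam / 2 ^ m"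
proof -
 obtain x y s where xy: "(x, y) \<in> Ed" "s \<in> {0..1}" "p = edge_pt x y s" using p by (auto simp: graph_pts_def)
 obtain w i j where w: "w \<in> words m" "(i, j) \<in> P3" "x = Fw w (q i)" "y = Fw w (q j)"
  using sg_edgeE[of x y m] xy(1) Ed by blast
 have i: "i \<in> {0,1,2}" "j \<in> {0,1,2}" using w(2) by (simp_all add: P3_iff)
 have c: "edge_pt (q i) (q j) s \<in> K" by (rule segment_K[OF i xy(2)])
 have p: "p = Fw w (edge_pt (q i) (q j) s)" unfolding xy(3) w(3,4) edge_pt_Fw ..
 show ?thesis by (rule that[OF xy]) (unfold p w(3,4), (intro Fw_K[OF _ w(1)] q_K i c cell_diam[OF w(1)] K_T)+)
qed

end

section \<open>The approximating graphs and their boundary fluxes\<close>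

context gasket_harmonic begin

text \<open>Covers the full and the reduced graph at once: connectedness and boundary vertices come
  from the reduced edge set, finiteness and the position of the edges from the full one.\<close>

lemma gasket_plane_graph:
 assumes Ed: "sg_edges_red q m \<subseteq> Ed" "Ed \<subseteq> sg_edges q m"
  and sym: "!!x y. (x, y) \<in> Ed ==> (y, x) \<in> Ed"
  and ne: "!!w i j. w \<in> words m ==> (i, j) \<in> P3 ==> (Fw w (q i), Fw w (q j)) \<in> Ed ==> ha w i ~= ha w j"
 shows "plane_graph Ed (sgV q 0) h (q 0)"
proof
 show "finite Ed" using Ed(2) finite_sg_edges finite_subset by blast
 show "h x ~= h y" if e: "(x, y) \<in> Ed" for x y
 proof -
  obtain w i j where w: "w \<in> words m" "(i, j) \<in> P3" "x = Fw w (q i)" "y = Fw w (q j)" using sg_edgeE[OF subsetD[OF Ed(2) e]] by blast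
  thus ?thesis using ne[OF w(1,2)] e cv_h[OF w(1), of i] cv_h[OF w(1), of j] by (simp add: cv_def P3_iff)
 qed
 show "(q 0, x) \<in> Ed\<^sup>*" if e: "(x, y) \<in> Ed" for x y
 proof -
  obtain w i j where w: "w \<in> words m" "(i, j) \<in> P3" "x = Fw w (q i)" "y = Fw w (q j)" using sg_edgeE[OF subsetD[OF Ed(2) e]] by blast
  hence "(q 0, x) \<in> (sg_edges_red q m)\<^sup>*" using cells_connected[OF sg_edges_red_connected w(1)] by (simp add: P3_iff)
  thus ?thesis using rtrancl_mono[OF Ed(1)] by blast
 qed
 show "(x', y') = (x, y) | (x', y') = (y, x)"
  if "(x, y) \<in> Ed" "(x', y') \<in> Ed" "0 < t" "t < 1" "0 <= t'" "t' <= 1" "edge_pt x y t = edge_pt x' y' t'" for x y x' y' t t'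
  by (rule sg_edges_meet[OF _ _ that(3-7)]) (use Ed that in auto)
 show "sgV q 0 \<subseteq> fst ` Ed" using sgV_sub_edges[of m] Ed(1) by blast
qed (use sym in auto)

text \<open>Edges on which h is constant contribute nothing to the energy against h. As all edges
  have length 1, the graph energy is (3/5)^m times the renormalised discrete energy, and the latter
  equals the boundary term of h on the gasket at every level.\<close>

lemma graph_bdry3:
 assumes Ed: "Ed \<subseteq> sg_edges q m" and g: "plane_graph Ed (sgV q 0) h (q 0)"
  and removed: "!!x y. (x, y) \<in> sg_edges q m - Ed ==> h x = h y" and c: "c > 0"
 shows "one_dim_bdry3 (graph_space Ed (sgV q 0)) (edge_linear Ed h) (plane_graph.MG Ed h)
  (plane_graph.DG Ed h) (%p. (3/5) ^ m * flux p) q c"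
proof -
 interpret g: plane_graph Ed "sgV q 0" h "q 0" by (rule g)
 interpret one_dim_energy "graph_space Ed (sgV q 0)" "edge_linear Ed h" g.MG g.DG by (rule g.GS_one_dim)
 have b: "bdry (graph_space Ed (sgV q 0)) = {q 0, q 1, q 2}" by (simp add: graph_space_def)
 show ?thesis
 proof
  fix f assume f: "f \<in> fdom (graph_space Ed (sgV q 0))"
  have "(\<Sum>(x, y)\<in>Ed. (h x - h y) * (f x - f y)) = (\<Sum>(x, y)\<in>sg_edges q m. (h x - h y) * (f x - f y))"
   by (rule sum.mono_neutral_left[OF finite_sg_edges Ed]) (use removed in auto)
  also have "\<dots> = (\<Sum>w\<in>words m. 2 * E0 (cv h w) (cv f w))"
   unfolding sum_edges sum_P3 by (intro sum.cong refl) (simp add: E0_def cv_def algebra_simps)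
  also have "\<dots> = 2 * ((3/5) ^ m * En m h f)"
   by (simp add: En_def sum_distrib_left power_mult_distrib[symmetric] mult.assoc[symmetric])
  finally have "energy (graph_space Ed (sgV q 0)) (edge_linear Ed h) f = (3/5) ^ m * E0 a (cv f [])"
   unfolding g.hl_energy[OF f] En_h by simp
  thus "energy (graph_space Ed (sgV q 0)) (edge_linear Ed h) f
    = (\<Sum>p\<in>bdry (graph_space Ed (sgV q 0)). (3/5) ^ m * flux p * f p)" unfolding b sum_flux .
 qed (use b c q_distinct in simp_all)
qed

end

section \<open>Convergence\<close>

lemma periodic_int: assumes "!!x. f (x + 1) = (f (x :: real) :: real)" shows "f (x + of_int k) = f x"
proof (induction k rule: int_induct[where k=0])
 case (step1 i)
 thus ?case using assms[of "x + of_int i"] by (simp add: add.assoc)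
next
 case (step2 i)
 thus ?case using assms[of "x + of_int (i - 1)"] by (simp add: algebra_simps)
qed simp

lemma periodic_uniformly_continuous:
 assumes c: "continuous_on UNIV f" and p: "!!x. f (x + 1) = (f (x :: real) :: real)"
 shows "uniformly_continuous_on UNIV f" unfolding uniformly_continuous_on_def
proof (intro allI impI)
 fix e :: real assume e: "e > 0"
 have uc: "uniformly_continuous_on {-1..2} f"
  by (rule compact_uniformly_continuous[OF continuous_on_subset[OF c] compact_Icc]) simp
 obtain d where d: "d > 0" "\<forall>x\<in>{-1..2}. \<forall>y\<in>{-1..2}. dist y x < d --> dist (f y) (f x) < e"
  using uc[unfolded uniformly_continuous_on_def, THEN spec, THEN mp, OF e] by (elim exE conjE)
 have "dist (f y) (f x) < e" if xy: "dist y x < min d 1" for x y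
 proof -
  \<comment> \<open>Shifting by the integer part of x moves both points into [-1, 2], the margin
    being room for the distance below 1.\<close>
  define k :: real where "k = of_int \<lfloor>x\<rfloor>"
  have "k <= x" "x < k + 1" unfolding k_def by (rule of_int_floor_le, rule real_of_int_floor_add_one_gt)
  hence "x - k \<in> {-1..2}" "y - k \<in> {-1..2}" "dist (y - k) (x - k) < d"
   using xy by (auto simp: dist_real_def abs_less_iff)
  hence "dist (f (y - k)) (f (x - k)) < e" using d(2) by blast
  moreover have "f (z - k) = f z" for z using periodic_int[of f "z - k" "\<lfloor>x\<rfloor>", OF p] by (simp add: k_def)
  ultimately show ?thesis by simp
 qed
 thus "\<exists>d>0. \<forall>x\<in>UNIV. \<forall>y\<in>UNIV. dist y x < d --> dist (f y) (f x) < e"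
  using d(1) by (intro exI[of _ "min d 1"]) simp
qed

lemma periodic_C1_deriv:
 assumes V: "V C1_differentiable_on UNIV" and p: "!!x. V (x + 1) = (V (x :: real) :: real)"
 obtains V' where "!!x. (V has_real_derivative V' x) (at x)" "uniformly_continuous_on UNIV V'"
proof -
 obtain V' where V': "!!x. (V has_real_derivative V' x) (at x)" "continuous_on UNIV V'"
  using V unfolding C1_differentiable_on_def has_real_derivative_iff_has_vector_derivative by blast
 have "V' (x + 1) = V' x" for x
 proof (rule DERIV_unique)
  show "(V has_real_derivative V' x) (at x)" by (rule V')
  have "((%x. V (x + 1)) has_real_derivative V' (x + 1)) (at x)"
   using V'(1)[of "x + 1"] DERIV_shift[of V "V' (x + 1)" x 1] by simp
  thus "(V has_real_derivative V' (x + 1)) (at x)" unfolding p .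
 qed
 from that[OF V'(1) periodic_uniformly_continuous[OF V'(2) this]] show ?thesis .
qed

text \<open>On an edge, h p - l m p is a convex combination of the increments of h from the two
  endpoints to p, and these are at distance at most diam / 2^m. The estimate does not involve t, so
  V can be applied uniformly in time.\<close>

lemma (in gasket_geom) transport_limit:
 fixes V :: "real => real"
 assumes V: "uniformly_continuous_on UNIV V" and h: "continuous_on K h"
  and Ed: "!!m. Ed m \<subseteq> sg_edges q m" "!!m. Ed m ~= {}"
  and l: "!!m x y s. (x, y) \<in> Ed m ==> s \<in> {0..1} ==> l m (edge_pt x y s) = (1 - s) * h x + s * h y"
  and v: "!!t x. t >= 0 ==> x \<in> K ==> v t x = V (h x - t)"
  and vm: "!!m t x. t >= 0 ==> x \<in> graph_pts (Ed m) ==> vm m t x = V (l m x - t)"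
 shows "(%m. SUP (t, x)\<in>{0..} \<times> graph_pts (Ed m). ereal \<bar>v t x - vm m t x\<bar>) \<longlonglongrightarrow> 0"
proof (rule order_tendstoI)
 let ?S = "%m. SUP (t, x)\<in>{0..} \<times> graph_pts (Ed m). ereal \<bar>v t x - vm m t x\<bar>"
 have nn: "0 <= ?S m" for m
 proof -
  obtain x y where "(x, y) \<in> Ed m" using Ed(2)[of m] by (metis equals0I surj_pair)
  hence "edge_pt x y 0 \<in> graph_pts (Ed m)" unfolding graph_pts_def by (intro UN_I[of "(x, y)"]) auto
  hence "ereal \<bar>v 0 (edge_pt x y 0) - vm m 0 (edge_pt x y 0)\<bar> <= ?S m"
   by (intro SUP_upper2[of "(0, edge_pt x y 0)"]) auto
  thus ?thesis by (rule order_trans[rotated]) simp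
 qed
 show "eventually (%m. a < ?S m) sequentially" if "a < 0" for a using order_less_le_trans[OF that nn] by simp
 fix b :: ereal assume "0 < b"
 then obtain e :: real where e: "0 < ereal e" "ereal e < b" using ereal_dense2 by blast
 obtain d where d: "d > 0" "!!x y. dist y x < d ==> dist (V y) (V x) < e"
  using V e(1) unfolding uniformly_continuous_on_def by auto
 obtain r where r: "r > 0" "\<forall>x\<in>K. \<forall>y\<in>K. dist y x < r --> dist (h y) (h x) < d"
  using compact_uniformly_continuous[OF h K_compact, unfolded uniformly_continuous_on_def, THEN spec, THEN mp, OF d(1)]
  by (elim exE conjE)
 obtain N where N: "!!m. m >= N ==> diam / 2 ^ m < r" using cells_small[OF r(1)] by blast
 have "?S m <= ereal e" if m: "m >= N" for m
 proof (rule SUP_least)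
  fix z assume "z \<in> {0 :: real..} \<times> graph_pts (Ed m)"
  then obtain t p where z: "z = (t, p)" "t >= 0" "p \<in> graph_pts (Ed m)" by auto
  obtain x y s where xy: "(x, y) \<in> Ed m" "s \<in> {0..1}" "p = edge_pt x y s" "p \<in> K" "x \<in> K" "y \<in> K"
   "dist p x <= diam / 2 ^ m" "dist p y <= diam / 2 ^ m" using graph_cell[OF z(3) Ed(1)] .
  have hd: "\<bar>h p - h x\<bar> < d" "\<bar>h p - h y\<bar> < d"
   using r(2)[rule_format, OF xy(5,4)] r(2)[rule_format, OF xy(6,4)] xy(7,8) N[OF m] by (simp_all add: dist_real_def)
  have "h p - l m p = (1 - s) * (h p - h x) + s * (h p - h y)"
   unfolding l[OF xy(1,2), folded xy(3)] by (simp add: algebra_simps)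
  also have "\<bar>\<dots>\<bar> < d" using hd xy(2) convex_bound_lt[of "\<bar>h p - h x\<bar>" d "\<bar>h p - h y\<bar>" "1 - s" s]
    abs_triangle_ineq[of "(1 - s) * (h p - h x)" "s * (h p - h y)"] by (auto simp: abs_mult)
  finally have "dist (V (h p - t)) (V (l m p - t)) < e" by (intro d(2)) (simp add: dist_real_def)
  hence "\<bar>v t p - vm m t p\<bar> <= e" unfolding v[OF z(2) xy(4)] vm[OF z(2,3)] by (simp add: dist_real_def)
  thus "(case z of (t, x) => ereal \<bar>v t x - vm m t x\<bar>) <= ereal e" by (simp add: z(1))
 qed
 thus "eventually (%m. ?S m < b) sequentially"
  unfolding eventually_sequentially using e(2) order_le_less_trans by blast
qed

section \<open>Transport on the gasket and on its graphs in items (i) and (ii)\<close>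

context gasket_geom begin

definition transport_claim :: "(real^2 => real) => ((real^2) bvec => (real^2) bvec) => (real => real)
  => (nat => ((real^2) \<times> (real^2)) set) => bool" where
 "transport_claim h \<Theta> V Ed \<longleftrightarrow> (\<exists>v. the_solution SG h \<Theta> (V \<circ> h) v) &
  (\<forall>m. \<exists>vm. the_solution (graph_space (Ed m) (sgV q 0)) (edge_linear (Ed m) h) \<Theta> (V \<circ> edge_linear (Ed m) h) vm) &
  (\<forall>v vm. the_solution SG h \<Theta> (V \<circ> h) v &
   (\<forall>m. the_solution (graph_space (Ed m) (sgV q 0)) (edge_linear (Ed m) h) \<Theta> (V \<circ> edge_linear (Ed m) h) (vm m)) -->
   (%m. SUP (t, x)\<in>{0..} \<times> graph_pts (Ed m). ereal \<bar>v t x - vm m t x\<bar>) \<longlonglongrightarrow> 0)"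

lemma transport_solutions:
 fixes V :: "real => real"
 assumes V: "uniformly_continuous_on UNIV V" and h: "continuous_on K h"
  and Ed: "!!m. Ed m \<subseteq> sg_edges q m" "!!m. Ed m ~= {}" and g: "!!m. plane_graph (Ed m) (sgV q 0) h (q 0)"
  and K1: "the_solution SG h \<Theta> (V \<circ> h) (%t x. V (h x - t))"
  and K2: "!!v t x. the_solution SG h \<Theta> (V \<circ> h) v ==> t >= 0 ==> x \<in> carr SG ==> v t x = V (h x - t)"
  and G1: "!!m. the_solution (graph_space (Ed m) (sgV q 0)) (edge_linear (Ed m) h) \<Theta>
    (V \<circ> edge_linear (Ed m) h) (%t x. V (edge_linear (Ed m) h x - t))"
  and G2: "!!m v t x. the_solution (graph_space (Ed m) (sgV q 0)) (edge_linear (Ed m) h) \<Theta>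
    (V \<circ> edge_linear (Ed m) h) v ==> t >= 0 ==> x \<in> carr (graph_space (Ed m) (sgV q 0)) ==>
    v t x = V (edge_linear (Ed m) h x - t)"
 shows "transport_claim h \<Theta> V Ed" unfolding transport_claim_def
proof (intro conjI allI impI)
 fix v vm
 assume v: "the_solution SG h \<Theta> (V \<circ> h) v &
  (\<forall>m. the_solution (graph_space (Ed m) (sgV q 0)) (edge_linear (Ed m) h) \<Theta> (V \<circ> edge_linear (Ed m) h) (vm m))"
 have carr: "carr (graph_space (Ed m) (sgV q 0)) = graph_pts (Ed m)" for m by (simp add: graph_space_def)
 show "(%m. SUP (t, x)\<in>{0..} \<times> graph_pts (Ed m). ereal \<bar>v t x - vm m t x\<bar>) \<longlonglongrightarrow> 0"
 proof (rule transport_limit[where h=h and V=V and l="%m. edge_linear (Ed m) h", OF V h Ed])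
  show "edge_linear (Ed m) h (edge_pt x y s) = (1 - s) * h x + s * h y" if "(x, y) \<in> Ed m" "s \<in> {0..1}" for m x y s
   using plane_graph.hl_edge[OF g that] plane_graph.ept_def[OF g, of "(x, y)" s] by simp
  show "v t x = V (h x - t)" if "t >= 0" "x \<in> K" for t x
   using K2[OF conjunct1[OF v]] that unfolding SG_simps(1) by blast
  show "vm m t x = V (edge_linear (Ed m) h x - t)" if "t >= 0" "x \<in> graph_pts (Ed m)" for m t x
   using G2[OF conjunct2[OF v, rule_format]] that unfolding carr by blast
 qed
qed (use K1 G1 in blast)+

lemma sgV_edge: assumes "sg_edges_red q m \<subseteq> Ed" "i \<in> {0,1,2}" shows "\<exists>y. (q i, y) \<in> Ed"
proof -
 have "q i \<in> sgV q 0" using assms(2) by auto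
 then obtain e where "e \<in> Ed" "q i = fst e" using sgV_sub_edges[of m] assms(1) by blast
 thus ?thesis by (intro exI[of _ "snd e"]) simp
qed

lemma transport_i:
 assumes V: "!!x. (V has_real_derivative V' x) (at x)" "uniformly_continuous_on UNIV V'"
  and Vu: "uniformly_continuous_on UNIV V" and per: "!!x. V (x + 1) = V x"
  and h: "harmonic SG h" "h (q 0) = 1/2" "h (q 1) = 0" "h (q 2) = 1"
 shows "transport_claim h (Theta_i q) V (sg_edges q)"
proof -
 let ?a = "%j. h (q j)" and ?G = "%m. graph_space (sg_edges q m) (sgV q 0)" and ?l = "%m. edge_linear (sg_edges q m) h"
 have E: "E0 ?a ?a > 0" by (simp add: E0_def h)
 interpret gasket_harmonic q ?a h by unfold_locales (rule E, rule harmonic_eq_hf[OF h(1)])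
 have n: "flux (q 0) = 0" "flux (q 1) = - (3/2)" "flux (q 2) = 3/2" by (simp_all add: flux_q h)
 have bd: "one_dim_bdry3 SG h Mh DS flux q (3/2)" by (rule SG_bdry3) simp
 \<comment> \<open>In units of 1/2 the differences of the values (1/2, 0, 1) are 1 and -2, both
   congruent to 1 modulo 3.\<close>
 have m3: "mod3_edges ?a" by (rule mod3_edgesI[of "1/2" _ 1 "-2"]) (simp_all add: h)
 have pg: "plane_graph (sg_edges q m) (sgV q 0) h (q 0)" for m
 proof (rule gasket_plane_graph)
  fix w i j assume w: "w \<in> words m" "(i, j) \<in> P3"
  have "mod3_edges (ha w)" using mod3_edges_hexts[OF _ m3] w(1) by (simp add: words_def)
  thus "ha w i ~= ha w j" using mod3_edges_ne w(2) unfolding P3_iff by blast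
 qed (use sg_edges_red_sub sg_edges_sym in auto)
 define c where "c m = (3/5) ^ m * (3/2 :: real)" for m :: nat
 have gb: "one_dim_bdry3 (?G m) (?l m) (plane_graph.MG (sg_edges q m) h)
   (plane_graph.DG (sg_edges q m) h) (%p. (3/5) ^ m * flux p) q (c m)" for m
  by (rule graph_bdry3[OF order_refl pg]) (simp_all add: c_def)
 have lq: "?l m (q i) = h (q i)" if "i \<in> {0,1,2}" for i m
  using sgV_edge[OF sg_edges_red_sub that, of m] plane_graph.hl_vertex[OF pg] by blast
 have ln: "(3/5) ^ m * flux (q 0) = 0" "(3/5) ^ m * flux (q 1) = - c m" "(3/5) ^ m * flux (q 2) = c m" for m
  by (simp_all add: n c_def)
 have l01: "?l m (q 1) = 0" "?l m (q 2) = 1" for m using lq[of 1 m] lq[of 2 m] h by simp_all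
 have ne: "sg_edges q m ~= {}" for m using sgV_edge[OF sg_edges_red_sub, of 0 m] by auto
 show ?thesis
 proof (rule transport_solutions[where h=h and V=V and Ed="sg_edges q" and \<Theta>="Theta_i q"])
  note K = one_dim_bdry3.theta_i[OF bd n h(3,4) V per] and G = one_dim_bdry3.theta_i[OF gb ln l01 V per]
  show "v t x = V (h x - t)" if "the_solution SG h (Theta_i q) (V \<circ> h) v" "t >= 0" "x \<in> carr SG" for v t x
   by (rule K(2)[OF that])
  show "v t x = V (?l m x - t)"
   if "the_solution (?G m) (?l m) (Theta_i q) (V \<circ> ?l m) v" "t >= 0" "x \<in> carr (?G m)" for m v t x
   by (rule G(2)[OF that])
  show "the_solution SG h (Theta_i q) (V \<circ> h) (%t x. V (h x - t))" by (rule K(1))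
  show "the_solution (?G m) (?l m) (Theta_i q) (V \<circ> ?l m) (%t x. V (?l m x - t))" for m by (rule G(1))
 qed (rule Vu h_cont order_refl ne pg)+
qed

lemma transport_ii:
 assumes V: "!!x. (V has_real_derivative V' x) (at x)" "uniformly_continuous_on UNIV V'"
  and Vu: "uniformly_continuous_on UNIV V" and per: "!!x. V (x + 1) = V x"
  and h: "harmonic SG h" "h (q 0) = 0" "h (q 1) = 1" "h (q 2) = 1"
 shows "transport_claim h (Theta_ii q) V (sg_edges_red q)"
proof -
 let ?a = "%j. h (q j)" and ?G = "%m. graph_space (sg_edges_red q m) (sgV q 0)" and ?l = "%m. edge_linear (sg_edges_red q m) h"
 have E: "E0 ?a ?a > 0" by (simp add: E0_def h)
 interpret gasket_harmonic q ?a h by unfold_locales (rule E, rule harmonic_eq_hf[OF h(1)])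
 have n: "flux (q 0) = - 2 * 1" "flux (q 1) = 1" "flux (q 2) = 1" by (simp_all add: flux_q h)
 have bd: "one_dim_bdry3 SG h Mh DS flux q 1" by (rule SG_bdry3) simp
 \<comment> \<open>Two of the boundary values coincide, so the invariant modulo 3 cannot hold at the
   start; the exceptional words are those of the cell at q 0, which contains the removed
   edge.\<close>
 have two: "mod3_edges (ha w) | w = replicate m 0 & ha w 0 ~= ha w 1 & ha w 1 = ha w 2" if "w \<in> words m" for w m
  using hexts_two_equal[of w ?a] that h by (auto simp: words_def)
 have pg: "plane_graph (sg_edges_red q m) (sgV q 0) h (q 0)" for m
 proof (rule gasket_plane_graph)
  fix w i j assume w: "w \<in> words m" "(i, j) \<in> P3" and e: "(Fw w (q i), Fw w (q j)) \<in> sg_edges_red q m"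
  have r: "~ (w = replicate m 0 & {i, j} = {1, 2})" using e sg_edges_red_iff[OF w] by blast
  have ij: "i \<in> {0,1,2}" "j \<in> {0,1,2}" "i ~= j" using w(2) by (simp_all add: P3_iff)
  from two[OF w(1)] show "ha w i ~= ha w j"
  proof
   assume "mod3_edges (ha w)"
   thus ?thesis using ij by (rule mod3_edges_ne)
  next
   assume "w = replicate m 0 & ha w 0 ~= ha w 1 & ha w 1 = ha w 2"
   hence "ha w 0 ~= ha w 1" "ha w 1 = ha w 2" "{i, j} ~= {1, 2}" using r by blast+
   thus ?thesis using ij by (auto simp: doubleton_eq_iff)
  qed
 qed (use sg_edges_red_sub sg_edges_red_sym in auto)
 \<comment> \<open>Along the word 0 ... 0 the values at corners 1 and 2 remain equal, so h agrees at
   the ends of the removed edge.\<close>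
 have removed: "h x = h y" if "(x, y) \<in> sg_edges q m - sg_edges_red q m" for x y m
 proof -
  have e: "(x, y) \<in> sg_edges q m" using that by blast
  obtain w i j where w: "w \<in> words m" "(i, j) \<in> P3" "x = Fw w (q i)" "y = Fw w (q j)" by (rule sg_edgeE[OF e])
  have r: "w = replicate m 0" "{i, j} = {1, 2}" using that sg_edges_red_iff[OF w(1,2)] unfolding w(3,4) by blast+
  have "ha w 1 = ha w 2"
   unfolding r(1) using h by (induction m) (simp_all add: hexts_def hext_def replicate_append_same[symmetric] del: replicate_Suc)
  hence "ha w i = ha w j" using r(2) by (auto simp: doubleton_eq_iff)
  thus ?thesis using cv_h[OF w(1), of i] cv_h[OF w(1), of j] w(2) unfolding w(3,4) by (simp add: cv_def P3_iff)
 qed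
 define c where "c m = ((3/5) ^ m :: real)" for m :: nat
 have gb: "one_dim_bdry3 (?G m) (?l m) (plane_graph.MG (sg_edges_red q m) h)
   (plane_graph.DG (sg_edges_red q m) h) (%p. (3/5) ^ m * flux p) q (c m)" for m
  by (rule graph_bdry3[OF sg_edges_red_sub pg removed]) (simp_all add: c_def)
 have lq: "?l m (q i) = h (q i)" if "i \<in> {0,1,2}" for i m
  using sgV_edge[OF order_refl that, of m] plane_graph.hl_vertex[OF pg] by blast
 have ln: "(3/5) ^ m * flux (q 0) = - 2 * c m" "(3/5) ^ m * flux (q 1) = c m" "(3/5) ^ m * flux (q 2) = c m" for m
  by (simp_all add: n c_def)
 have l01: "?l m (q 0) = 0" "?l m (q 1) = 1" "?l m (q 2) = 1" for m using lq[of 0 m] lq[of 1 m] lq[of 2 m] h by simp_all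
 have ne: "sg_edges_red q m ~= {}" for m using sgV_edge[OF order_refl, of 0 m] by auto
 show ?thesis
 proof (rule transport_solutions[where h=h and V=V and Ed="sg_edges_red q" and \<Theta>="Theta_ii q"])
  note K = one_dim_bdry3.theta_ii[OF bd n h(2-4) V per] and G = one_dim_bdry3.theta_ii[OF gb ln l01 V per]
  show "v t x = V (h x - t)" if "the_solution SG h (Theta_ii q) (V \<circ> h) v" "t >= 0" "x \<in> carr SG" for v t x
   by (rule K(2)[OF that])
  show "v t x = V (?l m x - t)"
   if "the_solution (?G m) (?l m) (Theta_ii q) (V \<circ> ?l m) v" "t >= 0" "x \<in> carr (?G m)" for m v t x
   by (rule G(2)[OF that])
  show "the_solution SG h (Theta_ii q) (V \<circ> h) (%t x. V (h x - t))" by (rule K(1))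
  show "the_solution (?G m) (?l m) (Theta_ii q) (V \<circ> ?l m) (%t x. V (?l m x - t))" for m by (rule G(1))
 qed (rule Vu h_cont sg_edges_red_sub ne pg)+
qed

end

theorem corollary11p6:
  fixes q :: "nat \<Rightarrow> real^2" and V :: "real \<Rightarrow> real"
  assumes "equilateral q"
    and "V C1_differentiable_on UNIV"
    and "\<And>x. V (x + 1) = V x"
  shows
    "(\<forall>h. harmonic (sg_space q) h \<and> h (q 0) = 1/2 \<and> h (q 1) = 0 \<and> h (q 2) = 1 \<longrightarrow>
       (\<exists>v. the_solution (sg_space q) h (Theta_i q) (V \<circ> h) v) \<and>
       (\<forall>m. \<exists>vm. the_solution (graph_space (sg_edges q m) (sgV q 0)) (edge_linear (sg_edges q m) h) (Theta_i q)
                    (V \<circ> edge_linear (sg_edges q m) h) vm) \<and>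
       (\<forall>v vm. the_solution (sg_space q) h (Theta_i q) (V \<circ> h) v \<and>
          (\<forall>m. the_solution (graph_space (sg_edges q m) (sgV q 0)) (edge_linear (sg_edges q m) h) (Theta_i q)
                  (V \<circ> edge_linear (sg_edges q m) h) (vm m)) \<longrightarrow>
          (\<lambda>m. SUP (t, x)\<in>{0..} \<times> graph_pts (sg_edges q m). ereal \<bar>v t x - vm m t x\<bar>)
             \<longlonglongrightarrow> 0))
     \<and>
     (\<forall>h. harmonic (sg_space q) h \<and> h (q 0) = 0 \<and> h (q 1) = 1 \<and> h (q 2) = 1 \<longrightarrow>
       (\<exists>v. the_solution (sg_space q) h (Theta_ii q) (V \<circ> h) v) \<and>
       (\<forall>m. \<exists>vm. the_solution (graph_space (sg_edges_red q m) (sgV q 0)) (edge_linear (sg_edges_red q m) h) (Theta_ii q)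
                    (V \<circ> edge_linear (sg_edges_red q m) h) vm) \<and>
       (\<forall>v vm. the_solution (sg_space q) h (Theta_ii q) (V \<circ> h) v \<and>
          (\<forall>m. the_solution (graph_space (sg_edges_red q m) (sgV q 0)) (edge_linear (sg_edges_red q m) h) (Theta_ii q)
                  (V \<circ> edge_linear (sg_edges_red q m) h) (vm m)) \<longrightarrow>
          (\<lambda>m. SUP (t, x)\<in>{0..} \<times> graph_pts (sg_edges_red q m). ereal \<bar>v t x - vm m t x\<bar>)
             \<longlonglongrightarrow> 0))"
proof -
 interpret gasket_geom q using assms(1) by unfold_locales
 note per = assms(3)
 obtain V' where V: "!!x. (V has_real_derivative V' x) (at x)" "uniformly_continuous_on UNIV V'"
  using periodic_C1_deriv[OF assms(2) per] by blast
 have "continuous_on UNIV V" by (intro continuous_at_imp_continuous_on ballI DERIV_isCont[OF V(1)])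
 hence Vu: "uniformly_continuous_on UNIV V" by (rule periodic_uniformly_continuous[where f=V, OF _ per])
 show ?thesis using transport_i[OF V Vu per] transport_ii[OF V Vu per] unfolding transport_claim_def by blast
qed

end
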